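(* In the setting and under the standing assumption of the context, suppose that $\Omega$ is a Polish space, that the perturbed process on $\Omega$ is Feller, and that $\varepsilon<\gamma$. Let $f\in C_b(\Omega)$. Given $n\in\mathbb N$, define the process $$B^{(n)}_t(f):=\int_0^{nt}\frac{f(\eta_s)-\mu_\varepsilon(f)}{\sqrt n}\,ds,\qquad t\in\mathbb R_+ .$$ Then there exists a constant $\sigma^2\ge0$ such that under $\mathbb P^{(\varepsilon)}_{\mu_\varepsilon}$ the process $(B^{(n)}_t(f))_{t\in\mathbb R_+}$ converges weakly, as $n\to\infty$, to a Brownian motion with diffusion coefficient $\sigma^2$.
   Context: Setting. $\Omega$ is a metric space with its Borel $\sigma$-algebra; $C_b(\Omega)$ denotes the bounded continuous real functions. The unperturbed process is a Markov process on $\Omega$ with càdlàg paths $(\eta_t)_{t\ge0}$, with law and expectation $\mathbb P_\eta,\mathbb E_\eta$ when started at $\eta$, and with an invariant distribution $\mu$. $\mu(f)=\int f\,d\mu$; $\|\cdot\|$ is the norm of $L^2(\mu)$ (and the operator norm). $S(t)f(\eta)=\mathbb E_\eta[f(\eta_t)]$ defines a strongly continuous contraction semigroup on $L^2(\mu)$ with generator $L$ of domain $\mathcal D(L)$. The perturbed process is a second Markov process on $\Omega$ with càdlàg paths, with law and expectation $\mathbb P^{(\varepsilon)}_\nu,\mathbb E^{(\varepsilon)}_\nu$ when started from the distribution $\nu$ ($\mathbb P^{(\varepsilon)}_\eta,\mathbb E^{(\varepsilon)}_\eta$ if $\nu=\delta_\eta$). $\hat L_\varepsilon$ is a bounded operator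 on $L^2(\mu)$ with norm $\varepsilon:=\|\hat L_\varepsilon\|>0$; $L_\varepsilon:=L+\hat L_\varepsilon$ with $\mathcal D(L_\varepsilon)=\mathcal D(L)$ generates a strongly continuous semigroup $(S_\varepsilon(t))_{t\ge0}$ on $L^2(\mu)$. Standing assumption. $\mu$ is invariant and ergodic (w.r.t. time translations) for the unperturbed process; for some $\gamma>0$ the Poincaré inequality $\gamma\|f\|^2\le-\mu(fLf)$ holds for all $f\in\mathcal D(L)$ with $\mu(f)=0$; and for all $t\ge0$, $f\in C_b(\Omega)$, $S_\varepsilon(t)f(\eta)=\mathbb E^{(\varepsilon)}_\eta(f(\eta_t))$ for $\mu$-a.e. $\eta$. When $\varepsilon<\gamma$ there is a unique probability measure on $\Omega$ that is absolutely continuous w.r.t. $\mu$ and invariant for the perturbed process; it is denoted $\mu_\varepsilon$. *)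

theory Defs
  imports "HOL-Probability.Probability"
begin

section \<open>The space \<open>L\<^sup>2(M)\<close>\<close>

text \<open>
  Elements of \<open>L\<^sup>2(M)\<close> are given by representatives, and equality in \<open>L\<^sup>2(M)\<close> is equality almost
  everywhere. Operators act on representatives.
\<close>

definition L2_space :: "'a measure \<Rightarrow> ('a \<Rightarrow> real) set" where
  "L2_space M = {f \<in> borel_measurable M. integrable M (\<lambda>x. (f x)\<^sup>2)}"

definition L2_norm :: "'a measure \<Rightarrow> ('a \<Rightarrow> real) \<Rightarrow> real" where
  "L2_norm M f = sqrt (\<integral>x. (f x)\<^sup>2 \<partial>M)"

text \<open>
  Linearity and boundedness together make the operator well defined on equivalence classes.
\<close>

definition L2_bounded_operator :: "'a measure \<Rightarrow> (('a \<Rightarrow> real) \<Rightarrow> ('a \<Rightarrow> real)) \<Rightarrow> bool" where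
  "L2_bounded_operator M A \<longleftrightarrow>
     (\<forall>f \<in> L2_space M. A f \<in> L2_space M) \<and>
     (\<forall>f \<in> L2_space M. \<forall>g \<in> L2_space M. \<forall>a b.
        AE x in M. A (\<lambda>y. a * f y + b * g y) x = a * A f x + b * A g x) \<and>
     (\<exists>K. \<forall>f \<in> L2_space M. L2_norm M (A f) \<le> K * L2_norm M f)"

definition L2_operator_norm :: "'a measure \<Rightarrow> (('a \<Rightarrow> real) \<Rightarrow> ('a \<Rightarrow> real)) \<Rightarrow> real" where
  "L2_operator_norm M A = (SUP f \<in> {f \<in> L2_space M. L2_norm M f \<le> 1}. L2_norm M (A f))"

definition L2_semigroup :: "'a measure \<Rightarrow> (real \<Rightarrow> ('a \<Rightarrow> real) \<Rightarrow> ('a \<Rightarrow> real)) \<Rightarrow> bool" where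
  "L2_semigroup M T \<longleftrightarrow>
     (\<forall>t\<ge>0. L2_bounded_operator M (T t)) \<and>
     (\<forall>f \<in> L2_space M. AE x in M. T 0 f x = f x) \<and>
     (\<forall>f \<in> L2_space M. \<forall>s\<ge>0. \<forall>t\<ge>0. AE x in M. T (s + t) f x = T s (T t f) x) \<and>
     (\<forall>f \<in> L2_space M. ((\<lambda>t. L2_norm M (\<lambda>x. T t f x - f x)) \<longlongrightarrow> 0) (at_right 0))"

definition L2_contraction_semigroup ::
    "'a measure \<Rightarrow> (real \<Rightarrow> ('a \<Rightarrow> real) \<Rightarrow> ('a \<Rightarrow> real)) \<Rightarrow> bool" where
  "L2_contraction_semigroup M T \<longleftrightarrow>
     L2_semigroup M T \<and> (\<forall>t\<ge>0. \<forall>f \<in> L2_space M. L2_norm M (T t f) \<le> L2_norm M f)"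

text \<open>
  The graph of the infinitesimal generator: \<open>L2_generator M T f g\<close> says that \<open>f\<close> is in the domain
  of the generator and that \<open>g\<close> is a representative of its image.
\<close>

definition L2_generator ::
    "'a measure \<Rightarrow> (real \<Rightarrow> ('a \<Rightarrow> real) \<Rightarrow> ('a \<Rightarrow> real)) \<Rightarrow> ('a \<Rightarrow> real) \<Rightarrow> ('a \<Rightarrow> real) \<Rightarrow> bool" where
  "L2_generator M T f g \<longleftrightarrow> f \<in> L2_space M \<and> g \<in> L2_space M \<and>
     ((\<lambda>t. L2_norm M (\<lambda>x. (T t f x - f x) / t - g x)) \<longlongrightarrow> 0) (at_right 0)"


section \<open>Markov processes with cadlag paths\<close>

definition cadlag :: "(real \<Rightarrow> 'a::topological_space) \<Rightarrow> bool" where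
  "cadlag \<omega> \<longleftrightarrow>
     (\<forall>t\<ge>0. (\<omega> \<longlongrightarrow> \<omega> t) (at_right t)) \<and> (\<forall>t>0. \<exists>l. (\<omega> \<longlongrightarrow> l) (at_left t))"

text \<open>
  Paths are indexed by \<open>{0..}\<close> and are extensional outside of it. The \<open>\<sigma>\<close>-algebra is generated by
  the coordinate maps.
\<close>

definition path_space :: "(real \<Rightarrow> 'a::topological_space) measure" where
  "path_space = restrict_space (Pi\<^sub>M {0..} (\<lambda>_. borel)) {\<omega>. cadlag \<omega>}"

definition time_shift :: "real \<Rightarrow> (real \<Rightarrow> 'a) \<Rightarrow> real \<Rightarrow> 'a" where
  "time_shift t \<omega> = (\<lambda>s\<in>{0..}. \<omega> (t + s))"

text \<open>The \<open>\<sigma>\<close>-algebra on paths generated by the coordinates with index in \<open>{0..t}\<close>.\<close>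

definition past :: "real \<Rightarrow> (real \<Rightarrow> 'a::topological_space) measure" where
  "past t = vimage_algebra (space path_space) (\<lambda>\<omega>. restrict \<omega> {0..t}) (Pi\<^sub>M {0..t} (\<lambda>_. borel))"

text \<open>A Markov process is the family of its laws on path space, indexed by the starting point.\<close>

definition markov_process :: "('a::metric_space \<Rightarrow> (real \<Rightarrow> 'a) measure) \<Rightarrow> bool" where
  "markov_process P \<longleftrightarrow>
     P \<in> borel \<rightarrow>\<^sub>M prob_algebra path_space \<and>
     (\<forall>\<eta>. AE \<omega> in P \<eta>. \<omega> 0 = \<eta>) \<and>
     (\<forall>\<eta>. \<forall>t\<ge>0. \<forall>A \<in> sets path_space. AE \<omega> in P \<eta>.
        real_cond_exp (P \<eta>) (past t) (indicator {\<omega> \<in> space path_space. time_shift t \<omega> \<in> A}) \<omega>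
          = measure (P (\<omega> t)) A)"

definition law_from ::
    "('a::metric_space \<Rightarrow> (real \<Rightarrow> 'a) measure) \<Rightarrow> 'a measure \<Rightarrow> (real \<Rightarrow> 'a) measure" where
  "law_from P \<nu> = \<nu> \<bind> P"

definition transition ::
    "('a::metric_space \<Rightarrow> (real \<Rightarrow> 'a) measure) \<Rightarrow> real \<Rightarrow> ('a \<Rightarrow> real) \<Rightarrow> ('a \<Rightarrow> real)" where
  "transition P t f \<eta> = (\<integral>\<omega>. f (\<omega> t) \<partial>P \<eta>)"

definition invariant_distribution ::
    "('a::metric_space \<Rightarrow> (real \<Rightarrow> 'a) measure) \<Rightarrow> 'a measure \<Rightarrow> bool" where
  "invariant_distribution P \<nu> \<longleftrightarrow> prob_space \<nu> \<and> sets \<nu> = sets borel \<and>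
     (\<forall>t\<ge>0. distr (law_from P \<nu>) borel (\<lambda>\<omega>. \<omega> t) = \<nu>)"

definition ergodic_distribution ::
    "('a::metric_space \<Rightarrow> (real \<Rightarrow> 'a) measure) \<Rightarrow> 'a measure \<Rightarrow> bool" where
  "ergodic_distribution P \<nu> \<longleftrightarrow>
     (\<forall>A \<in> sets path_space. (\<forall>t\<ge>0. {\<omega> \<in> space path_space. time_shift t \<omega> \<in> A} = A) \<longrightarrow>
        measure (law_from P \<nu>) A = 0 \<or> measure (law_from P \<nu>) A = 1)"

text \<open>
  The state space need not be locally compact, so the Feller property refers to bounded continuous
  functions.
\<close>

definition feller :: "('a::metric_space \<Rightarrow> (real \<Rightarrow> 'a) measure) \<Rightarrow> bool" where
  "feller P \<longleftrightarrow> (\<forall>t\<ge>0. \<forall>f \<in> bcontfun. transition P t f \<in> bcontfun)"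


section \<open>Weak convergence in the space of continuous paths\<close>

definition borel_of :: "'b topology \<Rightarrow> 'b measure" where
  "borel_of X = sigma (topspace X) {U. openin X U}"

definition weakly_converges :: "'b topology \<Rightarrow> (nat \<Rightarrow> 'b measure) \<Rightarrow> 'b measure \<Rightarrow> bool" where
  "weakly_converges X M N \<longleftrightarrow>
     (\<forall>\<Phi>. continuous_map X euclideanreal \<Phi> \<and> bounded (\<Phi> ` topspace X) \<longrightarrow>
        (\<lambda>n. \<integral>w. \<Phi> w \<partial>M n) \<longlonglongrightarrow> (\<integral>w. \<Phi> w \<partial>N))"

definition continuous_paths :: "(real \<Rightarrow> real) set" where
  "continuous_paths = {w \<in> extensional {0..}. continuous_on {0..} w}"

text \<open>The topology of uniform convergence on compact subsets of \<open>{0..}\<close>.\<close>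

definition continuous_path_topology :: "(real \<Rightarrow> real) topology" where
  "continuous_path_topology = topology_generated_by
     {{v \<in> continuous_paths. \<forall>t\<in>{0..T}. \<bar>v t - u t\<bar> < \<delta>} | u T \<delta>. u \<in> continuous_paths \<and> 0 < \<delta>}"

text \<open>The centred normal distribution of variance \<open>v\<close>, which is the Dirac mass at 0 for \<open>v = 0\<close>.\<close>

definition centred_normal :: "real \<Rightarrow> real measure" where
  "centred_normal v = (if v = 0 then return borel 0 else density lborel (normal_density 0 (sqrt v)))"

text \<open>
  The law on continuous paths of a Brownian motion started at 0 with diffusion coefficient \<open>v\<close>,
  i.e. with variance \<open>v * t\<close> at time \<open>t\<close>.
\<close>

definition brownian_motion_law :: "real \<Rightarrow> (real \<Rightarrow> real) measure \<Rightarrow> bool" where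
  "brownian_motion_law v W \<longleftrightarrow>
     prob_space W \<and> sets W = sets (borel_of continuous_path_topology) \<and>
     (AE w in W. w 0 = 0) \<and>
     (\<forall>s t. 0 \<le> s \<and> s < t \<longrightarrow> distr W borel (\<lambda>w. w t - w s) = centred_normal (v * (t - s))) \<and>
     (\<forall>\<tau> :: nat \<Rightarrow> real. \<forall>k. 0 \<le> \<tau> 0 \<and> mono \<tau> \<longrightarrow>
        prob_space.indep_vars W (\<lambda>_. borel) (\<lambda>i w. w (\<tau> (Suc i)) - w (\<tau> i)) {..<k})"


section \<open>Rescaled additive functionals\<close>

definition rescaled_functional ::
    "('a \<Rightarrow> real) \<Rightarrow> 'a measure \<Rightarrow> nat \<Rightarrow> (real \<Rightarrow> 'a) \<Rightarrow> real \<Rightarrow> real" where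
  "rescaled_functional f \<nu> n \<omega> =
     (\<lambda>t\<in>{0..}. LINT s:{0..real n * t}|lborel. (f (\<omega> s) - (\<integral>x. f x \<partial>\<nu>)) / sqrt (real n))"

end

theory Submission
  imports Defs
begin

text \<open>
  Why the theorem holds. Constants are annihilated by both generators, so the bilinear form of the
  perturbed generator at \<open>v\<close> only sees the centred function \<open>v - \<mu>(v)\<close>. There the Poincare inequality
  contributes \<open>-\<gamma>\<close> and the perturbation at most \<open>+\<epsilon>\<close> (\<open>generator_dissipation\<close>). Hence the variance of
  \<open>S\<^sub>\<epsilon>(t)h\<close> under \<open>\<mu>\<close> decays like \<open>exp (-2(\<gamma>-\<epsilon>)t)\<close>, and the mean of \<open>S\<^sub>\<epsilon>(t)h\<close> under \<open>\<mu>\<close>, which moves only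
  through the perturbation, converges like \<open>exp (-(\<gamma>-\<epsilon>)t)\<close>. Its limit is \<open>\<mu>\<^sub>\<epsilon>(h)\<close> because \<open>\<mu>\<^sub>\<epsilon>\<close> is invariant and
  absolutely continuous. So \<open>S\<^sub>\<epsilon>(t)h\<close> tends to \<open>\<mu>\<^sub>\<epsilon>(h)\<close> in \<open>L\<^sup>1(\<mu>\<^sub>\<epsilon>)\<close>, exponentially fast and uniformly in
  measurable \<open>h\<close> with \<open>|h| \<le> 1\<close> (\<open>decay_bounded\<close>). By the Markov property this is a statement about paths:
  under the stationary law, past and future separated by a gap \<open>g\<close> have covariance of order
  \<open>exp (-(\<gamma>-\<epsilon>)g)\<close> (\<open>law_mixing\<close>).

  The integrals \<open>Z\<^sub>j\<close> of \<open>f - \<mu>\<^sub>\<epsilon>(f)\<close> over the unit time intervals are thus a bounded, centred, stationary,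
  exponentially mixing sequence (locale \<open>mixing_sequence\<close>). For its partial sums, the fourth moment grows at
  most quadratically (\<open>fourth_moment\<close>), the variance grows linearly at some rate \<open>\<sigma>2\<close>, and
  cutting the sum into blocks separated by gaps gives a central limit theorem (\<open>clt_increment\<close>) and the
  asymptotic independence of increments over disjoint long intervals (\<open>asymptotic_independence\<close>).

  These facts determine the limit. Central limit theorem and asymptotic independence give convergence of the
  joint law of the increments over a dyadic grid (\<open>joint_convergence\<close>). The moment bound
  \<open>E|X\<^sub>t - X\<^sub>s|\<^sup>4 \<le> C|t-s|\<^sup>2\<close> makes the approximation of a path by its values on a grid uniform in \<open>n\<close>, so
  convergence on grids implies weak convergence for locally uniform convergence of paths
  (\<open>weak_convergence_criterion\<close>). The same chaining estimate turns a Gaussian process on the dyadic numbers,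
  obtained from Kolmogorov's extension theorem, into a Brownian motion (\<open>brownian_motion_exists\<close>).
\<close>


section \<open>Right-continuous functions and their integrals\<close>

text \<open>
  This is how a bounded continuous function behaves along a cadlag path.
\<close>
definition rc_on :: "(real \<Rightarrow> real) \<Rightarrow> real \<Rightarrow> bool" where
  "rc_on g B \<longleftrightarrow> (\<forall>t\<ge>0. (g \<longlongrightarrow> g t) (at_right t)) \<and> (\<forall>t\<ge>0. \<bar>g t\<bar> \<le> B)"

text \<open>
  The Riemann sum over \<open>Suc K\<close> equal cells of \<open>{a..a+d}\<close> with right end points as
  nodes, since only limits from the right are controlled.
\<close>
definition rsum :: "(real \<Rightarrow> real) \<Rightarrow> real \<Rightarrow> real \<Rightarrow> nat \<Rightarrow> real" where
  "rsum g a d K = (\<Sum>l<Suc K. g (a + d * real (Suc l) / real (Suc K)) * (d / real (Suc K)))"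

text \<open>
  The Riemann sum is the integral of a step function whose value at \<open>x\<close> is \<open>g\<close> at
  the right end point of the cell of \<open>x\<close>. That point tends to \<open>x\<close> from the right, so
  right continuity and dominated convergence apply.
\<close>
lemma rc_on_riemann:
  assumes g: "rc_on g B" and a: "0 \<le> a" and d: "0 < d"
  shows "set_integrable lborel {a..a+d} g"
    and "rsum g a d \<longlonglongrightarrow> (LINT s:{a..a+d}|lborel. g s)"
proof -
  define s where "s K x = (\<Sum>l<Suc K. g (a + d * real (Suc l) / real (Suc K)) *
     indicator {a + d * real l / real (Suc K) ..< a + d * real (Suc l) / real (Suc K)} x)" for K x
  define gi where "gi x = indicator {a..<a+d} x * g x" for x :: real
  have val: "s K x = g (a + d * (real_of_int \<lfloor>(x - a) * real (Suc K) / d\<rfloor> + 1) / real (Suc K))"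
    if x: "a \<le> x" "x < a + d" for K x
  proof -
    define m where "m = nat \<lfloor>(x - a) * real (Suc K) / d\<rfloor>"
    have m0: "0 \<le> (x - a) * real (Suc K) / d" using x d by simp
    hence mr: "real m = of_int \<lfloor>(x - a) * real (Suc K) / d\<rfloor>" unfolding m_def by simp
    have "(x - a) * real (Suc K) < d * real (Suc K)" using x by (intro mult_strict_right_mono) auto
    hence "(x - a) * real (Suc K) / d < real (Suc K)" using d by (simp add: field_simps)
    hence mK: "m < Suc K" using mr m0 by linarith
    have ind: "indicator {a + d * real l / real (Suc K) ..< a + d * real (Suc l) / real (Suc K)} x
        = (if l = m then 1 else 0 :: real)" for l
    proof -
      have "x \<in> {a + d * real l / real (Suc K) ..< a + d * real (Suc l) / real (Suc K)} \<longleftrightarrow>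
         real l \<le> (x - a) * real (Suc K) / d \<and> (x - a) * real (Suc K) / d < real (Suc l)"
        using d by (simp add: field_simps)
      also have "\<dots> \<longleftrightarrow> l = m" using mr by (simp add: le_floor_iff[symmetric] floor_less_iff[symmetric]) linarith
      finally show ?thesis by (simp add: indicator_def)
    qed
    have "s K x = (\<Sum>l<Suc K. if l = m then g (a + d * real (Suc l) / real (Suc K)) else 0)"
      unfolding s_def ind by (intro sum.cong) auto
    also have "\<dots> = g (a + d * real (Suc m) / real (Suc K))" using mK by (subst sum.delta) auto
    finally show ?thesis using mr by (simp add: add.commute)
  qed
  have zero: "s K x = 0" if out: "\<not> (a \<le> x \<and> x < a + d)" for K x
    unfolding s_def
  proof (intro sum.neutral ballI)
    fix l assume l: "l \<in> {..<Suc K}"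
    hence "d * real (Suc l) / real (Suc K) \<le> d" using d by (simp add: field_simps)
    moreover have "0 \<le> d * real l / real (Suc K)" using d by simp
    ultimately show "g (a + d * real (Suc l) / real (Suc K)) *
        indicator {a + d * real l / real (Suc K) ..< a + d * real (Suc l) / real (Suc K)} x = 0"
      using out by (auto simp: indicator_def)
  qed
  have lim: "(\<lambda>K. s K x) \<longlonglongrightarrow> gi x" for x
  proof (cases "a \<le> x \<and> x < a + d")
    case True
    \<comment> \<open>the right end point of the cell containing x\<close>
    define r where "r K = a + d * (real_of_int \<lfloor>(x - a) * real (Suc K) / d\<rfloor> + 1) / real (Suc K)" for K
    have r1: "x < r K" for K
    proof -
      have "(x - a) * real (Suc K) / d < real_of_int \<lfloor>(x - a) * real (Suc K) / d\<rfloor> + 1" by linarith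
      hence "(x - a) * real (Suc K) < d * (real_of_int \<lfloor>(x - a) * real (Suc K) / d\<rfloor> + 1)"
        using d by (simp add: field_simps)
      hence "x - a < d * (real_of_int \<lfloor>(x - a) * real (Suc K) / d\<rfloor> + 1) / real (Suc K)"
        by (simp add: field_simps)
      thus ?thesis unfolding r_def by linarith
    qed
    have r2: "r K \<le> x + d / real (Suc K)" for K
    proof -
      have "real_of_int \<lfloor>(x - a) * real (Suc K) / d\<rfloor> + 1 \<le> (x - a) * real (Suc K) / d + 1" by linarith
      hence "d * (real_of_int \<lfloor>(x - a) * real (Suc K) / d\<rfloor> + 1) / real (Suc K)
         \<le> d * ((x - a) * real (Suc K) / d + 1) / real (Suc K)"
        using d by (intro divide_right_mono mult_left_mono) auto
      also have "\<dots> = x - a + d / real (Suc K)" using d by (simp add: field_simps del: of_nat_Suc)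
      finally show ?thesis unfolding r_def by simp
    qed
    have "(\<lambda>K. x + d / real (Suc K)) \<longlonglongrightarrow> x + 0"
      by (intro tendsto_add tendsto_const) (rule LIMSEQ_Suc, rule lim_const_over_n)
    hence "r \<longlonglongrightarrow> x"
      using r1 r2 by (intro tendsto_sandwich[of "\<lambda>_. x" r sequentially "\<lambda>K. x + d / real (Suc K)"])
        (auto intro!: always_eventually less_imp_le[OF r1] r2 simp del: of_nat_Suc)
    hence "filterlim r (at_right x) sequentially"
      unfolding filterlim_at using r1 by (auto intro!: always_eventually simp: less_imp_neq[THEN not_sym])
    moreover have "(g \<longlongrightarrow> g x) (at_right x)" using g a True unfolding rc_on_def by auto
    ultimately have "(\<lambda>K. g (r K)) \<longlonglongrightarrow> g x" by (rule filterlim_compose[rotated])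
    thus ?thesis using True val by (simp add: gi_def r_def)
  next
    case False
    thus ?thesis using False zero by (auto simp: gi_def indicator_def)
  qed
  have B: "\<bar>s K x\<bar> \<le> B * indicator {a..<a+d} x" for K x
  proof (cases "a \<le> x \<and> x < a + d")
    case True
    have "0 \<le> (x - a) * real (Suc K) / d" using True d by simp
    thus ?thesis using True a d g unfolding rc_on_def by (simp add: val del: of_nat_Suc)
  next
    case False
    thus ?thesis using zero by simp
  qed
  have sm [measurable]: "s K \<in> borel_measurable borel" for K unfolding s_def by measurable
  have gm [measurable]: "gi \<in> borel_measurable borel"
    using lim sm by (rule borel_measurable_LIMSEQ_real)
  have bi: "integrable lborel (\<lambda>x. B * indicator {a..<a+d} x :: real)"
    using integrable_real_indicator[of "{a..<a+d}" lborel] d by (intro integrable_mult_right) auto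
  have gint: "integrable lborel gi" and conv: "(\<lambda>K. integral\<^sup>L lborel (s K)) \<longlonglongrightarrow> integral\<^sup>L lborel gi"
    using integrable_dominated_convergence[of gi lborel s "\<lambda>x. B * indicator {a..<a+d} x"]
      integral_dominated_convergence[of gi lborel s "\<lambda>x. B * indicator {a..<a+d} x"] lim B bi
    by auto
  have ae: "AE x in lborel. gi x = indicator {a..a+d} x *\<^sub>R g x"
    using AE_lborel_singleton[of "a+d"] by eventually_elim (auto simp: gi_def indicator_def)
  have ae': "AE x in lborel. indicator {a..a+d} x *\<^sub>R g x = gi x" using ae by eventually_elim simp
  have eq: "indicator {a..a+d} x *\<^sub>R g x = gi x + indicator {a+d} x * g (a+d)" for x
    using d by (auto simp: gi_def indicator_def)
  have m2: "(\<lambda>x. indicator {a..a+d} x *\<^sub>R g x) \<in> borel_measurable lborel"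
    unfolding eq by measurable
  show "set_integrable lborel {a..a+d} g" unfolding set_integrable_def
    using gint m2 ae by (subst integrable_cong_AE[OF m2 _ ae']) auto
  have leq: "a + d * real l / real (Suc K) \<le> a + d * real (Suc l) / real (Suc K)" for l K
    using d by (intro add_left_mono divide_right_mono mult_left_mono) auto
  have "integral\<^sup>L lborel (s K) = rsum g a d K" for K
  proof -
    have "integral\<^sup>L lborel (s K) = (\<Sum>l<Suc K. LINT x|lborel. g (a + d * real (Suc l) / real (Suc K)) *
     indicator {a + d * real l / real (Suc K) ..< a + d * real (Suc l) / real (Suc K)} x)"
      unfolding s_def by (rule Bochner_Integration.integral_sum)
        (intro integrable_mult_right integrable_real_indicator, auto simp: emeasure_lborel_Ico[OF leq] simp del: of_nat_Suc)
    also have "\<dots> = rsum g a d K" unfolding rsum_def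
    proof (intro sum.cong refl)
      fix l
      have "measure lborel {a + d * real l / real (Suc K) ..< a + d * real (Suc l) / real (Suc K)} = d / real (Suc K)"
        by (subst measure_lborel_Ico[OF leq]) (simp add: diff_divide_distrib[symmetric] algebra_simps)
      thus "(LINT x|lborel. g (a + d * real (Suc l) / real (Suc K)) *
     indicator {a + d * real l / real (Suc K) ..< a + d * real (Suc l) / real (Suc K)} x) =
       g (a + d * real (Suc l) / real (Suc K)) * (d / real (Suc K))" by simp
    qed
    finally show ?thesis .
  qed
  moreover have "integral\<^sup>L lborel gi = (LINT s:{a..a+d}|lborel. g s)"
    unfolding set_lebesgue_integral_def by (rule integral_cong_AE) (use m2 ae in auto)
  ultimately show "rsum g a d \<longlonglongrightarrow> (LINT s:{a..a+d}|lborel. g s)" using conv by simp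
qed

lemma rc_on_bound: "rc_on g B \<Longrightarrow> 0 \<le> t \<Longrightarrow> \<bar>g t\<bar> \<le> B"
  by (simp add: rc_on_def)

lemma rc_on_integrable:
  assumes g: "rc_on g B" and a: "0 \<le> a"
  shows "set_integrable lborel {a..b} g" "g integrable_on {a..b}"
    "(LINT s:{a..b}|lborel. g s) = integral {a..b} g"
proof -
  show 1: "set_integrable lborel {a..b} g"
  proof (cases "a < b")
    case True
    from rc_on_riemann(1)[OF g a, of "b - a"] True show ?thesis by simp
  next
    case False
    hence *: "{a..b} \<subseteq> {a}" by auto
    have "(\<lambda>x. indicator {a..b} x *\<^sub>R g x) = (\<lambda>x. indicator {a..b} x *\<^sub>R g a)"
      using * by (intro ext) (auto simp: indicator_def subset_iff)
    hence "set_integrable lborel {a..b} g \<longleftrightarrow> set_integrable lborel {a..b} (\<lambda>_. g a)"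
      by (simp add: set_integrable_def)
    moreover have "integrable lborel (indicat_real {a..b})"
      by (rule integrable_real_indicator) (auto simp: emeasure_lborel_Icc_eq)
    ultimately show ?thesis by (simp add: set_integrable_def)
  qed
  show "g integrable_on {a..b}" "(LINT s:{a..b}|lborel. g s) = integral {a..b} g"
    using set_borel_integral_eq_integral[OF 1] by auto
qed

lemma rsum_tendsto:
  assumes g: "rc_on g B" and a: "0 \<le> a" and d: "0 \<le> d"
  shows "rsum g a d \<longlonglongrightarrow> integral {a..a+d} g"
proof (cases "d = 0")
  case True thus ?thesis by (simp add: rsum_def[abs_def])
next
  case False
  thus ?thesis using rc_on_riemann(2)[OF g a, of d] d rc_on_integrable(3)[OF g a] by simp
qed

lemma rc_on_integral_bound:
  assumes g: "rc_on g B" and a: "0 \<le> a" "a \<le> b"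
  shows "\<bar>integral {a..b} g\<bar> \<le> B * (b - a)"
proof -
  have B: "0 \<le> B" using rc_on_bound[OF g, of 0] by simp
  have "norm (integral {a..b} g) \<le> B * measure lborel (cbox a b)"
    using a rc_on_bound[OF g] B rc_on_integrable(2)[OF g a(1)]
    by (intro has_integral_bound[where f=g]) (auto simp: has_integral_integral)
  thus ?thesis using a by simp
qed

lemma rc_on_integral_combine:
  assumes g: "rc_on g B" and a: "0 \<le> a" "a \<le> b" "b \<le> c"
  shows "integral {a..b} g + integral {b..c} g = integral {a..c} g"
  using a by (intro Henstock_Kurzweil_Integration.integral_combine rc_on_integrable(2)[OF g]) auto

lemma rc_on_shift:
  assumes g: "rc_on g B" and c: "0 \<le> c" shows "rc_on (\<lambda>s. g (c + s)) B"
  unfolding rc_on_def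
proof (intro conjI allI impI)
  fix t :: real assume t: "0 \<le> t"
  have "(g \<longlongrightarrow> g (c + t)) (at_right (c + t))" using g t c by (simp add: rc_on_def)
  thus "((\<lambda>s. g (c + s)) \<longlongrightarrow> g (c + t)) (at_right t)"
    by (subst (asm) filterlim_at_right_to_0, subst filterlim_at_right_to_0) (simp add: ac_simps)
  show "\<bar>g (c + t)\<bar> \<le> B" using rc_on_bound[OF g] c t by simp
qed

text \<open>
  Both sides are limits of the same Riemann sums.
\<close>
lemma rc_on_integral_shift:
  assumes g: "rc_on g B" and c: "0 \<le> c" and a: "0 \<le> a" "a \<le> b"
  shows "integral {a..b} (\<lambda>s. g (c + s)) = integral {c + a..c + b} g"
proof -
  have 1: "rsum g (c + a) (b - a) \<longlonglongrightarrow> integral {c + a..c + a + (b - a)} g"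
    using assms by (intro rsum_tendsto) auto
  have 2: "rsum (\<lambda>s. g (c + s)) a (b - a) \<longlonglongrightarrow> integral {a..a + (b - a)} (\<lambda>s. g (c + s))"
    using assms by (intro rsum_tendsto rc_on_shift) auto
  have "rsum (\<lambda>s. g (c + s)) a (b - a) = rsum g (c + a) (b - a)" by (auto simp: rsum_def ac_simps)
  with LIMSEQ_unique[OF 1] 2 show ?thesis by simp
qed

lemma rc_on_average_tendsto:
  assumes g: "rc_on g B" and a: "0 \<le> a"
  shows "((\<lambda>h. integral {a..a+h} g / h) \<longlongrightarrow> g a) (at_right 0)"
proof (rule tendstoI)
  fix e :: real assume e: "0 < e"
  have "(g \<longlongrightarrow> g a) (at_right a)" using g a by (simp add: rc_on_def)
  hence "\<forall>\<^sub>F x in at_right a. dist (g x) (g a) < e / 2" using e by (intro tendstoD) auto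
  then obtain b where b: "b > a" "\<And>x. a < x \<Longrightarrow> x < b \<Longrightarrow> \<bar>g x - g a\<bar> < e / 2"
    unfolding eventually_at_right_field by (auto simp: dist_real_def)
  have "\<forall>\<^sub>F h in at_right 0. h \<in> {0<..<b - a}"
    using b by (intro eventually_at_right_real) auto
  thus "\<forall>\<^sub>F h in at_right 0. dist (integral {a..a+h} g / h) (g a) < e"
  proof eventually_elim
    case (elim h)
    have i: "g integrable_on {a..a+h}" by (rule rc_on_integrable(2)[OF g a])
    have "norm (integral {a..a+h} (\<lambda>x. g x - g a)) \<le> e/2 * measure lborel (cbox a (a+h))"
    proof (rule has_integral_bound)
      show "((\<lambda>x. g x - g a) has_integral integral {a..a+h} (\<lambda>x. g x - g a)) (cbox a (a+h))"
        using i by (auto intro!: integrable_integral integrable_diff)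
      show "norm (g x - g a) \<le> e/2" if "x \<in> cbox a (a+h)" for x
        using that elim b(2)[of x] e by (cases "x = a") auto
    qed (use e in auto)
    also have "integral {a..a+h} (\<lambda>x. g x - g a) = integral {a..a+h} g - h * g a"
      using i elim by (subst integral_diff) auto
    finally have *: "\<bar>integral {a..a+h} g - h * g a\<bar> \<le> e/2 * h" using elim by simp
    have "\<bar>integral {a..a+h} g / h - g a\<bar> = \<bar>integral {a..a+h} g - h * g a\<bar> / h"
      using elim by (simp add: field_simps abs_divide[symmetric])
    also have "\<dots> \<le> e/2" using * elim by (simp add: field_simps)
    finally show ?case using e by (simp add: dist_real_def)
  qed
qed

text \<open>
  Semigroups are differentiated from the right only, so the mean value theorem does not apply. Instead, the
  last point at which \<open>\<phi> t \<le> \<phi> a + e * (t - a)\<close> must be \<open>b\<close>: from an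
  earlier point the right derivative allows a further step.
\<close>
lemma right_derivative_nonpos_imp_antimono:
  fixes \<phi> \<phi>' :: "real \<Rightarrow> real"
  assumes cont: "continuous_on {0..} \<phi>"
    and der: "\<And>t. 0 \<le> t \<Longrightarrow> ((\<lambda>h. (\<phi> (t + h) - \<phi> t) / h) \<longlongrightarrow> \<phi>' t) (at_right 0)"
    and neg: "\<And>t. 0 \<le> t \<Longrightarrow> \<phi>' t \<le> 0"
    and ab: "0 \<le> a" "a \<le> b"
  shows "\<phi> b \<le> \<phi> a"
proof (rule field_le_epsilon)
  fix e0 :: real assume e0: "0 < e0"
  define e where "e = e0 / (b - a + 1)"
  have e: "0 < e" using e0 ab by (simp add: e_def)
  define G where "G = {t \<in> {a..b}. \<phi> t \<le> \<phi> a + e * (t - a)}"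
  have "closedin (top_of_set {a..b}) G"
  proof -
    have c: "continuous_on {a..b} \<phi>" using cont ab by (auto intro: continuous_on_subset)
    have "G = {a..b} \<inter> (\<lambda>t. \<phi> t - (\<phi> a + e * (t - a))) -` {..0}" by (auto simp: G_def)
    thus ?thesis using c by (auto intro!: continuous_closedin_preimage continuous_intros)
  qed
  hence cl: "closed G" using closedin_closed_trans closed_atLeastAtMost by blast
  have ne: "a \<in> G" using ab by (simp add: G_def)
  have bd: "bdd_above G" by (auto simp: G_def bdd_above_def)
  define s where "s = Sup G"
  have sG: "s \<in> G" unfolding s_def using ne bd cl by (intro closed_contains_Sup) auto
  have "s = b"
  proof (rule ccontr)
    assume "s \<noteq> b"
    hence s: "a \<le> s" "s < b" using sG by (auto simp: G_def)
    have "\<forall>\<^sub>F h in at_right 0. (\<phi> (s + h) - \<phi> s) / h < e"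
      using der[of s] neg[of s] s ab e by (intro order_tendstoD(2)[of _ "\<phi>' s"]) auto
    moreover have "\<forall>\<^sub>F h in at_right 0. h \<in> {0<..<b - s}" using s by (intro eventually_at_right_real) auto
    ultimately have "\<forall>\<^sub>F h in at_right 0. s + h \<in> G \<and> h > 0"
    proof eventually_elim
      case (elim h)
      hence "\<phi> (s + h) \<le> \<phi> s + e * h" by (simp add: field_simps)
      thus ?case using elim sG s by (auto simp: G_def algebra_simps)
    qed
    then obtain h where "s + h \<in> G" "h > 0" using eventually_happens'[OF trivial_limit_at_right_real] by blast
    thus False using cSup_upper[OF _ bd, of "s+h"] s_def by simp
  qed
  hence "\<phi> b \<le> \<phi> a + e * (b - a)" using sG by (simp add: G_def)
  also have "e * (b - a) \<le> e0" using ab e0 by (simp add: e_def field_simps)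
  finally show "\<phi> b \<le> \<phi> a + e0" by simp
qed

section \<open>The Markov property and stationary path laws\<close>

lemma space_path_space: "space (path_space :: (real \<Rightarrow> 'a::topological_space) measure) = {w \<in> extensional {0..}. cadlag w}"
  by (auto simp: path_space_def space_restrict_space space_PiM PiE_def)

lemma evaluation_path_space [measurable]:
  assumes "0 \<le> t" shows "(\<lambda>w. w t) \<in> path_space \<rightarrow>\<^sub>M borel"
  unfolding path_space_def using assms by (intro measurable_restrict_space1 measurable_component_singleton) auto

lemma time_shift_in_space:
  assumes t: "0 \<le> t" and w: "w \<in> space path_space"
  shows "time_shift t w \<in> space path_space"
proof -
  have c: "cadlag w" using w by (simp add: space_path_space)
  have "cadlag (time_shift t w)" unfolding cadlag_def
  proof (intro conjI allI impI)
    fix s :: real assume s: "0 \<le> s"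
    have "(w \<longlongrightarrow> w (t + s)) (at_right (t + s))" using c t s by (simp add: cadlag_def)
    hence "((\<lambda>u. w (t + u)) \<longlongrightarrow> w (t + s)) (at_right s)"
      by (subst (asm) filterlim_at_right_to_0, subst filterlim_at_right_to_0) (simp add: ac_simps)
    thus "(time_shift t w \<longlongrightarrow> time_shift t w s) (at_right s)"
    proof (rule filterlim_cong[THEN iffD1, rotated -1])
      show "\<forall>\<^sub>F u in at_right s. w (t + u) = time_shift t w u"
        using eventually_at_right_less[of s] by eventually_elim (use s in \<open>auto simp: time_shift_def\<close>)
    qed (use s in \<open>auto simp: time_shift_def\<close>)
  next
    fix s :: real assume s: "0 < s"
    have "0 < t + s" using t s by simp
    then obtain l where "(w \<longlongrightarrow> l) (at_left (t + s))" using c unfolding cadlag_def by blast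
    hence "((\<lambda>u. w (t + u)) \<longlongrightarrow> l) (at_left s)"
    proof -
      have "filtermap (\<lambda>u. w (t + u)) (at_left s) = filtermap w (filtermap (\<lambda>u. u + t) (at_left s))"
        by (simp add: filtermap_filtermap add.commute)
      also have "filtermap (\<lambda>u. u + t) (at_left s) = at_left (t + s)"
        using filtermap_at_left_shift[of "-t" s] by (simp add: add.commute)
      finally show ?thesis using \<open>(w \<longlongrightarrow> l) (at_left (t + s))\<close> by (simp add: filterlim_def)
    qed
    hence "(time_shift t w \<longlongrightarrow> l) (at_left s)"
    proof (rule filterlim_cong[THEN iffD1, rotated -1])
      have "\<forall>\<^sub>F u in at_left s. u \<in> {0<..<s}" using s by (rule eventually_at_left_real)
      thus "\<forall>\<^sub>F u in at_left s. w (t + u) = time_shift t w u"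
        by eventually_elim (auto simp: time_shift_def)
    qed auto
    thus "\<exists>l. (time_shift t w \<longlongrightarrow> l) (at_left s)" by blast
  qed
  thus ?thesis by (simp add: space_path_space time_shift_def)
qed

lemma time_shift_measurable [measurable]:
  assumes t: "0 \<le> t" shows "time_shift t \<in> path_space \<rightarrow>\<^sub>M path_space"
proof -
  have "time_shift t \<in> path_space \<rightarrow>\<^sub>M restrict_space (Pi\<^sub>M {0..} (\<lambda>_. borel)) {w. cadlag w}"
  proof (rule measurable_restrict_space2)
    show "time_shift t \<in> space path_space \<rightarrow> {w. cadlag w}"
      using time_shift_in_space[OF t] by (auto simp: space_path_space)
    show "time_shift t \<in> path_space \<rightarrow>\<^sub>M Pi\<^sub>M {0..} (\<lambda>_. borel)"
      unfolding time_shift_def[abs_def] using t by (intro measurable_restrict evaluation_path_space) auto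
  qed
  thus ?thesis by (simp only: path_space_def[symmetric])
qed

lemma space_past [simp]: "space (past t) = space path_space" by (simp add: past_def)

lemma past_evaluation:
  assumes "0 \<le> s" "s \<le> t" shows "(\<lambda>w. w s) \<in> past t \<rightarrow>\<^sub>M (borel :: 'a::topological_space measure)"
proof -
  have "(\<lambda>w::real \<Rightarrow> 'a. restrict w {0..t}) \<in> past t \<rightarrow>\<^sub>M Pi\<^sub>M {0..t} (\<lambda>_. borel)"
    unfolding past_def by (rule measurable_vimage_algebra1) (auto simp: space_PiM)
  moreover have "(\<lambda>x. x s) \<in> Pi\<^sub>M {0..t} (\<lambda>_. borel :: 'a measure) \<rightarrow>\<^sub>M borel"
    using assms by (intro measurable_component_singleton) auto
  ultimately have "(\<lambda>w. (restrict w {0..t}) s) \<in> past t \<rightarrow>\<^sub>M (borel :: 'a measure)"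
    by (rule measurable_compose)
  thus ?thesis using assms by simp
qed

lemma sets_past_subset: "sets (past t) \<subseteq> sets (path_space :: (real \<Rightarrow> 'a::topological_space) measure)"
proof -
  have "(\<lambda>w::real \<Rightarrow> 'a. restrict w {0..t}) \<in> path_space \<rightarrow>\<^sub>M Pi\<^sub>M {0..t} (\<lambda>_. borel)"
    by (intro measurable_restrict evaluation_path_space) auto
  thus ?thesis unfolding past_def by (rule sets_image_in_sets[rotated]) simp
qed

lemma past_measurable_path_space: "G \<in> past t \<rightarrow>\<^sub>M N \<Longrightarrow> G \<in> path_space \<rightarrow>\<^sub>M N"
  using sets_past_subset[of t] unfolding measurable_def by auto

context
  fixes P :: "'a::metric_space \<Rightarrow> (real \<Rightarrow> 'a) measure"
  assumes mp: "markov_process P"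
begin

lemma markov_kernel [measurable]: "P \<in> borel \<rightarrow>\<^sub>M prob_algebra path_space"
  using mp by (simp add: markov_process_def)

lemma markov_kernel_sub [measurable]: "P \<in> borel \<rightarrow>\<^sub>M subprob_algebra path_space"
  by (rule measurable_prob_algebraD[OF markov_kernel])

lemma markov_prob: "prob_space (P \<eta>)" and markov_sets [measurable_cong]: "sets (P \<eta>) = sets path_space"
  using measurable_space[OF markov_kernel, of \<eta>] by (auto simp: space_prob_algebra)

lemma markov_space: "space (P \<eta>) = space path_space"
  by (rule sets_eq_imp_space_eq[OF markov_sets])

lemma markov_start: "AE w in P \<eta>. w 0 = \<eta>"
  using mp by (simp add: markov_process_def)

lemma markov_integral_measurable [measurable]:
  fixes F :: "_ \<Rightarrow> real"
  assumes "F \<in> borel_measurable path_space"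
  shows "(\<lambda>\<eta>. LINT w|P \<eta>. F w) \<in> borel_measurable (borel :: 'a measure)"
  using integral_measurable_subprob_algebra[OF assms] markov_kernel_sub by (rule measurable_compose[rotated])

lemma markov_integral_bound:
  assumes "\<And>w. w \<in> space path_space \<Longrightarrow> \<bar>F w\<bar> \<le> (B::real)" "0 \<le> B"
  shows "\<bar>LINT w|P \<eta>. F w\<bar> \<le> B"
proof -
  interpret prob_space "P \<eta>" by (rule markov_prob)
  have "\<bar>LINT w|P \<eta>. F w\<bar> \<le> (LINT w|P \<eta>. \<bar>F w\<bar>)" by (rule integral_abs_bound)
  also have "\<dots> \<le> (LINT w|P \<eta>. B)"
    using assms by (intro integral_mono') (auto simp: markov_space)
  finally show ?thesis by (simp add: prob_space)
qed

text \<open>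
  Weighting \<open>P \<eta>\<close> with the density \<open>G\<close> turns the claim into an equality of two
  measures on path space: the law of the shifted path and the mixture of the laws \<open>P (w t)\<close>. On a
  single event this is the Markov property as defined.
\<close>
lemma markov_property_nonneg:
  fixes G F :: "(real \<Rightarrow> 'a) \<Rightarrow> real"
  assumes t: "0 \<le> t" and G: "G \<in> borel_measurable (past t)" "\<And>w. w \<in> space path_space \<Longrightarrow> 0 \<le> G w \<and> G w \<le> c"
    and F: "F \<in> borel_measurable path_space" "\<And>w. w \<in> space path_space \<Longrightarrow> \<bar>F w\<bar> \<le> B"
  shows "(LINT w|P \<eta>. G w * F (time_shift t w)) = (LINT w|P \<eta>. G w * (LINT w'|P (w t). F w'))"
proof -
  interpret prob_space "P \<eta>" by (rule markov_prob)
  have Gm0: "G \<in> borel_measurable path_space" by (rule past_measurable_path_space[OF G(1)])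
  have Gm [measurable]: "G \<in> borel_measurable (P \<eta>)" using Gm0 by simp
  have tm [measurable]: "time_shift t \<in> P \<eta> \<rightarrow>\<^sub>M path_space" using time_shift_measurable[OF t]
    by (subst measurable_cong_sets[OF markov_sets refl])
  have em [measurable]: "(\<lambda>w. w t) \<in> P \<eta> \<rightarrow>\<^sub>M borel" using evaluation_path_space[OF t]
    by (subst measurable_cong_sets[OF markov_sets refl])
  note Fm [measurable] = F(1)
  have sub: "subalgebra (P \<eta>) (past t)"
    unfolding subalgebra_def using sets_past_subset[of t] by (auto simp: markov_space markov_sets)
  interpret S: finite_measure_subalgebra "P \<eta>" "past t" by unfold_locales (rule sub)
  define M where "M = density (P \<eta>) (\<lambda>w. ennreal (G w))"
  have spM: "space M = space path_space" and stM [measurable_cong]: "sets M = sets path_space"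
    by (simp_all add: M_def markov_space markov_sets)
  have Gint: "integrable (P \<eta>) G"
    by (rule integrable_const_bound[of _ c]) (use G in \<open>auto simp: markov_space intro!: AE_I2\<close>)
  have finM: "finite_measure M"
  proof
    have "emeasure M (space M) = (\<integral>\<^sup>+w. ennreal (G w) \<partial>P \<eta>)"
      unfolding M_def by (subst emeasure_density) (auto intro!: nn_integral_cong)
    also have "\<dots> < \<infinity>" using Gint G(2) by (subst nn_integral_eq_integral) (auto simp: markov_space intro!: AE_I2)
    finally show "emeasure M (space M) \<noteq> \<infinity>" by simp
  qed
  have tM: "time_shift t \<in> M \<rightarrow>\<^sub>M path_space" using time_shift_measurable[OF t] by (simp cong: measurable_cong_sets add: stM)
  have kM: "(\<lambda>w. P (w t)) \<in> M \<rightarrow>\<^sub>M subprob_algebra path_space"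
    using measurable_compose[OF evaluation_path_space[OF t] markov_kernel_sub] by (simp cong: measurable_cong_sets add: stM)
  have ne: "space M \<noteq> {}" using not_empty by (simp add: spM markov_space)
  have eq: "distr M path_space (time_shift t) = M \<bind> (\<lambda>w. P (w t))"
  proof (rule measure_eqI)
    show "sets (distr M path_space (time_shift t)) = sets (M \<bind> (\<lambda>w. P (w t)))"
      using ne by (subst sets_bind) (auto simp: markov_sets)
    fix A assume "A \<in> sets (distr M path_space (time_shift t))"
    hence A [measurable]: "A \<in> sets path_space" by simp
    define I where "I = (indicator {w \<in> space path_space. time_shift t w \<in> A} :: _ \<Rightarrow> real)"
    have As: "{w \<in> space path_space. time_shift t w \<in> A} \<in> sets path_space"
      using measurable_sets[OF time_shift_measurable[OF t] A] by (simp add: vimage_def Int_def conj_commute)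
    have Im [measurable]: "I \<in> borel_measurable (P \<eta>)" unfolding I_def using As by simp
    have ce: "AE w in P \<eta>. real_cond_exp (P \<eta>) (past t) I w = measure (P (w t)) A"
      using mp t A unfolding markov_process_def I_def by blast
    have GI: "integrable (P \<eta>) (\<lambda>w. G w * I w)"
      by (rule Bochner_Integration.integrable_bound[OF Gint]) (auto simp: I_def indicator_def)
    have mm [measurable]: "(\<lambda>w. measure (P (w t)) A) \<in> borel_measurable (P \<eta>)"
      using measurable_compose[OF em measurable_compose[OF markov_kernel_sub measurable_measure_subprob_algebra[OF A]]] by simp
    have m1: "measure (P x) A \<le> 1" for x by (rule prob_space.prob_le_1[OF markov_prob])
    have GM: "integrable (P \<eta>) (\<lambda>w. G w * measure (P (w t)) A)"
      by (rule Bochner_Integration.integrable_bound[OF Gint]) (auto simp: abs_mult m1 mult_left_le)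
    have "(LINT w|P \<eta>. G w * I w) = (LINT w|P \<eta>. G w * real_cond_exp (P \<eta>) (past t) I w)"
      by (rule S.real_cond_exp_intg(2)[OF GI G(1) Im, symmetric])
    also have "\<dots> = (LINT w|P \<eta>. G w * measure (P (w t)) A)"
    proof (rule integral_cong_AE)
      show "(\<lambda>w. G w * real_cond_exp (P \<eta>) (past t) I w) \<in> borel_measurable (P \<eta>)" by simp
      show "AE w in P \<eta>. G w * real_cond_exp (P \<eta>) (past t) I w = G w * measure (P (w t)) A"
        using ce by eventually_elim simp
    qed simp
    finally have *: "(LINT w|P \<eta>. G w * I w) = (LINT w|P \<eta>. G w * measure (P (w t)) A)" .
    have "emeasure (distr M path_space (time_shift t)) A = emeasure M {w \<in> space path_space. time_shift t w \<in> A}"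
      by (subst emeasure_distr[OF tM A]) (auto simp: spM intro!: arg_cong[where f="emeasure M"])
    also have "\<dots> = (\<integral>\<^sup>+w. ennreal (G w) * indicator {w \<in> space path_space. time_shift t w \<in> A} w \<partial>P \<eta>)"
      unfolding M_def by (rule emeasure_density) (use As in auto)
    also have "\<dots> = (\<integral>\<^sup>+w. ennreal (G w * I w) \<partial>P \<eta>)"
      by (intro nn_integral_cong) (auto simp: I_def indicator_def)
    also have "\<dots> = ennreal (LINT w|P \<eta>. G w * I w)"
      using GI G(2) by (intro nn_integral_eq_integral) (auto simp: markov_space I_def indicator_def intro!: AE_I2)
    also have "\<dots> = ennreal (LINT w|P \<eta>. G w * measure (P (w t)) A)" by (simp only: *)
    also have "\<dots> = (\<integral>\<^sup>+w. ennreal (G w * measure (P (w t)) A) \<partial>P \<eta>)"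
      using GM G(2) by (intro nn_integral_eq_integral[symmetric]) (auto simp: markov_space intro!: AE_I2)
    also have "\<dots> = (\<integral>\<^sup>+w. ennreal (G w) * emeasure (P (w t)) A \<partial>P \<eta>)"
      using G(2) by (intro nn_integral_cong)
        (auto simp: markov_space ennreal_mult finite_measure.emeasure_eq_measure[OF prob_space.finite_measure[OF markov_prob]])
    also have "\<dots> = (\<integral>\<^sup>+w. emeasure (P (w t)) A \<partial>M)"
      unfolding M_def by (rule nn_integral_density[symmetric])
        (auto intro!: measurable_compose[OF em measurable_compose[OF markov_kernel_sub measurable_emeasure_subprob_algebra[OF A]]])
    also have "\<dots> = emeasure (M \<bind> (\<lambda>w. P (w t))) A"
      by (rule emeasure_bind[OF ne kM A, symmetric])
    finally show "emeasure (distr M path_space (time_shift t)) A = emeasure (M \<bind> (\<lambda>w. P (w t))) A" .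
  qed
  have "(LINT w|P \<eta>. G w * F (time_shift t w)) = (LINT w|M. F (time_shift t w))"
    unfolding M_def using G(2) by (subst integral_density) (auto simp: markov_space intro!: AE_I2)
  also have "\<dots> = (LINT w|distr M path_space (time_shift t). F w)" by (rule integral_distr[OF tM F(1), symmetric])
  also have "\<dots> = (LINT w|M. (LINT w'|P (w t). F w'))"
    unfolding eq
  proof (rule integral_bind[OF F(1) F(2) kM finM])
    show "AE w in M. emeasure (P (w t)) (space (P (w t))) \<le> ennreal 1"
      using prob_space.emeasure_space_1[OF markov_prob] by simp
  qed
  also have "\<dots> = (LINT w|P \<eta>. G w * (LINT w'|P (w t). F w'))"
    unfolding M_def using G(2) measurable_compose[OF em markov_integral_measurable[OF F(1)]]
    by (subst integral_density) (auto simp: markov_space intro!: AE_I2)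
  finally show ?thesis .
qed

text \<open>
  The nonnegative case applied to \<open>G + c\<close> and to the constant \<open>c\<close>.
\<close>
lemma markov_property:
  fixes G F :: "(real \<Rightarrow> 'a) \<Rightarrow> real"
  assumes t: "0 \<le> t" and G: "G \<in> borel_measurable (past t)" "\<And>w. w \<in> space path_space \<Longrightarrow> \<bar>G w\<bar> \<le> c"
    and F: "F \<in> borel_measurable path_space" "\<And>w. w \<in> space path_space \<Longrightarrow> \<bar>F w\<bar> \<le> B"
  shows "(LINT w|P \<eta>. G w * F (time_shift t w)) = (LINT w|P \<eta>. G w * (LINT w'|P (w t). F w'))"
proof -
  interpret prob_space "P \<eta>" by (rule markov_prob)
  obtain w0 :: "real \<Rightarrow> 'a" where w0: "w0 \<in> space path_space" using not_empty by (auto simp: markov_space)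
  have c: "0 \<le> c" and B: "0 \<le> B" using G(2)[OF w0] F(2)[OF w0] by linarith+
  have Gm [measurable]: "G \<in> borel_measurable (P \<eta>)" using past_measurable_path_space[OF G(1)] by simp
  have Ft [measurable]: "(\<lambda>w. F (time_shift t w)) \<in> borel_measurable (P \<eta>)"
    using measurable_compose[OF time_shift_measurable[OF t] F(1)] by simp
  have Hm [measurable]: "(\<lambda>w. (LINT w'|P (w t). F w')) \<in> borel_measurable (P \<eta>)"
    using measurable_compose[OF evaluation_path_space[OF t] markov_integral_measurable[OF F(1)]] by simp
  have Fb: "\<bar>F (time_shift t w)\<bar> \<le> B" if "w \<in> space path_space" for w
    using F(2) time_shift_in_space[OF t that] by blast
  have Hb: "\<bar>LINT w'|P x. F w'\<bar> \<le> B" for x by (rule markov_integral_bound[OF F(2) B])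
  have i1: "integrable (P \<eta>) (\<lambda>w. F (time_shift t w))"
    by (rule integrable_const_bound[of _ B]) (use Fb in \<open>auto simp: markov_space intro!: AE_I2\<close>)
  have i2: "integrable (P \<eta>) (\<lambda>w. (LINT w'|P (w t). F w'))"
    by (rule integrable_const_bound[of _ B]) (use Hb in \<open>auto intro!: AE_I2\<close>)
  have i3: "integrable (P \<eta>) (\<lambda>w. G w * F (time_shift t w))"
    by (rule integrable_const_bound[of _ "c * B"])
       (use Fb G(2) c in \<open>auto simp: markov_space abs_mult intro!: AE_I2 mult_mono\<close>)
  have i4: "integrable (P \<eta>) (\<lambda>w. G w * (LINT w'|P (w t). F w'))"
    by (rule integrable_const_bound[of _ "c * B"])
       (use Hb G(2) c in \<open>auto simp: markov_space abs_mult intro!: AE_I2 mult_mono\<close>)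
  have Gc: "(\<lambda>w. G w + c) \<in> borel_measurable (past t)" using G(1) by simp
  have 1: "(LINT w|P \<eta>. (G w + c) * F (time_shift t w)) = (LINT w|P \<eta>. (G w + c) * (LINT w'|P (w t). F w'))"
  proof (rule markov_property_nonneg[OF t Gc _ F(1) F(2)])
    fix w :: "real \<Rightarrow> 'a" assume "w \<in> space path_space"
    thus "0 \<le> G w + c \<and> G w + c \<le> 2 * c" using G(2)[of w] by linarith
  qed
  have 2: "(LINT w|P \<eta>. c * F (time_shift t w)) = (LINT w|P \<eta>. c * (LINT w'|P (w t). F w'))"
    by (rule markov_property_nonneg[OF t _ _ F(1) F(2), where c=c]) (use c in auto)
  have 3: "c * (LINT w|P \<eta>. F (time_shift t w)) = c * (LINT w|P \<eta>. (LINT w'|P (w t). F w'))"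
    using 2 by simp
  from 1 show ?thesis using 3 i1 i2 i3 i4 by (simp add: distrib_right)
qed

text \<open>
  When \<open>F\<close> is a function of one coordinate this is the Chapman-Kolmogorov equation.
\<close>
lemma markov_shift_integral:
  fixes F :: "(real \<Rightarrow> 'a) \<Rightarrow> real"
  assumes t: "0 \<le> t" and F: "F \<in> borel_measurable path_space" "\<And>w. w \<in> space path_space \<Longrightarrow> \<bar>F w\<bar> \<le> B"
  shows "(LINT w|P \<eta>. F (time_shift t w)) = transition P t (\<lambda>x. LINT w|P x. F w) \<eta>"
  using markov_property[OF t _ _ F, of "\<lambda>_. 1" 1] by (simp add: transition_def)

lemma transition_measurable:
  assumes t: "0 \<le> t" and h: "h \<in> borel_measurable borel"
  shows "transition P t h \<in> borel_measurable borel"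
  unfolding transition_def by (rule markov_integral_measurable[OF measurable_compose[OF evaluation_path_space[OF t] h]])

lemma transition_bound:
  assumes "\<And>x. \<bar>h x\<bar> \<le> B" shows "\<bar>transition P t h \<eta>\<bar> \<le> B"
  unfolding transition_def using assms[of undefined] by (intro markov_integral_bound assms) linarith

lemma transition_add_time:
  assumes s: "0 \<le> s" and t: "0 \<le> t" and h: "h \<in> borel_measurable borel" "\<And>x. \<bar>h x\<bar> \<le> B"
  shows "transition P (s + t) h \<eta> = transition P s (transition P t h) \<eta>"
proof -
  have "(LINT w|P \<eta>. h (time_shift s w t)) = transition P s (\<lambda>x. LINT w|P x. h (w t)) \<eta>"
    by (rule markov_shift_integral[OF s measurable_compose[OF evaluation_path_space[OF t] h(1)] h(2)])
  thus ?thesis using t by (simp add: transition_def[abs_def] time_shift_def)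
qed

lemma transition_const: "transition P t (\<lambda>_. c) \<eta> = c"
  unfolding transition_def using markov_prob[of \<eta>] by (simp add: prob_space.prob_space)

lemma transition_0: assumes "h \<in> borel_measurable borel" shows "transition P 0 h \<eta> = h \<eta>"
proof -
  interpret prob_space "P \<eta>" by (rule markov_prob)
  have "transition P 0 h \<eta> = (LINT w|P \<eta>. h \<eta>)" unfolding transition_def
    by (rule integral_cong_AE) (use markov_start[of \<eta>] measurable_compose[OF evaluation_path_space[of 0] assms] in auto)
  thus ?thesis by (simp add: prob_space)
qed

lemma path_rc_on:
  fixes w :: "real \<Rightarrow> 'a" and h :: "'a \<Rightarrow> real"
  assumes w: "w \<in> space path_space" and h: "continuous_on UNIV h" "\<And>x. \<bar>h x\<bar> \<le> B"
  shows "rc_on (\<lambda>t. h (w t)) B"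
  unfolding rc_on_def
proof (intro conjI allI impI)
  fix t :: real assume "0 \<le> t"
  hence "(w \<longlongrightarrow> w t) (at_right t)" using w by (simp add: space_path_space cadlag_def)
  thus "((\<lambda>t. h (w t)) \<longlongrightarrow> h (w t)) (at_right t)"
    using h(1) by (intro isCont_tendsto_compose[of _ h]) (auto simp: continuous_on_eq_continuous_at)
qed (use h in auto)

lemma transition_rc_on:
  assumes h: "continuous_on UNIV h" "\<And>x. \<bar>h x\<bar> \<le> B"
  shows "rc_on (\<lambda>t. transition P t h \<eta>) B"
  unfolding rc_on_def
proof (intro conjI allI impI)
  fix t :: real assume t: "0 \<le> t"
  interpret prob_space "P \<eta>" by (rule markov_prob)
  have hm: "h \<in> borel_measurable borel" using h(1) by (rule borel_measurable_continuous_onI)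
  show "((\<lambda>t. transition P t h \<eta>) \<longlongrightarrow> transition P t h \<eta>) (at_right t)"
  proof (rule tendsto_at_right_sequentially[of t "t + 1"])
    fix S :: "nat \<Rightarrow> real" assume S: "\<And>n. t < S n" "S \<longlonglongrightarrow> t"
    have f: "filterlim S (at_right t) sequentially"
      unfolding filterlim_at using S by (auto intro!: always_eventually simp: less_imp_neq[THEN not_sym])
    show "(\<lambda>n. transition P (S n) h \<eta>) \<longlonglongrightarrow> transition P t h \<eta>"
      unfolding transition_def
    proof (rule integral_dominated_convergence[where w="\<lambda>_. B"])
      show "(\<lambda>w. h (w t)) \<in> borel_measurable (P \<eta>)"
        using measurable_compose[OF evaluation_path_space[OF t] hm] by simp
      show "(\<lambda>w. h (w (S n))) \<in> borel_measurable (P \<eta>)" for n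
        using measurable_compose[OF evaluation_path_space[of "S n"] hm] S(1)[of n] t by simp
      show "AE w in P \<eta>. (\<lambda>n. h (w (S n))) \<longlonglongrightarrow> h (w t)"
      proof (rule AE_I2)
        fix w assume "w \<in> space (P \<eta>)"
        hence "rc_on (\<lambda>t. h (w t)) B" by (intro path_rc_on h) (simp add: markov_space)
        hence "((\<lambda>t. h (w t)) \<longlongrightarrow> h (w t)) (at_right t)" using t by (simp add: rc_on_def)
        thus "(\<lambda>n. h (w (S n))) \<longlonglongrightarrow> h (w t)" using f by (rule filterlim_compose)
      qed
    qed (use h in auto)
  qed simp
qed (rule transition_bound[OF h(2)])

context
  fixes \<nu> :: "'a measure"
  assumes inv: "invariant_distribution P \<nu>"
begin

lemma inv_prob: "prob_space \<nu>" and inv_sets [measurable_cong]: "sets \<nu> = sets borel"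
  using inv by (auto simp: invariant_distribution_def)

lemma inv_kernel: "P \<in> \<nu> \<rightarrow>\<^sub>M subprob_algebra path_space"
  using markov_kernel_sub by (simp cong: measurable_cong_sets add: inv_sets)

lemma inv_nonempty: "space \<nu> \<noteq> {}" by (rule prob_space.not_empty[OF inv_prob])

lemma law_sets [measurable_cong]: "sets (law_from P \<nu>) = sets path_space"
  unfolding law_from_def by (rule sets_bind[OF _ inv_nonempty]) (simp add: markov_sets)

lemma law_space: "space (law_from P \<nu>) = space path_space"
  by (rule sets_eq_imp_space_eq[OF law_sets])

lemma law_prob: "prob_space (law_from P \<nu>)"
  unfolding law_from_def
  by (rule prob_space.prob_space_bind[OF inv_prob _ inv_kernel]) (use markov_prob in simp)

lemma law_integral:
  assumes F: "F \<in> borel_measurable path_space" "\<And>w. w \<in> space path_space \<Longrightarrow> \<bar>F w\<bar> \<le> (B::real)"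
  shows "(LINT w|law_from P \<nu>. F w) = (LINT x|\<nu>. (LINT w|P x. F w))"
  unfolding law_from_def
proof (rule integral_bind[OF F inv_kernel])
  show "finite_measure \<nu>" by (rule prob_space.finite_measure[OF inv_prob])
  show "AE x in \<nu>. emeasure (P x) (space (P x)) \<le> ennreal 1"
    using prob_space.emeasure_space_1[OF markov_prob] by simp
qed

lemma law_marginal:
  assumes t: "0 \<le> t" and h: "h \<in> borel_measurable borel"
  shows "(LINT w|law_from P \<nu>. h (w t)) = (LINT x|\<nu>. h x :: real)"
proof -
  have "(\<lambda>w. w t) \<in> law_from P \<nu> \<rightarrow>\<^sub>M borel" using evaluation_path_space[OF t] by (simp cong: measurable_cong_sets add: law_sets)
  hence "(LINT w|law_from P \<nu>. h (w t)) = (LINT x|distr (law_from P \<nu>) borel (\<lambda>w. w t). h x)"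
    using h by (rule integral_distr[symmetric])
  thus ?thesis using inv t by (simp add: invariant_distribution_def)
qed

lemma transition_invariant:
  assumes t: "0 \<le> t" and h: "h \<in> borel_measurable borel" "\<And>x. \<bar>h x\<bar> \<le> (B::real)"
  shows "(LINT x|\<nu>. transition P t h x) = (LINT x|\<nu>. h x)"
  using law_integral[OF measurable_compose[OF evaluation_path_space[OF t] h(1)] h(2)] law_marginal[OF t h(1)]
  by (simp add: transition_def)

lemma law_markov:
  assumes t: "0 \<le> t" and G: "G \<in> borel_measurable (past t)" "\<And>w. w \<in> space path_space \<Longrightarrow> \<bar>G w\<bar> \<le> (c::real)"
    and F: "F \<in> borel_measurable path_space" "\<And>w. w \<in> space path_space \<Longrightarrow> \<bar>F w\<bar> \<le> (B::real)"
  shows "(LINT w|law_from P \<nu>. G w * F (time_shift t w)) = (LINT w|law_from P \<nu>. G w * (LINT w'|P (w t). F w'))"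
proof -
  obtain w0 :: "real \<Rightarrow> 'a" where w0: "w0 \<in> space path_space"
    using prob_space.not_empty[OF law_prob] by (auto simp: law_space)
  have c: "0 \<le> c" and B: "0 \<le> B" using G(2)[OF w0] F(2)[OF w0] by linarith+
  have Gm [measurable]: "G \<in> borel_measurable path_space" by (rule past_measurable_path_space[OF G(1)])
  have Ft [measurable]: "(\<lambda>w. F (time_shift t w)) \<in> borel_measurable path_space"
    using measurable_compose[OF time_shift_measurable[OF t] F(1)] by simp
  have Hm [measurable]: "(\<lambda>w. (LINT w'|P (w t). F w')) \<in> borel_measurable path_space"
    using measurable_compose[OF evaluation_path_space[OF t] markov_integral_measurable[OF F(1)]] by simp
  have Fb: "\<bar>F (time_shift t w)\<bar> \<le> B" if "w \<in> space path_space" for w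
    using F(2) time_shift_in_space[OF t that] by blast
  have Hb: "\<bar>LINT w'|P x. F w'\<bar> \<le> B" for x by (rule markov_integral_bound[OF F(2) B])
  have "(LINT w|law_from P \<nu>. G w * F (time_shift t w)) = (LINT x|\<nu>. (LINT w|P x. G w * F (time_shift t w)))"
    by (rule law_integral[where B="c * B"]) (use Fb G(2) c in \<open>auto simp: abs_mult intro!: mult_mono\<close>)
  also have "\<dots> = (LINT x|\<nu>. (LINT w|P x. G w * (LINT w'|P (w t). F w')))"
    using markov_property[OF t G F] by simp
  also have "\<dots> = (LINT w|law_from P \<nu>. G w * (LINT w'|P (w t). F w'))"
    by (rule law_integral[symmetric, where B="c * B"]) (use Hb G(2) c in \<open>auto simp: abs_mult intro!: mult_mono\<close>)
  finally show ?thesis .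
qed

text \<open>
  By the Markov property the law of the shifted path depends on the law of \<open>w t\<close> only, which is
  \<open>\<nu>\<close>.
\<close>
lemma law_stationary:
  assumes t: "0 \<le> t" and F: "F \<in> borel_measurable path_space" "\<And>w. w \<in> space path_space \<Longrightarrow> \<bar>F w\<bar> \<le> (B::real)"
  shows "(LINT w|law_from P \<nu>. F (time_shift t w)) = (LINT w|law_from P \<nu>. F w)"
proof -
  have "(LINT w|law_from P \<nu>. F (time_shift t w)) = (LINT w|law_from P \<nu>. (LINT w'|P (w t). F w'))"
    using law_markov[OF t _ _ F, of "\<lambda>_. 1" 1] by simp
  also have "\<dots> = (LINT x|\<nu>. (LINT w'|P x. F w'))" by (rule law_marginal[OF t markov_integral_measurable[OF F(1)]])
  also have "\<dots> = (LINT w|law_from P \<nu>. F w)" by (rule law_integral[OF F, symmetric])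
  finally show ?thesis .
qed

text \<open>
  Given the past up to time \<open>s\<close>, the expectation of the future functional is \<open>transition P
  g H\<close> at the point \<open>w s\<close>, where \<open>H x\<close> is the expectation of \<open>F\<close>
  from \<open>x\<close>. Since \<open>w s\<close> has law \<open>\<nu>\<close> and \<open>|H| \<le> 1\<close>,
  the decay in \<open>L\<^sup>1(\<nu>)\<close> bounds the covariance.
\<close>
lemma law_mixing:
  assumes decay: "\<And>h. h \<in> borel_measurable borel \<Longrightarrow> (\<And>x. \<bar>h x\<bar> \<le> 1) \<Longrightarrow>
      (LINT x|\<nu>. \<bar>transition P g h x - (LINT y|\<nu>. h y)\<bar>) \<le> (\<alpha>::real)"
    and s: "0 \<le> s" and g: "0 \<le> g"
    and G: "G \<in> borel_measurable (past s)" "\<And>w. w \<in> space path_space \<Longrightarrow> \<bar>G w\<bar> \<le> (1::real)"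
    and F: "F \<in> borel_measurable path_space" "\<And>w. w \<in> space path_space \<Longrightarrow> \<bar>F w\<bar> \<le> (1::real)"
  shows "\<bar>(LINT w|law_from P \<nu>. G w * F (time_shift (s + g) w)) - (LINT w|law_from P \<nu>. G w) * (LINT w|law_from P \<nu>. F w)\<bar> \<le> \<alpha>"
proof -
  interpret Q: prob_space "law_from P \<nu>" by (rule law_prob)
  interpret N: prob_space \<nu> by (rule inv_prob)
  define H where "H x = (LINT w|P x. F w)" for x
  have Hm: "H \<in> borel_measurable borel" unfolding H_def by (rule markov_integral_measurable[OF F(1)])
  have Hb: "\<bar>H x\<bar> \<le> 1" for x unfolding H_def by (rule markov_integral_bound[OF F(2)]) auto
  define T where "T = transition P g H"
  have Tm: "T \<in> borel_measurable borel" unfolding T_def by (rule transition_measurable[OF g Hm])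
  have Tb: "\<bar>T x\<bar> \<le> 1" for x unfolding T_def by (rule transition_bound[OF Hb])
  have Gm [measurable]: "G \<in> borel_measurable path_space" by (rule past_measurable_path_space[OF G(1)])
  have Ts [measurable]: "(\<lambda>w. T (w s)) \<in> borel_measurable path_space" by (rule measurable_compose[OF evaluation_path_space[OF s] Tm])
  have Fg [measurable]: "(\<lambda>w. F (time_shift g w)) \<in> borel_measurable path_space"
    by (rule measurable_compose[OF time_shift_measurable[OF g] F(1)])
  define m where "m = (LINT x|\<nu>. H x)"
  have m: "m = (LINT w|law_from P \<nu>. F w)" unfolding m_def H_def by (rule law_integral[OF F, symmetric])
  have sh: "time_shift (s + g) w = time_shift g (time_shift s w)" for w :: "real \<Rightarrow> 'a"
    using s g by (auto simp: time_shift_def fun_eq_iff add.assoc)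
  have "(LINT w|law_from P \<nu>. G w * F (time_shift (s + g) w)) = (LINT w|law_from P \<nu>. G w * (LINT w'|P (w s). F (time_shift g w')))"
    unfolding sh
  proof (rule law_markov[OF s G Fg])
    fix w :: "real \<Rightarrow> 'a" assume "w \<in> space path_space"
    thus "\<bar>F (time_shift g w)\<bar> \<le> 1" by (intro F(2) time_shift_in_space[OF g])
  qed
  also have "\<dots> = (LINT w|law_from P \<nu>. G w * T (w s))"
    unfolding T_def H_def using markov_shift_integral[OF g F] by simp
  finally have 1: "(LINT w|law_from P \<nu>. G w * F (time_shift (s + g) w)) = (LINT w|law_from P \<nu>. G w * T (w s))" .
  have i1: "integrable (law_from P \<nu>) (\<lambda>w. G w * T (w s))"
    by (rule Q.integrable_const_bound[of _ 1])
       (use G(2) Tb mult_mono[OF G(2) Tb] in \<open>auto simp: law_space abs_mult intro!: AE_I2\<close>)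
  have i2: "integrable (law_from P \<nu>) G"
    by (rule Q.integrable_const_bound[of _ 1]) (use G(2) in \<open>auto simp: law_space intro!: AE_I2\<close>)
  have mb: "\<bar>T x - m\<bar> \<le> 1 + \<bar>m\<bar>" for x using Tb[of x] by linarith
  have "\<bar>(LINT w|law_from P \<nu>. G w * T (w s)) - (LINT w|law_from P \<nu>. G w) * m\<bar> = \<bar>LINT w|law_from P \<nu>. G w * (T (w s) - m)\<bar>"
    using i1 i2 by (simp add: right_diff_distrib)
  also have "\<dots> \<le> (LINT w|law_from P \<nu>. \<bar>G w * (T (w s) - m)\<bar>)" by (rule integral_abs_bound)
  also have "\<dots> \<le> (LINT w|law_from P \<nu>. \<bar>T (w s) - m\<bar>)"
  proof (rule integral_mono')
    show "integrable (law_from P \<nu>) (\<lambda>w. \<bar>T (w s) - m\<bar>)"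
      by (rule Q.integrable_const_bound[of _ "1 + \<bar>m\<bar>"]) (use mb in auto)
    show "\<bar>G w * (T (w s) - m)\<bar> \<le> \<bar>T (w s) - m\<bar>" if "w \<in> space (law_from P \<nu>)" for w
      using G(2)[of w] that by (auto simp: law_space abs_mult mult_left_le_one_le)
  qed auto
  also have "\<dots> = (LINT x|\<nu>. \<bar>T x - m\<bar>)" using law_marginal[OF s, of "\<lambda>x. \<bar>T x - m\<bar>"] Tm by simp
  also have "\<dots> \<le> \<alpha>" unfolding T_def m_def by (rule decay[OF Hm Hb])
  finally show ?thesis unfolding 1 m .
qed

end
end

section \<open>The space of continuous paths\<close>

definition path_ball :: "(real \<Rightarrow> real) \<Rightarrow> real \<Rightarrow> real \<Rightarrow> (real \<Rightarrow> real) set" where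
  "path_ball u T d = {v \<in> continuous_paths. \<forall>t\<in>{0..T}. \<bar>v t - u t\<bar> < d}"

lemma continuous_path_topology_eq:
  "continuous_path_topology = topology_generated_by {path_ball u T d | u T d. u \<in> continuous_paths \<and> 0 < d}"
  by (simp add: continuous_path_topology_def path_ball_def)

lemma continuous_paths_cont: "w \<in> continuous_paths \<Longrightarrow> continuous_on {0..} w"
  by (simp add: continuous_paths_def)

lemma path_ball_inside:
  assumes u: "u \<in> continuous_paths" and x: "x \<in> path_ball u T \<delta>" and d: "0 < \<delta>"
  shows "\<exists>r>0. path_ball x T r \<subseteq> path_ball u T \<delta>"
proof (cases "0 \<le> T")
  case True
  have "continuous_on {0..T} (\<lambda>t. \<bar>x t - u t\<bar>)"
  proof -
    have "continuous_on {0..T} x" "continuous_on {0..T} u"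
      using u x continuous_paths_cont[of x] continuous_paths_cont[of u]
      by (auto simp: path_ball_def elim: continuous_on_subset)
    thus ?thesis by (intro continuous_intros)
  qed
  then obtain t0 where t0: "t0 \<in> {0..T}" "\<And>t. t \<in> {0..T} \<Longrightarrow> \<bar>x t - u t\<bar> \<le> \<bar>x t0 - u t0\<bar>"
    using continuous_attains_sup[of "{0..T}" "\<lambda>t. \<bar>x t - u t\<bar>"] True by auto
  have "0 < \<delta> - \<bar>x t0 - u t0\<bar>" using x t0 by (auto simp: path_ball_def)
  moreover have "path_ball x T (\<delta> - \<bar>x t0 - u t0\<bar>) \<subseteq> path_ball u T \<delta>"
    unfolding path_ball_def using t0(2) by fastforce
  ultimately show ?thesis by blast
next
  case False
  thus ?thesis by (intro exI[of _ 1]) (auto simp: path_ball_def)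
qed

lemma path_ball_mono: "T \<le> T' \<Longrightarrow> r' \<le> r \<Longrightarrow> path_ball u T' r' \<subseteq> path_ball u T r"
  by (auto simp: path_ball_def intro!: less_le_trans[of _ r' r])

lemma path_ball_centre: "u \<in> continuous_paths \<Longrightarrow> 0 < r \<Longrightarrow> u \<in> path_ball u T r"
  by (simp add: path_ball_def)

lemma topspace_continuous_path_topology [simp]: "topspace continuous_path_topology = continuous_paths"
proof -
  have "\<Union>{path_ball u T d | u T d. u \<in> continuous_paths \<and> 0 < d} = continuous_paths"
  proof (intro subset_antisym subsetI)
    fix v assume "v \<in> continuous_paths"
    thus "v \<in> \<Union>{path_ball u T d | u T d. u \<in> continuous_paths \<and> 0 < d}"
      by (intro UnionI[OF _ path_ball_centre[of v 1 0]] CollectI exI[of _ v] exI[of _ 0] exI[of _ 1]) auto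
  qed (auto simp: path_ball_def)
  thus ?thesis by (simp add: continuous_path_topology_eq)
qed

text \<open>
  The topology is generated by balls with arbitrary centres; every point of such a ball is the centre of a
  smaller one, and two balls around the same centre contain a common one.
\<close>
lemma openin_continuous_path_topology_iff:
  "openin continuous_path_topology U \<longleftrightarrow>
    U \<subseteq> continuous_paths \<and> (\<forall>u\<in>U. \<exists>T. \<exists>r>0. path_ball u T r \<subseteq> U)"
proof (intro iffI conjI ballI)
  assume U: "openin continuous_path_topology U"
  thus "U \<subseteq> continuous_paths" using openin_subset by fastforce
  fix u assume u: "u \<in> U"
  from U have "generate_topology_on {path_ball u T \<delta> | u T \<delta>. u \<in> continuous_paths \<and> 0 < \<delta>} U"
    by (simp add: continuous_path_topology_eq openin_topology_generated_by_iff)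
  thus "\<exists>T. \<exists>r>0. path_ball u T r \<subseteq> U" using u
  proof (induction arbitrary: u)
    case (Int a b)
    then obtain T1 r1 T2 r2 where *: "r1 > 0" "path_ball u T1 r1 \<subseteq> a" "r2 > 0" "path_ball u T2 r2 \<subseteq> b"
      by (metis IntE)
    have "path_ball u (max T1 T2) (min r1 r2) \<subseteq> a \<inter> b"
      using *(2,4) path_ball_mono[of T1 "max T1 T2" "min r1 r2" r1 u] path_ball_mono[of T2 "max T1 T2" "min r1 r2" r2 u] by auto
    thus ?case using *(1,3) by (metis min_less_iff_conj)
  next
    case (UN K)
    then obtain k where "k \<in> K" "u \<in> k" by auto
    with UN.IH[of k u] show ?case by (meson Union_upper order_trans)
  next
    case (Basis s)
    then obtain v T d where "s = path_ball v T d" "v \<in> continuous_paths" "0 < d" by auto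
    thus ?case using path_ball_inside[of v u T d] Basis by auto
  qed simp
next
  assume *: "U \<subseteq> continuous_paths \<and> (\<forall>u\<in>U. \<exists>T. \<exists>r>0. path_ball u T r \<subseteq> U)"
  show "openin continuous_path_topology U"
  proof (subst openin_subopen, intro ballI)
    fix u assume u: "u \<in> U"
    then obtain T r where r: "r > 0" "path_ball u T r \<subseteq> U" using * by blast
    have "openin continuous_path_topology (path_ball u T r)" unfolding continuous_path_topology_eq
      using u * r by (intro topology_generated_by_Basis CollectI exI[of _ u] exI[of _ T] exI[of _ r]) auto
    thus "\<exists>V. openin continuous_path_topology V \<and> u \<in> V \<and> V \<subseteq> U"
      using r path_ball_centre[of u r T] u * by (intro exI[of _ "path_ball u T r"]) auto
  qed
qed

text \<open>
  Lower semicontinuous functions include the indicators of open sets, hence one approximation scheme serves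
  both the measurability of random paths and the convergence of expectations.
\<close>
definition path_lsc :: "((real \<Rightarrow> real) \<Rightarrow> real) \<Rightarrow> bool" where
  "path_lsc \<Phi> \<longleftrightarrow> (\<forall>x\<in>continuous_paths. \<forall>e>0. \<exists>T. \<exists>r>0. \<forall>y\<in>path_ball x T r. \<Phi> x - e \<le> \<Phi> y)"

lemma path_lsc_indicator:
  assumes "openin continuous_path_topology U" shows "path_lsc (indicator U)"
  unfolding path_lsc_def
proof (intro ballI allI impI)
  fix x e assume x: "x \<in> continuous_paths" and e: "(0::real) < e"
  show "\<exists>T. \<exists>r>0. \<forall>y\<in>path_ball x T r. indicator U x - e \<le> (indicator U y :: real)"
  proof (cases "x \<in> U")
    case True
    then obtain T r where "r > 0" "path_ball x T r \<subseteq> U" using assms openin_continuous_path_topology_iff by metis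
    thus ?thesis using e True by (intro exI[of _ T] exI[of _ r]) (auto simp: indicator_def)
  next
    case False
    thus ?thesis using e by (intro exI[of _ 1]) (auto simp: indicator_def)
  qed
qed

lemma path_lsc_continuous:
  assumes "continuous_map continuous_path_topology euclideanreal \<Phi>" shows "path_lsc \<Phi>"
  unfolding path_lsc_def
proof (intro ballI allI impI)
  fix x e assume x: "x \<in> continuous_paths" and e: "(0::real) < e"
  define U where "U = {y \<in> continuous_paths. \<Phi> y \<in> {\<Phi> x - e <..}}"
  have "openin continuous_path_topology U"
    using openin_continuous_map_preimage[OF assms, of "{\<Phi> x - e <..}"] by (simp add: U_def)
  moreover have "x \<in> U" using x e by (simp add: U_def)
  ultimately obtain T r where "r > 0" "path_ball x T r \<subseteq> U"
    unfolding openin_continuous_path_topology_iff by blast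
  thus "\<exists>T. \<exists>r>0. \<forall>y\<in>path_ball x T r. \<Phi> x - e \<le> \<Phi> y"
    by (intro exI[of _ T] exI[of _ r]) (auto simp: U_def intro: less_imp_le)
qed

text \<open>
  Truncation makes this a pseudometric on arbitrary functions, in particular on step functions.
\<close>
definition path_dist :: "nat \<Rightarrow> (real \<Rightarrow> real) \<Rightarrow> (real \<Rightarrow> real) \<Rightarrow> real" where
  "path_dist k x y = (SUP t\<in>{0..real k}. min 1 \<bar>x t - y t\<bar>)"

lemma path_dist_bdd: "bdd_above ((\<lambda>t. min 1 \<bar>x t - y t\<bar>) ` {0..real k})" for x y :: "real \<Rightarrow> real"
  by (auto intro!: bdd_aboveI[of _ 1])

lemma path_dist_upper: "t \<in> {0..real k} \<Longrightarrow> min 1 \<bar>x t - y t\<bar> \<le> path_dist k x y"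
  unfolding path_dist_def by (intro cSUP_upper path_dist_bdd)

lemma path_dist_least: "(\<And>t. t \<in> {0..real k} \<Longrightarrow> min 1 \<bar>x t - y t\<bar> \<le> c) \<Longrightarrow> path_dist k x y \<le> c"
  unfolding path_dist_def by (intro cSUP_least) auto

lemma path_dist_nonneg: "0 \<le> path_dist k x y"
  using path_dist_upper[of 0 k x y] by simp

lemma path_dist_le_1: "path_dist k x y \<le> 1"
  by (rule path_dist_least) simp

lemma path_dist_triangle: "path_dist k x z \<le> path_dist k x y + path_dist k y z"
proof (rule path_dist_least)
  fix t assume t: "t \<in> {0..real k}"
  show "min 1 \<bar>x t - z t\<bar> \<le> path_dist k x y + path_dist k y z"
    using path_dist_upper[OF t, of x y] path_dist_upper[OF t, of y z] by linarith
qed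

lemma path_dist_commute: "path_dist k x y = path_dist k y x"
  by (simp add: path_dist_def abs_minus_commute)

lemma path_dist_self: "path_dist k x x = 0"
  using path_dist_nonneg[of k x x] path_dist_least[of k x x 0] by simp

lemma path_dist_le: "(\<And>t. 0 \<le> t \<Longrightarrow> t \<le> real k \<Longrightarrow> \<bar>x t - y t\<bar> \<le> c) \<Longrightarrow> path_dist k x y \<le> c"
  by (rule path_dist_least) (auto intro: min.coboundedI2)

text \<open>
  The greatest function below \<open>\<Phi>\<close> that is \<open>k\<close>-Lipschitz for \<open>path_dist
  k\<close> (the Pasch-Hausdorff envelope).
\<close>
definition path_env :: "((real \<Rightarrow> real) \<Rightarrow> real) \<Rightarrow> nat \<Rightarrow> (real \<Rightarrow> real) \<Rightarrow> real" where
  "path_env \<Phi> k x = (INF y\<in>continuous_paths. \<Phi> y + real k * path_dist k x y)"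

lemma continuous_paths_nonempty: "continuous_paths \<noteq> {}"
proof -
  have "restrict (\<lambda>_::real. 0::real) {0..} \<in> continuous_paths"
  proof -
    have "continuous_on {0..} (restrict (\<lambda>_::real. 0::real) {0..})"
      by (rule continuous_on_eq[of _ "\<lambda>_. 0"]) auto
    thus ?thesis by (simp add: continuous_paths_def)
  qed
  thus ?thesis by blast
qed

context
  fixes \<Phi> :: "(real \<Rightarrow> real) \<Rightarrow> real" and M :: real
  assumes bound: "\<And>y. y \<in> continuous_paths \<Longrightarrow> \<bar>\<Phi> y\<bar> \<le> M"
begin

lemma path_env_bdd: "bdd_below ((\<lambda>y. \<Phi> y + real k * path_dist k x y) ` continuous_paths)"
proof (rule bdd_belowI2)
  fix y assume "y \<in> continuous_paths"
  thus "- M \<le> \<Phi> y + real k * path_dist k x y"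
    using bound[of y] path_dist_nonneg[of k x y] mult_nonneg_nonneg[of "real k" "path_dist k x y"] by linarith
qed

lemma path_env_lower: "y \<in> continuous_paths \<Longrightarrow> path_env \<Phi> k x \<le> \<Phi> y + real k * path_dist k x y"
  unfolding path_env_def by (intro cINF_lower path_env_bdd)

lemma path_env_greatest:
  "(\<And>y. y \<in> continuous_paths \<Longrightarrow> c \<le> \<Phi> y + real k * path_dist k x y) \<Longrightarrow> c \<le> path_env \<Phi> k x"
  unfolding path_env_def by (intro cINF_greatest continuous_paths_nonempty)

lemma path_env_le: "x \<in> continuous_paths \<Longrightarrow> path_env \<Phi> k x \<le> \<Phi> x"
  using path_env_lower[of x k x] by (simp add: path_dist_self)

lemma path_env_bound: "\<bar>path_env \<Phi> k x\<bar> \<le> M + real k"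
proof -
  obtain y where y: "y \<in> continuous_paths" using continuous_paths_nonempty by blast
  have "path_env \<Phi> k x \<le> \<Phi> y + real k * path_dist k x y" by (rule path_env_lower[OF y])
  also have "real k * path_dist k x y \<le> real k * 1" by (intro mult_left_mono path_dist_le_1) auto
  also have "\<Phi> y \<le> M" using bound[OF y] by simp
  finally have "path_env \<Phi> k x \<le> M + real k" by simp
  moreover have "- M \<le> path_env \<Phi> k x"
  proof (rule path_env_greatest)
    fix y assume "y \<in> continuous_paths"
    thus "- M \<le> \<Phi> y + real k * path_dist k x y"
    using bound[of y] path_dist_nonneg[of k x y] mult_nonneg_nonneg[of "real k" "path_dist k x y"] by linarith
  qed
  ultimately show ?thesis by (simp add: abs_le_iff)
qed

lemma path_env_lipschitz1:
  "path_env \<Phi> k x \<le> path_env \<Phi> k x' + real k * path_dist k x x'"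
proof -
  have "path_env \<Phi> k x - real k * path_dist k x x' \<le> path_env \<Phi> k x'"
  proof (rule path_env_greatest)
    fix y assume y: "y \<in> continuous_paths"
    have "path_env \<Phi> k x \<le> \<Phi> y + real k * path_dist k x y" by (rule path_env_lower[OF y])
    also have "real k * path_dist k x y \<le> real k * (path_dist k x x' + path_dist k x' y)"
      by (intro mult_left_mono path_dist_triangle) auto
    finally show "path_env \<Phi> k x - real k * path_dist k x x' \<le> \<Phi> y + real k * path_dist k x' y"
      by (simp add: algebra_simps)
  qed
  thus ?thesis by simp
qed

lemma path_env_lipschitz:
  "\<bar>path_env \<Phi> k x - path_env \<Phi> k x'\<bar> \<le> real k * path_dist k x x'"
  using path_env_lipschitz1[of k x x'] path_env_lipschitz1[of k x' x]
  by (simp add: path_dist_commute[of k x' x] abs_le_iff)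

text \<open>
  Near \<open>x\<close>, lower semicontinuity bounds \<open>\<Phi>\<close> from below; away from
  \<open>x\<close> the penalty \<open>k * path_dist k x y\<close> eventually exceeds the oscillation of
  \<open>\<Phi>\<close>.
\<close>
lemma path_env_tendsto:
  assumes lsc: "path_lsc \<Phi>" and x: "x \<in> continuous_paths"
  shows "(\<lambda>k. path_env \<Phi> k x) \<longlonglongrightarrow> \<Phi> x"
proof (rule LIMSEQ_I)
  fix e :: real assume e: "0 < e"
  obtain T r where r: "r > 0" "\<And>y. y \<in> path_ball x T r \<Longrightarrow> \<Phi> x - e / 2 \<le> \<Phi> y"
    using lsc[unfolded path_lsc_def, rule_format, OF x, of "e / 2"] e by auto
  have M: "0 \<le> M" using bound[OF x] by simp
  obtain k0 :: nat where k0: "max T (2 * M / min 1 r) \<le> real k0" using real_arch_simple by blast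
  have "norm (path_env \<Phi> k x - \<Phi> x) < e" if k: "k0 \<le> k" for k
  proof -
    have "\<Phi> x - e / 2 \<le> path_env \<Phi> k x"
    proof (rule path_env_greatest)
      fix y assume y: "y \<in> continuous_paths"
      show "\<Phi> x - e / 2 \<le> \<Phi> y + real k * path_dist k x y"
      proof (cases "y \<in> path_ball x T r")
        case True
        thus ?thesis using r(2)[OF True] path_dist_nonneg[of k x y] mult_nonneg_nonneg[of "real k" "path_dist k x y"] by linarith
      next
        case False
        then obtain t where t: "t \<in> {0..T}" "r \<le> \<bar>y t - x t\<bar>" using y by (auto simp: path_ball_def)
        have Tk: "T \<le> real k" using k0 k by simp
        have "min 1 r \<le> min 1 \<bar>x t - y t\<bar>" using t by linarith
        also have "\<dots> \<le> path_dist k x y" using t Tk by (intro path_dist_upper) auto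
        finally have "2 * M / min 1 r * min 1 r \<le> real k * path_dist k x y"
          using k0 k r M by (intro mult_mono) auto
        hence "2 * M \<le> real k * path_dist k x y" using r by simp
        thus ?thesis using bound[OF x] bound[OF y] e by linarith
      qed
    qed
    thus ?thesis using path_env_le[OF x, of k] e by simp
  qed
  thus "\<exists>k0. \<forall>k\<ge>k0. norm (path_env \<Phi> k x - \<Phi> x) < e" by blast
qed
end

text \<open>
  The step function with value \<open>x i\<close> on the dyadic cell \<open>{i/2^m..<(i+1)/2^m}\<close>.
\<close>
definition step_path :: "nat \<Rightarrow> (nat \<Rightarrow> real) \<Rightarrow> real \<Rightarrow> real" where
  "step_path m x t = x (nat \<lfloor>t * 2 ^ m\<rfloor>)"

definition grid_values :: "nat \<Rightarrow> (real \<Rightarrow> real) \<Rightarrow> nat \<Rightarrow> real" where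
  "grid_values m w i = w (real i / 2 ^ m)"

lemma step_grid_near:
  assumes t: "0 \<le> t"
  obtains s where "0 \<le> s" "s \<le> t" "t < s + 1 / 2 ^ m" "\<And>w. step_path m (grid_values m w) t = w s"
proof
  let ?s = "real (nat \<lfloor>t * 2 ^ m\<rfloor>) / 2 ^ m"
  have eq: "real (nat \<lfloor>t * 2 ^ m\<rfloor>) = of_int \<lfloor>t * 2 ^ m\<rfloor>" using t by simp
  show "0 \<le> ?s" by simp
  have "real (nat \<lfloor>t * 2 ^ m\<rfloor>) \<le> t * 2 ^ m" "t * 2 ^ m < real (nat \<lfloor>t * 2 ^ m\<rfloor>) + 1"
    unfolding eq by linarith+
  thus "?s \<le> t" "t < ?s + 1 / 2 ^ m" by (simp_all add: field_simps)
  show "step_path m (grid_values m w) t = w ?s" for w by (simp add: step_path_def grid_values_def)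
qed

lemma pow2_small: "0 < (e::real) \<Longrightarrow> \<exists>m0. \<forall>m\<ge>m0. 1 / 2 ^ m < e"
proof -
  assume e: "0 < e"
  have "(\<lambda>m. (1/2::real) ^ m) \<longlonglongrightarrow> 0" by (intro LIMSEQ_realpow_zero) auto
  from order_tendstoD(2)[OF this e] show ?thesis by (simp add: eventually_sequentially power_one_over)
qed

lemma step_grid_tendsto:
  assumes w: "continuous_on {0..} w"
  shows "(\<lambda>m. path_dist k (step_path m (grid_values m w)) w) \<longlonglongrightarrow> 0"
proof (rule LIMSEQ_I)
  fix e :: real assume e: "0 < e"
  have "uniformly_continuous_on {0..real k} w"
    by (intro compact_uniformly_continuous continuous_on_subset[OF w]) auto
  then obtain d where d: "d > 0" "\<And>s t. s \<in> {0..real k} \<Longrightarrow> t \<in> {0..real k} \<Longrightarrow> dist s t < d \<Longrightarrow> dist (w s) (w t) < e / 2"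
    unfolding uniformly_continuous_on_def using e by (metis half_gt_zero)
  obtain m0 where m0: "\<And>m. m \<ge> m0 \<Longrightarrow> 1 / 2 ^ m < d" using pow2_small[OF d(1)] by blast
  have "norm (path_dist k (step_path m (grid_values m w)) w - 0) < e" if m: "m0 \<le> m" for m
  proof -
    have "path_dist k (step_path m (grid_values m w)) w \<le> e / 2"
    proof (rule path_dist_le)
      fix t assume t: "0 \<le> t" "t \<le> real k"
      obtain s where s: "0 \<le> s" "s \<le> t" "t < s + 1 / 2 ^ m" "\<And>w. step_path m (grid_values m w) t = w s"
        using step_grid_near[OF t(1)] by metis
      have "dist s t < d" using s m0[OF m] by (simp add: dist_real_def)
      thus "\<bar>step_path m (grid_values m w) t - w t\<bar> \<le> e / 2"
        using d(2)[of s t] s t by (simp add: dist_real_def)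
    qed
    thus ?thesis using path_dist_nonneg[of k "step_path m (grid_values m w)" w] e by simp
  qed
  thus "\<exists>m0. \<forall>m\<ge>m0. norm (path_dist k (step_path m (grid_values m w)) w - 0) < e" by blast
qed

lemma path_dist_step_path:
  "path_dist k (step_path m x) (step_path m y) \<le> (\<Sum>i<Suc (k * 2 ^ m). \<bar>x i - y i\<bar>)"
proof (rule path_dist_le)
  fix t assume t: "0 \<le> t" "t \<le> real k"
  have "t * 2 ^ m \<le> real k * 2 ^ m" using t by (intro mult_right_mono) auto
  hence "\<lfloor>t * 2 ^ m\<rfloor> \<le> \<lfloor>real (k * 2 ^ m)\<rfloor>" by (intro floor_mono) simp
  hence "\<lfloor>t * 2 ^ m\<rfloor> \<le> int (k * 2 ^ m)" by (simp only: floor_of_nat)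
  hence "nat \<lfloor>t * 2 ^ m\<rfloor> < Suc (k * 2 ^ m)" by (simp add: nat_le_iff del: of_nat_mult)
  thus "\<bar>step_path m x t - step_path m y t\<bar> \<le> (\<Sum>i<Suc (k * 2 ^ m). \<bar>x i - y i\<bar>)"
    unfolding step_path_def
    by (intro member_le_sum[where f="\<lambda>i. \<bar>x i - y i\<bar>"]) auto
qed

text \<open>
  Lipschitz functions of the first \<open>K\<close> coordinates. Taking them on infinite sequences leaves
  \<open>K\<close> a plain number, on which one can induct.
\<close>
definition coord_lipschitz :: "nat \<Rightarrow> real \<Rightarrow> ((nat \<Rightarrow> real) \<Rightarrow> real) \<Rightarrow> bool" where
  "coord_lipschitz K L F \<longleftrightarrow> (\<forall>x y. \<bar>F x - F y\<bar> \<le> L * (\<Sum>i<K. \<bar>x i - y i\<bar>))"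

lemma coord_lipschitz_local:
  assumes "coord_lipschitz i L p" "\<And>j. j < i \<Longrightarrow> x j = y j" shows "p x = p y"
proof -
  have "\<bar>p x - p y\<bar> \<le> L * (\<Sum>j<i. \<bar>x j - y j\<bar>)" using assms(1) by (simp add: coord_lipschitz_def)
  also have "(\<Sum>j<i. \<bar>x j - y j\<bar>) = 0" using assms(2) by (intro sum.neutral) auto
  finally show ?thesis by simp
qed

lemma coord_lipschitz_measurable:
  assumes "coord_lipschitz K L F" shows "F \<in> borel_measurable borel"
proof (rule borel_measurable_continuous_onI)
  have "isCont F x" for x
    unfolding isCont_def
  proof (rule LIM_zero_cancel, rule tendsto_rabs_zero_cancel, rule tendsto_sandwich)
    show "\<forall>\<^sub>F y in at x. 0 \<le> \<bar>F y - F x\<bar>" by simp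
    show "\<forall>\<^sub>F y in at x. \<bar>F y - F x\<bar> \<le> L * (\<Sum>i<K. \<bar>y i - x i\<bar>)"
      using assms by (auto simp: coord_lipschitz_def)
    have "((\<lambda>y. y i) \<longlongrightarrow> x i) (at x)" for i
      using continuous_on_product_coordinates[of i] unfolding continuous_on_def by auto
    hence "((\<lambda>y. L * (\<Sum>i<K. \<bar>y i - x i\<bar>)) \<longlongrightarrow> L * (\<Sum>i<K. \<bar>x i - x i\<bar>)) (at x)"
      by (intro tendsto_intros) auto
    thus "((\<lambda>y. L * (\<Sum>i<K. \<bar>y i - x i\<bar>)) \<longlongrightarrow> 0) (at x)" by simp
  qed auto
  thus "continuous_on UNIV F" by (simp add: continuous_at_imp_continuous_on)
qed

lemma path_env_coord_lipschitz:
  assumes "\<And>y. y \<in> continuous_paths \<Longrightarrow> \<bar>\<Phi> y\<bar> \<le> M"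
  shows "coord_lipschitz (Suc (k * 2 ^ m)) (real k) (\<lambda>x. path_env \<Phi> k (step_path m x))"
  unfolding coord_lipschitz_def
proof (intro allI)
  fix x y
  have "\<bar>path_env \<Phi> k (step_path m x) - path_env \<Phi> k (step_path m y)\<bar>
     \<le> real k * path_dist k (step_path m x) (step_path m y)"
    by (rule path_env_lipschitz[OF assms])
  also have "\<dots> \<le> real k * (\<Sum>i<Suc (k * 2 ^ m). \<bar>x i - y i\<bar>)"
    by (intro mult_left_mono path_dist_step_path) auto
  finally show "\<bar>path_env \<Phi> k (step_path m x) - path_env \<Phi> k (step_path m y)\<bar>
     \<le> real k * (\<Sum>i<Suc (k * 2 ^ m). \<bar>x i - y i\<bar>)" .
qed

definition random_path :: "'b measure \<Rightarrow> ('b \<Rightarrow> real \<Rightarrow> real) \<Rightarrow> bool" where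
  "random_path N X \<longleftrightarrow> (\<forall>w\<in>space N. X w \<in> continuous_paths) \<and> (\<forall>t\<ge>0. (\<lambda>w. X w t) \<in> borel_measurable N)"

lemma random_path_grid:
  assumes "random_path N X" shows "(\<lambda>w. grid_values m (X w)) \<in> borel_measurable N"
  using assms by (intro measurable_coordinatewise_then_product) (auto simp: grid_values_def random_path_def)

lemma path_env_step_tendsto:
  assumes "\<And>y. y \<in> continuous_paths \<Longrightarrow> \<bar>\<Phi> y\<bar> \<le> M" and x: "x \<in> continuous_paths"
  shows "(\<lambda>m. path_env \<Phi> k (step_path m (grid_values m x))) \<longlonglongrightarrow> path_env \<Phi> k x"
proof (rule LIM_zero_cancel, rule tendsto_rabs_zero_cancel,
    rule tendsto_sandwich[of "\<lambda>_. 0" _ _ "\<lambda>m. real k * path_dist k (step_path m (grid_values m x)) x"])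
  show "(\<lambda>m. real k * path_dist k (step_path m (grid_values m x)) x) \<longlonglongrightarrow> 0"
    using tendsto_mult_left[OF step_grid_tendsto[OF continuous_paths_cont[OF x]], of "real k"] by simp
  show "\<forall>\<^sub>F m in sequentially. \<bar>path_env \<Phi> k (step_path m (grid_values m x)) - path_env \<Phi> k x\<bar>
    \<le> real k * path_dist k (step_path m (grid_values m x)) x"
    by (intro always_eventually allI path_env_lipschitz[OF assms(1)])
qed auto

lemma random_path_step_measurable:
  assumes b: "\<And>y. y \<in> continuous_paths \<Longrightarrow> \<bar>\<Phi> y\<bar> \<le> M" and X: "random_path N X"
  shows "(\<lambda>w. path_env \<Phi> k (step_path m (grid_values m (X w)))) \<in> borel_measurable N"
  using measurable_compose[OF random_path_grid[OF X] coord_lipschitz_measurable[OF path_env_coord_lipschitz[OF b]]] by simp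

lemma random_path_env_measurable:
  assumes b: "\<And>y. y \<in> continuous_paths \<Longrightarrow> \<bar>\<Phi> y\<bar> \<le> M" and X: "random_path N X"
  shows "(\<lambda>w. path_env \<Phi> k (X w)) \<in> borel_measurable N"
proof (rule borel_measurable_LIMSEQ_real)
  show "(\<lambda>m. path_env \<Phi> k (step_path m (grid_values m (X w)))) \<longlonglongrightarrow> path_env \<Phi> k (X w)"
    if "w \<in> space N" for w
    using that X by (intro path_env_step_tendsto[OF b]) (auto simp: random_path_def)
qed (rule random_path_step_measurable[OF b X])

text \<open>
  \<open>\<Phi>\<close> is the limit of its regularisations, and each of these is a limit of functions of
  finitely many coordinates of the path.
\<close>
lemma random_path_lsc_measurable:
  assumes b: "\<And>y. y \<in> continuous_paths \<Longrightarrow> \<bar>\<Phi> y\<bar> \<le> M" and X: "random_path N X" and lsc: "path_lsc \<Phi>"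
  shows "(\<lambda>w. \<Phi> (X w)) \<in> borel_measurable N"
proof (rule borel_measurable_LIMSEQ_real)
  show "(\<lambda>k. path_env \<Phi> k (X w)) \<longlonglongrightarrow> \<Phi> (X w)" if "w \<in> space N" for w
    using that X by (intro path_env_tendsto[OF b lsc]) (auto simp: random_path_def)
qed (rule random_path_env_measurable[OF b X])

lemma space_borel_of [simp]: "space (borel_of X) = topspace X"
  unfolding borel_of_def by (intro space_measure_of) (blast dest: openin_subset)

lemma sets_borel_of: "sets (borel_of X) = sigma_sets (topspace X) {U. openin X U}"
  unfolding borel_of_def by (intro sets_measure_of) (blast dest: openin_subset)

lemma random_path_measurable:
  assumes X: "random_path N X"
  shows "X \<in> N \<rightarrow>\<^sub>M borel_of continuous_path_topology"
  unfolding borel_of_def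
proof (rule measurable_measure_of)
  show "{U. openin continuous_path_topology U} \<subseteq> Pow (topspace continuous_path_topology)"
    using openin_subset by blast
  show "X \<in> space N \<rightarrow> topspace continuous_path_topology" using X by (auto simp: random_path_def)
  fix U assume "U \<in> {U. openin continuous_path_topology U}"
  hence lsc: "path_lsc (indicator U)" by (intro path_lsc_indicator) simp
  have [measurable]: "(\<lambda>w. indicator U (X w) :: real) \<in> borel_measurable N"
    by (rule random_path_lsc_measurable[where M=1, OF _ X lsc]) (auto simp: indicator_def)
  have "X -` U \<inter> space N = {w\<in>space N. indicator U (X w) = (1::real)}" by (auto simp: indicator_def)
  also have "\<dots> \<in> sets N" by measurable
  finally show "X -` U \<inter> space N \<in> sets N" .
qed

lemma coordinate_continuous_map:
  assumes t: "0 \<le> t"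
  shows "continuous_map continuous_path_topology euclideanreal (\<lambda>w. w t)"
  unfolding continuous_map_def
proof (intro conjI allI impI)
  fix V :: "real set" assume "openin euclidean V"
  hence V: "open V" by simp
  show "openin continuous_path_topology {w \<in> topspace continuous_path_topology. w t \<in> V}"
    unfolding openin_continuous_path_topology_iff
  proof (intro conjI ballI)
    fix u assume u: "u \<in> {w \<in> topspace continuous_path_topology. w t \<in> V}"
    then obtain e where e: "e > 0" "\<And>y. dist y (u t) < e \<Longrightarrow> y \<in> V" using V by (auto simp: open_dist)
    have "path_ball u t e \<subseteq> {w \<in> topspace continuous_path_topology. w t \<in> V}"
      using e(2) t by (auto simp: path_ball_def dist_real_def)
    thus "\<exists>T. \<exists>r>0. path_ball u T r \<subseteq> {w \<in> topspace continuous_path_topology. w t \<in> V}" using e by blast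
  qed auto
qed auto

lemma continuous_map_borel_measurable:
  assumes "continuous_map X euclideanreal \<Phi>" shows "\<Phi> \<in> borel_measurable (borel_of X)"
proof (rule borel_measurableI)
  fix S :: "real set" assume "open S"
  hence "openin X {w \<in> topspace X. \<Phi> w \<in> S}" using assms by (auto simp: continuous_map_def)
  also have "{w \<in> topspace X. \<Phi> w \<in> S} = \<Phi> -` S \<inter> space (borel_of X)" by auto
  finally show "\<Phi> -` S \<inter> space (borel_of X) \<in> sets (borel_of X)" by (auto simp: sets_borel_of)
qed

lemma random_path_id:
  assumes "sets W = sets (borel_of continuous_path_topology)" shows "random_path W (\<lambda>w. w)"
  unfolding random_path_def
proof (intro conjI allI impI)
  show "\<forall>w\<in>space W. w \<in> continuous_paths" using sets_eq_imp_space_eq[OF assms] by simp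
  fix t :: real assume "0 \<le> t"
  from continuous_map_borel_measurable[OF coordinate_continuous_map[OF this]]
  show "(\<lambda>w. w t) \<in> borel_measurable W" using assms by (simp cong: measurable_cong_sets)
qed

section \<open>Weak convergence of random continuous paths\<close>

text \<open>
  A bound for all increments of \<open>w\<close> between neighbouring points of the grid of mesh
  \<open>1/2^m\<close> in \<open>{0..N}\<close>, see \<open>abs_le_add_fourth_power\<close> with \<open>l =
  (9/10)^m\<close>. The base 9/10 is chosen close enough to 1 that the fourth moment bound still makes the
  expectations summable in \<open>m\<close>.
\<close>
definition dyadic_osc :: "nat \<Rightarrow> nat \<Rightarrow> (real \<Rightarrow> real) \<Rightarrow> real" where
  "dyadic_osc N m w = (9/10) ^ m +
     (\<Sum>i<N * 2 ^ m. (w (real (Suc i) / 2 ^ m) - w (real i / 2 ^ m)) ^ 4) / ((9/10) ^ m) ^ 3"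

lemma abs_le_add_fourth_power:
  fixes a l :: real assumes l: "0 < l" shows "\<bar>a\<bar> \<le> l + a ^ 4 / l ^ 3"
proof (cases "\<bar>a\<bar> \<le> l")
  case True
  have "0 \<le> a ^ 4 / l ^ 3" using l by (intro divide_nonneg_pos) auto
  thus ?thesis using True by linarith
next
  case False
  hence "l ^ 3 * \<bar>a\<bar> \<le> \<bar>a\<bar> ^ 3 * \<bar>a\<bar>" using l by (intro mult_right_mono power_mono) auto
  also have "\<bar>a\<bar> ^ 3 * \<bar>a\<bar> = a ^ 4" by (simp add: power_abs[symmetric] eval_nat_numeral abs_mult)
  finally have "\<bar>a\<bar> \<le> a ^ 4 / l ^ 3" using l by (simp add: field_simps)
  thus ?thesis using l by linarith
qed

lemma dyadic_osc_increment:
  assumes "i < N * 2 ^ m"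
  shows "\<bar>w (real (Suc i) / 2 ^ m) - w (real i / 2 ^ m)\<bar> \<le> dyadic_osc N m w"
proof -
  let ?a = "\<lambda>i. w (real (Suc i) / 2 ^ m) - w (real i / 2 ^ m)"
  have "\<bar>?a i\<bar> \<le> (9/10) ^ m + ?a i ^ 4 / ((9/10) ^ m) ^ 3" by (rule abs_le_add_fourth_power) simp
  also have "?a i ^ 4 \<le> (\<Sum>i<N * 2 ^ m. ?a i ^ 4)" using assms
    by (intro member_le_sum) auto
  finally show ?thesis unfolding dyadic_osc_def by (simp add: divide_right_mono)
qed

lemma dyadic_osc_nonneg: "0 \<le> dyadic_osc N m w"
  unfolding dyadic_osc_def by (intro add_nonneg_nonneg divide_nonneg_nonneg sum_nonneg) auto

lemma step_path_refine:
  assumes t: "0 \<le> t" "t \<le> real N"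
  shows "\<bar>step_path (Suc m) (grid_values (Suc m) w) t - step_path m (grid_values m w) t\<bar> \<le> dyadic_osc N (Suc m) w"
proof -
  define p where "p = nat \<lfloor>t * 2 ^ Suc m\<rfloor>"
  have "\<lfloor>(t * 2 ^ Suc m) / real_of_int 2\<rfloor> = \<lfloor>t * 2 ^ Suc m\<rfloor> div 2" by (rule floor_divide_real_eq_div) simp
  hence "\<lfloor>t * 2 ^ m\<rfloor> = \<lfloor>t * 2 ^ Suc m\<rfloor> div 2" by simp
  hence q: "nat \<lfloor>t * 2 ^ m\<rfloor> = p div 2" unfolding p_def by (simp add: nat_div_distrib)
  have "t * 2 ^ Suc m \<le> real N * 2 ^ Suc m" using t by (intro mult_right_mono) auto
  hence "\<lfloor>t * 2 ^ Suc m\<rfloor> \<le> \<lfloor>real (N * 2 ^ Suc m)\<rfloor>" by (intro floor_mono) simp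
  hence "\<lfloor>t * 2 ^ Suc m\<rfloor> \<le> int (N * 2 ^ Suc m)" by (simp only: floor_of_nat)
  hence pN: "p \<le> N * 2 ^ Suc m" unfolding p_def by (simp add: nat_le_iff del: of_nat_mult)
  have v: "step_path (Suc m) (grid_values (Suc m) w) t = w (real p / 2 ^ Suc m)"
    by (simp only: step_path_def grid_values_def p_def)
  have "step_path m (grid_values m w) t = w (real (p div 2) / 2 ^ m)"
    by (simp only: step_path_def grid_values_def q)
  also have "real (p div 2) / 2 ^ m = real (2 * (p div 2)) / 2 ^ Suc m" by simp
  finally have u: "step_path m (grid_values m w) t = w (real (2 * (p div 2)) / 2 ^ Suc m)" .
  show ?thesis
  proof (cases "even p")
    case True
    hence "2 * (p div 2) = p" by simp
    thus ?thesis unfolding u v by (simp add: dyadic_osc_nonneg)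
  next
    case False
    hence p: "p = Suc (2 * (p div 2))" by presburger
    have "2 * (p div 2) < N * 2 ^ Suc m" using pN p by linarith
    from dyadic_osc_increment[OF this, of w] show ?thesis unfolding u v using p by simp
  qed
qed

text \<open>
  There are \<open>N * 2^m\<close> increments of fourth moment at most \<open>C / 4^m\<close>, and
  \<open>(1/2) / (9/10)^3 = 500/729 < 9/10\<close>.
\<close>
lemma dyadic_osc_integral:
  assumes "prob_space M"
    and mom: "\<And>i. integrable M (\<lambda>w. (X w (real (Suc i) / 2 ^ m) - X w (real i / 2 ^ m)) ^ 4) \<and>
        (LINT w|M. (X w (real (Suc i) / 2 ^ m) - X w (real i / 2 ^ m)) ^ 4) \<le> C * (1 / 2 ^ m)\<^sup>2"
    and C: "0 \<le> C"
  shows "integrable M (\<lambda>w. dyadic_osc N m (X w))"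
    and "(LINT w|M. dyadic_osc N m (X w)) \<le> (1 + real N * C) * (9/10) ^ m"
proof -
  interpret prob_space M by fact
  let ?d = "\<lambda>i w. (X w (real (Suc i) / 2 ^ m) - X w (real i / 2 ^ m)) ^ 4"
  have i: "integrable M (?d i)" and b: "integral\<^sup>L M (?d i) \<le> C * (1 / 2 ^ m)\<^sup>2" for i
    using mom by auto
  show "integrable M (\<lambda>w. dyadic_osc N m (X w))"
    unfolding dyadic_osc_def using i by (intro Bochner_Integration.integrable_add integrable_divide Bochner_Integration.integrable_sum) auto
  have "(LINT w|M. dyadic_osc N m (X w)) = (9/10) ^ m + (\<Sum>i<N * 2 ^ m. integral\<^sup>L M (?d i)) / ((9/10) ^ m) ^ 3"
    unfolding dyadic_osc_def using i by (subst Bochner_Integration.integral_add) (auto simp: prob_space)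
  also have "\<dots> \<le> (9/10) ^ m + (\<Sum>i<N * 2 ^ m. C * (1 / 2 ^ m)\<^sup>2) / ((9/10) ^ m) ^ 3"
    by (intro add_left_mono divide_right_mono sum_mono b) auto
  also have "(\<Sum>i<N * 2 ^ m. C * (1 / 2 ^ m)\<^sup>2) / ((9/10) ^ m) ^ 3 = real N * C * (500/729) ^ m"
  proof -
    have "(500/729::real) ^ m = (1 / 2 ^ m) / ((9/10) ^ m) ^ 3"
    proof -
      have "(500/729::real) ^ m = ((1/2) / (9/10) ^ 3) ^ m" by (simp add: power3_eq_cube)
      also have "\<dots> = (1/2) ^ m / ((9/10) ^ 3) ^ m" by (rule power_divide)
      also have "((9/10::real) ^ 3) ^ m = ((9/10) ^ m) ^ 3" by (metis power_mult mult.commute)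
      finally show ?thesis by (simp add: power_one_over)
    qed
    thus ?thesis by (simp add: power2_eq_square field_simps)
  qed
  also have "real N * C * (500/729) ^ m \<le> real N * C * (9/10) ^ m" using C by (intro mult_left_mono power_mono) auto
  finally show "(LINT w|M. dyadic_osc N m (X w)) \<le> (1 + real N * C) * (9/10) ^ m" by (simp add: algebra_simps)
qed

text \<open>
  Telescoping over the grids finer than the one of level \<open>m\<close>: passing from one to the next moves
  the step path by at most \<open>dyadic_osc\<close>. The bound depends on the process only through
  \<open>C\<close>; this is where tightness comes from.
\<close>
lemma step_approximation:
  assumes "prob_space M" and X: "random_path M X"
    and mom: "\<And>s t. 0 \<le> s \<Longrightarrow> s \<le> t \<Longrightarrow> integrable M (\<lambda>w. (X w t - X w s) ^ 4) \<and>
        (LINT w|M. (X w t - X w s) ^ 4) \<le> C * (t - s)\<^sup>2"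
    and C: "0 \<le> C"
    and b: "\<And>y. y \<in> continuous_paths \<Longrightarrow> \<bar>\<Phi> y\<bar> \<le> B"
  shows "\<bar>(LINT w|M. path_env \<Phi> k (step_path m (grid_values m (X w)))) -
      (LINT w|M. path_env \<Phi> k (X w))\<bar> \<le> real k * (1 + real k * C) * 9 * (9/10) ^ m"
proof -
  interpret prob_space M by fact
  define g where "g j w = path_env \<Phi> k (step_path j (grid_values j (X w)))" for j w
  have gm [measurable]: "g j \<in> borel_measurable M" for j
    unfolding g_def by (rule random_path_step_measurable[OF b X])
  have gb: "\<bar>g j w\<bar> \<le> B + real k" for j w unfolding g_def by (rule path_env_bound[OF b])
  have gi: "integrable M (g j)" for j
    by (rule integrable_const_bound[of _ "B + real k"]) (use gb in auto)
  have step: "\<bar>integral\<^sup>L M (g j) - integral\<^sup>L M (g (Suc j))\<bar> \<le> real k * ((1 + real k * C) * (9/10) ^ Suc j)" for j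
  proof -
    have "integrable M (\<lambda>w. (X w (real (Suc i) / 2 ^ Suc j) - X w (real i / 2 ^ Suc j)) ^ 4) \<and>
        (LINT w|M. (X w (real (Suc i) / 2 ^ Suc j) - X w (real i / 2 ^ Suc j)) ^ 4) \<le> C * (1 / 2 ^ Suc j)\<^sup>2" for i
    proof -
      have e: "real (Suc i) / 2 ^ Suc j - real i / 2 ^ Suc j = 1 / 2 ^ Suc j" by (simp add: diff_divide_distrib[symmetric])
      have "0 \<le> real i / 2 ^ Suc j" "real i / 2 ^ Suc j \<le> real (Suc i) / 2 ^ Suc j" by (auto intro: divide_right_mono)
      from mom[OF this] show ?thesis unfolding e .
    qed
    note oi = dyadic_osc_integral[OF assms(1) this C, of k]
    have "\<bar>integral\<^sup>L M (g j) - integral\<^sup>L M (g (Suc j))\<bar> = \<bar>LINT w|M. g j w - g (Suc j) w\<bar>"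
      using gi by simp
    also have "\<dots> \<le> (LINT w|M. \<bar>g j w - g (Suc j) w\<bar>)" by (rule integral_abs_bound)
    also have "\<dots> \<le> (LINT w|M. real k * dyadic_osc k (Suc j) (X w))"
    proof (rule integral_mono)
      show "integrable M (\<lambda>w. \<bar>g j w - g (Suc j) w\<bar>)" using gi by auto
      show "integrable M (\<lambda>w. real k * dyadic_osc k (Suc j) (X w))" using oi(1) by simp
      fix w
      have "\<bar>g j w - g (Suc j) w\<bar> \<le> real k * path_dist k (step_path j (grid_values j (X w))) (step_path (Suc j) (grid_values (Suc j) (X w)))"
        unfolding g_def by (rule path_env_lipschitz[OF b])
      also have "\<dots> \<le> real k * dyadic_osc k (Suc j) (X w)"
        using step_path_refine[of _ k j "X w"]
        by (intro mult_left_mono path_dist_le) (auto simp: abs_minus_commute)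
      finally show "\<bar>g j w - g (Suc j) w\<bar> \<le> real k * dyadic_osc k (Suc j) (X w)" .
    qed
    also have "\<dots> \<le> real k * ((1 + real k * C) * (9/10) ^ Suc j)"
      using mult_left_mono[OF oi(2), of "real k"] by simp
    finally show ?thesis .
  qed
  have tail: "\<bar>integral\<^sup>L M (g m) - integral\<^sup>L M (g (m + j))\<bar> \<le> real k * (1 + real k * C) * (9 * (9/10) ^ m - 9 * (9/10) ^ (m + j))" for j
  proof (induction j)
    case (Suc j)
    let ?c = "real k * (1 + real k * C)"
    have "\<bar>integral\<^sup>L M (g m) - integral\<^sup>L M (g (m + Suc j))\<bar>
      \<le> \<bar>integral\<^sup>L M (g m) - integral\<^sup>L M (g (m + j))\<bar> + \<bar>integral\<^sup>L M (g (m + j)) - integral\<^sup>L M (g (Suc (m + j)))\<bar>" by simp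
    also have "\<dots> \<le> ?c * (9 * (9/10) ^ m - 9 * (9/10) ^ (m + j)) + real k * ((1 + real k * C) * (9/10) ^ Suc (m + j))"
      by (intro add_mono Suc step)
    also have "\<dots> = ?c * (9 * (9/10) ^ m - 9 * (9/10) ^ (m + j) + (9/10) ^ Suc (m + j))"
      by (simp only: distrib_left[symmetric] mult.assoc)
    also have "9 * (9/10) ^ m - 9 * (9/10) ^ (m + j) + (9/10::real) ^ Suc (m + j) = 9 * (9/10) ^ m - 9 * (9/10) ^ (m + Suc j)"
      by simp
    finally show ?case .
  qed simp
  have "(\<lambda>j. integral\<^sup>L M (g j)) \<longlonglongrightarrow> (LINT w|M. path_env \<Phi> k (X w))"
  proof (rule integral_dominated_convergence[where w="\<lambda>_. B + real k"])
    show "(\<lambda>w. path_env \<Phi> k (X w)) \<in> borel_measurable M"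
      by (rule random_path_env_measurable[OF b X])
    show "AE w in M. (\<lambda>j. g j w) \<longlonglongrightarrow> path_env \<Phi> k (X w)"
      unfolding g_def using X by (intro AE_I2 path_env_step_tendsto[OF b]) (auto simp: random_path_def)
  qed (use gb in auto)
  hence "(\<lambda>j. \<bar>integral\<^sup>L M (g m) - integral\<^sup>L M (g (m + j))\<bar>) \<longlonglongrightarrow> \<bar>integral\<^sup>L M (g m) - (LINT w|M. path_env \<Phi> k (X w))\<bar>"
    by (intro tendsto_intros) (drule LIMSEQ_ignore_initial_segment[where k=m], simp add: add.commute)
  hence "\<bar>integral\<^sup>L M (g m) - (LINT w|M. path_env \<Phi> k (X w))\<bar> \<le> real k * (1 + real k * C) * 9 * (9/10) ^ m"
  proof (rule LIMSEQ_le_const2, intro exI[of _ 0] allI impI)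
    fix j
    have "real k * (1 + real k * C) * (9 * (9/10) ^ m - 9 * (9/10) ^ (m + j)) \<le> real k * (1 + real k * C) * (9 * (9/10) ^ m)"
      using C by (intro mult_left_mono) auto
    thus "\<bar>integral\<^sup>L M (g m) - integral\<^sup>L M (g (m + j))\<bar> \<le> real k * (1 + real k * C) * 9 * (9/10) ^ m"
      using tail[of j] by (simp only: mult.assoc)
  qed
  thus ?thesis by (simp add: g_def[abs_def])
qed

text \<open>
  A regularisation of a bounded function is, up to an error uniform in \<open>n\<close>, a function of
  finitely many coordinates, so its expectations converge. As regularisations lie below a lower semicontinuous
  \<open>\<Phi>\<close> and approximate it, the lower limit of the expectations of \<open>\<Phi>\<close> is at
  least that under \<open>W\<close>. For continuous \<open>\<Phi>\<close> this applies to
  \<open>\<Phi>\<close> and \<open>- \<Phi>\<close>.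
\<close>
theorem weak_convergence_criterion:
  fixes N :: "nat \<Rightarrow> 'b measure" and X :: "nat \<Rightarrow> 'b \<Rightarrow> real \<Rightarrow> real"
  assumes P: "\<And>n. prob_space (N n)" and X: "\<And>n. random_path (N n) (X n)"
    and C: "0 \<le> C"
    and mom: "\<And>n s t. 0 < n \<Longrightarrow> 0 \<le> s \<Longrightarrow> s \<le> t \<Longrightarrow> integrable (N n) (\<lambda>z. (X n z t - X n z s) ^ 4) \<and>
        (LINT z|N n. (X n z t - X n z s) ^ 4) \<le> C * (t - s)\<^sup>2"
    and W: "prob_space W" "sets W = sets (borel_of continuous_path_topology)"
    and fdd: "\<And>m K L B F. coord_lipschitz K L F \<Longrightarrow> (\<And>x. \<bar>F x\<bar> \<le> B) \<Longrightarrow>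
        (\<lambda>n. LINT z|N n. F (grid_values m (X n z))) \<longlonglongrightarrow> (LINT w|W. F (grid_values m w))"
  shows "weakly_converges continuous_path_topology (\<lambda>n. distr (N n) (borel_of continuous_path_topology) (X n)) W"
proof -
  interpret W: prob_space W by fact
  have idW: "random_path W (\<lambda>w. w)" by (rule random_path_id[OF W(2)])
  have reg: "(\<lambda>n. LINT z|N n. path_env \<Phi> k (X n z)) \<longlonglongrightarrow> (LINT w|W. path_env \<Phi> k w)"
    if b: "\<And>y. y \<in> continuous_paths \<Longrightarrow> \<bar>\<Phi> y\<bar> \<le> B" for \<Phi> k B
  proof (rule LIMSEQ_I)
    fix e :: real assume e: "0 < e"
    let ?f = "\<lambda>m x. path_env \<Phi> k (step_path m x)"
    have 1: "(\<lambda>m. real k * (1 + real k * C) * 9 * (9/10) ^ m) \<longlonglongrightarrow> real k * (1 + real k * C) * 9 * 0"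
      by (intro tendsto_mult_left LIMSEQ_realpow_zero) auto
    have 2: "(\<lambda>m. LINT w|W. ?f m (grid_values m w)) \<longlonglongrightarrow> (LINT w|W. path_env \<Phi> k w)"
    proof (rule integral_dominated_convergence[where w="\<lambda>_. B + real k"])
      show "(\<lambda>z. path_env \<Phi> k z) \<in> borel_measurable W"
        by (rule random_path_env_measurable[OF b idW])
      show "AE z in W. (\<lambda>j. ?f j (grid_values j z)) \<longlonglongrightarrow> path_env \<Phi> k z"
        using idW by (intro AE_I2 path_env_step_tendsto[OF b]) (auto simp: random_path_def)
      show "(\<lambda>w. ?f m (grid_values m w)) \<in> borel_measurable W" for m
        by (rule random_path_step_measurable[OF b idW])
    qed (use path_env_bound[OF b] in auto)
    have "\<forall>\<^sub>F m in sequentially. real k * (1 + real k * C) * 9 * (9/10) ^ m < e / 3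
       \<and> dist (LINT w|W. ?f m (grid_values m w)) (LINT w|W. path_env \<Phi> k w) < e / 3"
      using e order_tendstoD(2)[OF 1, of "e/3"] tendstoD[OF 2, of "e/3"] by (intro eventually_conj) auto
    then obtain m where m: "real k * (1 + real k * C) * 9 * (9/10) ^ m < e / 3"
       "dist (LINT w|W. ?f m (grid_values m w)) (LINT w|W. path_env \<Phi> k w) < e / 3"
      using eventually_happens' sequentially_bot by blast
    have "(\<lambda>n. LINT z|N n. ?f m (grid_values m (X n z))) \<longlonglongrightarrow> (LINT w|W. ?f m (grid_values m w))"
    proof (rule fdd)
      show "coord_lipschitz (Suc (k * 2 ^ m)) (real k) (?f m)"
        by (rule path_env_coord_lipschitz) (rule b)
      show "\<bar>?f m x\<bar> \<le> B + real k" for x by (rule path_env_bound) (rule b)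
    qed
    from LIMSEQ_D[OF this, of "e/3"] e obtain n0 where
      n0: "\<And>n. n \<ge> n0 \<Longrightarrow> norm ((LINT z|N n. ?f m (grid_values m (X n z))) - (LINT w|W. ?f m (grid_values m w))) < e / 3" by auto
    have "norm ((LINT z|N n. path_env \<Phi> k (X n z)) - (LINT w|W. path_env \<Phi> k w)) < e"
      if n: "n \<ge> max n0 1" for n
    proof -
      have "\<bar>(LINT z|N n. ?f m (grid_values m (X n z))) - (LINT z|N n. path_env \<Phi> k (X n z))\<bar> \<le> real k * (1 + real k * C) * 9 * (9/10) ^ m"
        using n by (intro step_approximation[OF P X mom C b]) auto
      thus ?thesis using m n0[of n] n unfolding dist_real_def real_norm_def by linarith
    qed
    thus "\<exists>no. \<forall>n\<ge>no. norm ((LINT z|N n. path_env \<Phi> k (X n z)) - (LINT w|W. path_env \<Phi> k w)) < e" by blast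
  qed
  have lower: "\<exists>n0. \<forall>n\<ge>n0. (LINT w|W. \<Phi> w) - e < (LINT z|N n. \<Phi> (X n z))"
    if b: "\<And>y. y \<in> continuous_paths \<Longrightarrow> \<bar>\<Phi> y\<bar> \<le> B" and lsc: "path_lsc \<Phi>" and e: "0 < e" for \<Phi> B e
  proof -
    have "0 \<le> B" using b continuous_paths_nonempty by fastforce
    have "(\<lambda>k. LINT w|W. path_env \<Phi> k w) \<longlonglongrightarrow> (LINT w|W. \<Phi> w)"
    proof (rule integral_dominated_convergence[where w="\<lambda>_. B"])
      show "\<Phi> \<in> borel_measurable W" using random_path_lsc_measurable[OF b idW lsc] by simp
      show "AE z in W. (\<lambda>k. path_env \<Phi> k z) \<longlonglongrightarrow> \<Phi> z"
        using idW by (intro AE_I2 path_env_tendsto[OF b lsc]) (auto simp: random_path_def)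
      show "(\<lambda>w. path_env \<Phi> k w) \<in> borel_measurable W" for k
        by (rule random_path_env_measurable[OF b idW])
      show "AE w in W. norm (path_env \<Phi> k w) \<le> B" for k
      proof (rule AE_I2)
        fix w assume "w \<in> space W"
        hence w: "w \<in> continuous_paths" using idW by (auto simp: random_path_def)
        have "- B \<le> path_env \<Phi> k w"
        proof (rule path_env_greatest[OF b])
          fix y assume y: "y \<in> continuous_paths"
          show "- B \<le> \<Phi> y + real k * path_dist k w y"
            using b[OF y] path_dist_nonneg[of k w y] mult_nonneg_nonneg[of "real k" "path_dist k w y"] by linarith
        qed
        moreover have "path_env \<Phi> k w \<le> \<Phi> w" by (rule path_env_le[OF b w])
        ultimately show "norm (path_env \<Phi> k w) \<le> B" using b[OF w] by simp
      qed
    qed auto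
    from LIMSEQ_D[OF this, of "e/2"] e obtain k where
      k: "norm ((LINT w|W. path_env \<Phi> k w) - (LINT w|W. \<Phi> w)) < e/2" by auto
    have "(\<lambda>n. LINT z|N n. path_env \<Phi> k (X n z)) \<longlonglongrightarrow> (LINT w|W. path_env \<Phi> k w)"
      by (rule reg[OF b])
    from LIMSEQ_D[OF this, of "e/2"] e obtain n0 where
      n0: "\<And>n. n \<ge> n0 \<Longrightarrow> norm ((LINT z|N n. path_env \<Phi> k (X n z)) - (LINT w|W. path_env \<Phi> k w)) < e/2" by auto
    have "(LINT w|W. \<Phi> w) - e < (LINT z|N n. \<Phi> (X n z))" if n: "n \<ge> n0" for n
    proof -
      interpret prob_space "N n" by (rule P)
      have [measurable]: "(\<lambda>z. path_env \<Phi> k (X n z)) \<in> borel_measurable (N n)"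
        by (rule random_path_env_measurable[OF b X])
      have [measurable]: "(\<lambda>z. \<Phi> (X n z)) \<in> borel_measurable (N n)"
        by (rule random_path_lsc_measurable[OF b X lsc])
      have Xc: "X n z \<in> continuous_paths" if "z \<in> space (N n)" for z
        using X[of n] that by (auto simp: random_path_def)
      have "(LINT z|N n. path_env \<Phi> k (X n z)) \<le> (LINT z|N n. \<Phi> (X n z))"
      proof (rule integral_mono)
        show "integrable (N n) (\<lambda>z. path_env \<Phi> k (X n z))"
          by (rule integrable_const_bound[of _ "B + real k"]) (use path_env_bound[OF b] in auto)
        show "integrable (N n) (\<lambda>z. \<Phi> (X n z))"
          by (rule integrable_const_bound[of _ "B"]) (use b Xc in auto)
        show "path_env \<Phi> k (X n z) \<le> \<Phi> (X n z)" if "z \<in> space (N n)" for z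
          by (rule path_env_le[OF b Xc[OF that]])
      qed
      thus ?thesis using n0[OF n] k unfolding real_norm_def by linarith
    qed
    thus ?thesis by blast
  qed
  show ?thesis unfolding weakly_converges_def
  proof (intro allI impI, elim conjE)
    fix \<Phi> assume cont: "continuous_map continuous_path_topology euclideanreal \<Phi>"
      and bd: "bounded (\<Phi> ` topspace continuous_path_topology)"
    obtain B where b: "\<And>y. y \<in> continuous_paths \<Longrightarrow> \<bar>\<Phi> y\<bar> \<le> B"
      using bd by (auto simp: bounded_iff)
    have cont': "continuous_map continuous_path_topology euclideanreal (\<lambda>w. - \<Phi> w)"
      using cont by (rule continuous_map_minus)
    have eq: "(LINT w|distr (N n) (borel_of continuous_path_topology) (X n). \<Phi> w) = (LINT z|N n. \<Phi> (X n z))" for n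
      by (rule integral_distr[OF random_path_measurable[OF X] continuous_map_borel_measurable[OF cont]])
    show "(\<lambda>n. LINT w|distr (N n) (borel_of continuous_path_topology) (X n). \<Phi> w) \<longlonglongrightarrow> (LINT w|W. \<Phi> w)"
      unfolding eq
    proof (rule LIMSEQ_I)
      fix e :: real assume e: "0 < e"
      obtain n1 where n1: "\<And>n. n \<ge> n1 \<Longrightarrow> (LINT w|W. \<Phi> w) - e < (LINT z|N n. \<Phi> (X n z))"
        using lower[OF b path_lsc_continuous[OF cont] e] by auto
      obtain n2 where n2: "\<And>n. n \<ge> n2 \<Longrightarrow> (LINT w|W. - \<Phi> w) - e < (LINT z|N n. - \<Phi> (X n z))"
        using lower[OF _ path_lsc_continuous[OF cont'] e, of B] b by auto
      show "\<exists>n0. \<forall>n\<ge>n0. norm ((LINT z|N n. \<Phi> (X n z)) - (LINT w|W. \<Phi> w)) < e"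
      proof (intro exI[of _ "max n1 n2"] allI impI)
        fix n assume "max n1 n2 \<le> n"
        thus "norm ((LINT z|N n. \<Phi> (X n z)) - (LINT w|W. \<Phi> w)) < e" using n1[of n] n2[of n] by (auto simp: abs_less_iff)
      qed
    qed
  qed
qed

section \<open>Joint convergence of asymptotically independent variables\<close>

definition bdd_lipschitz :: "(real \<Rightarrow> real) \<Rightarrow> bool" where
  "bdd_lipschitz h \<longleftrightarrow> (\<exists>L. \<forall>x y. \<bar>h x - h y\<bar> \<le> L * \<bar>x - y\<bar>) \<and> (\<exists>B. \<forall>x. \<bar>h x\<bar> \<le> B)"

lemma bdd_lipschitz_continuous: "bdd_lipschitz h \<Longrightarrow> continuous_on UNIV h"
proof -
  assume "bdd_lipschitz h"
  then obtain L where L: "\<And>x y. \<bar>h x - h y\<bar> \<le> L * \<bar>x - y\<bar>" by (auto simp: bdd_lipschitz_def)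
  have "0 \<le> L" using L[of 0 1] by simp
  hence "L-lipschitz_on UNIV h" using L by (intro lipschitz_onI) (auto simp: dist_real_def)
  thus ?thesis by (rule lipschitz_on_continuous_on)
qed

lemma bdd_lipschitz_measurable: "bdd_lipschitz h \<Longrightarrow> h \<in> borel_measurable borel"
  by (intro borel_measurable_continuous_onI bdd_lipschitz_continuous)

definition ramp :: "real \<Rightarrow> real" where "ramp v = max 0 (min 1 v)"

lemma ramp_lipschitz: "\<bar>ramp x - ramp y\<bar> \<le> \<bar>x - y\<bar>" unfolding ramp_def by linarith
lemma ramp_01: "0 \<le> ramp x" "ramp x \<le> 1" unfolding ramp_def by linarith+
lemma ramp_mono: "x \<le> y \<Longrightarrow> ramp x \<le> ramp y" unfolding ramp_def by linarith

lemma abs_diff_diff_le: "\<bar>a - b\<bar> \<le> e \<Longrightarrow> \<bar>c - d\<bar> \<le> e \<Longrightarrow> \<bar>a - c - (b - d)\<bar> \<le> 2 * e" for a b c d e :: real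
  by linarith

text \<open>
  The tents with \<open>i \<le> 2 * Z\<close> form a partition of unity of mesh \<open>d\<close> on \<open>{-
  d * Z..d * Z}\<close>. As differences of ramps they sum up by telescoping.
\<close>
definition tent :: "real \<Rightarrow> nat \<Rightarrow> nat \<Rightarrow> real \<Rightarrow> real" where
  "tent d Z i y = ramp (y / d + real Z + 1 - real i) - ramp (y / d + real Z - real i)"

lemma tent_nonneg: "0 \<le> tent d Z i y" unfolding tent_def by (simp add: ramp_mono)

lemma tent_support:
  assumes "0 < d" "tent d Z i y \<noteq> 0" shows "\<bar>y - d * (real i - real Z)\<bar> \<le> d"
proof -
  have "\<bar>y / d - (real i - real Z)\<bar> \<le> 1" using assms(2) unfolding tent_def ramp_def by linarith
  thus ?thesis using assms(1) by (simp add: abs_le_iff field_simps)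
qed

lemma tent_lipschitz: assumes "0 < d" shows "bdd_lipschitz (tent d Z i)"
  unfolding bdd_lipschitz_def
proof (intro conjI exI allI)
  fix x y
  have "\<bar>tent d Z i x - tent d Z i y\<bar> \<le> 2 * \<bar>x / d - y / d\<bar>"
  proof -
    have "\<bar>ramp (x / d + real Z + 1 - real i) - ramp (y / d + real Z + 1 - real i)\<bar> \<le> \<bar>x / d - y / d\<bar>"
      "\<bar>ramp (x / d + real Z - real i) - ramp (y / d + real Z - real i)\<bar> \<le> \<bar>x / d - y / d\<bar>"
      by (rule order_trans[OF ramp_lipschitz], simp)+
    thus ?thesis unfolding tent_def by (rule abs_diff_diff_le)
  qed
  also have "\<bar>x / d - y / d\<bar> = \<bar>x - y\<bar> / d" using assms by (simp add: diff_divide_distrib[symmetric])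
  finally show "\<bar>tent d Z i x - tent d Z i y\<bar> \<le> 2 / d * \<bar>x - y\<bar>" by simp
  show "\<bar>tent d Z i x\<bar> \<le> 2" unfolding tent_def
    using ramp_01[of "x / d + real Z + 1 - real i"] ramp_01[of "x / d + real Z - real i"] by linarith
qed

text \<open>
  The part of the constant 1 that the tents leave uncovered; it lives outside \<open>{- d * Z..d * Z}\<close>.
\<close>
definition tent_rest :: "real \<Rightarrow> nat \<Rightarrow> real \<Rightarrow> real" where
  "tent_rest d Z y = 1 - (\<Sum>i<2 * Z + 1. tent d Z i y)"

lemma tent_rest_eq: "tent_rest d Z y = 1 - ramp (y / d + real Z + 1) + ramp (y / d - real Z)"
proof -
  have "(\<Sum>i<2 * Z + 1. tent d Z i y) =
     (\<Sum>i<2 * Z + 1. ramp (y / d + real Z + 1 - real i) - ramp (y / d + real Z + 1 - real (Suc i)))"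
    unfolding tent_def by (intro sum.cong refl) (simp add: algebra_simps)
  also have "\<dots> = ramp (y / d + real Z + 1 - real 0) - ramp (y / d + real Z + 1 - real (2 * Z + 1))"
    by (rule sum_lessThan_telescope')
  finally show ?thesis unfolding tent_rest_def by (simp add: algebra_simps)
qed

lemma tent_rest_01: "0 \<le> tent_rest d Z y" "tent_rest d Z y \<le> 1"
proof -
  show "tent_rest d Z y \<le> 1" unfolding tent_rest_def
    using sum_nonneg[of "{..<2 * Z + 1}" "\<lambda>i. tent d Z i y"] tent_nonneg by (simp del: sum.lessThan_Suc)
  show "0 \<le> tent_rest d Z y" unfolding tent_rest_eq using ramp_01[of "y / d + real Z + 1"] ramp_01[of "y / d - real Z"] by linarith
qed

lemma tent_rest_lipschitz: assumes "0 < d" shows "bdd_lipschitz (tent_rest d Z)"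
  unfolding bdd_lipschitz_def
proof (intro conjI exI allI)
  fix x y
  have "\<bar>tent_rest d Z x - tent_rest d Z y\<bar> \<le> 2 * \<bar>x / d - y / d\<bar>"
  proof -
    have "\<bar>ramp (x / d + real Z + 1) - ramp (y / d + real Z + 1)\<bar> \<le> \<bar>x / d - y / d\<bar>"
      "\<bar>ramp (x / d - real Z) - ramp (y / d - real Z)\<bar> \<le> \<bar>x / d - y / d\<bar>"
      by (rule order_trans[OF ramp_lipschitz], simp)+
    from abs_diff_diff_le[OF this] show ?thesis unfolding tent_rest_eq by linarith
  qed
  also have "\<bar>x / d - y / d\<bar> = \<bar>x - y\<bar> / d" using assms by (simp add: diff_divide_distrib[symmetric])
  finally show "\<bar>tent_rest d Z x - tent_rest d Z y\<bar> \<le> 2 / d * \<bar>x - y\<bar>" by simp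
  show "\<bar>tent_rest d Z x\<bar> \<le> 1" using tent_rest_01[of d Z x] by simp
qed

lemma tent_rest_tendsto: "(\<lambda>Z. tent_rest d Z y) \<longlonglongrightarrow> 0"
proof (rule tendsto_eventually)
  obtain Z0 :: nat where Z0: "\<bar>y / d\<bar> \<le> real Z0" using real_arch_simple by blast
  have "tent_rest d Z y = 0" if "Z \<ge> Z0" for Z
  proof -
    have "real Z0 \<le> real Z" using that by simp
    hence "y / d \<le> real Z" "- real Z \<le> y / d" using Z0 by linarith+
    thus ?thesis unfolding tent_rest_eq ramp_def by linarith
  qed
  thus "\<forall>\<^sub>F Z in sequentially. tent_rest d Z y = 0" by (auto simp: eventually_sequentially)
qed

lemma sum_split_remainder:
  fixes t :: "'i \<Rightarrow> real"
  shows "c - (\<Sum>i\<in>I. f i * t i) = (1 - (\<Sum>i\<in>I. t i)) * c + (\<Sum>i\<in>I. (c - f i) * t i)"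
  by (simp add: left_diff_distrib sum_subtractf sum_distrib_right mult.commute[of c])

lemma tent_approximation:
  assumes d: "0 < d" and F: "coord_lipschitz (Suc K) L F" and B: "\<And>x. \<bar>F x\<bar> \<le> B" and L: "0 \<le> L"
  shows "\<bar>F x - (\<Sum>i<2 * Z + 1. F (x(K := d * (real i - real Z))) * tent d Z i (x K))\<bar> \<le> L * d + B * tent_rest d Z (x K)"
proof -
  let ?I = "{..<2 * Z + 1}" and ?t = "\<lambda>i. tent d Z i (x K)" and ?F = "\<lambda>i. F (x(K := d * (real i - real Z)))"
  have "F x - (\<Sum>i\<in>?I. ?F i * ?t i) = tent_rest d Z (x K) * F x + (\<Sum>i\<in>?I. (F x - ?F i) * ?t i)"
    unfolding tent_rest_def by (rule sum_split_remainder)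
  also have "\<bar>\<dots>\<bar> \<le> B * tent_rest d Z (x K) + (\<Sum>i\<in>?I. L * d * ?t i)"
  proof (rule order_trans[OF abs_triangle_ineq add_mono])
    show "\<bar>tent_rest d Z (x K) * F x\<bar> \<le> B * tent_rest d Z (x K)"
      using B[of x] tent_rest_01[of d Z "x K"] by (simp add: abs_mult mult.commute mult_right_mono)
    show "\<bar>\<Sum>i\<in>?I. (F x - ?F i) * ?t i\<bar> \<le> (\<Sum>i\<in>?I. L * d * ?t i)"
    proof (rule order_trans[OF sum_abs sum_mono])
      fix i
      show "\<bar>(F x - ?F i) * ?t i\<bar> \<le> L * d * ?t i"
      proof (cases "?t i = 0")
        case False
        have "\<bar>F x - ?F i\<bar> \<le> L * (\<Sum>j<Suc K. \<bar>x j - (x(K := d * (real i - real Z))) j\<bar>)"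
          using F unfolding coord_lipschitz_def by blast
        also have "(\<Sum>j<Suc K. \<bar>x j - (x(K := d * (real i - real Z))) j\<bar>) = \<bar>x K - d * (real i - real Z)\<bar>"
          by simp
        also have "L * \<dots> \<le> L * d" using tent_support[OF d False] L by (intro mult_left_mono) auto
        finally show ?thesis using mult_right_mono[OF _ tent_nonneg[of d Z i "x K"]] tent_nonneg[of d Z i "x K"]
          by (simp only: abs_mult abs_of_nonneg)
      qed simp
    qed
  qed
  also have "(\<Sum>i\<in>?I. L * d * ?t i) = L * d * (1 - tent_rest d Z (x K))"
    by (simp add: tent_rest_def sum_distrib_left del: sum.lessThan_Suc lessThan_Suc)
  also have "\<dots> \<le> L * d" using L d tent_rest_01[of d Z "x K"] mult_left_mono[of "1 - tent_rest d Z (x K)" 1 "L * d"] by simp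
  finally show ?thesis by linarith
qed

lemma coord_lipschitz_nonneg: "coord_lipschitz K L F \<Longrightarrow> coord_lipschitz K (max L 0) F"
  unfolding coord_lipschitz_def by (meson max.cobounded1 mult_right_mono order_trans sum_nonneg abs_ge_zero)

lemma coord_lipschitz_upd:
  assumes "coord_lipschitz (Suc K) L F" "0 \<le> L" shows "coord_lipschitz K L (\<lambda>x. F (x(K := c)))"
  unfolding coord_lipschitz_def
proof (intro allI)
  fix x y :: "nat \<Rightarrow> real"
  have "\<bar>F (x(K := c)) - F (y(K := c))\<bar> \<le> L * (\<Sum>j<Suc K. \<bar>(x(K := c)) j - (y(K := c)) j\<bar>)"
    using assms unfolding coord_lipschitz_def by blast
  also have "(\<Sum>j<Suc K. \<bar>(x(K := c)) j - (y(K := c)) j\<bar>) = (\<Sum>j<K. \<bar>x j - y j\<bar>)" by simp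
  finally show "\<bar>F (x(K := c)) - F (y(K := c))\<bar> \<le> L * (\<Sum>j<K. \<bar>x j - y j\<bar>)" .
qed

text \<open>
  Induction on the number of coordinates. A partition of unity in the last coordinate replaces
  \<open>F\<close> by a finite sum of products \<open>p(x\<^sub>0,...,x\<^sub>K\<^sub>-\<^sub>1)
  h(x\<^sub>K)\<close>, to which asymptotic independence, the induction hypothesis and the convergence of each
  single coordinate apply. The error far out in the last coordinate is itself the expectation of a function of
  that coordinate, so it converges as well.
\<close>
theorem joint_convergence:
  fixes N :: "nat \<Rightarrow> 'b measure" and D :: "nat \<Rightarrow> nat \<Rightarrow> 'b \<Rightarrow> real" and W :: "'c measure" and E :: "nat \<Rightarrow> 'c \<Rightarrow> real"
  assumes P: "\<And>n. prob_space (N n)" and Dm: "\<And>n i. D n i \<in> borel_measurable (N n)"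
    and W: "prob_space W" and Em: "\<And>i. E i \<in> borel_measurable W"
    and asym: "\<And>i L p B h. coord_lipschitz i L p \<Longrightarrow> (\<And>x. \<bar>p x\<bar> \<le> B) \<Longrightarrow> bdd_lipschitz h \<Longrightarrow>
      (\<lambda>n. (LINT w|N n. p (\<lambda>j. D n j w) * h (D n i w)) - (LINT w|N n. p (\<lambda>j. D n j w)) * (LINT w|N n. h (D n i w))) \<longlonglongrightarrow> 0"
    and ind: "\<And>i L p B h. coord_lipschitz i L p \<Longrightarrow> (\<And>x. \<bar>p x\<bar> \<le> B) \<Longrightarrow> bdd_lipschitz h \<Longrightarrow>
      (LINT w|W. p (\<lambda>j. E j w) * h (E i w)) = (LINT w|W. p (\<lambda>j. E j w)) * (LINT w|W. h (E i w))"
    and one: "\<And>i h. bdd_lipschitz h \<Longrightarrow> (\<lambda>n. LINT w|N n. h (D n i w)) \<longlonglongrightarrow> (LINT w|W. h (E i w))"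
    and F: "coord_lipschitz K L F" and B: "\<And>x. \<bar>F x\<bar> \<le> B"
  shows "(\<lambda>n. LINT w|N n. F (\<lambda>j. D n j w)) \<longlonglongrightarrow> (LINT w|W. F (\<lambda>j. E j w))"
  using F B
proof (induction K arbitrary: L F B)
  case 0
  have "F x = F (\<lambda>_. 0)" for x using 0(1) by (simp add: coord_lipschitz_def)
  hence "F = (\<lambda>_. F (\<lambda>_. 0))" by blast
  then obtain c where "F = (\<lambda>_. c)" by blast
  thus ?case using P W by (simp add: prob_space.prob_space)
next
  case (Suc K)
  interpret W: prob_space W by fact
  define L' where "L' = max L 0"
  have L': "0 \<le> L'" and F': "coord_lipschitz (Suc K) L' F"
    using coord_lipschitz_nonneg[OF Suc.prems(1)] by (auto simp: L'_def)
  have B0: "0 \<le> B" using Suc.prems(2)[of undefined] by linarith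
  have Dv: "(\<lambda>w. (\<lambda>j. D n j w)) \<in> borel_measurable (N n)" for n
    by (intro measurable_coordinatewise_then_product Dm)
  have Ev: "(\<lambda>w. (\<lambda>j. E j w)) \<in> borel_measurable W"
    by (intro measurable_coordinatewise_then_product Em)
  note Fm = coord_lipschitz_measurable[OF F']
  show ?case
  proof (rule LIMSEQ_I)
    fix e :: real assume e: "0 < e"
    \<comment> \<open>the mesh keeps the Lipschitz error below e / 6\<close>
    define d where "d = e / (6 * (L' + 1))"
    have d: "0 < d" using e L' by (simp add: d_def)
    have "L' * d = (L' / (L' + 1)) * (e / 6)" using L' by (simp add: d_def)
    also have "\<dots> \<le> 1 * (e / 6)" using L' e by (intro mult_right_mono) (auto simp: field_simps)
    finally have Ld: "L' * d \<le> e / 6" by simp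
    have rm: "tent_rest d Z \<in> borel_measurable borel" for Z by (intro bdd_lipschitz_measurable tent_rest_lipschitz d)
    have tm: "tent d Z i \<in> borel_measurable borel" for Z i by (intro bdd_lipschitz_measurable tent_lipschitz d)
    have "(\<lambda>Z. LINT w|W. tent_rest d Z (E K w)) \<longlonglongrightarrow> (LINT w|W. 0)"
    proof (rule integral_dominated_convergence[where w="\<lambda>_. 1"])
      show "(\<lambda>w. tent_rest d Z (E K w)) \<in> borel_measurable W" for Z by (rule measurable_compose[OF Em rm])
      show "AE x in W. (\<lambda>Z. tent_rest d Z (E K x)) \<longlonglongrightarrow> 0" by (intro AE_I2 tent_rest_tendsto)
    qed (use tent_rest_01 in auto)
    hence "(\<lambda>Z. B * (LINT w|W. tent_rest d Z (E K w))) \<longlonglongrightarrow> B * 0" by (intro tendsto_mult_left) simp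
    from order_tendstoD(2)[OF this, of "e/12"] e obtain Z where Z: "B * (LINT w|W. tent_rest d Z (E K w)) < e / 12"
      by (auto simp: eventually_sequentially)
    define G where "G x = (\<Sum>i<2 * Z + 1. F (x(K := d * (real i - real Z))) * tent d Z i (x K))" for x
    have GF: "\<bar>F x - G x\<bar> \<le> L' * d + B * tent_rest d Z (x K)" for x
      unfolding G_def by (rule tent_approximation[OF d F' Suc.prems(2) L'])
    have cl: "coord_lipschitz K L' (\<lambda>x. F (x(K := c)))" for c by (rule coord_lipschitz_upd[OF F' L'])
    note cm = coord_lipschitz_measurable[OF cl]
    \<comment> \<open>needed for the vectors D n under N n and for the vector E under W\<close>
    have err: "\<bar>(LINT w|M. F (\<lambda>j. V j w)) - (LINT w|M. G (\<lambda>j. V j w))\<bar> \<le> e / 6 + B * (LINT w|M. tent_rest d Z (V K w))"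
      and prod: "integrable M (\<lambda>w. F ((\<lambda>j. V j w)(K := c)) * tent d Z i (V K w))"
      if M: "prob_space M" and V: "\<And>j. V j \<in> borel_measurable M" for M :: "'d measure" and V c i
    proof -
      interpret prob_space M by fact
      have Vv: "(\<lambda>w. (\<lambda>j. V j w)) \<in> borel_measurable M" by (intro measurable_coordinatewise_then_product V)
      have [measurable]: "(\<lambda>w. F (\<lambda>j. V j w)) \<in> borel_measurable M"
        "(\<lambda>w. F ((\<lambda>j. V j w)(K := c))) \<in> borel_measurable M" for c
        using measurable_compose[OF Vv Fm] measurable_compose[OF Vv cm] by simp_all
      have [measurable]: "(\<lambda>w. tent d Z i (V K w)) \<in> borel_measurable M" "(\<lambda>w. tent_rest d Z (V K w)) \<in> borel_measurable M" for i
        using measurable_compose[OF V tm] measurable_compose[OF V rm] by simp_all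
      have tb: "\<bar>tent d Z i y\<bar> \<le> 2" for i y unfolding tent_def
        using ramp_01[of "y / d + real Z + 1 - real i"] ramp_01[of "y / d + real Z - real i"] by linarith
      have pi: "integrable M (\<lambda>w. F ((\<lambda>j. V j w)(K := c)) * tent d Z i (V K w))" for c i
        by (rule integrable_const_bound[of _ "B * 2"])
           (use Suc.prems(2) tb B0 in \<open>auto simp: abs_mult intro!: AE_I2 mult_mono\<close>)
      show "integrable M (\<lambda>w. F ((\<lambda>j. V j w)(K := c)) * tent d Z i (V K w))" by (rule pi)
      have iF: "integrable M (\<lambda>w. F (\<lambda>j. V j w))"
        by (rule integrable_const_bound[of _ B]) (use Suc.prems(2) in auto)
      have iG: "integrable M (\<lambda>w. G (\<lambda>j. V j w))" unfolding G_def by (intro Bochner_Integration.integrable_sum pi)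
      have ir: "integrable M (\<lambda>w. tent_rest d Z (V K w))"
        by (rule integrable_const_bound[of _ 1]) (use tent_rest_01 in auto)
      have "\<bar>(LINT w|M. F (\<lambda>j. V j w)) - (LINT w|M. G (\<lambda>j. V j w))\<bar> = \<bar>LINT w|M. F (\<lambda>j. V j w) - G (\<lambda>j. V j w)\<bar>"
        using iF iG by simp
      also have "\<dots> \<le> (LINT w|M. \<bar>F (\<lambda>j. V j w) - G (\<lambda>j. V j w)\<bar>)" by (rule integral_abs_bound)
      also have "\<dots> \<le> (LINT w|M. e / 6 + B * tent_rest d Z (V K w))"
      proof (rule integral_mono)
        show "\<bar>F (\<lambda>j. V j w) - G (\<lambda>j. V j w)\<bar> \<le> e / 6 + B * tent_rest d Z (V K w)" for w
          using GF[of "\<lambda>j. V j w"] Ld by linarith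
      qed (use iF iG ir in auto)
      also have "\<dots> = e / 6 + B * (LINT w|M. tent_rest d Z (V K w))" using ir by (simp add: prob_space)
      finally show "\<bar>(LINT w|M. F (\<lambda>j. V j w)) - (LINT w|M. G (\<lambda>j. V j w))\<bar> \<le> e / 6 + B * (LINT w|M. tent_rest d Z (V K w))" .
    qed
    have "(\<lambda>n. LINT w|N n. G (\<lambda>j. D n j w)) \<longlonglongrightarrow> (LINT w|W. G (\<lambda>j. E j w))"
    proof -
      let ?F = "\<lambda>i x. F (x(K := d * (real i - real Z)))"
      have 1: "(\<lambda>n. LINT w|N n. ?F i (\<lambda>j. D n j w) * tent d Z i (D n K w)) \<longlonglongrightarrow>
         (LINT w|W. ?F i (\<lambda>j. E j w) * tent d Z i (E K w))" for i
      proof -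
        have "(\<lambda>n. (LINT w|N n. ?F i (\<lambda>j. D n j w)) * (LINT w|N n. tent d Z i (D n K w))) \<longlonglongrightarrow>
          (LINT w|W. ?F i (\<lambda>j. E j w)) * (LINT w|W. tent d Z i (E K w))"
          by (intro tendsto_mult one Suc.IH[OF cl Suc.prems(2)] tent_lipschitz d)
        from tendsto_add[OF asym[OF cl[of "d * (real i - real Z)"] Suc.prems(2) tent_lipschitz[OF d, of Z i]] this]
        have "(\<lambda>n. LINT w|N n. ?F i (\<lambda>j. D n j w) * tent d Z i (D n K w)) \<longlonglongrightarrow>
          (LINT w|W. ?F i (\<lambda>j. E j w)) * (LINT w|W. tent d Z i (E K w))"
          by (simp only: diff_add_cancel add_0_left)
        thus ?thesis by (simp only: ind[OF cl[of "d * (real i - real Z)"] Suc.prems(2) tent_lipschitz[OF d, of Z i]])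
      qed
      have "(\<lambda>n. \<Sum>i<2 * Z + 1. LINT w|N n. ?F i (\<lambda>j. D n j w) * tent d Z i (D n K w)) \<longlonglongrightarrow>
         (\<Sum>i<2 * Z + 1. LINT w|W. ?F i (\<lambda>j. E j w) * tent d Z i (E K w))" by (intro tendsto_sum 1)
      moreover have "(LINT w|N n. G (\<lambda>j. D n j w)) = (\<Sum>i<2 * Z + 1. LINT w|N n. ?F i (\<lambda>j. D n j w) * tent d Z i (D n K w))" for n
        unfolding G_def by (rule Bochner_Integration.integral_sum) (rule prod[OF P Dm])
      moreover have "(LINT w|W. G (\<lambda>j. E j w)) = (\<Sum>i<2 * Z + 1. LINT w|W. ?F i (\<lambda>j. E j w) * tent d Z i (E K w))"
        unfolding G_def by (rule Bochner_Integration.integral_sum) (rule prod[OF W Em])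
      ultimately show ?thesis by simp
    qed
    from LIMSEQ_D[OF this, of "e/6"] e obtain n1 where
      n1: "\<And>n. n \<ge> n1 \<Longrightarrow> norm ((LINT w|N n. G (\<lambda>j. D n j w)) - (LINT w|W. G (\<lambda>j. E j w))) < e/6" by auto
    have "(\<lambda>n. B * (LINT w|N n. tent_rest d Z (D n K w))) \<longlonglongrightarrow> B * (LINT w|W. tent_rest d Z (E K w))"
      by (intro tendsto_mult_left one tent_rest_lipschitz d)
    from order_tendstoD(2)[OF this Z] obtain n2 where
      n2: "\<And>n. n \<ge> n2 \<Longrightarrow> B * (LINT w|N n. tent_rest d Z (D n K w)) < e / 12" by (auto simp: eventually_sequentially)
    show "\<exists>no. \<forall>n\<ge>no. norm ((LINT w|N n. F (\<lambda>j. D n j w)) - (LINT w|W. F (\<lambda>j. E j w))) < e"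
    proof (intro exI[of _ "max n1 n2"] allI impI)
      fix n assume n: "max n1 n2 \<le> n"
      have e1: "\<bar>(LINT w|N n. F (\<lambda>j. D n j w)) - (LINT w|N n. G (\<lambda>j. D n j w))\<bar> \<le> e / 6 + B * (LINT w|N n. tent_rest d Z (D n K w))"
        by (rule err[OF P Dm])
      have e2: "\<bar>(LINT w|W. F (\<lambda>j. E j w)) - (LINT w|W. G (\<lambda>j. E j w))\<bar> \<le> e / 6 + B * (LINT w|W. tent_rest d Z (E K w))"
        by (rule err[OF W Em])
      show "norm ((LINT w|N n. F (\<lambda>j. D n j w)) - (LINT w|W. F (\<lambda>j. E j w))) < e"
        using e1 e2 n1[of n] n2[of n] n Z e unfolding real_norm_def by linarith
    qed
  qed
qed

subsection \<open>L2\<close>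

section \<open>Square-integrable functions and time averages of a semigroup\<close>

context prob_space
begin

lemma L2_bounded: "f \<in> borel_measurable M \<Longrightarrow> (\<And>x. \<bar>f x\<bar> \<le> B) \<Longrightarrow> f \<in> L2_space M"
proof -
  assume f [measurable]: "f \<in> borel_measurable M" and B: "\<And>x. \<bar>f x\<bar> \<le> B"
  have "\<bar>(f x)\<^sup>2\<bar> \<le> B\<^sup>2" for x using power_mono[OF B[of x], of 2] by simp
  hence "integrable M (\<lambda>x. (f x)\<^sup>2)" by (intro integrable_const_bound[of _ "B\<^sup>2"]) auto
  thus ?thesis by (simp add: L2_space_def)
qed

lemma L2_mult_integrable:
  assumes "f \<in> L2_space M" "g \<in> L2_space M" shows "integrable M (\<lambda>x. f x * g x)"
proof (rule Bochner_Integration.integrable_bound)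
  show "integrable M (\<lambda>x. (f x)\<^sup>2 + (g x)\<^sup>2)" using assms by (auto simp: L2_space_def)
  show "(\<lambda>x. f x * g x) \<in> borel_measurable M" using assms by (auto simp: L2_space_def)
  show "AE x in M. norm (f x * g x) \<le> norm ((f x)\<^sup>2 + (g x)\<^sup>2)"
  proof (rule AE_I2)
    fix x
    have "2 * \<bar>f x * g x\<bar> \<le> (f x)\<^sup>2 + (g x)\<^sup>2"
      using sum_squares_bound[of "\<bar>f x\<bar>" "\<bar>g x\<bar>"] by (simp add: abs_mult)
    moreover have "0 \<le> (f x)\<^sup>2 + (g x)\<^sup>2" by simp
    ultimately show "norm (f x * g x) \<le> norm ((f x)\<^sup>2 + (g x)\<^sup>2)" by (simp add: abs_of_nonneg)
  qed
qed

lemma L2_integrable: "f \<in> L2_space M \<Longrightarrow> integrable M f"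
  using L2_mult_integrable[of f "\<lambda>_. 1"] L2_bounded[of "\<lambda>_. 1" 1] by simp

lemma L2_lincomb:
  assumes "f \<in> L2_space M" "g \<in> L2_space M" shows "(\<lambda>x. a * f x + b * g x) \<in> L2_space M"
proof -
  have "integrable M (\<lambda>x. a\<^sup>2 * (f x)\<^sup>2 + 2 * a * b * (f x * g x) + b\<^sup>2 * (g x)\<^sup>2)"
    using assms L2_mult_integrable[OF assms] by (intro Bochner_Integration.integrable_add) (auto simp: L2_space_def)
  moreover have "a\<^sup>2 * (f x)\<^sup>2 + 2 * a * b * (f x * g x) + b\<^sup>2 * (g x)\<^sup>2 = (a * f x + b * g x)\<^sup>2" for x
    by (simp add: power2_eq_square algebra_simps)
  ultimately show ?thesis using assms by (auto simp: L2_space_def)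
qed

lemma L2_norm_nonneg: "0 \<le> L2_norm M f" by (simp add: L2_norm_def)

lemma L2_norm_sq: "(L2_norm M f)\<^sup>2 = (LINT x|M. (f x)\<^sup>2)" by (simp add: L2_norm_def)

lemma L2_cauchy_schwarz:
  assumes f: "f \<in> L2_space M" and g: "g \<in> L2_space M"
  shows "\<bar>LINT x|M. f x * g x\<bar> \<le> L2_norm M f * L2_norm M g"
proof -
  define a b c where "a = L2_norm M f" and "b = L2_norm M g" and "c = (LINT x|M. f x * g x)"
  have q: "0 \<le> s\<^sup>2 * a\<^sup>2 + 2 * s * t * c + t\<^sup>2 * b\<^sup>2" for s t
  proof -
    have "0 \<le> (LINT x|M. (s * f x + t * g x)\<^sup>2)" by simp
    also have "\<dots> = (LINT x|M. s\<^sup>2 * (f x)\<^sup>2 + (2 * s * t) * (f x * g x) + t\<^sup>2 * (g x)\<^sup>2)"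
      by (intro Bochner_Integration.integral_cong) (auto simp: power2_eq_square algebra_simps)
    also have "\<dots> = s\<^sup>2 * a\<^sup>2 + 2 * s * t * c + t\<^sup>2 * b\<^sup>2"
      using f g L2_mult_integrable[OF f g] by (simp add: L2_space_def L2_norm_sq a_def b_def c_def)
    finally show ?thesis .
  qed
  have ab: "0 \<le> a" "0 \<le> b" by (simp_all add: a_def b_def L2_norm_nonneg)
  have "\<bar>c\<bar> \<le> a * b"
  proof (cases "a = 0 \<or> b = 0")
    case False
    hence p: "0 < a * b" using ab by simp
    have "0 \<le> b\<^sup>2 * a\<^sup>2 + 2 * b * a * c + a\<^sup>2 * b\<^sup>2" by (rule q)
    hence "0 \<le> (a * b) * (2 * (a * b) + 2 * c)" by (simp add: power2_eq_square algebra_simps)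
    hence 1: "0 \<le> 2 * (a * b) + 2 * c" using p by (simp add: zero_le_mult_iff)
    have "0 \<le> b\<^sup>2 * a\<^sup>2 + 2 * b * (-a) * c + (-a)\<^sup>2 * b\<^sup>2" by (rule q)
    hence "0 \<le> (a * b) * (2 * (a * b) - 2 * c)" by (simp add: power2_eq_square algebra_simps)
    hence 2: "0 \<le> 2 * (a * b) - 2 * c" using p by (simp add: zero_le_mult_iff)
    show ?thesis using 1 2 by linarith
  next
    case True
    have "c = 0"
    proof (rule ccontr)
      assume c: "c \<noteq> 0"
      show False
      proof (cases "a = 0")
        case True
        have "0 \<le> ((- (b\<^sup>2 + 1)) / (2 * c))\<^sup>2 * a\<^sup>2 + 2 * ((- (b\<^sup>2 + 1)) / (2 * c)) * 1 * c + 1\<^sup>2 * b\<^sup>2" by (rule q)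
        thus False using c True by (simp add: field_simps)
      next
        case False
        hence b: "b = 0" using True by simp
        have "0 \<le> 1\<^sup>2 * a\<^sup>2 + 2 * 1 * ((- (a\<^sup>2 + 1)) / (2 * c)) * c + ((- (a\<^sup>2 + 1)) / (2 * c))\<^sup>2 * b\<^sup>2" by (rule q)
        thus False using c b by (simp add: field_simps)
      qed
    qed
    thus ?thesis using True by auto
  qed
  thus ?thesis by (simp add: a_def b_def c_def)
qed

lemma L2_integral_le: "f \<in> L2_space M \<Longrightarrow> \<bar>LINT x|M. f x\<bar> \<le> L2_norm M f"
  using L2_cauchy_schwarz[of f "\<lambda>_. 1"] L2_bounded[of "\<lambda>_. 1" 1] by (simp add: L2_norm_def[of M "\<lambda>_. 1"] prob_space)

lemma L2_abs_integral_le: "f \<in> L2_space M \<Longrightarrow> (LINT x|M. \<bar>f x\<bar>) \<le> L2_norm M f"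
  using L2_integral_le[of "\<lambda>x. \<bar>f x\<bar>"] by (auto simp: L2_space_def L2_norm_def)

lemma L2_norm_cong_AE:
  assumes "f \<in> borel_measurable M" "g \<in> borel_measurable M" "AE x in M. f x = g x"
  shows "L2_norm M f = L2_norm M g"
  unfolding L2_norm_def using assms by (intro arg_cong[where f=sqrt] integral_cong_AE) auto

lemma L2_norm_0_AE:
  assumes f: "f \<in> L2_space M" and 0: "L2_norm M f = 0" shows "AE x in M. f x = 0"
proof -
  have "(LINT x|M. (f x)\<^sup>2) = 0" using L2_norm_sq[of f] 0 by simp
  hence "AE x in M. (f x)\<^sup>2 = 0"
    using f by (subst (asm) integral_nonneg_eq_0_iff_AE) (auto simp: L2_space_def)
  thus ?thesis by simp
qed

lemma L2_norm_triangle: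
  assumes f: "f \<in> L2_space M" and g: "g \<in> L2_space M"
  shows "L2_norm M (\<lambda>x. f x + g x) \<le> L2_norm M f + L2_norm M g"
proof (rule power2_le_imp_le)
  have "(L2_norm M (\<lambda>x. f x + g x))\<^sup>2 = (LINT x|M. (f x)\<^sup>2 + 2 * (f x * g x) + (g x)\<^sup>2)"
    unfolding L2_norm_sq by (intro Bochner_Integration.integral_cong) (auto simp: power2_eq_square algebra_simps)
  also have "\<dots> = (L2_norm M f)\<^sup>2 + 2 * (LINT x|M. f x * g x) + (L2_norm M g)\<^sup>2"
    using f g L2_mult_integrable[OF f g] by (simp add: L2_space_def L2_norm_sq)
  also have "\<dots> \<le> (L2_norm M f)\<^sup>2 + 2 * (L2_norm M f * L2_norm M g) + (L2_norm M g)\<^sup>2"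
    using L2_cauchy_schwarz[OF f g] by simp
  also have "\<dots> = (L2_norm M f + L2_norm M g)\<^sup>2" by (simp add: power2_eq_square algebra_simps)
  finally show "(L2_norm M (\<lambda>x. f x + g x))\<^sup>2 \<le> (L2_norm M f + L2_norm M g)\<^sup>2" .
qed (simp add: L2_norm_nonneg)

lemma L2_norm_mult: "L2_norm M (\<lambda>x. c * f x) = \<bar>c\<bar> * L2_norm M f"
  by (simp add: L2_norm_def power_mult_distrib real_sqrt_mult)

text \<open>
  The supremum runs over the unit ball, so \<open>f\<close> is scaled to norm 1. If its norm is 0, boundedness
  alone gives the claim.
\<close>
lemma L2_operator_norm_bound:
  assumes A: "L2_bounded_operator M A" and f: "f \<in> L2_space M"
  shows "L2_norm M (A f) \<le> L2_operator_norm M A * L2_norm M f"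
proof -
  obtain K where K: "\<And>f. f \<in> L2_space M \<Longrightarrow> L2_norm M (A f) \<le> K * L2_norm M f"
    using A unfolding L2_bounded_operator_def by blast
  have bdd: "bdd_above ((\<lambda>f. L2_norm M (A f)) ` {f \<in> L2_space M. L2_norm M f \<le> 1})"
  proof (rule bdd_aboveI2)
    fix f assume "f \<in> {f \<in> L2_space M. L2_norm M f \<le> 1}"
    hence f: "f \<in> L2_space M" "L2_norm M f \<le> 1" by auto
    have "L2_norm M (A f) \<le> K * L2_norm M f" by (rule K[OF f(1)])
    also have "\<dots> \<le> \<bar>K\<bar> * 1" using f(2) L2_norm_nonneg[of f] by (intro mult_mono) auto
    finally show "L2_norm M (A f) \<le> \<bar>K\<bar>" by simp
  qed
  show ?thesis
  proof (cases "L2_norm M f = 0")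
    case True thus ?thesis using K[OF f] by simp
  next
    case False
    hence p: "0 < L2_norm M f" using L2_norm_nonneg[of f] by linarith
    define c where "c = 1 / L2_norm M f"
    have fc: "(\<lambda>x. c * f x + 0 * f x) \<in> L2_space M" by (rule L2_lincomb[OF f f])
    have n1: "L2_norm M (\<lambda>x. c * f x + 0 * f x) = 1"
      unfolding mult_zero_left add_0_right L2_norm_mult using p by (simp add: c_def)
    have "AE x in M. A (\<lambda>x. c * f x + 0 * f x) x = c * A f x + 0 * A f x"
      using A f unfolding L2_bounded_operator_def by blast
    hence "L2_norm M (A (\<lambda>x. c * f x + 0 * f x)) = L2_norm M (\<lambda>x. c * A f x + 0 * A f x)"
      using A f fc by (intro L2_norm_cong_AE) (auto simp: L2_bounded_operator_def L2_space_def)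
    also have "\<dots> = c * L2_norm M (A f)"
      unfolding mult_zero_left add_0_right L2_norm_mult using p by (simp add: c_def)
    finally have "c * L2_norm M (A f) = L2_norm M (A (\<lambda>x. c * f x + 0 * f x))" ..
    also have "\<dots> \<le> L2_operator_norm M A"
      unfolding L2_operator_norm_def by (rule cSUP_upper[OF _ bdd]) (use fc n1 in auto)
    finally show ?thesis using p by (simp add: c_def field_simps)
  qed
qed

lemma integral_tendsto_bounded:
  fixes f :: "nat \<Rightarrow> 'a \<Rightarrow> real"
  assumes "\<And>n. f n \<in> borel_measurable M" "g \<in> borel_measurable M" "\<And>x. (\<lambda>n. f n x) \<longlonglongrightarrow> g x" "\<And>n x. \<bar>f n x\<bar> \<le> B"
  shows "(\<lambda>n. LINT x|M. f n x) \<longlonglongrightarrow> (LINT x|M. g x)"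
  using assms by (intro integral_dominated_convergence[where w="\<lambda>_. B"]) auto

lemma integral_tendsto_bounded_at_right:
  fixes f :: "real \<Rightarrow> 'a \<Rightarrow> real"
  assumes fm: "\<And>h. 0 < h \<Longrightarrow> f h \<in> borel_measurable M" and gm: "g \<in> borel_measurable M"
    and lim: "\<And>x. ((\<lambda>h. f h x) \<longlongrightarrow> g x) (at_right 0)" and B: "\<And>h x. 0 < h \<Longrightarrow> \<bar>f h x\<bar> \<le> B"
  shows "((\<lambda>h. LINT x|M. f h x) \<longlongrightarrow> (LINT x|M. g x)) (at_right 0)"
proof (rule tendsto_at_right_sequentially[of 0 1])
  fix S :: "nat \<Rightarrow> real" assume S: "\<And>n. 0 < S n" "S \<longlonglongrightarrow> 0"
  have f: "filterlim S (at_right 0) sequentially"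
    unfolding filterlim_at using S by (auto intro!: always_eventually simp: less_imp_neq[THEN not_sym])
  show "(\<lambda>n. LINT x|M. f (S n) x) \<longlonglongrightarrow> (LINT x|M. g x)"
    using fm gm S(1) B filterlim_compose[OF lim f] by (intro integral_tendsto_bounded) auto
qed simp

end

lemma bcontfunD: "h \<in> bcontfun \<Longrightarrow> continuous_on UNIV h" "h \<in> bcontfun \<Longrightarrow> \<exists>B. \<forall>x. \<bar>h x\<bar> \<le> (B::real)"
  by (auto simp: bcontfun_def bounded_iff)

lemma bcontfunI: "continuous_on UNIV h \<Longrightarrow> (\<And>x. \<bar>h x\<bar> \<le> (B::real)) \<Longrightarrow> h \<in> bcontfun"
  by (auto simp: bcontfun_def bounded_iff)

lemma bcontfun_measurable: "h \<in> bcontfun \<Longrightarrow> h \<in> borel_measurable borel" for h :: "_ \<Rightarrow> real"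
  by (intro borel_measurable_continuous_onI bcontfunD)

subsection \<open>Averaged semigroup\<close>

text \<open>
  A bounded continuous \<open>h\<close> need not lie in the domain of the generator, but averages of its orbit
  over intervals of length \<open>d\<close> do. Estimates are shown for the averages, and \<open>d\<close>
  tends to 0 afterwards.
\<close>
definition time_average :: "('a::metric_space \<Rightarrow> (real \<Rightarrow> 'a) measure) \<Rightarrow> ('a \<Rightarrow> real) \<Rightarrow> real \<Rightarrow> real \<Rightarrow> 'a \<Rightarrow> real" where
  "time_average P h d t x = integral {t..t+d} (\<lambda>s. transition P s h x) / d"

context
  fixes P :: "'a::metric_space \<Rightarrow> (real \<Rightarrow> 'a) measure" and h :: "'a \<Rightarrow> real" and B d :: real
  assumes mp: "markov_process P" and fe: "feller P" and h: "h \<in> bcontfun" "\<And>x. \<bar>h x\<bar> \<le> B" and d: "0 < d"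
begin

lemma transition_bcontfun: "0 \<le> t \<Longrightarrow> transition P t h \<in> bcontfun"
  using fe h by (simp add: feller_def)

lemma orbit_rc: "rc_on (\<lambda>s. transition P s h x) B"
  by (rule transition_rc_on[OF mp bcontfunD(1)[OF h(1)] h(2)])

lemma orbit_bound: "\<bar>transition P s h x\<bar> \<le> B" by (rule transition_bound[OF mp h(2)])

lemma time_average_bound: assumes "0 \<le> t" shows "\<bar>time_average P h d t x\<bar> \<le> B"
proof -
  have "\<bar>integral {t..t+d} (\<lambda>s. transition P s h x)\<bar> \<le> B * (t + d - t)"
    using assms d by (intro rc_on_integral_bound[OF orbit_rc]) auto
  thus ?thesis unfolding time_average_def using d by (simp add: field_simps)
qed

lemma time_average_continuous:
  assumes t: "0 \<le> t" shows "continuous_on UNIV (time_average P h d t)"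
proof (rule continuous_on_sequentiallyI)
  fix u :: "nat \<Rightarrow> 'a" and a assume u: "u \<longlonglongrightarrow> a"
  have m: "set_borel_measurable lborel {t..t+d} (\<lambda>s. transition P s h x)" for x
    using rc_on_integrable(1)[OF orbit_rc t, of "t+d" x] by (auto simp: set_integrable_def set_borel_measurable_def)
  have "(\<lambda>n. LINT s:{t..t+d}|lborel. transition P s h (u n)) \<longlonglongrightarrow> (LINT s:{t..t+d}|lborel. transition P s h a)"
    unfolding set_lebesgue_integral_def
  proof (rule integral_dominated_convergence[where w="\<lambda>s. indicator {t..t+d} s * B"])
    show "AE s in lborel. (\<lambda>n. indicator {t..t+d} s *\<^sub>R transition P s h (u n)) \<longlonglongrightarrow> indicator {t..t+d} s *\<^sub>R transition P s h a"
    proof (rule AE_I2)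
      fix s :: real
      show "(\<lambda>n. indicator {t..t+d} s *\<^sub>R transition P s h (u n)) \<longlonglongrightarrow> indicator {t..t+d} s *\<^sub>R transition P s h a"
      proof (cases "s \<in> {t..t+d}")
        case True
        hence "isCont (transition P s h) a"
          using t bcontfunD(1)[OF transition_bcontfun[of s]] by (auto simp: continuous_on_eq_continuous_at)
        thus ?thesis using u by (intro tendsto_scaleR tendsto_const) (rule isCont_tendsto_compose)
      qed simp
    qed
    show "integrable lborel (\<lambda>s. indicator {t..t+d} s * B)" by (intro integrable_mult_left) (auto intro!: integrable_real_indicator simp: emeasure_lborel_Icc_eq)
    show "AE s in lborel. norm (indicator {t..t+d} s *\<^sub>R transition P s h (u n)) \<le> indicator {t..t+d} s * B" for n
      using orbit_bound by (auto simp: indicator_def)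
  qed (use m in \<open>auto simp: set_borel_measurable_def\<close>)
  thus "(\<lambda>n. time_average P h d t (u n)) \<longlonglongrightarrow> time_average P h d t a"
    unfolding time_average_def using rc_on_integrable(3)[OF orbit_rc t] d by (intro tendsto_divide) auto
qed

lemma time_average_bcontfun: "0 \<le> t \<Longrightarrow> time_average P h d t \<in> bcontfun"
  using time_average_continuous time_average_bound by (rule bcontfunI)

text \<open>
  The transition operator is interchanged with the time integral on the level of Riemann sums.
\<close>
lemma transition_time_average:
  assumes r: "0 \<le> r" and t: "0 \<le> t"
  shows "transition P r (time_average P h d t) x = time_average P h d (r + t) x"
proof -
  let ?R = "\<lambda>K y. rsum (\<lambda>s. transition P s h y) t d K"
  interpret prob_space "P x" by (rule markov_prob[OF mp])
  have ev: "(\<lambda>w. w r) \<in> P x \<rightarrow>\<^sub>M borel"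
    using evaluation_path_space[OF r] by (subst measurable_cong_sets[OF markov_sets[OF mp] refl])
  have Tm: "transition P s h \<in> borel_measurable borel" if "0 \<le> s" for s
    using transition_bcontfun[OF that] by (rule bcontfun_measurable)
  have pos: "0 \<le> t + d * real (Suc l) / real (Suc K)" for l K using t d by simp
  have Rm: "?R K \<in> borel_measurable borel" for K unfolding rsum_def
    by (intro borel_measurable_sum borel_measurable_times Tm pos borel_measurable_const)
  have Rb: "\<bar>?R K y\<bar> \<le> B * d" for K y
  proof -
    have "\<bar>?R K y\<bar> \<le> (\<Sum>l<Suc K. B * (d / real (Suc K)))"
      unfolding rsum_def using d orbit_bound
      by (intro order_trans[OF sum_abs sum_mono]) (auto simp: abs_mult intro!: divide_right_mono mult_right_mono)
    thus ?thesis by simp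
  qed
  have "(\<lambda>K. LINT w|P x. ?R K (w r)) \<longlonglongrightarrow> (LINT w|P x. integral {t..t+d} (\<lambda>s. transition P s h (w r)))"
  proof (rule integral_tendsto_bounded[where B="B * d"])
    show lim: "(\<lambda>K. ?R K (w r)) \<longlonglongrightarrow> integral {t..t+d} (\<lambda>s. transition P s h (w r))" for w
      using t d by (intro rsum_tendsto[OF orbit_rc]) auto
    show Rm': "(\<lambda>w. ?R K (w r)) \<in> borel_measurable (P x)" for K by (rule measurable_compose[OF ev Rm])
    show "(\<lambda>w. integral {t..t+d} (\<lambda>s. transition P s h (w r))) \<in> borel_measurable (P x)"
      by (rule borel_measurable_LIMSEQ_real) (rule lim, rule Rm')
  qed (rule Rb)
  moreover have "(LINT w|P x. ?R K (w r)) = rsum (\<lambda>s. transition P s h x) (r + t) d K" for K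
  proof -
    have "integrable (P x) (\<lambda>w. transition P s h (w r))" if "0 \<le> s" for s
      by (rule integrable_const_bound[of _ B]) (use orbit_bound measurable_compose[OF ev Tm[OF that]] in auto)
    hence "(LINT w|P x. ?R K (w r)) = (\<Sum>l<Suc K. transition P r (transition P (t + d * real (Suc l) / real (Suc K)) h) x * (d / real (Suc K)))"
      unfolding rsum_def using pos by (subst Bochner_Integration.integral_sum) (auto simp: transition_def)
    also have "\<dots> = rsum (\<lambda>s. transition P s h x) (r + t) d K"
      unfolding rsum_def using transition_add_time[OF mp r pos bcontfun_measurable[OF h(1)] h(2)]
      by (simp add: add.assoc del: of_nat_Suc)
    finally show ?thesis .
  qed
  moreover have "(\<lambda>K. rsum (\<lambda>s. transition P s h x) (r + t) d K) \<longlonglongrightarrow> integral {r + t..r + t + d} (\<lambda>s. transition P s h x)"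
    using r t d by (intro rsum_tendsto[OF orbit_rc]) auto
  ultimately have "(LINT w|P x. integral {t..t+d} (\<lambda>s. transition P s h (w r))) = integral {r + t..r + t + d} (\<lambda>s. transition P s h x)"
    using LIMSEQ_unique by simp
  thus ?thesis by (simp add: transition_def[of P r] time_average_def)
qed

lemma time_average_diff:
  assumes t: "0 \<le> t" and s: "0 \<le> s"
  shows "time_average P h d (t + s) x - time_average P h d t x =
    (integral {t+d..t+d+s} (\<lambda>s. transition P s h x) - integral {t..t+s} (\<lambda>s. transition P s h x)) / d"
proof -
  let ?g = "\<lambda>s. transition P s h x"
  have 1: "integral {t..t+s} ?g + integral {t+s..t+s+d} ?g = integral {t..t+s+d} ?g"
    using t s d by (intro rc_on_integral_combine[OF orbit_rc]) auto
  have 2: "integral {t..t+d} ?g + integral {t+d..t+d+s} ?g = integral {t..t+d+s} ?g"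
    using t s d by (intro rc_on_integral_combine[OF orbit_rc]) auto
  have 3: "t + d + s = t + s + d" by simp
  have "integral {t+s..t+s+d} ?g - integral {t..t+d} ?g = integral {t+d..t+d+s} ?g - integral {t..t+s} ?g"
    using 1 2 unfolding 3 by linarith
  thus ?thesis by (simp add: time_average_def diff_divide_distrib[symmetric])
qed

lemma time_average_lipschitz:
  assumes t: "0 \<le> t" and s: "0 \<le> s"
  shows "\<bar>time_average P h d (t + s) x - time_average P h d t x\<bar> \<le> 2 * B / d * s"
proof -
  let ?g = "\<lambda>s. transition P s h x"
  have "\<bar>integral {t+d..t+d+s} ?g\<bar> \<le> B * s"
    using rc_on_integral_bound[OF orbit_rc, of "t+d" "t+d+s" x] t s d by simp
  moreover have "\<bar>integral {t..t+s} ?g\<bar> \<le> B * s"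
    using rc_on_integral_bound[OF orbit_rc, of t "t+s" x] t s d by simp
  ultimately have "\<bar>integral {t+d..t+d+s} ?g - integral {t..t+s} ?g\<bar> \<le> 2 * B * s" by linarith
  thus ?thesis unfolding time_average_diff[OF t s] using d by (simp add: abs_divide divide_right_mono)
qed

text \<open>
  The derivative of the time average in \<open>t\<close>, by the fundamental theorem of calculus; it is again
  a function of class \<open>L\<^sup>2\<close>, namely the generator applied to the average.
\<close>
definition average_derivative :: "real \<Rightarrow> 'a \<Rightarrow> real" where
  "average_derivative t x = (transition P (t + d) h x - transition P t h x) / d"

lemma time_average_derivative:
  assumes t: "0 \<le> t"
  shows "((\<lambda>s. (time_average P h d (t + s) x - time_average P h d t x) / s) \<longlongrightarrow> average_derivative t x) (at_right 0)"
proof -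
  let ?g = "\<lambda>s. transition P s h x"
  have "((\<lambda>s. (integral {t+d..t+d+s} ?g / s - integral {t..t+s} ?g / s) / d) \<longlongrightarrow> average_derivative t x) (at_right 0)"
    unfolding average_derivative_def using t d by (intro tendsto_divide tendsto_diff rc_on_average_tendsto[OF orbit_rc] tendsto_const) auto
  thus ?thesis
  proof (rule Lim_transform_eventually)
    show "\<forall>\<^sub>F s in at_right 0. (integral {t+d..t+d+s} ?g / s - integral {t..t+s} ?g / s) / d =
       (time_average P h d (t + s) x - time_average P h d t x) / s"
      using eventually_at_right_less[of "0::real"]
      by eventually_elim (subst time_average_diff[OF t], auto simp: diff_divide_distrib mult.commute)
  qed
qed

lemma average_derivative_bound: "0 \<le> t \<Longrightarrow> \<bar>average_derivative t x\<bar> \<le> 2 * B / d"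
  using orbit_bound[of "t+d" x] orbit_bound[of t x] d
  by (auto simp: average_derivative_def abs_divide intro!: divide_right_mono)

lemma average_derivative_measurable: "0 \<le> t \<Longrightarrow> average_derivative t \<in> borel_measurable borel"
  unfolding average_derivative_def[abs_def]
  using bcontfun_measurable[OF transition_bcontfun[of t]] bcontfun_measurable[OF transition_bcontfun[of "t+d"]] d by simp

end

lemma time_average_tendsto:
  fixes h :: "'a::metric_space \<Rightarrow> real"
  assumes mp: "markov_process P" and h: "h \<in> bcontfun" and t: "0 \<le> t"
  shows "((\<lambda>d. time_average P h d t x) \<longlongrightarrow> transition P t h x) (at_right 0)"
proof -
  obtain B where B: "\<And>x. \<bar>h x\<bar> \<le> B" using bcontfunD(2)[OF h] by blast
  show ?thesis unfolding time_average_def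
    by (rule rc_on_average_tendsto[OF transition_rc_on[OF mp bcontfunD(1)[OF h] B] t])
qed

lemma right_derivative_transfer:
  "((\<lambda>h. (f (t + h) - f t) / h) \<longlongrightarrow> D) (at_right 0) \<longleftrightarrow> (f has_real_derivative D) (at_right t)"
  unfolding has_field_derivative_iff by (subst (2) filterlim_at_right_to_0) (simp add: add.commute)

lemma right_deriv_antimono:
  fixes \<phi> \<phi>' :: "real \<Rightarrow> real"
  assumes cont: "continuous_on {0..} \<phi>"
    and der: "\<And>t. 0 \<le> t \<Longrightarrow> (\<phi> has_real_derivative \<phi>' t) (at_right t)"
    and neg: "\<And>t. 0 \<le> t \<Longrightarrow> \<phi>' t \<le> 0"
    and ab: "0 \<le> a" "a \<le> b"
  shows "\<phi> b \<le> \<phi> a"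
  by (rule right_derivative_nonpos_imp_antimono[OF cont _ neg ab]) (simp_all add: right_derivative_transfer der)

section \<open>Exponential decay for the perturbed process\<close>

text \<open>
  The two processes and the relation between their generators, as in the theorem. The strict bound
  \<open>\<epsilon> < \<gamma>\<close> is the source of all rates below.
\<close>
locale perturbed_process =
  fixes P Pe :: "'a::polish_space \<Rightarrow> (real \<Rightarrow> 'a) measure"
    and \<mu> :: "'a measure"
    and Lhat :: "('a \<Rightarrow> real) \<Rightarrow> ('a \<Rightarrow> real)"
    and Se :: "real \<Rightarrow> ('a \<Rightarrow> real) \<Rightarrow> ('a \<Rightarrow> real)"
    and \<epsilon> \<gamma> :: real
  assumes unperturbed: "markov_process P"
    and perturbed: "markov_process Pe"
    and invariant: "invariant_distribution P \<mu>"
    and perturbation: "L2_bounded_operator \<mu> Lhat"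
    and eps: "\<epsilon> = L2_operator_norm \<mu> Lhat"
    and perturbed_semigroup: "L2_semigroup \<mu> Se"
    and perturbed_generator:
      "\<And>h g. L2_generator \<mu> Se h g \<longleftrightarrow> g \<in> L2_space \<mu> \<and>
         (\<exists>g0. L2_generator \<mu> (transition P) h g0 \<and> (AE x in \<mu>. g x = g0 x + Lhat h x))"
    and poincare:
      "\<And>h g. L2_generator \<mu> (transition P) h g \<Longrightarrow> (LINT x|\<mu>. h x) = 0 \<Longrightarrow>
         \<gamma> * (L2_norm \<mu> h)\<^sup>2 \<le> - (LINT x|\<mu>. h x * g x)"
    and represents:
      "\<And>t h. 0 \<le> t \<Longrightarrow> h \<in> bcontfun \<Longrightarrow> AE \<eta> in \<mu>. Se t h \<eta> = transition Pe t h \<eta>"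
    and feller: "feller Pe"
    and small: "0 \<le> \<epsilon>" "\<epsilon> < \<gamma>"
begin

sublocale M: prob_space \<mu> by (rule inv_prob[OF unperturbed invariant])

lemma mu_sets [measurable_cong]: "sets \<mu> = sets borel" by (rule inv_sets[OF unperturbed invariant])

lemma mu_measurable: "h \<in> borel_measurable borel \<Longrightarrow> h \<in> borel_measurable \<mu>" for h :: "_ \<Rightarrow> real"
  by (simp cong: measurable_cong_sets add: mu_sets)

lemma mu_bcontfun: "h \<in> bcontfun \<Longrightarrow> h \<in> borel_measurable \<mu>" for h :: "_ \<Rightarrow> real"
  by (intro mu_measurable bcontfun_measurable)

lemma L2_bcontfun: "h \<in> bcontfun \<Longrightarrow> h \<in> L2_space \<mu>" for h :: "_ \<Rightarrow> real"
  using bcontfunD(2)[of h] mu_bcontfun[of h] M.L2_bounded[of h] by blast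

lemma L2_generator_unique_null:
  assumes gen: "L2_generator \<mu> T f g" and fixed: "\<And>t x. 0 < t \<Longrightarrow> T t f x = f x"
  shows "AE x in \<mu>. g x = 0"
proof (rule M.L2_norm_0_AE)
  show g: "g \<in> L2_space \<mu>" using gen by (simp add: L2_generator_def)
  have "((\<lambda>t. L2_norm \<mu> (\<lambda>x. (T t f x - f x) / t - g x)) \<longlongrightarrow> 0) (at_right 0)" using gen by (simp add: L2_generator_def)
  hence "((\<lambda>t::real. L2_norm \<mu> g) \<longlongrightarrow> 0) (at_right 0)"
  proof (rule Lim_transform_eventually)
    show "\<forall>\<^sub>F t in at_right 0. L2_norm \<mu> (\<lambda>x. (T t f x - f x) / t - g x) = L2_norm \<mu> g"
      using eventually_at_right_less[of "0::real"] by eventually_elim (simp add: fixed L2_norm_def)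
  qed
  thus "L2_norm \<mu> g = 0" by (simp add: tendsto_const_iff)
qed

text \<open>
  Both semigroups fix the constants, so both generators annihilate them, and the perturbation is the
  difference.
\<close>
lemma Lhat_const_null: "AE x in \<mu>. Lhat (\<lambda>_. 1) x = 0"
proof -
  have one: "(\<lambda>_. 1::real) \<in> bcontfun" by (rule bcontfunI[of _ 1]) auto
  have "L2_generator \<mu> Se (\<lambda>_. 1) (\<lambda>_. 0)"
    unfolding L2_generator_def
  proof (intro conjI)
    show "((\<lambda>t. L2_norm \<mu> (\<lambda>x. (Se t (\<lambda>_. 1) x - 1) / t - 0)) \<longlongrightarrow> 0) (at_right 0)"
    proof (rule tendsto_eventually)
      show "\<forall>\<^sub>F t in at_right 0. L2_norm \<mu> (\<lambda>x. (Se t (\<lambda>_. 1) x - 1) / t - 0) = 0"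
        using eventually_at_right_less[of "0::real"]
      proof eventually_elim
        case (elim t)
        have "AE x in \<mu>. Se t (\<lambda>_. 1) x = 1"
          using represents[of t "\<lambda>_. 1"] one elim by (simp add: transition_const[OF perturbed])
        hence "AE x in \<mu>. ((Se t (\<lambda>_. 1) x - 1) / t - 0)\<^sup>2 = 0" by eventually_elim simp
        hence "(LINT x|\<mu>. ((Se t (\<lambda>_. 1) x - 1) / t - 0)\<^sup>2) = 0" by (rule integral_eq_zero_AE)
        thus ?case by (simp add: L2_norm_def)
      qed
    qed
  qed (auto intro: L2_bcontfun one M.L2_bounded[of _ 0])
  then obtain g0 where g0: "L2_generator \<mu> (transition P) (\<lambda>_. 1) g0" "AE x in \<mu>. 0 = g0 x + Lhat (\<lambda>_. 1) x"
    using iffD1[OF perturbed_generator[of "\<lambda>_. 1" "\<lambda>_. 0"]] by auto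
  have "AE x in \<mu>. g0 x = 0" by (rule L2_generator_unique_null[OF g0(1)]) (simp add: transition_const[OF unperturbed])
  with g0(2) show ?thesis by eventually_elim simp
qed

text \<open>
  Replace \<open>v\<close> by \<open>w = v - m\<close>, which changes neither the generators nor the
  perturbation. The unperturbed part is at most \<open>- \<gamma> * \<parallel>w\<parallel>^2\<close> by the
  Poincare inequality, the perturbation at most \<open>\<epsilon> * \<parallel>w\<parallel>^2\<close> by
  Cauchy-Schwarz. The unperturbed generator has mean 0 by invariance, so the mean of \<open>g\<close> comes
  from the perturbation only.
\<close>
lemma generator_dissipation:
  assumes v: "v \<in> bcontfun" and gen: "L2_generator \<mu> Se v g"
  defines "m \<equiv> LINT x|\<mu>. v x"
  shows "(LINT x|\<mu>. (v x - m) * g x) \<le> - (\<gamma> - \<epsilon>) * (L2_norm \<mu> (\<lambda>x. v x - m))\<^sup>2"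
    and "\<bar>LINT x|\<mu>. g x\<bar> \<le> \<epsilon> * L2_norm \<mu> (\<lambda>x. v x - m)"
proof -
  obtain B where B: "\<And>x. \<bar>v x\<bar> \<le> B" using bcontfunD(2)[OF v] by blast
  note vm = bcontfun_measurable[OF v]
  have one: "(\<lambda>_. 1::real) \<in> bcontfun" by (rule bcontfunI[of _ 1]) auto
  obtain g0 where g0: "L2_generator \<mu> (transition P) v g0" and gg: "AE x in \<mu>. g x = g0 x + Lhat v x"
    using gen perturbed_generator by blast
  have gL: "g \<in> L2_space \<mu>" and g0L: "g0 \<in> L2_space \<mu>" using gen g0 by (auto simp: L2_generator_def)
  have vL: "v \<in> L2_space \<mu>" by (rule L2_bcontfun[OF v])
  define w where "w x = v x - m" for x
  have w_eq: "w = (\<lambda>y. 1 * v y + (- m) * 1)" by (auto simp: w_def)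
  have wb: "w \<in> bcontfun" unfolding w_eq using bcontfunD(1)[OF v] B
    by (intro bcontfunI[of _ "B + \<bar>m\<bar>"] continuous_intros) (auto intro: order_trans[OF abs_triangle_ineq4] )
  have wL: "w \<in> L2_space \<mu>" by (rule L2_bcontfun[OF wb])
  have w0: "(LINT x|\<mu>. w x) = 0" unfolding w_def using M.L2_integrable[OF vL] by (simp add: m_def M.prob_space)
  have LwL: "Lhat w \<in> L2_space \<mu>" and LvL: "Lhat v \<in> L2_space \<mu>" using perturbation wL vL by (auto simp: L2_bounded_operator_def)
  have lin: "AE x in \<mu>. Lhat w x = Lhat v x"
  proof -
    have "\<And>f g a b. f \<in> L2_space \<mu> \<Longrightarrow> g \<in> L2_space \<mu> \<Longrightarrow>
        AE x in \<mu>. Lhat (\<lambda>y. a * f y + b * g y) x = a * Lhat f x + b * Lhat g x"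
      using perturbation by (simp add: L2_bounded_operator_def)
    from this[OF vL L2_bcontfun[OF one], of 1 "- m"]
    have "AE x in \<mu>. Lhat (\<lambda>y. 1 * v y + (- m) * 1) x = 1 * Lhat v x + (- m) * Lhat (\<lambda>_. 1) x" .
    thus ?thesis using Lhat_const_null unfolding w_eq by eventually_elim simp
  qed
  have genw: "L2_generator \<mu> (transition P) w g0"
    unfolding L2_generator_def
  proof (intro conjI wL g0L)
    have tr: "transition P t w x = transition P t v x - m" if "0 < t" for t x
    proof -
      interpret prob_space "P x" by (rule markov_prob[OF unperturbed])
      have "(\<lambda>\<omega>. \<omega> t) \<in> P x \<rightarrow>\<^sub>M borel" using evaluation_path_space[of t] that
        by (subst measurable_cong_sets[OF markov_sets[OF unperturbed] refl]) simp
      from measurable_compose[OF this vm] have "integrable (P x) (\<lambda>\<omega>. v (\<omega> t))"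
        by (intro integrable_const_bound[of _ B]) (use B in auto)
      thus ?thesis by (simp add: transition_def w_def prob_space)
    qed
    have lim: "((\<lambda>t. L2_norm \<mu> (\<lambda>x. (transition P t v x - v x) / t - g0 x)) \<longlongrightarrow> 0) (at_right 0)"
      using g0 by (simp add: L2_generator_def)
    thus "((\<lambda>t. L2_norm \<mu> (\<lambda>x. (transition P t w x - w x) / t - g0 x)) \<longlongrightarrow> 0) (at_right 0)"
    proof (rule Lim_transform_eventually)
      show "\<forall>\<^sub>F t in at_right 0. L2_norm \<mu> (\<lambda>x. (transition P t v x - v x) / t - g0 x) = L2_norm \<mu> (\<lambda>x. (transition P t w x - w x) / t - g0 x)"
        using eventually_at_right_less[of "0::real"] by eventually_elim (simp add: tr, simp add: w_def)
    qed
  qed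
  have g00: "(LINT x|\<mu>. g0 x) = 0"
  proof -
    have lim: "((\<lambda>t. L2_norm \<mu> (\<lambda>x. (transition P t v x - v x) / t - g0 x)) \<longlongrightarrow> 0) (at_right 0)"
      using g0 by (simp add: L2_generator_def)
    have le: "\<bar>LINT x|\<mu>. g0 x\<bar> \<le> L2_norm \<mu> (\<lambda>x. (transition P t v x - v x) / t - g0 x)" if t: "0 < t" for t
    proof -
      have Tm: "transition P t v \<in> borel_measurable \<mu>" using transition_measurable[OF unperturbed _ vm, of t] t by (intro mu_measurable) auto
      have TL: "transition P t v \<in> L2_space \<mu>" by (rule M.L2_bounded[OF Tm transition_bound[OF unperturbed B]])
      have "(\<lambda>x. 1 * ((1/t) * transition P t v x + (-1/t) * v x) + (-1) * g0 x) \<in> L2_space \<mu>"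
        by (intro M.L2_lincomb TL vL g0L)
      hence L: "(\<lambda>x. (transition P t v x - v x) / t - g0 x) \<in> L2_space \<mu>" by (simp add: diff_divide_distrib)
      have "(LINT x|\<mu>. (transition P t v x - v x) / t - g0 x) = ((LINT x|\<mu>. transition P t v x) - (LINT x|\<mu>. v x)) / t - (LINT x|\<mu>. g0 x)"
        using M.L2_integrable[OF TL] M.L2_integrable[OF vL] M.L2_integrable[OF g0L] by simp
      also have "\<dots> = - (LINT x|\<mu>. g0 x)"
        using transition_invariant[OF unperturbed invariant _ vm B, of t] t by simp
      finally show ?thesis using M.L2_integral_le[OF L] by simp
    qed
    have "((\<lambda>t::real. \<bar>LINT x|\<mu>. g0 x\<bar>) \<longlongrightarrow> 0) (at_right 0)"
      by (rule tendsto_sandwich[OF _ _ tendsto_const lim])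
         (use eventually_at_right_less[of "0::real"] le in \<open>auto elim: eventually_mono\<close>)
    thus ?thesis by (simp add: tendsto_const_iff)
  qed
  have Lb: "L2_norm \<mu> (Lhat w) \<le> \<epsilon> * L2_norm \<mu> w" unfolding eps by (rule M.L2_operator_norm_bound[OF perturbation wL])
  have ge: "AE x in \<mu>. g x = g0 x + Lhat w x" using gg lin by eventually_elim simp
  have "(LINT x|\<mu>. w x * g x) = (LINT x|\<mu>. w x * g0 x + w x * Lhat w x)"
    using ge wL gL g0L LwL by (intro integral_cong_AE) (auto simp: L2_space_def distrib_left elim: eventually_mono)
  also have "\<dots> = (LINT x|\<mu>. w x * g0 x) + (LINT x|\<mu>. w x * Lhat w x)"
    using M.L2_mult_integrable[OF wL g0L] M.L2_mult_integrable[OF wL LwL] by simp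
  also have "\<dots> \<le> - \<gamma> * (L2_norm \<mu> w)\<^sup>2 + \<epsilon> * (L2_norm \<mu> w)\<^sup>2"
  proof (rule add_mono)
    show "(LINT x|\<mu>. w x * g0 x) \<le> - \<gamma> * (L2_norm \<mu> w)\<^sup>2" using poincare[OF genw w0] by simp
    have "(LINT x|\<mu>. w x * Lhat w x) \<le> L2_norm \<mu> w * L2_norm \<mu> (Lhat w)"
      using M.L2_cauchy_schwarz[OF wL LwL] by simp
    also have "\<dots> \<le> L2_norm \<mu> w * (\<epsilon> * L2_norm \<mu> w)" by (intro mult_left_mono Lb M.L2_norm_nonneg)
    finally show "(LINT x|\<mu>. w x * Lhat w x) \<le> \<epsilon> * (L2_norm \<mu> w)\<^sup>2" by (simp add: power2_eq_square mult_ac)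
  qed
  finally show "(LINT x|\<mu>. (v x - m) * g x) \<le> - (\<gamma> - \<epsilon>) * (L2_norm \<mu> (\<lambda>x. v x - m))\<^sup>2"
    by (simp add: w_def[abs_def] algebra_simps)
  have "(LINT x|\<mu>. g x) = (LINT x|\<mu>. g0 x + Lhat w x)"
    using ge gL g0L LwL by (intro integral_cong_AE) (auto simp: L2_space_def)
  also have "\<dots> = (LINT x|\<mu>. Lhat w x)" using g00 M.L2_integrable[OF g0L] M.L2_integrable[OF LwL] by simp
  finally show "\<bar>LINT x|\<mu>. g x\<bar> \<le> \<epsilon> * L2_norm \<mu> (\<lambda>x. v x - m)"
    using M.L2_integral_le[OF LwL] Lb by (simp add: w_def[abs_def])
qed

definition variance_of :: "('a \<Rightarrow> real) \<Rightarrow> real" where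
  "variance_of h = (LINT x|\<mu>. (h x)\<^sup>2) - (LINT x|\<mu>. h x)\<^sup>2"

lemma variance_of_eq:
  assumes "h \<in> L2_space \<mu>"
  shows "variance_of h = (L2_norm \<mu> (\<lambda>x. h x - (LINT x|\<mu>. h x)))\<^sup>2"
proof -
  let ?m = "LINT x|\<mu>. h x"
  have "(L2_norm \<mu> (\<lambda>x. h x - ?m))\<^sup>2 = (LINT x|\<mu>. (h x)\<^sup>2 - 2 * ?m * h x + ?m\<^sup>2)"
    unfolding M.L2_norm_sq by (intro Bochner_Integration.integral_cong) (auto simp: power2_eq_square algebra_simps)
  also have "\<dots> = (LINT x|\<mu>. (h x)\<^sup>2) - 2 * ?m * ?m + ?m\<^sup>2"
    using assms M.L2_integrable[OF assms] by (simp add: L2_space_def M.prob_space)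
  finally show ?thesis by (simp add: variance_of_def power2_eq_square)
qed

lemma variance_of_nonneg: "h \<in> L2_space \<mu> \<Longrightarrow> 0 \<le> variance_of h" by (simp add: variance_of_eq)

context
  fixes h :: "'a \<Rightarrow> real" and B d :: real
  assumes h: "h \<in> bcontfun" "\<And>x. \<bar>h x\<bar> \<le> B" and d: "0 < d"
begin

abbreviation "u \<equiv> time_average Pe h d"
abbreviation "g \<equiv> average_derivative Pe h d"

lemma u_bcont: "0 \<le> t \<Longrightarrow> u t \<in> bcontfun" by (rule time_average_bcontfun[OF perturbed feller h d])
lemma u_bound: "0 \<le> t \<Longrightarrow> \<bar>u t x\<bar> \<le> B" by (rule time_average_bound[OF perturbed feller h d])
lemma u_meas: "0 \<le> t \<Longrightarrow> u t \<in> borel_measurable \<mu>" by (intro mu_bcontfun u_bcont)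
lemma g_meas: "0 \<le> t \<Longrightarrow> g t \<in> borel_measurable \<mu>"
  by (intro mu_measurable average_derivative_measurable[OF perturbed feller h d])
lemma g_bound: "0 \<le> t \<Longrightarrow> \<bar>g t x\<bar> \<le> 2 * B / d" by (rule average_derivative_bound[OF perturbed feller h d])
lemma B0: "0 \<le> B" using h(2)[of undefined] by linarith

lemma quotient_bound:
  assumes t: "0 \<le> t" and s: "0 < s"
  shows "\<bar>(u (t + s) x - u t x) / s\<bar> \<le> 2 * B / d"
proof -
  have "\<bar>u (t + s) x - u t x\<bar> \<le> 2 * B / d * s"
    using time_average_lipschitz[OF perturbed feller h d t, of s x] s by simp
  thus ?thesis using s by (simp add: abs_divide divide_le_eq)
qed

text \<open>
  On bounded continuous functions the semigroup \<open>Se\<close> is given by the transition operators, and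
  the difference quotients of \<open>u\<close> converge pointwise and boundedly.
\<close>
lemma u_generator: assumes t: "0 \<le> t" shows "L2_generator \<mu> Se (u t) (g t)"
  unfolding L2_generator_def
proof (intro conjI)
  show "u t \<in> L2_space \<mu>" by (intro L2_bcontfun u_bcont t)
  show "g t \<in> L2_space \<mu>" by (rule M.L2_bounded[OF g_meas[OF t] g_bound[OF t]])
  have "((\<lambda>s. LINT x|\<mu>. ((u (t + s) x - u t x) / s - g t x)\<^sup>2) \<longlongrightarrow> (LINT x|\<mu>. 0)) (at_right 0)"
  proof (rule M.integral_tendsto_bounded_at_right)
    show "(\<lambda>x. ((u (t + s) x - u t x) / s - g t x)\<^sup>2) \<in> borel_measurable \<mu>" if "0 < s" for s
      using u_meas[OF t] u_meas[of "t+s"] g_meas[OF t] t that by simp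
    show "((\<lambda>s. ((u (t + s) x - u t x) / s - g t x)\<^sup>2) \<longlongrightarrow> 0) (at_right 0)" for x
    proof -
      have "((\<lambda>s. ((u (t + s) x - u t x) / s - g t x)\<^sup>2) \<longlongrightarrow> (g t x - g t x)\<^sup>2) (at_right 0)"
        by (intro tendsto_intros time_average_derivative[OF perturbed feller h d t])
      thus ?thesis by simp
    qed
    show "\<bar>((u (t + s) x - u t x) / s - g t x)\<^sup>2\<bar> \<le> (4 * B / d)\<^sup>2" if "0 < s" for s x
    proof -
      have "\<bar>(u (t + s) x - u t x) / s - g t x\<bar> \<le> 4 * B / d"
        using quotient_bound[OF t that, of x] g_bound[OF t, of x] by linarith
      thus ?thesis using power_mono[of "\<bar>(u (t + s) x - u t x) / s - g t x\<bar>" "4 * B / d" 2] by simp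
    qed
  qed simp
  hence "((\<lambda>s. sqrt (LINT x|\<mu>. ((u (t + s) x - u t x) / s - g t x)\<^sup>2)) \<longlongrightarrow> sqrt 0) (at_right 0)"
    by (intro tendsto_real_sqrt) simp
  hence "((\<lambda>s. sqrt (LINT x|\<mu>. ((u (t + s) x - u t x) / s - g t x)\<^sup>2)) \<longlongrightarrow> 0) (at_right 0)" by simp
  thus "((\<lambda>s. L2_norm \<mu> (\<lambda>x. (Se s (u t) x - u t x) / s - g t x)) \<longlongrightarrow> 0) (at_right 0)"
  proof (rule Lim_transform_eventually)
    show "\<forall>\<^sub>F s in at_right 0. sqrt (LINT x|\<mu>. ((u (t + s) x - u t x) / s - g t x)\<^sup>2) = L2_norm \<mu> (\<lambda>x. (Se s (u t) x - u t x) / s - g t x)"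
      using eventually_at_right_less[of "0::real"]
    proof eventually_elim
      case (elim s)
      have "Se s (u t) \<in> L2_space \<mu>"
        using perturbed_semigroup elim L2_bcontfun[OF u_bcont[OF t]] by (simp add: L2_semigroup_def L2_bounded_operator_def)
      hence Sm: "Se s (u t) \<in> borel_measurable \<mu>" by (simp add: L2_space_def)
      have "AE x in \<mu>. Se s (u t) x = transition Pe s (u t) x" using elim by (intro represents u_bcont t) simp
      hence ae: "AE x in \<mu>. ((u (t + s) x - u t x) / s - g t x)\<^sup>2 = ((Se s (u t) x - u t x) / s - g t x)\<^sup>2"
      proof eventually_elim
        case (elim x)
        thus ?case using transition_time_average[OF perturbed feller h d _ t, of s x] \<open>0 < s\<close> by (simp add: add.commute)
      qed
      have "(LINT x|\<mu>. ((u (t + s) x - u t x) / s - g t x)\<^sup>2) = (LINT x|\<mu>. ((Se s (u t) x - u t x) / s - g t x)\<^sup>2)"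
        using ae u_meas[OF t] u_meas[of "t+s"] g_meas[OF t] t \<open>0 < s\<close> Sm by (intro integral_cong_AE) auto
      thus ?case by (simp add: L2_norm_def)
    qed
  qed
qed

lemma u_int_deriv: assumes t: "0 \<le> t" shows "((\<lambda>t. LINT x|\<mu>. u t x) has_real_derivative (LINT x|\<mu>. g t x)) (at_right t)"
  unfolding right_derivative_transfer[symmetric]
proof (rule Lim_transform_eventually)
  show "((\<lambda>s. LINT x|\<mu>. (u (t + s) x - u t x) / s) \<longlongrightarrow> (LINT x|\<mu>. g t x)) (at_right 0)"
  proof (rule M.integral_tendsto_bounded_at_right)
    show "(\<lambda>x. (u (t + s) x - u t x) / s) \<in> borel_measurable \<mu>" if "0 < s" for s
      using u_meas[OF t] u_meas[of "t+s"] t that by simp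
    show "((\<lambda>s. (u (t + s) x - u t x) / s) \<longlongrightarrow> g t x) (at_right 0)" for x
      by (rule time_average_derivative[OF perturbed feller h d t])
  qed (use quotient_bound[OF t] g_meas[OF t] in auto)
  show "\<forall>\<^sub>F s in at_right 0. (LINT x|\<mu>. (u (t + s) x - u t x) / s) = ((LINT x|\<mu>. u (t + s) x) - (LINT x|\<mu>. u t x)) / s"
    using eventually_at_right_less[of "0::real"]
  proof eventually_elim
    case (elim s)
    have "integrable \<mu> (u t)" "integrable \<mu> (u (t + s))"
      using t elim by (auto intro!: M.L2_integrable L2_bcontfun u_bcont)
    thus ?case by simp
  qed
qed

lemma u_sq_deriv: assumes t: "0 \<le> t" shows "((\<lambda>t. LINT x|\<mu>. (u t x)\<^sup>2) has_real_derivative (LINT x|\<mu>. 2 * u t x * g t x)) (at_right t)"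
  unfolding right_derivative_transfer[symmetric]
proof (rule Lim_transform_eventually)
  show "((\<lambda>s. LINT x|\<mu>. (u (t + s) x + u t x) * ((u (t + s) x - u t x) / s)) \<longlongrightarrow> (LINT x|\<mu>. 2 * u t x * g t x)) (at_right 0)"
  proof (rule M.integral_tendsto_bounded_at_right)
    show "(\<lambda>x. (u (t + s) x + u t x) * ((u (t + s) x - u t x) / s)) \<in> borel_measurable \<mu>" if "0 < s" for s
      using u_meas[OF t] u_meas[of "t+s"] t that by simp
    show "((\<lambda>s. (u (t + s) x + u t x) * ((u (t + s) x - u t x) / s)) \<longlongrightarrow> 2 * u t x * g t x) (at_right 0)" for x
    proof -
      have q: "((\<lambda>s. (u (t + s) x - u t x) / s) \<longlongrightarrow> g t x) (at_right 0)"
        by (rule time_average_derivative[OF perturbed feller h d t])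
      have "((\<lambda>s. (u (t + s) x - u t x) / s * s + u t x) \<longlongrightarrow> g t x * 0 + u t x) (at_right 0)"
        by (intro tendsto_intros q)
      hence "((\<lambda>s. u (t + s) x) \<longlongrightarrow> u t x) (at_right 0)"
      proof (subst (asm) mult_zero_right, subst (asm) add_0_left, elim Lim_transform_eventually)
        show "\<forall>\<^sub>F s in at_right 0. (u (t + s) x - u t x) / s * s + u t x = u (t + s) x"
          using eventually_at_right_less[of "0::real"] by eventually_elim simp
      qed
      hence "((\<lambda>s. (u (t + s) x + u t x) * ((u (t + s) x - u t x) / s)) \<longlongrightarrow> (u t x + u t x) * g t x) (at_right 0)"
        by (intro tendsto_intros q)
      thus ?thesis by (simp only: mult_2)
    qed
    show "\<bar>(u (t + s) x + u t x) * ((u (t + s) x - u t x) / s)\<bar> \<le> (B + B) * (2 * B / d)" if "0 < s" for s x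
      unfolding abs_mult using u_bound[OF t, of x] u_bound[of "t+s" x] t that quotient_bound[OF t that, of x] B0
      by (intro mult_mono order_trans[OF abs_triangle_ineq add_mono]) auto
  qed (use u_meas[OF t] g_meas[OF t] in auto)
  show "\<forall>\<^sub>F s in at_right 0. (LINT x|\<mu>. (u (t + s) x + u t x) * ((u (t + s) x - u t x) / s)) = ((LINT x|\<mu>. (u (t + s) x)\<^sup>2) - (LINT x|\<mu>. (u t x)\<^sup>2)) / s"
    using eventually_at_right_less[of "0::real"]
  proof eventually_elim
    case (elim s)
    have i: "integrable \<mu> (\<lambda>x. (u t x)\<^sup>2)" "integrable \<mu> (\<lambda>x. (u (t + s) x)\<^sup>2)"
      using t elim L2_bcontfun[OF u_bcont[of t]] L2_bcontfun[OF u_bcont[of "t+s"]] by (auto simp: L2_space_def)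
    have "(LINT x|\<mu>. (u (t + s) x + u t x) * ((u (t + s) x - u t x) / s)) = (LINT x|\<mu>. ((u (t + s) x)\<^sup>2 - (u t x)\<^sup>2) / s)"
      by (intro Bochner_Integration.integral_cong refl) (simp add: power2_eq_square algebra_simps)
    thus ?case using i by simp
  qed
qed

lemma u_continuous: "continuous_on {0..} (\<lambda>t. u t x)"
proof -
  have "(2 * B / d)-lipschitz_on {0..} (\<lambda>t. u t x)"
  proof (rule lipschitz_onI)
    show "0 \<le> 2 * B / d" using B0 d by simp
    have *: "dist (u s x) (u t x) \<le> 2 * B / d * dist s t" if "0 \<le> s" "s \<le> t" for s t
      using time_average_lipschitz[OF perturbed feller h d that(1), of "t - s" x] that
      by (simp add: dist_real_def abs_minus_commute)
    fix s t :: real assume "s \<in> {0..}" "t \<in> {0..}"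
    thus "dist (u s x) (u t x) \<le> 2 * B / d * dist s t"
      using *[of s t] *[of t s] by (cases "s \<le> t") (auto simp: dist_commute)
  qed
  thus ?thesis by (rule lipschitz_on_continuous_on)
qed

lemma u_int_continuous: "continuous_on {0..} (\<lambda>t. LINT x|\<mu>. u t x)" "continuous_on {0..} (\<lambda>t. LINT x|\<mu>. (u t x)\<^sup>2)"
proof -
  show "continuous_on {0..} (\<lambda>t. LINT x|\<mu>. u t x)"
  proof (rule continuous_on_sequentiallyI)
    fix s :: "nat \<Rightarrow> real" and a assume s: "\<forall>n. s n \<in> {0..}" "a \<in> {0..}" "s \<longlonglongrightarrow> a"
    show "(\<lambda>n. LINT x|\<mu>. u (s n) x) \<longlonglongrightarrow> (LINT x|\<mu>. u a x)"
    proof (rule M.integral_tendsto_bounded[where B=B])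
      show "(\<lambda>n. u (s n) x) \<longlonglongrightarrow> u a x" for x using continuous_on_tendsto_compose[OF u_continuous s(3) s(2)] s(1) by simp
    qed (use s u_meas u_bound in auto)
  qed
  show "continuous_on {0..} (\<lambda>t. LINT x|\<mu>. (u t x)\<^sup>2)"
  proof (rule continuous_on_sequentiallyI)
    fix s :: "nat \<Rightarrow> real" and a assume s: "\<forall>n. s n \<in> {0..}" "a \<in> {0..}" "s \<longlonglongrightarrow> a"
    show "(\<lambda>n. LINT x|\<mu>. (u (s n) x)\<^sup>2) \<longlonglongrightarrow> (LINT x|\<mu>. (u a x)\<^sup>2)"
    proof (rule M.integral_tendsto_bounded[where B="B\<^sup>2"])
      show "(\<lambda>n. (u (s n) x)\<^sup>2) \<longlonglongrightarrow> (u a x)\<^sup>2" for x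
        using continuous_on_tendsto_compose[OF u_continuous s(3) s(2)] s(1) by (intro tendsto_power) simp
      show "\<bar>(u (s n) x)\<^sup>2\<bar> \<le> B\<^sup>2" for n x using power_mono[OF u_bound[of "s n" x], of 2] s(1) by simp
    qed (use s u_meas in auto)
  qed
qed

text \<open>
  By dissipation, \<open>exp (2 * (\<gamma> - \<epsilon>) * t)\<close> times the variance has a nonpositive
  right derivative.
\<close>
lemma u_variance_decay:
  assumes t: "0 \<le> t" shows "variance_of (u t) \<le> exp (- (2 * (\<gamma> - \<epsilon>)) * t) * variance_of (u 0)"
proof -
  define c where "c = 2 * (\<gamma> - \<epsilon>)"
  define \<phi> where "\<phi> t = exp (c * t) * variance_of (u t)" for t
  define D where "D t = (LINT x|\<mu>. 2 * u t x * g t x) - 2 * (LINT x|\<mu>. u t x) * (LINT x|\<mu>. g t x)" for t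
  have der: "(\<phi> has_real_derivative exp (c * t) * (c * variance_of (u t) + D t)) (at_right t)" if "0 \<le> t" for t
    unfolding \<phi>_def variance_of_def D_def
    by (rule derivative_eq_intros u_sq_deriv[OF that] u_int_deriv[OF that] refl)+ (simp add: algebra_simps power2_eq_square)
  have neg: "c * variance_of (u t) + D t \<le> 0" if t: "0 \<le> t" for t
  proof -
    let ?m = "LINT x|\<mu>. u t x"
    have L: "u t \<in> L2_space \<mu>" "g t \<in> L2_space \<mu>"
      by (rule L2_bcontfun[OF u_bcont[OF t]], rule M.L2_bounded[OF g_meas[OF t] g_bound[OF t]])
    have "D t = 2 * (LINT x|\<mu>. (u t x - ?m) * g t x)"
      unfolding D_def using M.L2_mult_integrable[OF L] M.L2_integrable[OF L(2)] by (simp add: left_diff_distrib mult.assoc)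
    also have "\<dots> \<le> 2 * (- (\<gamma> - \<epsilon>) * (L2_norm \<mu> (\<lambda>x. u t x - ?m))\<^sup>2)"
      using generator_dissipation(1)[OF u_bcont[OF t] u_generator[OF t]] by simp
    also have "\<dots> = - c * variance_of (u t)" unfolding variance_of_eq[OF L(1)] c_def by simp
    finally show ?thesis by simp
  qed
  have "\<phi> t \<le> \<phi> 0"
  proof (rule right_deriv_antimono[OF _ der])
    show "continuous_on {0..} \<phi>" unfolding \<phi>_def variance_of_def by (intro continuous_intros u_int_continuous)
    show "exp (c * t) * (c * variance_of (u t) + D t) \<le> 0" if "0 \<le> t" for t
      using neg[OF that] by (simp add: mult_le_0_iff)
  qed (use t in auto)
  hence "exp (c * t) * variance_of (u t) \<le> variance_of (u 0)" by (simp add: \<phi>_def)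
  hence "variance_of (u t) \<le> variance_of (u 0) / exp (c * t)" by (simp add: field_simps)
  moreover have "exp (- (2 * (\<gamma> - \<epsilon>)) * t) = inverse (exp (c * t))" unfolding exp_minus[symmetric] c_def by (simp add: algebra_simps)
  ultimately show ?thesis by (simp only: divide_inverse mult.commute)
qed

text \<open>
  The mean changes at a rate of at most \<open>\<epsilon>\<close> times the standard deviation. Adding the
  integral of this bound makes both the mean and its negative decreasing.
\<close>
lemma u_mean_drift:
  assumes s: "0 \<le> s" "s \<le> t"
  shows "\<bar>(LINT x|\<mu>. u t x) - (LINT x|\<mu>. u s x)\<bar> \<le> \<epsilon> / (\<gamma> - \<epsilon>) * sqrt (variance_of (u 0)) * exp (- (\<gamma> - \<epsilon>) * s)"
proof -
  define c where "c = \<gamma> - \<epsilon>"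
  have c: "0 < c" using small by (simp add: c_def)
  define R where "R = \<epsilon> / c * sqrt (variance_of (u 0))"
  have V: "0 \<le> variance_of (u t)" if "0 \<le> t" for t using that by (intro variance_of_nonneg L2_bcontfun u_bcont)
  have gb: "\<bar>LINT x|\<mu>. g t x\<bar> \<le> R * c * exp (- c * t)" if t: "0 \<le> t" for t
  proof -
    have L: "u t \<in> L2_space \<mu>" using t by (auto intro!: L2_bcontfun u_bcont)
    have "L2_norm \<mu> (\<lambda>x. u t x - (LINT x|\<mu>. u t x)) = sqrt (variance_of (u t))"
      unfolding variance_of_eq[OF L] using M.L2_norm_nonneg by simp
    also have "\<dots> \<le> sqrt (exp (- (2 * c) * t) * variance_of (u 0))"
      using u_variance_decay[OF t] by (simp add: c_def)
    also have "exp (- (2 * c) * t) = (exp (- c * t))\<^sup>2" by (simp add: power2_eq_square exp_add[symmetric])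
    finally have *: "L2_norm \<mu> (\<lambda>x. u t x - (LINT x|\<mu>. u t x)) \<le> exp (- c * t) * sqrt (variance_of (u 0))"
      by (simp add: real_sqrt_mult)
    have "\<bar>LINT x|\<mu>. g t x\<bar> \<le> \<epsilon> * L2_norm \<mu> (\<lambda>x. u t x - (LINT x|\<mu>. u t x))"
      by (rule generator_dissipation(2)[OF u_bcont[OF t] u_generator[OF t]])
    also have "\<dots> \<le> \<epsilon> * (exp (- c * t) * sqrt (variance_of (u 0)))" using small by (intro mult_left_mono *) auto
    also have "\<dots> = R * c * exp (- c * t)" using c by (simp add: R_def)
    finally show ?thesis .
  qed
  have R: "0 \<le> R" unfolding R_def using small c V[of 0] by simp
  have up: "(LINT x|\<mu>. u t x) + R * exp (- c * t) \<le> (LINT x|\<mu>. u s x) + R * exp (- c * s)"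
  proof (rule right_deriv_antimono[where \<phi>="\<lambda>t. (LINT x|\<mu>. u t x) + R * exp (- c * t)" and \<phi>'="\<lambda>t. (LINT x|\<mu>. g t x) - R * c * exp (- c * t)"])
    show "((\<lambda>t. (LINT x|\<mu>. u t x) + R * exp (- c * t)) has_real_derivative (LINT x|\<mu>. g t x) - R * c * exp (- c * t)) (at_right t)" if "0 \<le> t" for t
      by (rule derivative_eq_intros u_int_deriv[OF that] refl)+ simp
    show "(LINT x|\<mu>. g t x) - R * c * exp (- c * t) \<le> 0" if "0 \<le> t" for t using gb[OF that] by linarith
  qed (use s in \<open>auto intro!: continuous_intros u_int_continuous\<close>)
  have down: "- (LINT x|\<mu>. u t x) + R * exp (- c * t) \<le> - (LINT x|\<mu>. u s x) + R * exp (- c * s)"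
  proof (rule right_deriv_antimono[where \<phi>="\<lambda>t. - (LINT x|\<mu>. u t x) + R * exp (- c * t)" and \<phi>'="\<lambda>t. - (LINT x|\<mu>. g t x) - R * c * exp (- c * t)"])
    show "((\<lambda>t. - (LINT x|\<mu>. u t x) + R * exp (- c * t)) has_real_derivative - (LINT x|\<mu>. g t x) - R * c * exp (- c * t)) (at_right t)" if "0 \<le> t" for t
      by (rule derivative_eq_intros u_int_deriv[OF that] refl)+ simp
    show "- (LINT x|\<mu>. g t x) - R * c * exp (- c * t) \<le> 0" if "0 \<le> t" for t using gb[OF that] by linarith
  qed (use s in \<open>auto intro!: continuous_intros u_int_continuous\<close>)
  have "0 \<le> R * exp (- c * t)" using R by simp
  hence "\<bar>(LINT x|\<mu>. u t x) - (LINT x|\<mu>. u s x)\<bar> \<le> R * exp (- c * s)" using up down by linarith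
  thus ?thesis by (simp add: R_def c_def)
qed

end

lemma moments_tendsto:
  assumes h: "h \<in> bcontfun" and t: "0 \<le> t"
  shows "((\<lambda>d. LINT x|\<mu>. time_average Pe h d t x) \<longlongrightarrow> (LINT x|\<mu>. transition Pe t h x)) (at_right 0)"
    and "((\<lambda>d. variance_of (time_average Pe h d t)) \<longlongrightarrow> variance_of (transition Pe t h)) (at_right 0)"
proof -
  obtain B where B: "\<And>x. \<bar>h x\<bar> \<le> B" using bcontfunD(2)[OF h] by blast
  have Tm: "transition Pe t h \<in> borel_measurable \<mu>" using feller h t by (intro mu_bcontfun) (simp add: feller_def)
  show 1: "((\<lambda>d. LINT x|\<mu>. time_average Pe h d t x) \<longlongrightarrow> (LINT x|\<mu>. transition Pe t h x)) (at_right 0)"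
    by (rule M.integral_tendsto_bounded_at_right[where B=B])
       (use u_meas[OF h B _ t] u_bound[OF h B _ t] Tm time_average_tendsto[OF perturbed h t] in auto)
  have 2: "((\<lambda>d. LINT x|\<mu>. (time_average Pe h d t x)\<^sup>2) \<longlongrightarrow> (LINT x|\<mu>. (transition Pe t h x)\<^sup>2)) (at_right 0)"
  proof (rule M.integral_tendsto_bounded_at_right[where B="B\<^sup>2"])
    show "\<bar>(time_average Pe h d t x)\<^sup>2\<bar> \<le> B\<^sup>2" if "0 < d" for d x
      using power_mono[OF u_bound[OF h B that t, of x], of 2] by simp
  qed (use u_meas[OF h B _ t] Tm time_average_tendsto[OF perturbed h t] in \<open>auto intro!: tendsto_power\<close>)
  show "((\<lambda>d. variance_of (time_average Pe h d t)) \<longlongrightarrow> variance_of (transition Pe t h)) (at_right 0)"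
    unfolding variance_of_def by (intro tendsto_diff tendsto_power 1 2)
qed

lemma transition_0_fun: "h \<in> bcontfun \<Longrightarrow> transition Pe 0 h = h"
  by (rule ext) (rule transition_0[OF perturbed bcontfun_measurable])

lemma variance_decay:
  assumes h: "h \<in> bcontfun" and t: "0 \<le> t"
  shows "variance_of (transition Pe t h) \<le> exp (- (2 * (\<gamma> - \<epsilon>)) * t) * variance_of h"
proof (rule tendsto_le)
  obtain B where B: "\<And>x. \<bar>h x\<bar> \<le> B" using bcontfunD(2)[OF h] by blast
  show "((\<lambda>d. variance_of (time_average Pe h d t)) \<longlongrightarrow> variance_of (transition Pe t h)) (at_right 0)" by (rule moments_tendsto(2)[OF h t])
  show "((\<lambda>d. exp (- (2 * (\<gamma> - \<epsilon>)) * t) * variance_of (time_average Pe h d 0)) \<longlongrightarrow> exp (- (2 * (\<gamma> - \<epsilon>)) * t) * variance_of h) (at_right 0)"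
    using moments_tendsto(2)[OF h, of 0] transition_0_fun[OF h] by (intro tendsto_mult_left) simp
  show "\<forall>\<^sub>F d in at_right 0. variance_of (time_average Pe h d t) \<le> exp (- (2 * (\<gamma> - \<epsilon>)) * t) * variance_of (time_average Pe h d 0)"
    using eventually_at_right_less[of "0::real"] by eventually_elim (rule u_variance_decay[OF h B _ t])
qed simp

lemma mean_drift:
  assumes h: "h \<in> bcontfun" and s: "0 \<le> s" "s \<le> t"
  shows "\<bar>(LINT x|\<mu>. transition Pe t h x) - (LINT x|\<mu>. transition Pe s h x)\<bar> \<le> \<epsilon> / (\<gamma> - \<epsilon>) * sqrt (variance_of h) * exp (- (\<gamma> - \<epsilon>) * s)"
proof (rule tendsto_le)
  obtain B where B: "\<And>x. \<bar>h x\<bar> \<le> B" using bcontfunD(2)[OF h] by blast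
  show "((\<lambda>d. \<bar>(LINT x|\<mu>. time_average Pe h d t x) - (LINT x|\<mu>. time_average Pe h d s x)\<bar>) \<longlongrightarrow> \<bar>(LINT x|\<mu>. transition Pe t h x) - (LINT x|\<mu>. transition Pe s h x)\<bar>) (at_right 0)"
    using s by (intro tendsto_intros moments_tendsto(1)[OF h]) auto
  show "((\<lambda>d. \<epsilon> / (\<gamma> - \<epsilon>) * sqrt (variance_of (time_average Pe h d 0)) * exp (- (\<gamma> - \<epsilon>) * s)) \<longlongrightarrow> \<epsilon> / (\<gamma> - \<epsilon>) * sqrt (variance_of h) * exp (- (\<gamma> - \<epsilon>) * s)) (at_right 0)"
    using moments_tendsto(2)[OF h, of 0] transition_0_fun[OF h] by (intro tendsto_mult_left tendsto_mult_right tendsto_real_sqrt) simp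
  show "\<forall>\<^sub>F d in at_right 0. \<bar>(LINT x|\<mu>. time_average Pe h d t x) - (LINT x|\<mu>. time_average Pe h d s x)\<bar> \<le> \<epsilon> / (\<gamma> - \<epsilon>) * sqrt (variance_of (time_average Pe h d 0)) * exp (- (\<gamma> - \<epsilon>) * s)"
    using eventually_at_right_less[of "0::real"] by eventually_elim (rule u_mean_drift[OF h B _ s])
qed simp

end

lemma open_indicator_limit:
  fixes U :: "'a::metric_space set"
  assumes U: "open U"
  obtains h :: "nat \<Rightarrow> 'a \<Rightarrow> real"
  where "\<And>n. continuous_on UNIV (h n)" "\<And>n x. \<bar>h n x\<bar> \<le> 1" "\<And>x. (\<lambda>n. h n x) \<longlonglongrightarrow> indicator U x"
\<comment> \<open>the distance to the empty set is 0, so this case is separate\<close>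
proof (cases "U = UNIV")
  case True
  show ?thesis by (rule that[of "\<lambda>_ _. 1"]) (auto simp: True)
next
  case False
  define h where "h n x = min 1 (real n * infdist x (- U))" for n x
  show ?thesis
  proof
    show "continuous_on UNIV (h n)" for n unfolding h_def by (intro continuous_intros)
    show "\<bar>h n x\<bar> \<le> 1" for n x unfolding h_def using infdist_nonneg[of x "- U"] by (simp add: min_def)
    show "(\<lambda>n. h n x) \<longlonglongrightarrow> indicator U x" for x
    proof (cases "x \<in> U")
      case True
      have "infdist x (- U) \<noteq> 0" using in_closed_iff_infdist_zero[of "- U" x] U False True by (auto simp: closed_Compl)
      hence p: "0 < infdist x (- U)" using infdist_nonneg[of x "- U"] by linarith
      obtain n0 :: nat where n0: "1 / infdist x (- U) < real n0" using reals_Archimedean2 by blast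
      have "h n x = 1" if "n0 \<le> n" for n
      proof -
        have "1 / infdist x (- U) \<le> real n" using n0 that by linarith
        hence "1 \<le> real n * infdist x (- U)" using p by (simp add: field_simps)
        thus ?thesis by (simp add: h_def)
      qed
      hence "\<forall>\<^sub>F n in sequentially. h n x = 1" unfolding eventually_sequentially by blast
      thus ?thesis using True by (simp add: tendsto_eventually)
    next
      case False
      hence "infdist x (- U) = 0" by simp
      thus ?thesis using False by (simp add: h_def)
    qed
  qed
qed

text \<open>
  Inner regularity of finite Borel measures on a Polish space reduces indicators to those of compact sets, and
  these are decreasing limits of continuous functions. Sums and dominated limits preserve the property.
\<close>
lemma bcontfun_dense_L1:
  fixes \<nu> :: "'a::polish_space measure" and h :: "'a \<Rightarrow> real"
  assumes fin: "finite_measure \<nu>" and sets: "sets \<nu> = sets borel" and h: "integrable \<nu> h" and e: "0 < e"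
  shows "\<exists>q\<in>bcontfun. (LINT x|\<nu>. \<bar>h x - q x\<bar>) < e"
proof -
  interpret finite_measure \<nu> by fact
  have bm: "q \<in> borel_measurable \<nu>" if "q \<in> bcontfun" for q :: "'a \<Rightarrow> real"
    using bcontfun_measurable[OF that] by (simp cong: measurable_cong_sets add: sets)
  have bi: "integrable \<nu> q" if p: "q \<in> bcontfun" for q :: "'a \<Rightarrow> real"
  proof -
    obtain B where "\<And>x. \<bar>q x\<bar> \<le> B" using bcontfunD(2)[OF p] by blast
    thus ?thesis by (intro integrable_const_bound[of _ B] bm p) auto
  qed
  have "\<forall>e>0. \<exists>q\<in>bcontfun. (LINT x|\<nu>. \<bar>h x - q x\<bar>) < e"
    using h
  proof (induction rule: integrable_induct)
    case (base A c)
    show ?case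
    proof (intro allI impI)
      fix e :: real assume e: "0 < e"
      define d where "d = e / (\<bar>c\<bar> + 1)"
      have d: "0 < d" using e by (simp add: d_def)
      have A: "A \<in> sets borel" using base sets by simp
      have fin: "emeasure \<nu> (space \<nu>) \<noteq> \<infinity>" by simp
      have Afin: "emeasure \<nu> A = ennreal (measure \<nu> A)" by (rule emeasure_eq_measure)
      obtain K where K: "K \<subseteq> A" "compact K" "measure \<nu> A < measure \<nu> K + d"
      proof (cases "measure \<nu> A < d")
        case True
        show ?thesis by (rule that[of "{}"]) (use True in auto)
      next
        case False
        have "ennreal (measure \<nu> A - d) < ennreal (measure \<nu> A)" using d False by (intro ennreal_lessI) auto
        also have "\<dots> = (SUP K\<in>{K. K \<subseteq> A \<and> compact K}. emeasure \<nu> K)"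
          using inner_regular[OF sets fin A] by (simp add: Afin)
        finally obtain K where K: "K \<subseteq> A" "compact K" "ennreal (measure \<nu> A - d) < emeasure \<nu> K"
          unfolding less_SUP_iff by auto
        have "0 \<le> measure \<nu> A - d" using False by simp
        hence "measure \<nu> A - d < measure \<nu> K"
          using K(3) by (simp only: emeasure_eq_measure ennreal_less_iff)
        thus ?thesis using that[of K] K by auto
      qed
      have Km: "K \<in> sets \<nu>" using compact_imp_closed[OF K(2)] sets by auto
      obtain h :: "nat \<Rightarrow> 'a \<Rightarrow> real" where h: "\<And>n. continuous_on UNIV (h n)" "\<And>n x. \<bar>h n x\<bar> \<le> 1"
        "\<And>x. (\<lambda>n. h n x) \<longlonglongrightarrow> indicator (- K) x"
        using open_indicator_limit[of "- K"] compact_imp_closed[OF K(2)] by (auto simp: open_Compl)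
      have hb: "\<bar>(1 - h n x) * c\<bar> \<le> 2 * \<bar>c\<bar>" for n x
        unfolding abs_mult using h(2)[of n x] by (intro mult_right_mono) auto
      have cb: "(\<lambda>x. (1 - h n x) * c) \<in> bcontfun" for n by (rule bcontfunI[OF _ hb]) (intro continuous_intros h)
      have "(\<lambda>n. LINT x|\<nu>. \<bar>indicator A x *\<^sub>R c - (1 - h n x) * c\<bar>) \<longlonglongrightarrow> (LINT x|\<nu>. \<bar>c\<bar> * indicator (A - K) x)"
      proof (rule integral_dominated_convergence[where w="\<lambda>_. 3 * \<bar>c\<bar>"])
        show "AE x in \<nu>. (\<lambda>n. \<bar>indicator A x *\<^sub>R c - (1 - h n x) * c\<bar>) \<longlonglongrightarrow> \<bar>c\<bar> * indicator (A - K) x"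
        proof (rule AE_I2)
          fix x
          have "(\<lambda>n. \<bar>indicator A x *\<^sub>R c - (1 - h n x) * c\<bar>) \<longlonglongrightarrow> \<bar>indicator A x *\<^sub>R c - (1 - indicator (- K) x) * c\<bar>"
            by (intro tendsto_intros h)
          also have "\<bar>indicator A x *\<^sub>R c - (1 - indicator (- K) x) * c\<bar> = \<bar>c\<bar> * indicator (A - K) x"
            using K(1) by (auto simp: indicator_def)
          finally show "(\<lambda>n. \<bar>indicator A x *\<^sub>R c - (1 - h n x) * c\<bar>) \<longlonglongrightarrow> \<bar>c\<bar> * indicator (A - K) x" .
        qed
        show "AE x in \<nu>. norm \<bar>indicator A x *\<^sub>R c - (1 - h n x) * c\<bar> \<le> 3 * \<bar>c\<bar>" for n
        proof (rule AE_I2)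
          fix x
          have "\<bar>indicator A x *\<^sub>R c\<bar> \<le> \<bar>c\<bar>" by (simp add: indicator_def)
          thus "norm \<bar>indicator A x *\<^sub>R c - (1 - h n x) * c\<bar> \<le> 3 * \<bar>c\<bar>" using hb[of n x] unfolding real_norm_def by linarith
        qed
        show "(\<lambda>x. \<bar>indicator A x *\<^sub>R c - (1 - h n x) * c\<bar>) \<in> borel_measurable \<nu>" for n
          using base(1) bm[OF cb[of n]] by measurable
        show "(\<lambda>x. \<bar>c\<bar> * indicator (A - K) x) \<in> borel_measurable \<nu>" using base(1) Km by measurable
      qed simp
      moreover have "(LINT x|\<nu>. \<bar>c\<bar> * indicator (A - K) x) < e"
      proof -
        have "(LINT x|\<nu>. \<bar>c\<bar> * indicator (A - K) x) = \<bar>c\<bar> * (measure \<nu> A - measure \<nu> K)"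
          using base(1) Km K(1) by (simp add: finite_measure_Diff)
        also have "\<dots> \<le> \<bar>c\<bar> * d" using K(3) by (intro mult_left_mono) auto
        also have "\<dots> < (\<bar>c\<bar> + 1) * d" using d by (intro mult_strict_right_mono) auto
        also have "\<dots> = e"
        proof -
          have "\<bar>c\<bar> + 1 \<noteq> 0" by linarith
          thus ?thesis by (simp add: d_def)
        qed
        finally show ?thesis .
      qed
      ultimately obtain n where "(LINT x|\<nu>. \<bar>indicator A x *\<^sub>R c - (1 - h n x) * c\<bar>) < e"
        using order_tendstoD(2) eventually_happens' sequentially_bot by blast
      thus "\<exists>q\<in>bcontfun. (LINT x|\<nu>. \<bar>indicator A x *\<^sub>R c - q x\<bar>) < e" by (intro bexI[OF _ cb[of n]])
    qed
  next
    case (add f g)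
    show ?case
    proof (intro allI impI)
      fix e :: real assume e: "0 < e"
      obtain q \<phi> where p: "q \<in> bcontfun" "(LINT x|\<nu>. \<bar>f x - q x\<bar>) < e / 2" "\<phi> \<in> bcontfun" "(LINT x|\<nu>. \<bar>g x - \<phi> x\<bar>) < e / 2"
        using add.IH e by (metis half_gt_zero)
      have "(\<lambda>x. q x + \<phi> x) \<in> bcontfun" using p by (intro plus_cont)
      moreover have "(LINT x|\<nu>. \<bar>f x + g x - (q x + \<phi> x)\<bar>) \<le> (LINT x|\<nu>. \<bar>f x - q x\<bar> + \<bar>g x - \<phi> x\<bar>)"
        using add.hyps bi[OF p(1)] bi[OF p(3)] by (intro integral_mono) auto
      moreover have "\<dots> = (LINT x|\<nu>. \<bar>f x - q x\<bar>) + (LINT x|\<nu>. \<bar>g x - \<phi> x\<bar>)"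
        using add.hyps bi[OF p(1)] bi[OF p(3)] by simp
      ultimately show "\<exists>q\<in>bcontfun. (LINT x|\<nu>. \<bar>f x + g x - q x\<bar>) < e" using p by (intro bexI[of _ "\<lambda>x. q x + \<phi> x"]) auto
    qed
  next
    case (lim f s)
    show ?case
    proof (intro allI impI)
      fix e :: real assume e: "0 < e"
      have "(\<lambda>i. LINT x|\<nu>. \<bar>f x - s i x\<bar>) \<longlonglongrightarrow> (LINT x|\<nu>. 0)"
      proof (rule integral_dominated_convergence[where w="\<lambda>x. 3 * \<bar>f x\<bar>"])
        show "AE x in \<nu>. (\<lambda>i. \<bar>f x - s i x\<bar>) \<longlonglongrightarrow> 0"
        proof (rule AE_I2)
          fix x assume "x \<in> space \<nu>"
          hence "(\<lambda>i. \<bar>f x - s i x\<bar>) \<longlonglongrightarrow> \<bar>f x - f x\<bar>" using lim by (intro tendsto_intros) auto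
          thus "(\<lambda>i. \<bar>f x - s i x\<bar>) \<longlonglongrightarrow> 0" by simp
        qed
        show "AE x in \<nu>. norm \<bar>f x - s i x\<bar> \<le> 3 * \<bar>f x\<bar>" for i
        proof (rule AE_I2)
          fix x assume "x \<in> space \<nu>"
          hence "norm (s i x) \<le> 2 * norm (f x)" by (rule lim.hyps)
          thus "norm \<bar>f x - s i x\<bar> \<le> 3 * \<bar>f x\<bar>" by simp
        qed
      qed (use lim in auto)
      from order_tendstoD(2)[OF this, of "e/2"] e obtain i where i: "(LINT x|\<nu>. \<bar>f x - s i x\<bar>) < e / 2"
        by (auto simp: eventually_sequentially)
      obtain q where p: "q \<in> bcontfun" "(LINT x|\<nu>. \<bar>s i x - q x\<bar>) < e / 2" using lim.IH e by (metis half_gt_zero)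
      have "(LINT x|\<nu>. \<bar>f x - q x\<bar>) \<le> (LINT x|\<nu>. \<bar>f x - s i x\<bar> + \<bar>s i x - q x\<bar>)"
        using lim bi[OF p(1)] by (intro integral_mono) auto
      also have "\<dots> = (LINT x|\<nu>. \<bar>f x - s i x\<bar>) + (LINT x|\<nu>. \<bar>s i x - q x\<bar>)"
        using lim bi[OF p(1)] by simp
      finally show "\<exists>q\<in>bcontfun. (LINT x|\<nu>. \<bar>f x - q x\<bar>) < e" using p i by (intro bexI[of _ q]) auto
    qed
  qed
  thus ?thesis using e by blast
qed

lemma transition_abs_integral:
  assumes mp: "markov_process P" and inv: "invariant_distribution P \<nu>" and t: "0 \<le> t"
    and k: "k \<in> borel_measurable borel" "\<And>x. \<bar>k x\<bar> \<le> (B::real)"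
  shows "(LINT x|\<nu>. \<bar>transition P t k x\<bar>) \<le> (LINT x|\<nu>. \<bar>k x\<bar>)"
proof -
  interpret N: prob_space \<nu> by (rule inv_prob[OF mp inv])
  have ms: "g \<in> borel_measurable \<nu>" if "g \<in> borel_measurable borel" for g :: "'a \<Rightarrow> real"
    using that by (simp cong: measurable_cong_sets add: inv_sets[OF mp inv])
  have am: "(\<lambda>x. \<bar>k x\<bar>) \<in> borel_measurable borel" using k(1) by simp
  have ab: "\<bar>\<bar>k x\<bar>\<bar> \<le> B" for x using k(2) by simp
  have "(LINT x|\<nu>. \<bar>transition P t k x\<bar>) \<le> (LINT x|\<nu>. transition P t (\<lambda>x. \<bar>k x\<bar>) x)"
  proof (rule integral_mono)
    show "integrable \<nu> (\<lambda>x. \<bar>transition P t k x\<bar>)"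
      by (rule N.integrable_const_bound[of _ B]) (use transition_bound[OF mp k(2)] ms[OF transition_measurable[OF mp t k(1)]] in auto)
    show "integrable \<nu> (transition P t (\<lambda>x. \<bar>k x\<bar>))"
      by (rule N.integrable_const_bound[of _ B]) (use transition_bound[OF mp ab] ms[OF transition_measurable[OF mp t am]] in auto)
    show "\<bar>transition P t k x\<bar> \<le> transition P t (\<lambda>x. \<bar>k x\<bar>) x" for x
      unfolding transition_def by (rule integral_abs_bound)
  qed
  also have "\<dots> = (LINT x|\<nu>. \<bar>k x\<bar>)" by (rule transition_invariant[OF mp inv t am ab])
  finally show ?thesis .
qed

context perturbed_process
begin

context
  fixes \<mu>e :: "'a measure"
  assumes inve: "invariant_distribution Pe \<mu>e" and ac: "absolutely_continuous \<mu> \<mu>e"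
begin

interpretation E: prob_space \<mu>e by (rule inv_prob[OF perturbed inve])

lemma mue_sets: "sets \<mu>e = sets borel" by (rule inv_sets[OF perturbed inve])

lemma mue_measurable: "h \<in> borel_measurable borel \<Longrightarrow> h \<in> borel_measurable \<mu>e" for h :: "_ \<Rightarrow> real"
  by (simp cong: measurable_cong_sets add: mue_sets)

lemma transition_bcont: "0 \<le> t \<Longrightarrow> h \<in> bcontfun \<Longrightarrow> transition Pe t h \<in> bcontfun"
  using feller by (simp add: feller_def)

definition drift_const :: real where "drift_const = \<epsilon> / (\<gamma> - \<epsilon>)"

lemma drift_const_nonneg: "0 \<le> drift_const" using small by (simp add: drift_const_def)

lemma L2_deviation_decay:
  assumes h: "h \<in> bcontfun" and t: "0 \<le> t"
  shows "L2_norm \<mu> (\<lambda>x. transition Pe t h x - (LINT x|\<mu>. transition Pe t h x)) \<le> exp (- (\<gamma> - \<epsilon>) * t) * sqrt (variance_of h)"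
proof -
  have L: "transition Pe t h \<in> L2_space \<mu>" by (intro L2_bcontfun transition_bcont h t)
  have "L2_norm \<mu> (\<lambda>x. transition Pe t h x - (LINT x|\<mu>. transition Pe t h x)) = sqrt (variance_of (transition Pe t h))"
    unfolding variance_of_eq[OF L] using M.L2_norm_nonneg by simp
  also have "\<dots> \<le> sqrt (exp (- (2 * (\<gamma> - \<epsilon>)) * t) * variance_of h)" using variance_decay[OF h t] by simp
  also have "exp (- (2 * (\<gamma> - \<epsilon>)) * t) = (exp (- (\<gamma> - \<epsilon>) * t))\<^sup>2" by (simp add: power2_eq_square exp_add[symmetric] algebra_simps)
  finally show ?thesis by (simp add: real_sqrt_mult)
qed

text \<open>
  Along integer times the centred functions \<open>transition Pe n h - m n\<close> tend to 0 in
  \<open>L\<^sup>1(\<mu>)\<close>, hence \<open>\<mu>\<close>-almost everywhere along a subsequence, hence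
  almost everywhere for the absolutely continuous \<open>\<mu>e\<close>. Integrating against the invariant
  \<open>\<mu>e\<close> shows \<open>m n\<close> to have limit \<open>\<mu>e(h)\<close>, and the drift bound
  gives the rate.
\<close>
lemma invariant_mean_limit:
  assumes h: "h \<in> bcontfun" and s: "0 \<le> s"
  shows "\<bar>(LINT x|\<mu>e. h x) - (LINT x|\<mu>. transition Pe s h x)\<bar> \<le> drift_const * sqrt (variance_of h) * exp (- (\<gamma> - \<epsilon>) * s)"
proof -
  obtain B where B: "\<And>x. \<bar>h x\<bar> \<le> B" using bcontfunD(2)[OF h] by blast
  have Tbd: "\<bar>transition Pe t h x\<bar> \<le> B" for t x by (rule transition_bound[OF perturbed B])
  define m where "m n = (LINT x|\<mu>. transition Pe (real n) h x)" for n
  define D where "D n x = transition Pe (real n) h x - m n" for n x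
  have Tb: "transition Pe (real n) h \<in> bcontfun" for n by (intro transition_bcont h) auto
  have mb: "\<bar>m n\<bar> \<le> B" for n
  proof -
    have "\<bar>m n\<bar> \<le> (LINT x|\<mu>. \<bar>transition Pe (real n) h x\<bar>)" unfolding m_def by (rule integral_abs_bound)
    also have "\<dots> \<le> (LINT x|\<mu>. B)" using Tbd B[of undefined] by (intro integral_mono') auto
    finally show ?thesis by (simp add: M.prob_space)
  qed
  have Db: "\<bar>D n x\<bar> \<le> 2 * B" for n x
    unfolding D_def using mb[of n] Tbd[of "real n" x] by linarith
  have Dm: "D n \<in> borel_measurable \<mu>" for n unfolding D_def using mu_bcontfun[OF Tb] by simp
  have DL: "D n \<in> L2_space \<mu>" for n by (rule M.L2_bounded[OF Dm Db])
  have "\<exists>r::nat\<Rightarrow>nat. strict_mono r \<and> (AE x in \<mu>. (\<lambda>n. D (r n) x) \<longlonglongrightarrow> 0)"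
  proof (rule tendsto_L1_AE_subseq)
    show "integrable \<mu> (D n)" for n by (rule M.L2_integrable[OF DL])
    show "(\<lambda>n. LINT x|\<mu>. norm (D n x)) \<longlonglongrightarrow> 0"
    proof (rule tendsto_sandwich[OF _ _ tendsto_const])
      show "\<forall>\<^sub>F n in sequentially. (LINT x|\<mu>. norm (D n x)) \<le> exp (- (\<gamma> - \<epsilon>) * real n) * sqrt (variance_of h)"
      proof (intro always_eventually allI)
        fix n
        have "(LINT x|\<mu>. norm (D n x)) \<le> L2_norm \<mu> (D n)" using M.L2_abs_integral_le[OF DL] by simp
        also have "\<dots> \<le> exp (- (\<gamma> - \<epsilon>) * real n) * sqrt (variance_of h)"
          unfolding D_def[abs_def] m_def by (rule L2_deviation_decay[OF h]) simp
        finally show "(LINT x|\<mu>. norm (D n x)) \<le> exp (- (\<gamma> - \<epsilon>) * real n) * sqrt (variance_of h)" .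
      qed
      have "(\<lambda>n. exp (- (\<gamma> - \<epsilon>)) ^ n * sqrt (variance_of h)) \<longlonglongrightarrow> 0 * sqrt (variance_of h)"
        using small by (intro tendsto_mult_right LIMSEQ_realpow_zero) auto
      moreover have "exp (- (\<gamma> - \<epsilon>)) ^ n = exp (- (\<gamma> - \<epsilon>) * real n)" for n by (simp add: exp_of_nat_mult[symmetric] mult.commute)
      ultimately show "(\<lambda>n. exp (- (\<gamma> - \<epsilon>) * real n) * sqrt (variance_of h)) \<longlonglongrightarrow> 0" by simp
    qed (auto intro: always_eventually)
  qed
  then obtain r :: "nat \<Rightarrow> nat" where r: "strict_mono r" and ae: "AE x in \<mu>. (\<lambda>n. D (r n) x) \<longlonglongrightarrow> 0" by blast
  have aee: "AE x in \<mu>e. (\<lambda>n. D (r n) x) \<longlonglongrightarrow> 0"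
    by (rule absolutely_continuous_AE[OF _ ac ae]) (simp add: mue_sets mu_sets)
  have "(\<lambda>n. LINT x|\<mu>e. D (r n) x) \<longlonglongrightarrow> (LINT x|\<mu>e. 0)"
    by (rule integral_dominated_convergence[where w="\<lambda>_. 2 * B"])
       (use aee Db mue_measurable[OF bcontfun_measurable[OF Tb]] in \<open>auto simp: D_def\<close>)
  moreover have "(LINT x|\<mu>e. D n x) = (LINT x|\<mu>e. h x) - m n" for n
  proof -
    have "integrable \<mu>e (transition Pe (real n) h)"
      by (rule E.integrable_const_bound[of _ B]) (use Tbd mue_measurable[OF bcontfun_measurable[OF Tb]] in auto)
    thus ?thesis unfolding D_def using transition_invariant[OF perturbed inve _ bcontfun_measurable[OF h] B, of "real n"]
      by (simp add: E.prob_space)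
  qed
  ultimately have "(\<lambda>n. (LINT x|\<mu>e. h x) - m (r n)) \<longlonglongrightarrow> 0" by simp
  from tendsto_diff[OF tendsto_const this, of "LINT x|\<mu>e. h x"]
  have "(\<lambda>n. m (r n)) \<longlonglongrightarrow> (LINT x|\<mu>e. h x)" by simp
  hence "(\<lambda>n. \<bar>m (r n) - (LINT x|\<mu>. transition Pe s h x)\<bar>) \<longlonglongrightarrow> \<bar>(LINT x|\<mu>e. h x) - (LINT x|\<mu>. transition Pe s h x)\<bar>"
    by (intro tendsto_intros)
  thus ?thesis
  proof (rule LIMSEQ_le_const2)
    obtain N :: nat where N: "s \<le> real N" using real_arch_simple by blast
    show "\<exists>N. \<forall>n\<ge>N. \<bar>m (r n) - (LINT x|\<mu>. transition Pe s h x)\<bar> \<le> drift_const * sqrt (variance_of h) * exp (- (\<gamma> - \<epsilon>) * s)"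
    proof (intro exI[of _ N] allI impI)
      fix n assume "N \<le> n"
      hence "s \<le> real (r n)" using N seq_suble[OF r, of n] by linarith
      thus "\<bar>m (r n) - (LINT x|\<mu>. transition Pe s h x)\<bar> \<le> drift_const * sqrt (variance_of h) * exp (- (\<gamma> - \<epsilon>) * s)"
        unfolding m_def drift_const_def by (intro mean_drift[OF h s])
    qed
  qed
qed

lemma sqrt_variance_le: assumes "h \<in> L2_space \<mu>" shows "sqrt (variance_of h) \<le> L2_norm \<mu> h"
  unfolding L2_norm_def variance_of_def by simp

text \<open>
  The density of \<open>\<mu>e\<close> may be unbounded; the bound by the norm of
  \<open>L\<^sup>2(\<mu>)\<close> is the case \<open>s = 0\<close> of \<open>invariant_mean_limit\<close>.
\<close>
lemma mue_le_L2: assumes h: "h \<in> bcontfun" shows "\<bar>LINT x|\<mu>e. h x\<bar> \<le> (1 + drift_const) * L2_norm \<mu> h"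
proof -
  have L: "h \<in> L2_space \<mu>" by (rule L2_bcontfun[OF h])
  have "\<bar>(LINT x|\<mu>e. h x) - (LINT x|\<mu>. h x)\<bar> \<le> drift_const * sqrt (variance_of h)"
    using invariant_mean_limit[OF h, of 0] transition_0_fun[OF h] by simp
  also have "\<dots> \<le> drift_const * L2_norm \<mu> h" by (intro mult_left_mono sqrt_variance_le L drift_const_nonneg)
  finally show ?thesis using M.L2_integral_le[OF L] by (simp add: algebra_simps)
qed

text \<open>
  \<open>mue_le_L2\<close> moves the estimate to \<open>L\<^sup>2(\<mu>)\<close>, where the deviation splits
  into the fluctuation around the mean and the distance of the mean from its limit.
\<close>
lemma decay_bcontfun:
  assumes h: "h \<in> bcontfun" "\<And>x. \<bar>h x\<bar> \<le> 1" and t: "0 \<le> t"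
  shows "(LINT x|\<mu>e. \<bar>transition Pe t h x - (LINT x|\<mu>e. h x)\<bar>) \<le> (1 + drift_const)\<^sup>2 * exp (- (\<gamma> - \<epsilon>) * t)"
proof -
  let ?T = "transition Pe t h" and ?e = "LINT x|\<mu>e. h x" and ?m = "LINT x|\<mu>. transition Pe t h x"
  note R = drift_const_nonneg
  have Tb: "?T \<in> bcontfun" by (rule transition_bcont[OF t h(1)])
  have kb: "(\<lambda>x. ?T x - c) \<in> bcontfun" for c
  proof (rule bcontfunI)
    show "continuous_on UNIV (\<lambda>x. ?T x - c)" by (intro continuous_intros bcontfunD(1) Tb)
    have "\<bar>?T x\<bar> \<le> 1" for x by (rule transition_bound[OF perturbed h(2)])
    thus "\<bar>?T x - c\<bar> \<le> 1 + \<bar>c\<bar>" for x by (rule order_trans[OF abs_triangle_ineq4 add_right_mono])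
  qed
  have akb: "(\<lambda>x. \<bar>?T x - ?e\<bar>) \<in> bcontfun"
  proof -
    obtain B where "\<And>x. \<bar>?T x - ?e\<bar> \<le> B" using bcontfunD(2)[OF kb[of ?e]] by blast
    thus ?thesis by (intro bcontfunI[of _ B] continuous_on_rabs bcontfunD(1)[OF kb]) simp
  qed
  have V1: "sqrt (variance_of h) \<le> 1"
  proof -
    have "(LINT x|\<mu>. (h x)\<^sup>2) \<le> (LINT x|\<mu>. 1)"
      using L2_bcontfun[OF h(1)] h(2) by (intro integral_mono) (auto simp: L2_space_def abs_square_le_1)
    moreover have "0 \<le> (LINT x|\<mu>. h x)\<^sup>2" by simp
    moreover have "(LINT x|\<mu>. 1) = (1::real)" by (simp add: M.prob_space)
    ultimately have "variance_of h \<le> 1" unfolding variance_of_def by linarith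
    thus ?thesis by simp
  qed
  have "(LINT x|\<mu>e. \<bar>?T x - ?e\<bar>) \<le> (1 + drift_const) * L2_norm \<mu> (\<lambda>x. \<bar>?T x - ?e\<bar>)"
    using mue_le_L2[OF akb] by (meson abs_le_D1)
  also have "L2_norm \<mu> (\<lambda>x. \<bar>?T x - ?e\<bar>) = L2_norm \<mu> (\<lambda>x. (?T x - ?m) + (?m - ?e))" by (simp add: L2_norm_def)
  also have "\<dots> \<le> L2_norm \<mu> (\<lambda>x. ?T x - ?m) + L2_norm \<mu> (\<lambda>x. ?m - ?e)"
    by (intro M.L2_norm_triangle L2_bcontfun kb M.L2_bounded[of _ "\<bar>?m - ?e\<bar>"]) auto
  also have "L2_norm \<mu> (\<lambda>x. ?m - ?e) = \<bar>?e - ?m\<bar>" by (simp add: L2_norm_def M.prob_space abs_minus_commute)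
  also have "L2_norm \<mu> (\<lambda>x. ?T x - ?m) + \<bar>?e - ?m\<bar> \<le>
     exp (- (\<gamma> - \<epsilon>) * t) * sqrt (variance_of h) + drift_const * sqrt (variance_of h) * exp (- (\<gamma> - \<epsilon>) * t)"
    by (intro add_mono L2_deviation_decay[OF h(1) t] invariant_mean_limit[OF h(1) t])
  also have "\<dots> = (1 + drift_const) * exp (- (\<gamma> - \<epsilon>) * t) * sqrt (variance_of h)" by (simp add: algebra_simps)
  also have "\<dots> \<le> (1 + drift_const) * exp (- (\<gamma> - \<epsilon>) * t) * 1" using R V1 by (intro mult_left_mono) auto
  finally show ?thesis using R by (simp add: power2_eq_square mult_left_mono mult.assoc)
qed

text \<open>
  Approximate \<open>h\<close> in \<open>L\<^sup>1(\<mu>e)\<close> by continuous functions truncated to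
  \<open>{-1..1}\<close>; the transition operators contract \<open>L\<^sup>1(\<mu>e)\<close>.
\<close>
theorem decay_bounded:
  assumes h: "h \<in> borel_measurable borel" "\<And>x. \<bar>h x\<bar> \<le> 1" and t: "0 \<le> t"
  shows "(LINT x|\<mu>e. \<bar>transition Pe t h x - (LINT x|\<mu>e. h x)\<bar>) \<le> (1 + drift_const)\<^sup>2 * exp (- (\<gamma> - \<epsilon>) * t)"
proof (rule field_le_epsilon)
  fix e :: real assume e: "0 < e"
  have hi: "integrable \<mu>e h" by (rule E.integrable_const_bound[of _ 1]) (use h(2) mue_measurable[OF h(1)] in auto)
  obtain q0 where p0: "q0 \<in> bcontfun" "(LINT x|\<mu>e. \<bar>h x - q0 x\<bar>) < e / 2"
    using bcontfun_dense_L1[OF E.finite_measure_axioms mue_sets hi, of "e/2"] e by auto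
  define q where "q x = max (-1) (min 1 (q0 x))" for x
  have qb: "\<bar>q x\<bar> \<le> 1" for x unfolding q_def by linarith
  have qc: "q \<in> bcontfun" unfolding q_def using bcontfunD(1)[OF p0(1)] qb[unfolded q_def]
    by (intro bcontfunI[of _ 1] continuous_intros)
  have qm: "q \<in> borel_measurable borel" by (rule bcontfun_measurable[OF qc])
  have qi: "integrable \<mu>e q" by (rule E.integrable_const_bound[of _ 1]) (use qb mue_measurable[OF qm] in auto)
  obtain B0 where B0: "\<And>x. \<bar>q0 x\<bar> \<le> B0" using bcontfunD(2)[OF p0(1)] by blast
  have q0i: "integrable \<mu>e q0" by (rule E.integrable_const_bound[of _ B0]) (use B0 mue_measurable[OF bcontfun_measurable[OF p0(1)]] in auto)
  have "(LINT x|\<mu>e. \<bar>h x - q x\<bar>) \<le> (LINT x|\<mu>e. \<bar>h x - q0 x\<bar>)"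
  proof (rule integral_mono)
    show "\<bar>h x - q x\<bar> \<le> \<bar>h x - q0 x\<bar>" for x using h(2)[of x] unfolding q_def by linarith
  qed (use hi qi q0i in auto)
  hence p: "(LINT x|\<mu>e. \<bar>h x - q x\<bar>) < e / 2" using p0 by linarith
  define k where "k x = h x - q x" for x
  have km: "k \<in> borel_measurable borel" unfolding k_def using h(1) qm by simp
  have kb: "\<bar>k x\<bar> \<le> 2" for x unfolding k_def using h(2)[of x] qb[of x] by linarith
  have split: "transition Pe t h x = transition Pe t q x + transition Pe t k x" for x
  proof -
    interpret prob_space "Pe x" by (rule markov_prob[OF perturbed])
    have ev: "(\<lambda>w. w t) \<in> Pe x \<rightarrow>\<^sub>M borel"
      using evaluation_path_space[OF t] by (subst measurable_cong_sets[OF markov_sets[OF perturbed] refl])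
    have "integrable (Pe x) (\<lambda>w. q (w t))"
      by (rule integrable_const_bound[of _ 1]) (use measurable_compose[OF ev qm] qb in auto)
    moreover have "integrable (Pe x) (\<lambda>w. k (w t))"
      by (rule integrable_const_bound[of _ 2]) (use measurable_compose[OF ev km] kb in auto)
    ultimately show ?thesis unfolding transition_def by (subst Bochner_Integration.integral_add[symmetric]) (auto simp: k_def)
  qed
  let ?f = "LINT x|\<mu>e. h x" and ?p = "LINT x|\<mu>e. q x"
  have Ti: "integrable \<mu>e (\<lambda>x. \<bar>transition Pe t g x - c\<bar>)" if "g \<in> borel_measurable borel" "\<And>x. \<bar>g x\<bar> \<le> 2" for g c
  proof -
    have "integrable \<mu>e (transition Pe t g)"
      by (rule E.integrable_const_bound[of _ 2])
         (use transition_bound[OF perturbed that(2)] mue_measurable[OF transition_measurable[OF perturbed t that(1)]] in auto)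
    thus ?thesis by simp
  qed
  have Tk: "integrable \<mu>e (\<lambda>x. \<bar>transition Pe t k x\<bar>)" using Ti[OF km kb, of 0] by simp
  have q2: "\<bar>q x\<bar> \<le> 2" and h2: "\<bar>h x\<bar> \<le> 2" for x using qb[of x] h(2)[of x] by linarith+
  have fp: "\<bar>?f - ?p\<bar> \<le> (LINT x|\<mu>e. \<bar>k x\<bar>)"
    unfolding k_def using integral_abs_bound[of \<mu>e "\<lambda>x. h x - q x"] hi qi by simp
  have "(LINT x|\<mu>e. \<bar>transition Pe t h x - ?f\<bar>) \<le> (LINT x|\<mu>e. \<bar>transition Pe t q x - ?p\<bar> + \<bar>transition Pe t k x\<bar> + \<bar>?f - ?p\<bar>)"
  proof (rule integral_mono)
    show "\<bar>transition Pe t h x - ?f\<bar> \<le> \<bar>transition Pe t q x - ?p\<bar> + \<bar>transition Pe t k x\<bar> + \<bar>?f - ?p\<bar>" for x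
      unfolding split[of x] by linarith
  qed (use Ti[OF h(1) h2] Ti[OF qm q2] Tk in auto)
  also have "\<dots> = (LINT x|\<mu>e. \<bar>transition Pe t q x - ?p\<bar>) + (LINT x|\<mu>e. \<bar>transition Pe t k x\<bar>) + \<bar>?f - ?p\<bar>"
    using Ti[OF qm q2] Tk by (simp add: E.prob_space)
  also have "\<dots> \<le> (1 + drift_const)\<^sup>2 * exp (- (\<gamma> - \<epsilon>) * t) + e / 2 + e / 2"
    using decay_bcontfun[OF qc qb t] transition_abs_integral[OF perturbed inve t km kb] fp p unfolding k_def by linarith
  finally show "(LINT x|\<mu>e. \<bar>transition Pe t h x - ?f\<bar>) \<le> (1 + drift_const)\<^sup>2 * exp (- (\<gamma> - \<epsilon>) * t) + e" by simp
qed

end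
end

section \<open>Moments of partial sums of a mixing sequence\<close>

text \<open>
  Adjacent transpositions generate all permutations, so a symmetric statement needs proof for sorted indices
  only.
\<close>
lemma sort4_wlog:
  fixes i j k l :: "'b::linorder"
  assumes s12: "\<And>i j k l. P i j k l \<Longrightarrow> P j i k l"
    and s23: "\<And>i j k l. P i j k l \<Longrightarrow> P i k j l"
    and s34: "\<And>i j k l. P i j k l \<Longrightarrow> P i j l k"
    and sorted: "\<And>i j k l. i \<le> j \<Longrightarrow> j \<le> k \<Longrightarrow> k \<le> l \<Longrightarrow> P i j k l"
  shows "P i j k l"
proof -
  have three: "P i j k l" if "j \<le> k" "k \<le> l" for i j k l
  proof -
    consider "i \<le> j" | "j \<le> i" "i \<le> k" | "k \<le> i" "i \<le> l" | "l \<le> i" by fastforce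
    thus ?thesis
    proof cases
      case 1 thus ?thesis using that by (intro sorted)
    next
      case 2 thus ?thesis using that by (intro s12[OF sorted]) auto
    next
      case 3 thus ?thesis using that by (intro s12[OF s23[OF sorted]]) auto
    next
      case 4 thus ?thesis using that by (intro s12[OF s23[OF s34[OF sorted]]]) auto
    qed
  qed
  have two: "P i j k l" if "k \<le> l" for i j k l
  proof -
    consider "j \<le> k" | "k \<le> j" "j \<le> l" | "l \<le> j" by fastforce
    thus ?thesis
    proof cases
      case 1 thus ?thesis using that by (intro three)
    next
      case 2 thus ?thesis using that by (intro s23[OF three]) auto
    next
      case 3 thus ?thesis using that by (intro s23[OF s34[OF three]]) auto
    qed
  qed
  show ?thesis using two[of k l i j] s34[OF two[of l k i j]] by (cases "k \<le> l") auto
qed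

definition nat_dist :: "nat \<Rightarrow> nat \<Rightarrow> nat" where "nat_dist i j = (i - j) + (j - i)"

lemma nat_dist_commute: "nat_dist i j = nat_dist j i" by (simp add: nat_dist_def)

lemma sum_power_inj_le:
  fixes q :: real
  assumes q: "0 \<le> q" "q < 1" and A: "finite A" "inj_on f A"
  shows "(\<Sum>k\<in>A. q ^ f k) \<le> 1 / (1 - q)"
proof -
  have "(\<Sum>k\<in>A. q ^ f k) = (\<Sum>a\<in>f ` A. q ^ a)" using A(2) by (simp add: sum.reindex)
  also have "\<dots> \<le> (\<Sum>a. q ^ a)" using A q by (intro sum_le_suminf summable_geometric) auto
  also have "\<dots> = 1 / (1 - q)" using q by (intro suminf_geometric) auto
  finally show ?thesis .
qed

lemma sum_nat_dist_le:
  fixes q :: real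
  assumes q: "0 \<le> q" "q < 1"
  shows "(\<Sum>k<N. q ^ nat_dist i k) \<le> 2 / (1 - q)"
proof -
  have "(\<Sum>k<N. q ^ nat_dist i k) = (\<Sum>k\<in>{k\<in>{..<N}. k \<le> i} \<union> {k\<in>{..<N}. i < k}. q ^ nat_dist i k)"
    by (rule sum.cong[OF _ refl]) auto
  also have "\<dots> = (\<Sum>k\<in>{k\<in>{..<N}. k \<le> i}. q ^ nat_dist i k) + (\<Sum>k\<in>{k\<in>{..<N}. i < k}. q ^ nat_dist i k)"
    by (rule sum.union_disjoint) auto
  also have "\<dots> \<le> 1 / (1 - q) + 1 / (1 - q)"
    by (intro add_mono sum_power_inj_le q) (auto simp: inj_on_def nat_dist_def)
  finally show ?thesis by simp
qed

lemma abs_sum_bound: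
  fixes f :: "nat \<Rightarrow> real" assumes "\<And>i. \<bar>f i\<bar> \<le> K" shows "\<bar>\<Sum>i<n. f i\<bar> \<le> real n * K"
proof -
  have "\<bar>\<Sum>i<n. f i\<bar> \<le> (\<Sum>i<n. \<bar>f i\<bar>)" by (rule sum_abs)
  also have "\<dots> \<le> (\<Sum>i<n. K)" using assms by (intro sum_mono)
  finally show ?thesis by simp
qed

text \<open>
  The past is passed as a sequence padded with zeros, so that \<open>u\<close> and \<open>v\<close> are
  functions on one fixed space for all \<open>n\<close>.
\<close>
locale mixing_sequence = prob_space M for M :: "'a measure" +
  fixes Z :: "nat \<Rightarrow> 'a \<Rightarrow> real" and K C r :: real
  assumes Zm [measurable]: "\<And>j. Z j \<in> borel_measurable M"
    and Zb: "\<And>j w. w \<in> space M \<Longrightarrow> \<bar>Z j w\<bar> \<le> K"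
    and Z0: "\<And>j. expectation (Z j) = 0"
    and K: "0 < K" and C: "0 \<le> C" and r: "0 < r" "r < 1"
    and mixing: "\<And>n g (u :: (nat \<Rightarrow> real) \<Rightarrow> real) (v :: (nat \<Rightarrow> real) \<Rightarrow> real). u \<in> borel_measurable borel \<Longrightarrow> v \<in> borel_measurable borel \<Longrightarrow>
        (\<And>x. (\<And>i. \<bar>x i\<bar> \<le> K) \<Longrightarrow> \<bar>u x\<bar> \<le> 1) \<Longrightarrow> (\<And>x. (\<And>i. \<bar>x i\<bar> \<le> K) \<Longrightarrow> \<bar>v x\<bar> \<le> 1) \<Longrightarrow>
        \<bar>expectation (\<lambda>w. u (\<lambda>i. if i < n then Z i w else 0) * v (\<lambda>i. Z (n + g + i) w)) -
          expectation (\<lambda>w. u (\<lambda>i. if i < n then Z i w else 0)) * expectation (\<lambda>w. v (\<lambda>i. Z (n + g + i) w))\<bar> \<le> C * r ^ g"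
    and stationary: "\<And>n (v :: (nat \<Rightarrow> real) \<Rightarrow> real). v \<in> borel_measurable borel \<Longrightarrow> (\<And>x. (\<And>i. \<bar>x i\<bar> \<le> K) \<Longrightarrow> \<bar>v x\<bar> \<le> 1) \<Longrightarrow>
        expectation (\<lambda>w. v (\<lambda>i. Z (n + i) w)) = expectation (\<lambda>w. v (\<lambda>i. Z i w))"
begin

lemma mixing_scaled:
  fixes u v :: "(nat \<Rightarrow> real) \<Rightarrow> real"
  assumes u: "u \<in> borel_measurable borel" and v: "v \<in> borel_measurable borel"
    and ub: "\<And>x. (\<And>i. \<bar>x i\<bar> \<le> K) \<Longrightarrow> \<bar>u x\<bar> \<le> a" and vb: "\<And>x. (\<And>i. \<bar>x i\<bar> \<le> K) \<Longrightarrow> \<bar>v x\<bar> \<le> b"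
    and ab: "0 < a" "0 < b"
  shows "\<bar>expectation (\<lambda>w. u (\<lambda>i. if i < n then Z i w else 0) * v (\<lambda>i. Z (n + g + i) w)) -
          expectation (\<lambda>w. u (\<lambda>i. if i < n then Z i w else 0)) * expectation (\<lambda>w. v (\<lambda>i. Z (n + g + i) w))\<bar> \<le> a * b * C * r ^ g"
proof -
  have "\<bar>expectation (\<lambda>w. u (\<lambda>i. if i < n then Z i w else 0) / a * (v (\<lambda>i. Z (n + g + i) w) / b)) -
          expectation (\<lambda>w. u (\<lambda>i. if i < n then Z i w else 0) / a) * expectation (\<lambda>w. v (\<lambda>i. Z (n + g + i) w) / b)\<bar> \<le> C * r ^ g"
    (is "\<bar>?A\<bar> \<le> _")
    by (rule mixing[of "\<lambda>x. u x / a" "\<lambda>x. v x / b"]) (use u v ub vb ab in \<open>auto simp: abs_divide\<close>)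
  moreover have "?A = (expectation (\<lambda>w. u (\<lambda>i. if i < n then Z i w else 0) * v (\<lambda>i. Z (n + g + i) w)) -
          expectation (\<lambda>w. u (\<lambda>i. if i < n then Z i w else 0)) * expectation (\<lambda>w. v (\<lambda>i. Z (n + g + i) w))) / (a * b)"
    by (simp add: diff_divide_distrib)
  ultimately show ?thesis using ab by (simp add: abs_divide pos_divide_le_eq mult_ac)
qed

lemma stationary_scaled:
  fixes v :: "(nat \<Rightarrow> real) \<Rightarrow> real"
  assumes v: "v \<in> borel_measurable borel" and vb: "\<And>x. (\<And>i. \<bar>x i\<bar> \<le> K) \<Longrightarrow> \<bar>v x\<bar> \<le> b" and b: "0 < b"
  shows "expectation (\<lambda>w. v (\<lambda>i. Z (n + i) w)) = expectation (\<lambda>w. v (\<lambda>i. Z i w))"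
proof -
  have "expectation (\<lambda>w. v (\<lambda>i. Z (n + i) w) / b) = expectation (\<lambda>w. v (\<lambda>i. Z i w) / b)"
    by (rule stationary[of "\<lambda>x. v x / b"]) (use v vb b in \<open>auto simp: abs_divide\<close>)
  thus ?thesis using b by simp
qed

definition prod4_const :: real where "prod4_const = K ^ 4 * (1 + C / r)"

lemma prod4_const_nonneg: "0 \<le> prod4_const" using K C r by (simp add: prod4_const_def)

lemma gap_bound: "i < j \<Longrightarrow> K ^ 4 * C * r ^ (j - Suc i) \<le> prod4_const * r ^ (j - i)"
proof -
  assume "i < j"
  hence "r ^ (j - i) = r * r ^ (j - Suc i)" by (metis Suc_diff_Suc power_Suc)
  hence "prod4_const * r ^ (j - i) = K ^ 4 * (r + C) * r ^ (j - Suc i)" using r by (simp add: prod4_const_def field_simps)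
  also have "\<dots> \<ge> K ^ 4 * C * r ^ (j - Suc i)" using K r by (intro mult_right_mono mult_left_mono) auto
  finally show ?thesis .
qed

lemma abs_mult4_le:
  assumes "\<bar>a\<bar> \<le> K" "\<bar>b\<bar> \<le> K" "\<bar>c\<bar> \<le> K" "\<bar>d\<bar> \<le> K"
  shows "\<bar>a * b * c * d\<bar> \<le> K ^ 4"
proof -
  have "\<bar>a * b * c * d\<bar> \<le> K * K * K * K" unfolding abs_mult using assms K by (intro mult_mono) auto
  thus ?thesis by (simp add: eval_nat_numeral)
qed

lemma abs_mult3_le:
  assumes "\<bar>a\<bar> \<le> K" "\<bar>b\<bar> \<le> K" "\<bar>c\<bar> \<le> K" shows "\<bar>a * b * c\<bar> \<le> K ^ 3"
proof -
  have "\<bar>a * b * c\<bar> \<le> K * K * K" unfolding abs_mult using assms K by (intro mult_mono) auto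
  thus ?thesis by (simp add: eval_nat_numeral)
qed

lemma integrable_prod4: "integrable M (\<lambda>w. Z i w * Z j w * Z k w * Z l w)"
  by (rule integrable_const_bound[of _ "K ^ 4"]) (auto intro!: AE_I2 abs_mult4_le Zb)

lemma integrable_prod2: "integrable M (\<lambda>w. Z i w * Z j w)"
  by (rule integrable_const_bound[of _ "K * K"]) (use K in \<open>auto intro!: AE_I2 mult_mono Zb simp: abs_mult\<close>)

lemma expect4_trivial: "\<bar>expectation (\<lambda>w. Z i w * Z j w * Z k w * Z l w)\<bar> \<le> K ^ 4"
proof -
  have "\<bar>expectation (\<lambda>w. Z i w * Z j w * Z k w * Z l w)\<bar> \<le> expectation (\<lambda>w. \<bar>Z i w * Z j w * Z k w * Z l w\<bar>)" by (rule integral_abs_bound)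
  also have "\<dots> \<le> expectation (\<lambda>w. K ^ 4)" by (intro integral_mono) (auto intro!: integrable_abs integrable_prod4 abs_mult4_le Zb)
  finally show ?thesis by (simp add: prob_space)
qed

text \<open>
  \<open>Z i\<close> is centred, so the expectation is a covariance between \<open>Z i\<close> and the later
  factors.
\<close>
lemma expect4_left:
  assumes "i \<le> j" "j \<le> k" "k \<le> l"
  shows "\<bar>expectation (\<lambda>w. Z i w * Z j w * Z k w * Z l w)\<bar> \<le> prod4_const * r ^ (j - i)"
proof (cases "i = j")
  case True
  have "K ^ 4 \<le> prod4_const" using K C r by (simp add: prod4_const_def mult_le_cancel_left1)
  thus ?thesis using expect4_trivial[of i j k l] True by simp
next
  case False
  hence ij: "i < j" using assms by simp
  define g where "g = j - Suc i"
  have g: "Suc i + g = j" using ij by (simp add: g_def)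
  define v where "v x = x 0 * x (k - j) * x (l - j)" for x :: "nat \<Rightarrow> real"
  have "\<bar>expectation (\<lambda>w. (\<lambda>x. x i) (\<lambda>i'. if i' < Suc i then Z i' w else 0) * v (\<lambda>i'. Z (Suc i + g + i') w)) -
          expectation (\<lambda>w. (\<lambda>x. x i) (\<lambda>i'. if i' < Suc i then Z i' w else 0)) * expectation (\<lambda>w. v (\<lambda>i'. Z (Suc i + g + i') w))\<bar> \<le> K * K ^ 3 * C * r ^ g"
    using K unfolding v_def by (intro mixing_scaled) (auto intro!: abs_mult3_le)
  also have "K * K ^ 3 = K ^ 4" by (simp add: eval_nat_numeral)
  also have "K ^ 4 * C * r ^ g \<le> prod4_const * r ^ (j - i)" unfolding g_def by (rule gap_bound[OF ij])
  finally show ?thesis unfolding g v_def using assms by (simp add: Z0 mult.assoc)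
qed

lemma expect4_right:
  assumes "i \<le> j" "j \<le> k" "k \<le> l"
  shows "\<bar>expectation (\<lambda>w. Z i w * Z j w * Z k w * Z l w)\<bar> \<le> prod4_const * r ^ (l - k)"
proof (cases "k = l")
  case True
  have "K ^ 4 \<le> prod4_const" using K C r by (simp add: prod4_const_def mult_le_cancel_left1)
  thus ?thesis using expect4_trivial[of i j k l] True by simp
next
  case False
  hence ij: "k < l" using assms by simp
  define g where "g = l - Suc k"
  have g: "Suc k + g = l" using ij by (simp add: g_def)
  define u where "u x = x i * x j * x k" for x :: "nat \<Rightarrow> real"
  have "\<bar>expectation (\<lambda>w. u (\<lambda>i'. if i' < Suc k then Z i' w else 0) * (\<lambda>x. x 0) (\<lambda>i'. Z (Suc k + g + i') w)) -
          expectation (\<lambda>w. u (\<lambda>i'. if i' < Suc k then Z i' w else 0)) * expectation (\<lambda>w. (\<lambda>x. x 0) (\<lambda>i'. Z (Suc k + g + i') w))\<bar> \<le> K ^ 3 * K * C * r ^ g"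
    using K unfolding u_def by (intro mixing_scaled) (auto intro!: abs_mult3_le)
  also have "K ^ 3 * K = K ^ 4" by (simp add: eval_nat_numeral)
  also have "K ^ 4 * C * r ^ g \<le> prod4_const * r ^ (l - k)" unfolding g_def by (rule gap_bound[OF ij])
  finally show ?thesis unfolding g u_def using assms by (simp add: Z0 mult.assoc)
qed

abbreviation (input) \<beta> :: "nat \<Rightarrow> nat \<Rightarrow> real" where "\<beta> i j \<equiv> sqrt r ^ nat_dist i j"

text \<open>
  For sorted indices both the left and the right gap give a bound; the minimum is at most the geometric mean,
  which is \<open>\<beta> i j * \<beta> k l\<close>. The sum over the three pairings makes the bound
  symmetric.
\<close>
lemma expect4:
  "\<bar>expectation (\<lambda>w. Z i w * Z j w * Z k w * Z l w)\<bar> \<le> prod4_const * (\<beta> i j * \<beta> k l + \<beta> i k * \<beta> j l + \<beta> i l * \<beta> j k)"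
proof (rule sort4_wlog[of "\<lambda>i j k l. \<bar>expectation (\<lambda>w. Z i w * Z j w * Z k w * Z l w)\<bar> \<le> prod4_const * (\<beta> i j * \<beta> k l + \<beta> i k * \<beta> j l + \<beta> i l * \<beta> j k)"])
  fix i j k l :: nat assume s: "i \<le> j" "j \<le> k" "k \<le> l"
  have q: "0 \<le> sqrt r" "sqrt r \<le> 1" using r by auto
  have rq: "r ^ a = sqrt r ^ (2 * a)" for a using r by (simp add: power_mult)
  have "\<bar>expectation (\<lambda>w. Z i w * Z j w * Z k w * Z l w)\<bar> \<le> prod4_const * sqrt r ^ ((j - i) + (l - k))"
  proof (cases "l - k \<le> j - i")
    case True
    have "r ^ (j - i) \<le> sqrt r ^ ((j - i) + (l - k))" unfolding rq using True q by (intro power_decreasing) auto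
    thus ?thesis using expect4_left[OF s] prod4_const_nonneg by (meson mult_left_mono order_trans)
  next
    case False
    have "r ^ (l - k) \<le> sqrt r ^ ((j - i) + (l - k))" unfolding rq using False q by (intro power_decreasing) auto
    thus ?thesis using expect4_right[OF s] prod4_const_nonneg by (meson mult_left_mono order_trans)
  qed
  also have "sqrt r ^ ((j - i) + (l - k)) = \<beta> i j * \<beta> k l"
  proof -
    have "nat_dist i j = j - i" "nat_dist k l = l - k" using s by (simp_all add: nat_dist_def)
    thus ?thesis by (simp only: power_add)
  qed
  also have "prod4_const * (\<beta> i j * \<beta> k l) \<le> prod4_const * (\<beta> i j * \<beta> k l + \<beta> i k * \<beta> j l + \<beta> i l * \<beta> j k)"
    using prod4_const_nonneg q by (intro mult_left_mono) auto
  finally show "\<bar>expectation (\<lambda>w. Z i w * Z j w * Z k w * Z l w)\<bar> \<le> prod4_const * (\<beta> i j * \<beta> k l + \<beta> i k * \<beta> j l + \<beta> i l * \<beta> j k)" .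
qed (simp_all only: nat_dist_commute mult_ac add_ac)

definition S :: "nat \<Rightarrow> 'a \<Rightarrow> real" where "S n w = (\<Sum>i<n. Z i w)"

lemma S_measurable [measurable]: "S n \<in> borel_measurable M" unfolding S_def by measurable

lemma S_bound: "w \<in> space M \<Longrightarrow> \<bar>S n w\<bar> \<le> real n * K"
  unfolding S_def by (rule abs_sum_bound) (rule Zb)

lemma S_shift: "S (m + n) w - S m w = (\<Sum>i<n. Z (m + i) w)"
proof -
  have "S (m + n) w = S m w + (\<Sum>i<n. Z (m + i) w)" unfolding S_def by (induction n) auto
  thus ?thesis by simp
qed

definition sum_const :: real where "sum_const = 2 / (1 - sqrt r)"
definition mom4_const :: real where "mom4_const = 3 * prod4_const * sum_const\<^sup>2"

lemma sum_const_nonneg: "0 \<le> sum_const" using r by (simp add: sum_const_def)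
lemma mom4_const_nonneg: "0 \<le> mom4_const" using prod4_const_nonneg by (simp add: mom4_const_def)

text \<open>
  Each of the three pairings contributes the square of \<open>\<Sum>i j. \<beta> i j\<close>, which is linear
  in \<open>n\<close>.
\<close>
lemma fourth_moment: "expectation (\<lambda>w. S n w ^ 4) \<le> mom4_const * (real n)\<^sup>2"
proof -
  let ?E = "\<lambda>i j k l. expectation (\<lambda>w. Z i w * Z j w * Z k w * Z l w)"
  have q: "0 \<le> sqrt r" "sqrt r < 1" using r by auto
  have A: "(\<Sum>k<n. \<beta> i k) \<le> sum_const" for i unfolding sum_const_def by (rule sum_nat_dist_le[OF q])
  have A0: "0 \<le> (\<Sum>k<n. \<beta> i k)" for i using q by (intro sum_nonneg) auto
  have eq: "S n w ^ 4 = (\<Sum>i<n. \<Sum>j<n. \<Sum>k<n. \<Sum>l<n. Z i w * Z j w * Z k w * Z l w)" for w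
  proof -
    have W: "S n w * S n w = (\<Sum>i<n. \<Sum>j<n. Z i w * Z j w)" unfolding S_def by (rule sum_product)
    have "S n w ^ 4 = (\<Sum>i<n. \<Sum>j<n. Z i w * Z j w) * (\<Sum>k<n. \<Sum>l<n. Z k w * Z l w)"
      unfolding W[symmetric] by (simp add: eval_nat_numeral)
    also have "\<dots> = (\<Sum>i<n. \<Sum>j<n. \<Sum>k<n. \<Sum>l<n. Z i w * Z j w * Z k w * Z l w)"
      by (simp only: sum_distrib_right) (simp only: sum_distrib_left mult.assoc)
    finally show ?thesis .
  qed
  have "expectation (\<lambda>w. S n w ^ 4) = (\<Sum>i<n. \<Sum>j<n. \<Sum>k<n. \<Sum>l<n. ?E i j k l)"
    unfolding eq by (simp add: integrable_prod4)
  also have "\<dots> \<le> (\<Sum>i<n. \<Sum>j<n. \<Sum>k<n. \<Sum>l<n. prod4_const * (\<beta> i j * \<beta> k l + \<beta> i k * \<beta> j l + \<beta> i l * \<beta> j k))"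
    using expect4 by (intro sum_mono) (meson abs_le_D1)
  also have "\<dots> = prod4_const * ((\<Sum>i<n. \<Sum>j<n. \<beta> i j * (\<Sum>k<n. \<Sum>l<n. \<beta> k l)) + (\<Sum>i<n. \<Sum>j<n. (\<Sum>k<n. \<beta> i k) * (\<Sum>l<n. \<beta> j l))
      + (\<Sum>i<n. \<Sum>j<n. (\<Sum>l<n. \<beta> i l) * (\<Sum>k<n. \<beta> j k)))"
  proof -
    have inner: "(\<Sum>k<n. \<Sum>l<n. prod4_const * (\<beta> i j * \<beta> k l + \<beta> i k * \<beta> j l + \<beta> i l * \<beta> j k)) =
       prod4_const * (\<beta> i j * (\<Sum>k<n. \<Sum>l<n. \<beta> k l) + (\<Sum>k<n. \<beta> i k) * (\<Sum>l<n. \<beta> j l) + (\<Sum>l<n. \<beta> i l) * (\<Sum>k<n. \<beta> j k))" for i j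
    proof -
      have "(\<Sum>k<n. \<Sum>l<n. \<beta> i l * \<beta> j k) = (\<Sum>l<n. \<beta> i l) * (\<Sum>k<n. \<beta> j k)"
        by (subst sum.swap) (simp add: sum_product)
      thus ?thesis by (simp add: sum_distrib_left[symmetric] sum.distrib sum_product)
    qed
    show ?thesis unfolding inner by (simp only: sum_distrib_left[symmetric] sum.distrib)
  qed
  also have "\<dots> \<le> prod4_const * ((real n * sum_const) * (real n * sum_const) + real n * (real n * (sum_const * sum_const)) + real n * (real n * (sum_const * sum_const)))"
  proof (intro mult_left_mono add_mono prod4_const_nonneg)
    have 1: "(\<Sum>k<n. \<Sum>l<n. \<beta> k l) \<le> real n * sum_const" using sum_mono[of "{..<n}" "\<lambda>k. \<Sum>l<n. \<beta> k l" "\<lambda>_. sum_const"] A by simp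
    have 0: "0 \<le> (\<Sum>k<n. \<Sum>l<n. \<beta> k l)" by (intro sum_nonneg A0)
    have "(\<Sum>i<n. \<Sum>j<n. \<beta> i j * (\<Sum>k<n. \<Sum>l<n. \<beta> k l)) = (\<Sum>k<n. \<Sum>l<n. \<beta> k l) * (\<Sum>k<n. \<Sum>l<n. \<beta> k l)"
      by (simp add: sum_distrib_right)
    also have "\<dots> \<le> (real n * sum_const) * (real n * sum_const)" using 0 1 sum_const_nonneg by (intro mult_mono) auto
    finally show "(\<Sum>i<n. \<Sum>j<n. \<beta> i j * (\<Sum>k<n. \<Sum>l<n. \<beta> k l)) \<le> (real n * sum_const) * (real n * sum_const)" .
    have "(\<Sum>k<n. \<beta> i k) * (\<Sum>l<n. \<beta> j l) \<le> sum_const * sum_const" for i j using A A0 sum_const_nonneg by (intro mult_mono) auto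
    hence "(\<Sum>i<n. \<Sum>j<n. (\<Sum>k<n. \<beta> i k) * (\<Sum>l<n. \<beta> j l)) \<le> (\<Sum>i<n. \<Sum>j<n. sum_const * sum_const)" by (intro sum_mono)
    thus "(\<Sum>i<n. \<Sum>j<n. (\<Sum>k<n. \<beta> i k) * (\<Sum>l<n. \<beta> j l)) \<le> real n * (real n * (sum_const * sum_const))"
      "(\<Sum>i<n. \<Sum>j<n. (\<Sum>l<n. \<beta> i l) * (\<Sum>k<n. \<beta> j k)) \<le> real n * (real n * (sum_const * sum_const))" by simp_all
  qed
  also have "\<dots> = mom4_const * (real n)\<^sup>2" by (simp add: mom4_const_def power2_eq_square algebra_simps)
  finally show ?thesis .
qed

lemma S_shift_law:
  fixes h :: "real \<Rightarrow> real"
  assumes h: "h \<in> borel_measurable borel" and b: "\<And>y. \<bar>y\<bar> \<le> real n * K \<Longrightarrow> \<bar>h y\<bar> \<le> b" and b0: "0 < b"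
  shows "expectation (\<lambda>w. h (S (m + n) w - S m w)) = expectation (\<lambda>w. h (S n w))"
proof -
  have "expectation (\<lambda>w. (\<lambda>x. h (\<Sum>i<n. x i)) (\<lambda>i. Z (m + i) w)) = expectation (\<lambda>w. (\<lambda>x. h (\<Sum>i<n. x i)) (\<lambda>i. Z i w))"
  proof (rule stationary_scaled[where b=b])
    show "0 < b" by (rule b0)
    show "(\<lambda>x::nat \<Rightarrow> real. h (\<Sum>i<n. x i)) \<in> borel_measurable borel" using h by measurable
    fix x :: "nat \<Rightarrow> real" assume "\<And>i. \<bar>x i\<bar> \<le> K"
    hence "\<bar>\<Sum>i<n. x i\<bar> \<le> real n * K" by (intro abs_sum_bound)
    thus "\<bar>h (\<Sum>i<n. x i)\<bar> \<le> b" by (rule b)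
  qed
  thus ?thesis by (simp add: S_shift) (simp add: S_def)
qed

lemma fourth_moment_increment: "expectation (\<lambda>w. (S (m + n) w - S m w) ^ 4) \<le> mom4_const * (real n)\<^sup>2"
proof -
  have "expectation (\<lambda>w. (S (m + n) w - S m w) ^ 4) = expectation (\<lambda>w. S n w ^ 4)"
  proof (rule S_shift_law[where h="\<lambda>y. y ^ 4" and b="(real n * K) ^ 4 + 1"])
    show "\<bar>y ^ 4\<bar> \<le> (real n * K) ^ 4 + 1" if "\<bar>y\<bar> \<le> real n * K" for y
      using power_mono[OF that, of 4] by (simp add: power_abs)
    show "0 < (real n * K) ^ 4 + 1" using K by (intro add_nonneg_pos) auto
  qed simp
  thus ?thesis using fourth_moment by simp
qed

definition var_S :: "nat \<Rightarrow> real" where "var_S n = expectation (\<lambda>w. (S n w)\<^sup>2)"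

lemma var_S_nonneg: "0 \<le> var_S n" by (simp add: var_S_def)

definition add_const :: real where "add_const = 2 * (K * K * C) * (1 / (1 - r)) * (1 / (1 - r))"

lemma add_const_nonneg: "0 \<le> add_const" using K C r by (simp add: add_const_def)

lemma expect2: assumes "i < m" shows "\<bar>expectation (\<lambda>w. Z i w * Z (m + j) w)\<bar> \<le> K * K * C * (r ^ (m - Suc i) * r ^ j)"
proof -
  define g where "g = (m - Suc i) + j"
  have g: "Suc i + g = m + j" using assms by (simp add: g_def)
  have "\<bar>expectation (\<lambda>w. (\<lambda>x. x i) (\<lambda>i'. if i' < Suc i then Z i' w else 0) * (\<lambda>x. x 0) (\<lambda>i'. Z (Suc i + g + i') w)) -
          expectation (\<lambda>w. (\<lambda>x. x i) (\<lambda>i'. if i' < Suc i then Z i' w else 0)) * expectation (\<lambda>w. (\<lambda>x. x 0) (\<lambda>i'. Z (Suc i + g + i') w))\<bar> \<le> K * K * C * r ^ g"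
    using K by (intro mixing_scaled) auto
  thus ?thesis unfolding g by (simp add: Z0 g_def power_add)
qed

lemma S2_integrable [simp]: "integrable M (\<lambda>w. (S n w)\<^sup>2)"
proof (rule integrable_const_bound[of _ "(real n * K)\<^sup>2"])
  show "AE w in M. norm ((S n w)\<^sup>2) \<le> (real n * K)\<^sup>2"
    by (rule AE_I2) (use power_mono[OF S_bound, of _ n 2] in simp)
qed simp

text \<open>
  The cross covariances are bounded by \<open>r^(m - Suc i) * r^j\<close>, whose double sum is bounded in
  \<open>m\<close> and \<open>n\<close>.
\<close>
lemma var_S_almost_additive: "\<bar>var_S (m + n) - var_S m - var_S n\<bar> \<le> add_const"
proof -
  define T where "T w = S (m + n) w - S m w" for w
  have Tm [measurable]: "T \<in> borel_measurable M" unfolding T_def by measurable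
  have T: "T w = (\<Sum>j<n. Z (m + j) w)" for w unfolding T_def by (rule S_shift)
  have Tb: "\<bar>T w\<bar> \<le> real n * K" if "w \<in> space M" for w
    unfolding T using that by (intro abs_sum_bound Zb)
  have T2: "expectation (\<lambda>w. (T w)\<^sup>2) = var_S n" unfolding T_def var_S_def
  proof (rule S_shift_law[where h="\<lambda>y. y\<^sup>2" and b="(real n * K)\<^sup>2 + 1"])
    show "\<bar>y\<^sup>2\<bar> \<le> (real n * K)\<^sup>2 + 1" if "\<bar>y\<bar> \<le> real n * K" for y
      using power_mono[OF that, of 2] by simp
    show "0 < (real n * K)\<^sup>2 + 1" by (intro add_nonneg_pos) auto
  qed simp
  have iT: "integrable M (\<lambda>w. (T w)\<^sup>2)"
  proof (rule integrable_const_bound[of _ "(real n * K)\<^sup>2"])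
    show "AE w in M. norm ((T w)\<^sup>2) \<le> (real n * K)\<^sup>2"
    by (rule AE_I2) (use power_mono[OF Tb, of _ 2] in simp)
  qed simp
  have prod: "S m w * T w = (\<Sum>i<m. \<Sum>j<n. Z i w * Z (m + j) w)" for w
    unfolding T S_def by (rule sum_product)
  have iST: "integrable M (\<lambda>w. S m w * T w)" unfolding prod by (intro Bochner_Integration.integrable_sum integrable_prod2)
  have "(S (m + n) w)\<^sup>2 = (S m w)\<^sup>2 + 2 * (S m w * T w) + (T w)\<^sup>2" for w
    unfolding T_def by (simp add: power2_eq_square algebra_simps)
  hence "var_S (m + n) = var_S m + 2 * expectation (\<lambda>w. S m w * T w) + var_S n"
    unfolding var_S_def T2[unfolded var_S_def, symmetric] using iT iST by simp
  moreover have "\<bar>expectation (\<lambda>w. S m w * T w)\<bar> \<le> (K * K * C) * (1 / (1 - r)) * (1 / (1 - r))"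
  proof -
    have "\<bar>expectation (\<lambda>w. S m w * T w)\<bar> = \<bar>\<Sum>i<m. \<Sum>j<n. expectation (\<lambda>w. Z i w * Z (m + j) w)\<bar>"
      unfolding prod by (simp add: integrable_prod2)
    also have "\<dots> \<le> (\<Sum>i<m. \<Sum>j<n. K * K * C * (r ^ (m - Suc i) * r ^ j))"
      by (intro order_trans[OF sum_abs sum_mono] expect2) simp
    also have "\<dots> = K * K * C * ((\<Sum>i<m. r ^ (m - Suc i)) * (\<Sum>j<n. r ^ j))"
      unfolding sum_product by (simp only: sum_distrib_left)
    also have "\<dots> \<le> K * K * C * ((1 / (1 - r)) * (1 / (1 - r)))"
      using K C r by (intro mult_left_mono mult_mono sum_power_inj_le sum_nonneg) (auto simp: inj_on_def)
    finally show ?thesis by (simp add: mult.assoc)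
  qed
  ultimately show ?thesis unfolding add_const_def by linarith
qed

lemma var_S_multiple: "\<bar>var_S (k * n) - real k * var_S n\<bar> \<le> real k * add_const"
proof (induction k)
  case 0 thus ?case by (simp add: var_S_def S_def)
next
  case (Suc k)
  have "\<bar>var_S (n + k * n) - var_S n - var_S (k * n)\<bar> \<le> add_const" by (rule var_S_almost_additive)
  thus ?case using Suc by (simp add: algebra_simps)
qed

text \<open>
  Both ratios are compared with the one at \<open>n * m\<close>.
\<close>
lemma var_S_ratio_cauchy:
  assumes "0 < m" "0 < n" shows "\<bar>var_S m / real m - var_S n / real n\<bar> \<le> add_const / real m + add_const / real n"
proof -
  have 1: "\<bar>var_S (n * m) / (real n * real m) - var_S m / real m\<bar> \<le> add_const / real m"
  proof -
    have "var_S (n * m) / (real n * real m) - var_S m / real m = (var_S (n * m) - real n * var_S m) / (real n * real m)"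
      using assms by (simp add: field_simps)
    also have "\<bar>\<dots>\<bar> = \<bar>var_S (n * m) - real n * var_S m\<bar> / (real n * real m)" by (simp add: abs_divide abs_mult)
    also have "\<dots> \<le> real n * add_const / (real n * real m)" by (intro divide_right_mono var_S_multiple) simp
    finally show ?thesis using assms by simp
  qed
  have 2: "\<bar>var_S (n * m) / (real n * real m) - var_S n / real n\<bar> \<le> add_const / real n"
  proof -
    have "var_S (n * m) / (real n * real m) - var_S n / real n = (var_S (m * n) - real m * var_S n) / (real n * real m)"
      using assms by (simp add: field_simps)
    also have "\<bar>\<dots>\<bar> = \<bar>var_S (m * n) - real m * var_S n\<bar> / (real n * real m)" by (simp add: abs_divide abs_mult)
    also have "\<dots> \<le> real m * add_const / (real n * real m)" by (intro divide_right_mono var_S_multiple) simp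
    finally show ?thesis using assms by simp
  qed
  have "\<bar>y - z\<bar> \<le> a + b" if "\<bar>x - y\<bar> \<le> a" "\<bar>x - z\<bar> \<le> b" for x y z a b :: real using that by linarith
  from this[OF 1 2] show ?thesis .
qed

definition \<sigma>2 :: real where "\<sigma>2 = lim (\<lambda>n. var_S n / real n)"

lemma var_S_ratio_tendsto: "(\<lambda>n. var_S n / real n) \<longlonglongrightarrow> \<sigma>2"
proof -
  have "Cauchy (\<lambda>n. var_S n / real n)"
  proof (rule metric_CauchyI)
    fix e :: real assume e: "0 < e"
    obtain N :: nat where N: "2 * add_const / e < real N" using reals_Archimedean2 by blast
    have sm: "add_const / real n < e / 2" if "max 1 N \<le> n" for n
    proof -
      have "2 * add_const < e * real N" using N e by (simp add: field_simps)
      also have "\<dots> \<le> e * real n" using that e by (intro mult_left_mono) auto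
      finally show ?thesis using that by (simp add: field_simps)
    qed
    show "\<exists>N. \<forall>m\<ge>N. \<forall>n\<ge>N. dist (var_S m / real m) (var_S n / real n) < e"
    proof (intro exI[of _ "max 1 N"] allI impI)
      fix m n assume mn: "max 1 N \<le> m" "max 1 N \<le> n"
      have "\<bar>var_S m / real m - var_S n / real n\<bar> \<le> add_const / real m + add_const / real n" using mn by (intro var_S_ratio_cauchy) auto
      thus "dist (var_S m / real m) (var_S n / real n) < e" using sm[OF mn(1)] sm[OF mn(2)] unfolding dist_real_def by linarith
    qed
  qed
  thus ?thesis unfolding \<sigma>2_def by (simp add: Cauchy_convergent_iff convergent_LIMSEQ_iff)
qed

lemma \<sigma>2_nonneg: "0 \<le> \<sigma>2"
  by (rule LIMSEQ_le_const[OF var_S_ratio_tendsto]) (auto simp: var_S_nonneg)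

definition var_const :: real where "var_const = var_S 1 + 2 * add_const"

lemma var_S_le: "var_S n \<le> var_const * real n"
proof (cases "n = 0")
  case True thus ?thesis by (simp add: var_S_def S_def)
next
  case False
  have "\<bar>var_S (n * 1) - real n * var_S 1\<bar> \<le> real n * add_const" by (rule var_S_multiple)
  moreover have "0 \<le> real n * add_const" using add_const_nonneg by simp
  ultimately show ?thesis by (simp add: var_const_def algebra_simps)
qed

lemma var_const_nonneg: "0 \<le> var_const" using var_S_nonneg add_const_nonneg by (simp add: var_const_def)

end

subsection \<open>Centred normal distributions\<close>

section \<open>The central limit theorem for a mixing sequence\<close>

lemma centred_normal_eq:
  assumes v: "0 \<le> v"
  shows "centred_normal v = distr std_normal_distribution borel (\<lambda>x. sqrt v * x)"
proof (cases "v = 0")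
  case True
  interpret real_distribution std_normal_distribution by (rule real_dist_normal_dist)
  have "distr std_normal_distribution borel (\<lambda>x. 0) = return borel (0::real)"
    by (rule distr_const) simp
  thus ?thesis using True by (simp add: centred_normal_def)
next
  case False
  interpret real_distribution std_normal_distribution by (rule real_dist_normal_dist)
  have "distributed std_normal_distribution lborel (\<lambda>x. x) std_normal_density"
    by (auto simp: distributed_def distr_id2 intro!: measurable_compose[OF _ measurable_ennreal])
  from normal_density_affine[OF this, of "sqrt v" 0]
  have "distributed std_normal_distribution lborel (\<lambda>x. sqrt v * x) (normal_density 0 (sqrt v))" using False v by simp
  hence "distr std_normal_distribution lborel (\<lambda>x. sqrt v * x) = density lborel (normal_density 0 (sqrt v))"
    by (simp add: distributed_def)
  moreover have "distr std_normal_distribution lborel (\<lambda>x. sqrt v * x) = distr std_normal_distribution borel (\<lambda>x. sqrt v * x)"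
    by (rule distr_cong) auto
  ultimately show ?thesis using False by (simp add: centred_normal_def)
qed

lemma centred_normal_distribution: "0 \<le> v \<Longrightarrow> real_distribution (centred_normal v)"
proof -
  assume v: "0 \<le> v"
  interpret real_distribution std_normal_distribution by (rule real_dist_normal_dist)
  show ?thesis unfolding centred_normal_eq[OF v] by (rule real_distribution_distr) simp
qed

lemma char_distr: "X \<in> borel_measurable M \<Longrightarrow> char (distr M borel X) t = (CLINT w|M. iexp (t * X w))"
  unfolding char_def by (rule integral_distr) auto

lemma char_centred_normal: "0 \<le> v \<Longrightarrow> char (centred_normal v) t = exp (- (v * t\<^sup>2 / 2))"
proof -
  assume v: "0 \<le> v"
  have "char (centred_normal v) t = char std_normal_distribution (t * sqrt v)"
    unfolding centred_normal_eq[OF v] by (subst char_distr) (auto simp: char_def mult.assoc)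
  thus ?thesis using v by (simp add: char_std_normal_distribution power_mult_distrib mult.commute)
qed

subsection \<open>Exponentials\<close>

lemma iexp_lipschitz: "cmod (iexp x - iexp y) \<le> \<bar>x - y\<bar>"
proof -
  have "iexp x - iexp y = iexp y * (iexp (x - y) - 1)" by (simp add: right_diff_distrib exp_add[symmetric] algebra_simps)
  moreover have "cmod (iexp (x - y) - 1) \<le> \<bar>x - y\<bar>" using iexp_approx1[of "x - y" 0] by simp
  ultimately show ?thesis by (simp add: norm_mult)
qed

lemma iexp_Re_Im: "iexp x = complex_of_real (cos x) + \<i> * complex_of_real (sin x)"
  by (simp add: exp_eq_polar cis_conv_exp[symmetric] complex_eq_iff)

lemma (in prob_space) expectation_iexp:
  assumes [measurable]: "A \<in> borel_measurable M"
  shows "(CLINT w|M. iexp (A w)) = complex_of_real (expectation (\<lambda>w. cos (A w))) + \<i> * complex_of_real (expectation (\<lambda>w. sin (A w)))"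
proof -
  have i: "integrable M (\<lambda>w. cos (A w))" "integrable M (\<lambda>w. sin (A w))"
    by (auto intro!: integrable_const_bound[of _ 1])
  show ?thesis unfolding iexp_Re_Im using i by (subst Bochner_Integration.integral_add) auto
qed

lemma (in prob_space) iexp_expectation_diff:
  assumes [measurable]: "A \<in> borel_measurable M" "B \<in> borel_measurable M"
    and le: "\<And>w. w \<in> space M \<Longrightarrow> \<bar>A w - B w\<bar> \<le> c"
  shows "cmod ((CLINT w|M. iexp (A w)) - (CLINT w|M. iexp (B w))) \<le> c"
proof -
  have i: "integrable M (\<lambda>w. iexp (A w))" "integrable M (\<lambda>w. iexp (B w))"
    by (auto intro!: integrable_const_bound[of _ 1])
  have "cmod ((CLINT w|M. iexp (A w)) - (CLINT w|M. iexp (B w))) = cmod (CLINT w|M. iexp (A w) - iexp (B w))"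
    using i by simp
  also have "\<dots> \<le> (LINT w|M. cmod (iexp (A w) - iexp (B w)))" by (rule integral_norm_bound)
  also have "\<dots> \<le> (LINT w|M. c)"
  proof (rule integral_mono)
    show "integrable M (\<lambda>w. cmod (iexp (A w) - iexp (B w)))" using i by (intro integrable_norm Bochner_Integration.integrable_diff)
    show "cmod (iexp (A w) - iexp (B w)) \<le> c" if "w \<in> space M" for w
      using order_trans[OF iexp_lipschitz le[OF that]] .
  qed simp
  finally show ?thesis by (simp add: prob_space)
qed

context mixing_sequence
begin

definition \<phi> :: "nat \<Rightarrow> real \<Rightarrow> complex" where "\<phi> n a = (CLINT w|M. iexp (a * S n w))"

lemma \<phi>_shift: "(CLINT w|M. iexp (a * (S (m + n) w - S m w))) = \<phi> n a"
proof -
  have "expectation (\<lambda>w. cos (a * (S (m + n) w - S m w))) = expectation (\<lambda>w. cos (a * S n w))"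
    by (rule S_shift_law[where h="\<lambda>y. cos (a * y)" and b=1]) auto
  moreover have "expectation (\<lambda>w. sin (a * (S (m + n) w - S m w))) = expectation (\<lambda>w. sin (a * S n w))"
    by (rule S_shift_law[where h="\<lambda>y. sin (a * y)" and b=1]) auto
  moreover have "(CLINT w|M. iexp (a * (S (m + n) w - S m w))) = complex_of_real (expectation (\<lambda>w. cos (a * (S (m + n) w - S m w)))) +
      \<i> * complex_of_real (expectation (\<lambda>w. sin (a * (S (m + n) w - S m w))))" by (rule expectation_iexp) simp
  moreover have "\<phi> n a = complex_of_real (expectation (\<lambda>w. cos (a * S n w))) + \<i> * complex_of_real (expectation (\<lambda>w. sin (a * S n w)))"
    unfolding \<phi>_def by (rule expectation_iexp) simp
  ultimately show ?thesis by (simp only:)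
qed

lemma \<phi>_norm: "cmod (\<phi> n a) \<le> 1"
proof -
  have "cmod (\<phi> n a) \<le> (LINT w|M. cmod (iexp (a * S n w)))" unfolding \<phi>_def by (rule integral_norm_bound)
  thus ?thesis by (simp add: prob_space)
qed

text \<open>
  Mixing is stated for real functions; splitting both exponentials into cosine and sine leaves four
  covariances.
\<close>
lemma mixing_iexp:
  "cmod ((CLINT w|M. iexp (s * S m w + s' * (S (m + g + n) w - S (m + g) w))) - \<phi> m s * \<phi> n s') \<le> 4 * (C * r ^ g)"
proof -
  let ?A = "\<lambda>w. s * S m w" and ?B = "\<lambda>w. s' * (S (m + g + n) w - S (m + g) w)"
  define dev where "dev p q = expectation (\<lambda>w. p (?A w) * q (?B w)) - expectation (\<lambda>w. p (?A w)) * expectation (\<lambda>w. q (?B w))" for p q :: "real \<Rightarrow> real"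
  have dev: "\<bar>dev p q\<bar> \<le> C * r ^ g" if pq: "p \<in> borel_measurable borel" "q \<in> borel_measurable borel" "\<And>x. \<bar>p x\<bar> \<le> 1" "\<And>x. \<bar>q x\<bar> \<le> 1" for p q :: "real \<Rightarrow> real"
  proof -
    have "\<bar>expectation (\<lambda>w. (\<lambda>x. p (s * (\<Sum>i<m. x i))) (\<lambda>i. if i < m then Z i w else 0) * (\<lambda>x. q (s' * (\<Sum>i<n. x i))) (\<lambda>i. Z (m + g + i) w)) -
          expectation (\<lambda>w. (\<lambda>x. p (s * (\<Sum>i<m. x i))) (\<lambda>i. if i < m then Z i w else 0)) * expectation (\<lambda>w. (\<lambda>x. q (s' * (\<Sum>i<n. x i))) (\<lambda>i. Z (m + g + i) w))\<bar> \<le> C * r ^ g"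
    proof (rule mixing)
      show "(\<lambda>x::nat \<Rightarrow> real. p (s * (\<Sum>i<m. x i))) \<in> borel_measurable borel"
        by (rule measurable_compose[OF _ pq(1)]) measurable
      show "(\<lambda>x::nat \<Rightarrow> real. q (s' * (\<Sum>i<n. x i))) \<in> borel_measurable borel"
        by (rule measurable_compose[OF _ pq(2)]) measurable
    qed (use pq in auto)
    moreover have "(\<Sum>i<m. if i < m then Z i w else 0) = S m w" for w unfolding S_def by (intro sum.cong) auto
    moreover have "(\<Sum>i<n. Z (m + g + i) w) = S (m + g + n) w - S (m + g) w" for w by (rule S_shift[symmetric])
    ultimately show ?thesis unfolding dev_def by simp
  qed
  have pm: "(\<lambda>w. p (?A w) * q (?B w)) \<in> borel_measurable M" if "p \<in> borel_measurable borel" "q \<in> borel_measurable borel" for p q :: "real \<Rightarrow> real"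
    using measurable_compose[OF _ that(1), of ?A M] measurable_compose[OF _ that(2), of ?B M] by simp
  have i: "integrable M (\<lambda>w. p (?A w) * q (?B w))" if pq: "p \<in> borel_measurable borel" "q \<in> borel_measurable borel" "\<And>x. \<bar>p x\<bar> \<le> 1" "\<And>x. \<bar>q x\<bar> \<le> 1" for p q :: "real \<Rightarrow> real"
    by (rule integrable_const_bound[of _ 1, OF _ pm[OF pq(1,2)]])
       (use pq(3,4) in \<open>auto simp: abs_mult intro!: AE_I2 mult_le_one\<close>)
  have cs: "(cos :: real \<Rightarrow> real) \<in> borel_measurable borel" "sin \<in> borel_measurable (borel :: real measure)"
    "\<And>x::real. \<bar>cos x\<bar> \<le> 1" "\<And>x::real. \<bar>sin x\<bar> \<le> 1" by auto
  note ii = i[OF cs(1,1,3,3)] i[OF cs(1,2,3,4)] i[OF cs(2,1,4,3)] i[OF cs(2,2,4,4)]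
  let ?E = "expectation"
  have "(CLINT w|M. iexp (?A w + ?B w)) =
      complex_of_real (?E (\<lambda>w. cos (?A w) * cos (?B w)) - ?E (\<lambda>w. sin (?A w) * sin (?B w)))
      + \<i> * complex_of_real (?E (\<lambda>w. sin (?A w) * cos (?B w)) + ?E (\<lambda>w. cos (?A w) * sin (?B w)))"
    by (subst expectation_iexp) (use ii in \<open>simp_all add: cos_add sin_add\<close>)
  moreover have "\<phi> m s = complex_of_real (?E (\<lambda>w. cos (?A w))) + \<i> * complex_of_real (?E (\<lambda>w. sin (?A w)))"
    unfolding \<phi>_def by (rule expectation_iexp) simp
  moreover have "\<phi> n s' = complex_of_real (?E (\<lambda>w. cos (?B w))) + \<i> * complex_of_real (?E (\<lambda>w. sin (?B w)))"
  proof -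
    have "(CLINT w|M. iexp (?B w)) = complex_of_real (?E (\<lambda>w. cos (?B w))) + \<i> * complex_of_real (?E (\<lambda>w. sin (?B w)))"
      by (rule expectation_iexp) simp
    thus ?thesis unfolding \<phi>_shift .
  qed
  ultimately have eq: "(CLINT w|M. iexp (?A w + ?B w)) - \<phi> m s * \<phi> n s' =
      complex_of_real (dev cos cos) - complex_of_real (dev sin sin) + \<i> * complex_of_real (dev sin cos) + \<i> * complex_of_real (dev cos sin)"
    unfolding dev_def by (simp add: complex_eq_iff algebra_simps)
  have "cmod ((CLINT w|M. iexp (?A w + ?B w)) - \<phi> m s * \<phi> n s') \<le> \<bar>dev cos cos\<bar> + \<bar>dev sin sin\<bar> + \<bar>dev sin cos\<bar> + \<bar>dev cos sin\<bar>"
  proof -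
    have *: "cmod (complex_of_real a - complex_of_real b + \<i> * complex_of_real c + \<i> * complex_of_real d) \<le> \<bar>a\<bar> + \<bar>b\<bar> + \<bar>c\<bar> + \<bar>d\<bar>" for a b c d
    proof -
      have "cmod (complex_of_real a - complex_of_real b + \<i> * complex_of_real c + \<i> * complex_of_real d)
         \<le> cmod (complex_of_real a - complex_of_real b) + cmod (\<i> * complex_of_real c) + cmod (\<i> * complex_of_real d)"
        by (rule order_trans[OF norm_triangle_ineq add_right_mono[OF norm_triangle_ineq]])
      also have "cmod (complex_of_real a - complex_of_real b) \<le> \<bar>a\<bar> + \<bar>b\<bar>"
        using norm_triangle_ineq4[of "complex_of_real a" "complex_of_real b"] by simp
      finally show ?thesis by (simp add: norm_mult)
    qed
    show ?thesis unfolding eq by (rule *)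
  qed
  also have "\<dots> \<le> 4 * (C * r ^ g)"
    using dev[OF cs(1,1,3,3)] dev[OF cs(1,2,3,4)] dev[OF cs(2,1,4,3)] dev[OF cs(2,2,4,4)] by linarith
  finally show ?thesis .
qed

lemma S_diff_bound: "w \<in> space M \<Longrightarrow> \<bar>S (m + n) w - S m w\<bar> \<le> real n * K"
  unfolding S_shift by (intro abs_sum_bound Zb)

text \<open>
  Omitting the first \<open>g\<close> terms of the second block costs \<open>|a| * (g * K)\<close> in the
  exponent, twice, and creates the gap that makes the blocks nearly independent.
\<close>
lemma \<phi>_add:
  assumes "g \<le> n"
  shows "cmod (\<phi> (m + n) a - \<phi> m a * \<phi> n a) \<le> 2 * (\<bar>a\<bar> * (real g * K)) + 4 * (C * r ^ g)"
proof -
  obtain l where n: "n = g + l" using assms le_Suc_ex by blast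
  let ?J = "CLINT w|M. iexp (a * S m w + a * (S (m + g + l) w - S (m + g) w))"
  have 1: "cmod (\<phi> (m + n) a - ?J) \<le> \<bar>a\<bar> * (real g * K)"
  proof -
    have b: "\<bar>a * S (m + n) w - (a * S m w + a * (S (m + g + l) w - S (m + g) w))\<bar> \<le> \<bar>a\<bar> * (real g * K)"
      if w0: "w \<in> space M" for w
    proof -
      have "a * S (m + n) w - (a * S m w + a * (S (m + g + l) w - S (m + g) w)) = a * (S (m + g) w - S m w)"
        unfolding n by (simp add: algebra_simps)
      also have "\<bar>\<dots>\<bar> = \<bar>a\<bar> * \<bar>S (m + g) w - S m w\<bar>" by (rule abs_mult)
      also have "\<dots> \<le> \<bar>a\<bar> * (real g * K)" by (intro mult_left_mono S_diff_bound w0) simp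
      finally show ?thesis .
    qed
    show ?thesis unfolding \<phi>_def by (rule iexp_expectation_diff[OF _ _ b]) simp_all
  qed
  have 2: "cmod (?J - \<phi> m a * \<phi> l a) \<le> 4 * (C * r ^ g)" by (rule mixing_iexp)
  have "cmod (\<phi> l a - \<phi> n a) \<le> \<bar>a\<bar> * (real g * K)"
  proof -
    have b: "\<bar>a * (S (g + l) w - S g w) - a * S n w\<bar> \<le> \<bar>a\<bar> * (real g * K)"
      if w0: "w \<in> space M" for w
    proof -
      have "a * (S (g + l) w - S g w) - a * S n w = (- a) * S g w" unfolding n by (simp add: algebra_simps)
      also have "\<bar>\<dots>\<bar> = \<bar>- a\<bar> * \<bar>S g w\<bar>" by (rule abs_mult)
      also have "\<dots> \<le> \<bar>- a\<bar> * (real g * K)" by (intro mult_left_mono S_bound w0) simp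
      finally show ?thesis by simp
    qed
    have "cmod ((CLINT w|M. iexp (a * (S (g + l) w - S g w))) - (CLINT w|M. iexp (a * S n w))) \<le> \<bar>a\<bar> * (real g * K)"
      by (rule iexp_expectation_diff[OF _ _ b]) simp_all
    thus ?thesis unfolding \<phi>_shift by (simp only: \<phi>_def)
  qed
  hence 3: "cmod (\<phi> m a * \<phi> l a - \<phi> m a * \<phi> n a) \<le> \<bar>a\<bar> * (real g * K)"
    using \<phi>_norm[of m a] by (simp add: right_diff_distrib[symmetric] norm_mult) (metis mult_left_le_one_le norm_ge_zero order_trans)
  have "cmod (\<phi> (m + n) a - \<phi> m a * \<phi> n a) \<le> cmod (\<phi> (m + n) a - ?J) + (cmod (?J - \<phi> m a * \<phi> l a) + cmod (\<phi> m a * \<phi> l a - \<phi> m a * \<phi> n a))"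
    by (intro norm_diff_triangle_le[OF order_refl norm_diff_triangle_le[OF order_refl order_refl]])
  thus ?thesis using 1 2 3 by linarith
qed

lemma \<phi>_power:
  assumes "g \<le> L"
  shows "cmod (\<phi> (k * L) a - \<phi> L a ^ k) \<le> real k * (2 * (\<bar>a\<bar> * (real g * K)) + 4 * (C * r ^ g))"
proof (induction k)
  case 0 thus ?case by (simp add: \<phi>_def S_def prob_space)
next
  case (Suc k)
  let ?e = "2 * (\<bar>a\<bar> * (real g * K)) + 4 * (C * r ^ g)"
  have 1: "cmod (\<phi> (k * L + L) a - \<phi> (k * L) a * \<phi> L a) \<le> ?e" by (rule \<phi>_add[OF assms])
  have "cmod (\<phi> (k * L) a * \<phi> L a - \<phi> L a ^ k * \<phi> L a) = cmod (\<phi> (k * L) a - \<phi> L a ^ k) * cmod (\<phi> L a)"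
    by (simp add: left_diff_distrib[symmetric] norm_mult)
  also have "\<dots> \<le> cmod (\<phi> (k * L) a - \<phi> L a ^ k) * 1" by (intro mult_left_mono \<phi>_norm) auto
  finally have 2: "cmod (\<phi> (k * L) a * \<phi> L a - \<phi> L a ^ k * \<phi> L a) \<le> real k * ?e" using Suc by linarith
  have "cmod (\<phi> (k * L + L) a - \<phi> L a ^ k * \<phi> L a) \<le> ?e + real k * ?e"
    by (rule norm_diff_triangle_le[OF 1 2])
  thus ?case by (simp add: algebra_simps)
qed

text \<open>
  By the arithmetic-geometric mean inequality, \<open>|s|^3 \<le> (t * s^2 + s^4 / t) / 2\<close>, here with
  \<open>t = sqrt n\<close>.
\<close>
lemma third_moment:
  assumes "0 < n"
  shows "integrable M (\<lambda>w. \<bar>S n w\<bar> ^ 3)" "expectation (\<lambda>w. \<bar>S n w\<bar> ^ 3) \<le> sqrt (real n) ^ 3 * ((var_const + mom4_const) / 2)"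
proof -
  show i3: "integrable M (\<lambda>w. \<bar>S n w\<bar> ^ 3)"
    by (rule integrable_const_bound[of _ "(real n * K) ^ 3"]) (use S_bound in \<open>auto intro!: AE_I2 power_mono\<close>)
  have i4: "integrable M (\<lambda>w. S n w ^ 4)"
    by (rule integrable_const_bound[of _ "(real n * K) ^ 4"]) (use S_bound power_mono[of "\<bar>S n _\<bar>" _ 4] in \<open>auto intro!: AE_I2 simp: power_abs\<close>)
  define t where "t = sqrt (real n)"
  have t: "0 < t" "t * t = real n" using assms by (auto simp: t_def)
  have le: "\<bar>s\<bar> ^ 3 \<le> (t * s\<^sup>2 + s ^ 4 / t) / 2" for s :: real
  proof -
    have "0 \<le> s\<^sup>2 / t * (t - \<bar>s\<bar>)\<^sup>2" using t by simp
    also have "s\<^sup>2 / t * (t - \<bar>s\<bar>)\<^sup>2 = t * s\<^sup>2 + s ^ 4 / t - 2 * \<bar>s\<bar> ^ 3"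
    proof -
      have "\<bar>s\<bar> ^ 3 = \<bar>s\<bar> * s\<^sup>2" by (simp add: eval_nat_numeral abs_mult_self_eq)
      thus ?thesis using t(1) by (simp add: field_simps power2_eq_square eval_nat_numeral abs_mult_self_eq)
    qed
    finally show ?thesis by simp
  qed
  have "expectation (\<lambda>w. \<bar>S n w\<bar> ^ 3) \<le> expectation (\<lambda>w. (t * (S n w)\<^sup>2 + S n w ^ 4 / t) / 2)"
    using i3 i4 by (intro integral_mono le) auto
  also have "\<dots> = (t * var_S n + expectation (\<lambda>w. S n w ^ 4) / t) / 2" using i4 by (simp add: var_S_def)
  also have "\<dots> \<le> (t * (var_const * real n) + mom4_const * (real n)\<^sup>2 / t) / 2"
    using t var_S_le[of n] fourth_moment[of n] by (intro divide_right_mono add_mono mult_left_mono) auto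
  also have "\<dots> = t ^ 3 * ((var_const + mom4_const) / 2)" unfolding t(2)[symmetric] using t(1) by (simp add: field_simps eval_nat_numeral)
  finally show "expectation (\<lambda>w. \<bar>S n w\<bar> ^ 3) \<le> sqrt (real n) ^ 3 * ((var_const + mom4_const) / 2)" by (simp add: t_def)
qed

lemma S_mean: "expectation (S n) = 0"
proof -
  have "integrable M (Z i)" for i by (rule integrable_const_bound[of _ K]) (use Zb in auto)
  thus ?thesis unfolding S_def[abs_def] by (simp add: Z0)
qed

lemma \<phi>_taylor:
  assumes "0 < L"
  shows "cmod (\<phi> L a - (1 - a\<^sup>2 * var_S L / 2)) \<le> (\<bar>a\<bar> * sqrt (real L)) ^ 3 * ((var_const + mom4_const) / 12)"
proof -
  have iS: "integrable M (S L)" by (rule integrable_const_bound[of _ "real L * K"]) (use S_bound in auto)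
  have "cmod (char (distr M borel (S L)) a - (1 - a\<^sup>2 * var_S L / 2)) \<le> (a\<^sup>2 / 6) * expectation (\<lambda>x. min (6 * (S L x)\<^sup>2) (\<bar>a\<bar> * \<bar>S L x\<bar> ^ 3))"
    by (rule char_approx3') (use iS in \<open>auto simp: S_mean var_S_def\<close>)
  also have "\<dots> \<le> (a\<^sup>2 / 6) * expectation (\<lambda>x. \<bar>a\<bar> * \<bar>S L x\<bar> ^ 3)"
    using third_moment(1)[OF assms] by (intro mult_left_mono integral_mono) (auto intro!: Bochner_Integration.integrable_bound[OF integrable_mult_right[OF third_moment(1)[OF assms], of "\<bar>a\<bar>"]])
  also have "\<dots> \<le> (a\<^sup>2 / 6) * (\<bar>a\<bar> * (sqrt (real L) ^ 3 * ((var_const + mom4_const) / 2)))"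
  proof -
    have e: "expectation (\<lambda>x. \<bar>a\<bar> * \<bar>S L x\<bar> ^ 3) = \<bar>a\<bar> * expectation (\<lambda>x. \<bar>S L x\<bar> ^ 3)" by simp
    show ?thesis unfolding e by (intro mult_left_mono third_moment(2)[OF assms]) auto
  qed
  also have "\<dots> = (\<bar>a\<bar> * sqrt (real L)) ^ 3 * ((var_const + mom4_const) / 12)"
  proof -
    have h: "\<bar>a\<bar> ^ 3 = a\<^sup>2 * \<bar>a\<bar>" by (simp add: eval_nat_numeral abs_mult_self_eq)
    show ?thesis unfolding power_mult_distrib h by (simp add: field_simps)
  qed
  finally show ?thesis by (simp add: \<phi>_def char_distr)
qed

end

lemma div_ratio_tendsto:
  assumes k: "0 < k" shows "(\<lambda>N. real (N div k) / real N) \<longlonglongrightarrow> 1 / real k"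
proof (rule tendsto_sandwich)
  show "\<forall>\<^sub>F N in sequentially. 1 / real k - 1 / real N \<le> real (N div k) / real N"
    using eventually_gt_at_top[of 0]
  proof eventually_elim
    case (elim N)
    have "real N = real k * real (N div k) + real (N mod k)" by (metis mult_div_mod_eq of_nat_add of_nat_mult)
    moreover have "real (N mod k) \<le> real k" using k by simp
    ultimately have "real N - real k \<le> real k * real (N div k)" by linarith
    hence "(real N - real k) / (real k * real N) \<le> (real k * real (N div k)) / (real k * real N)"
      by (intro divide_right_mono) auto
    moreover have "(real N - real k) / (real k * real N) = 1 / real k - 1 / real N"
      using elim k by (simp add: diff_divide_distrib)
    ultimately show ?case using k by simp
  qed
  show "\<forall>\<^sub>F N in sequentially. real (N div k) / real N \<le> 1 / real k"
    using eventually_gt_at_top[of 0]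
  proof eventually_elim
    case (elim N)
    have "real k * real (N div k) \<le> real N" by (metis mult.commute of_nat_mono of_nat_mult div_times_less_eq_dividend)
    thus ?case using elim k by (simp add: field_simps)
  qed
  have "(\<lambda>N. 1 / real k - 1 / real N) \<longlonglongrightarrow> 1 / real k - 0" by (intro tendsto_intros lim_1_over_n)
  thus "(\<lambda>N. 1 / real k - 1 / real N) \<longlonglongrightarrow> 1 / real k" by simp
qed simp

lemma inverse_sqrt_tendsto: "(\<lambda>n. c / sqrt (real n)) \<longlonglongrightarrow> 0"
  by (intro tendsto_divide_0[OF tendsto_const] filterlim_at_top_imp_at_infinity filterlim_compose[OF sqrt_at_top] filterlim_real_sequentially)

lemma exp_minus_taylor: assumes "0 \<le> (x::real)" shows "\<bar>1 - x - exp (- x)\<bar> \<le> x\<^sup>2 / 2"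
proof -
  have 1: "1 - x \<le> exp (- x)" using exp_ge_add_one_self[of "- x"] by simp
  have "exp (- x) \<le> 1 - x + x\<^sup>2 / 2"
  proof -
    define f where "f x = 1 - x + x\<^sup>2 / 2 - exp (- x)" for x :: real
    have "f 0 \<le> f x"
    proof (rule DERIV_nonneg_imp_nondecreasing[OF assms])
      fix y :: real assume "0 \<le> y" "y \<le> x"
      have "(f has_real_derivative (- 1 + y + exp (- y))) (at y)" unfolding f_def
        by (auto intro!: derivative_eq_intros)
      moreover have "0 \<le> - 1 + y + exp (- y)" using exp_ge_add_one_self[of "- y"] by simp
      ultimately show "\<exists>z. (f has_real_derivative z) (at y) \<and> 0 \<le> z" by blast
    qed
    thus ?thesis by (simp add: f_def)
  qed
  thus ?thesis using 1 by linarith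
qed

context mixing_sequence
begin

text \<open>
  The errors come, in this order, from dropping the last \<open>N mod k\<close> terms, from factorising into
  \<open>k\<close> blocks, and from comparing the characteristic function of one block with \<open>exp (-
  x)\<close> by Taylor expansion.
\<close>
lemma \<phi>_block_bound:
  fixes a0 :: real
  assumes k: "0 < k" and g: "g \<le> N div k" and L0: "0 < N div k"
  defines "a \<equiv> a0 / sqrt (real N)" and "x \<equiv> \<sigma>2 * a0\<^sup>2 / (2 * real k)"
  shows "cmod (\<phi> N a - exp (- (\<sigma>2 * a0\<^sup>2 / 2))) \<le>
     \<bar>a\<bar> * (real k * K) + real k * (2 * (\<bar>a\<bar> * (real g * K)) + 4 * (C * r ^ g))
     + real k * ((\<bar>a0\<bar> / sqrt (real k)) ^ 3 * ((var_const + mom4_const) / 12) + \<bar>a\<^sup>2 * var_S (N div k) / 2 - x\<bar> + x\<^sup>2 / 2)"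
proof -
  define L where "L = N div k"
  have N0: "0 < N" using L0 by (cases "N = 0") auto
  have kL: "k * L \<le> N" unfolding L_def by (metis mult.commute div_times_less_eq_dividend)
  \<comment> \<open>the k-th power of w is the limit of the characteristic functions\<close>
  define w where "w = complex_of_real (exp (- x))"
  have x0: "0 \<le> x" using \<sigma>2_nonneg by (simp add: x_def)
  have wk: "w ^ k = exp (- (\<sigma>2 * a0\<^sup>2 / 2))"
  proof -
    have "exp (- x) ^ k = exp (real k * (- x))" by (rule exp_of_nat_mult[symmetric])
    also have "real k * (- x) = - (\<sigma>2 * a0\<^sup>2 / 2)" using k by (simp add: x_def)
    finally show ?thesis by (simp add: w_def flip: of_real_power of_real_exp)
  qed
  have e1: "cmod (\<phi> N a - \<phi> (k * L) a) \<le> \<bar>a\<bar> * (real k * K)"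
  proof -
    define m where "m = N mod k"
    have m: "N = k * L + m" "m \<le> k" unfolding L_def m_def using k by (auto simp: less_imp_le)
    have "\<bar>a * S N \<omega> - a * S (k * L) \<omega>\<bar> \<le> \<bar>a\<bar> * (real k * K)" if w: "\<omega> \<in> space M" for \<omega>
    proof -
      have "\<bar>S N \<omega> - S (k * L) \<omega>\<bar> \<le> real m * K" unfolding m(1) by (rule S_diff_bound[OF w])
      also have "\<dots> \<le> real k * K" using m(2) K by simp
      finally have "\<bar>a\<bar> * \<bar>S N \<omega> - S (k * L) \<omega>\<bar> \<le> \<bar>a\<bar> * (real k * K)" by (intro mult_left_mono) auto
      thus ?thesis by (simp add: right_diff_distrib[symmetric] abs_mult)
    qed
    thus ?thesis unfolding \<phi>_def by (intro iexp_expectation_diff) auto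
  qed
  have e2: "cmod (\<phi> (k * L) a - \<phi> L a ^ k) \<le> real k * (2 * (\<bar>a\<bar> * (real g * K)) + 4 * (C * r ^ g))"
    using g unfolding L_def by (rule \<phi>_power)
  have e3: "cmod (\<phi> L a - (1 - a\<^sup>2 * var_S L / 2)) \<le> (\<bar>a0\<bar> / sqrt (real k)) ^ 3 * ((var_const + mom4_const) / 12)"
  proof -
    have "sqrt (real L) / sqrt (real N) \<le> 1 / sqrt (real k)"
    proof -
      have "real k * real L \<le> real N" using kL by (metis of_nat_mono of_nat_mult)
      hence "sqrt (real k) * sqrt (real L) \<le> sqrt (real N)" by (simp add: real_sqrt_mult[symmetric])
      thus ?thesis using k N0 by (simp add: field_simps)
    qed
    hence "\<bar>a0\<bar> * (sqrt (real L) / sqrt (real N)) \<le> \<bar>a0\<bar> * (1 / sqrt (real k))" by (intro mult_left_mono) auto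
    hence "\<bar>a\<bar> * sqrt (real L) \<le> \<bar>a0\<bar> / sqrt (real k)" by (simp add: a_def abs_divide)
    hence "(\<bar>a\<bar> * sqrt (real L)) ^ 3 \<le> (\<bar>a0\<bar> / sqrt (real k)) ^ 3" by (intro power_mono) auto
    hence "(\<bar>a\<bar> * sqrt (real L)) ^ 3 * ((var_const + mom4_const) / 12) \<le> (\<bar>a0\<bar> / sqrt (real k)) ^ 3 * ((var_const + mom4_const) / 12)"
      using var_const_nonneg mom4_const_nonneg by (intro mult_right_mono) auto
    thus ?thesis using \<phi>_taylor[of L a] L0 unfolding L_def by linarith
  qed
  have e4: "cmod (complex_of_real (1 - a\<^sup>2 * var_S L / 2) - w) \<le> \<bar>a\<^sup>2 * var_S L / 2 - x\<bar> + x\<^sup>2 / 2"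
  proof -
    have "cmod (complex_of_real (1 - a\<^sup>2 * var_S L / 2) - w) = \<bar>(1 - a\<^sup>2 * var_S L / 2) - exp (- x)\<bar>"
      unfolding w_def by (metis norm_of_real of_real_diff)
    thus ?thesis using exp_minus_taylor[OF x0] by linarith
  qed
  have "cmod (\<phi> L a - w) \<le> (\<bar>a0\<bar> / sqrt (real k)) ^ 3 * ((var_const + mom4_const) / 12) + (\<bar>a\<^sup>2 * var_S L / 2 - x\<bar> + x\<^sup>2 / 2)"
    by (rule norm_diff_triangle_le[OF e3 e4])
  moreover have "cmod (\<phi> L a ^ k - w ^ k) \<le> real k * cmod (\<phi> L a - w)"
    by (rule norm_power_diff[OF \<phi>_norm]) (use x0 in \<open>simp add: w_def\<close>)
  ultimately have e5: "cmod (\<phi> L a ^ k - w ^ k) \<le> real k * ((\<bar>a0\<bar> / sqrt (real k)) ^ 3 * ((var_const + mom4_const) / 12) + \<bar>a\<^sup>2 * var_S L / 2 - x\<bar> + x\<^sup>2 / 2)"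
    by (smt (verit) mult_left_mono of_nat_0_le_iff)
  from norm_diff_triangle_le[OF norm_diff_triangle_le[OF e1 e2] e5] show ?thesis unfolding wk L_def by simp
qed

text \<open>
  The order of choices matters: first the number \<open>k\<close> of blocks, for which the Taylor error is of
  order \<open>1 / sqrt k\<close>, then the gap \<open>g\<close>, and only then large \<open>N\<close>.
\<close>
theorem clt: "(\<lambda>N. \<phi> N (s0 / sqrt (real N))) \<longlonglongrightarrow> exp (- (\<sigma>2 * s0\<^sup>2 / 2))"
proof (rule LIMSEQ_I)
  fix e :: real assume e: "0 < e"
  define c where "c = \<bar>s0\<bar> ^ 3 * ((var_const + mom4_const) / 12)"
  define c' where "c' = \<sigma>2\<^sup>2 * s0 ^ 4 / 8"
  have Bk: "(\<lambda>k. c / sqrt (real k) + c' / real k) \<longlonglongrightarrow> 0 + 0"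
    by (intro tendsto_add inverse_sqrt_tendsto lim_const_over_n)
  have "\<forall>\<^sub>F k in sequentially. c / sqrt (real k) + c' / real k < e / 3 \<and> 0 < k"
    using order_tendstoD(2)[OF Bk, of "e/3"] e eventually_gt_at_top[of "0::nat"] by (intro eventually_conj) auto
  then obtain k where k: "c / sqrt (real k) + c' / real k < e / 3" "0 < k"
    using eventually_happens' sequentially_bot by blast
  have "(\<lambda>g. real k * (4 * (C * r ^ g))) \<longlonglongrightarrow> real k * (4 * (C * 0))"
    using r by (intro tendsto_intros LIMSEQ_realpow_zero) auto
  from order_tendstoD(2)[OF this, of "e/3"] e obtain g where g: "real k * (4 * (C * r ^ g)) < e / 3"
    by (auto simp: eventually_sequentially)
  define x where "x = \<sigma>2 * s0\<^sup>2 / (2 * real k)"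
  define Bd where "Bd N = \<bar>s0 / sqrt (real N)\<bar> * (real k * K) + real k * (2 * (\<bar>s0 / sqrt (real N)\<bar> * (real g * K)) + 4 * (C * r ^ g))
     + real k * ((\<bar>s0\<bar> / sqrt (real k)) ^ 3 * ((var_const + mom4_const) / 12) + \<bar>(s0 / sqrt (real N))\<^sup>2 * var_S (N div k) / 2 - x\<bar> + x\<^sup>2 / 2)" for N
  have kinf: "filterlim (\<lambda>N. N div k) at_top sequentially"
    by (rule filterlim_at_top_div_const_nat[OF k(2)])
  have l4: "(\<lambda>N. (s0 / sqrt (real N))\<^sup>2 * var_S (N div k) / 2) \<longlonglongrightarrow> x"
  proof -
    have "(\<lambda>N. s0\<^sup>2 * ((var_S (N div k) / real (N div k)) * (real (N div k) / real N)) / 2) \<longlonglongrightarrow> s0\<^sup>2 * (\<sigma>2 * (1 / real k)) / 2"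
      by (intro tendsto_intros div_ratio_tendsto[OF k(2)] filterlim_compose[OF var_S_ratio_tendsto kinf]) auto
    moreover have "\<forall>\<^sub>F N in sequentially. s0\<^sup>2 * ((var_S (N div k) / real (N div k)) * (real (N div k) / real N)) / 2 = (s0 / sqrt (real N))\<^sup>2 * var_S (N div k) / 2"
      using eventually_ge_at_top[of k]
    proof eventually_elim
      case (elim N)
      hence "0 < N div k" "0 < N" using k(2) by (auto simp: div_greater_zero_iff)
      thus ?case by (simp add: power_divide)
    qed
    ultimately have "(\<lambda>N. (s0 / sqrt (real N))\<^sup>2 * var_S (N div k) / 2) \<longlonglongrightarrow> s0\<^sup>2 * (\<sigma>2 * (1 / real k)) / 2"
      by (rule Lim_transform_eventually)
    moreover have "s0\<^sup>2 * (\<sigma>2 * (1 / real k)) / 2 = x" by (simp add: x_def mult.commute)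
    ultimately show ?thesis by (simp only:)
  qed
  have "Bd \<longlonglongrightarrow> \<bar>0\<bar> * (real k * K) + real k * (2 * (\<bar>0\<bar> * (real g * K)) + 4 * (C * r ^ g))
     + real k * ((\<bar>s0\<bar> / sqrt (real k)) ^ 3 * ((var_const + mom4_const) / 12) + \<bar>x - x\<bar> + x\<^sup>2 / 2)"
    unfolding Bd_def by (intro tendsto_add tendsto_mult tendsto_rabs tendsto_diff tendsto_const inverse_sqrt_tendsto l4)
  moreover have "\<bar>0\<bar> * (real k * K) + real k * (2 * (\<bar>0\<bar> * (real g * K)) + 4 * (C * r ^ g))
     + real k * ((\<bar>s0\<bar> / sqrt (real k)) ^ 3 * ((var_const + mom4_const) / 12) + \<bar>x - x\<bar> + x\<^sup>2 / 2) < e"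
  proof -
    have A: "real k * ((\<bar>s0\<bar> / sqrt (real k)) ^ 3 * ((var_const + mom4_const) / 12)) = c / sqrt (real k)"
    proof -
      have "sqrt (real k) ^ 3 = real k * sqrt (real k)" by (simp add: eval_nat_numeral)
      thus ?thesis using k(2) by (simp add: c_def power_divide)
    qed
    have B: "real k * (x\<^sup>2 / 2) = c' / real k"
      using k(2) by (simp add: x_def c'_def power2_eq_square power4_eq_xxxx field_simps)
    have gen: "\<bar>0\<bar> * a + k * (2 * (\<bar>0\<bar> * b) + z) + k * (q + \<bar>x - x\<bar> + y) = k * z + (k * q + k * y)"
      for a b z q y x k :: real by (simp add: algebra_simps)
    show ?thesis unfolding gen A B using k(1) g e by linarith
  qed
  ultimately have "\<forall>\<^sub>F N in sequentially. Bd N < e" by (rule order_tendstoD(2))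
  moreover have "\<forall>\<^sub>F N in sequentially. max g 1 \<le> N div k" using kinf unfolding filterlim_at_top by blast
  ultimately have "\<forall>\<^sub>F N in sequentially. norm (\<phi> N (s0 / sqrt (real N)) - exp (- (\<sigma>2 * s0\<^sup>2 / 2))) < e"
  proof eventually_elim
    case (elim N)
    have "norm (\<phi> N (s0 / sqrt (real N)) - exp (- (\<sigma>2 * s0\<^sup>2 / 2))) \<le> Bd N"
      unfolding Bd_def x_def using elim by (intro \<phi>_block_bound[OF k(2)]) auto
    thus ?case using elim by linarith
  qed
  thus "\<exists>no. \<forall>n\<ge>no. norm (\<phi> n (s0 / sqrt (real n)) - exp (- (\<sigma>2 * s0\<^sup>2 / 2))) < e"
    by (simp add: eventually_sequentially)
qed

lemma \<phi>_lipschitz: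
  assumes "0 < n"
  shows "cmod (\<phi> n a - \<phi> n a') \<le> \<bar>a - a'\<bar> * (sqrt (real n) * ((var_const + 1) / 2))"
proof -
  define t where "t = sqrt (real n)"
  have t: "0 < t" "t * t = real n" using assms by (auto simp: t_def)
  have i: "integrable M (\<lambda>w. iexp (a * S n w))" for a by (auto intro!: integrable_const_bound[of _ 1])
  have iS: "integrable M (S n)" by (rule integrable_const_bound[of _ "real n * K"]) (use S_bound in auto)
  have "expectation (\<lambda>w. \<bar>S n w\<bar>) \<le> expectation (\<lambda>w. ((S n w)\<^sup>2 / t + t) / 2)"
  proof (rule integral_mono)
    show "integrable M (\<lambda>w. \<bar>S n w\<bar>)" using iS by simp
    show "integrable M (\<lambda>w. ((S n w)\<^sup>2 / t + t) / 2)" by simp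
    fix w
    have "0 \<le> (\<bar>S n w\<bar> - t)\<^sup>2 / t" using t by simp
    also have "\<dots> = (S n w)\<^sup>2 / t + t - 2 * \<bar>S n w\<bar>" using t(1) by (simp add: field_simps power2_eq_square abs_mult_self_eq)
    finally show "\<bar>S n w\<bar> \<le> ((S n w)\<^sup>2 / t + t) / 2" by simp
  qed
  also have "\<dots> = (var_S n / t + t) / 2" by (simp add: var_S_def prob_space)
  also have "\<dots> \<le> (var_const * real n / t + t) / 2" using var_S_le[of n] t by (intro divide_right_mono add_right_mono) auto
  also have "\<dots> = t * ((var_const + 1) / 2)" unfolding t(2)[symmetric] using t(1) by (simp add: field_simps)
  finally have eS: "expectation (\<lambda>w. \<bar>S n w\<bar>) \<le> t * ((var_const + 1) / 2)" .
  have "cmod (\<phi> n a - \<phi> n a') = cmod (CLINT w|M. iexp (a * S n w) - iexp (a' * S n w))"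
    unfolding \<phi>_def using i[of a] i[of a'] by simp
  also have "\<dots> \<le> (LINT w|M. cmod (iexp (a * S n w) - iexp (a' * S n w)))" by (rule integral_norm_bound)
  also have "\<dots> \<le> (LINT w|M. \<bar>a - a'\<bar> * \<bar>S n w\<bar>)"
  proof (rule integral_mono)
    show "integrable M (\<lambda>w. cmod (iexp (a * S n w) - iexp (a' * S n w)))" by (intro integrable_norm Bochner_Integration.integrable_diff i)
    show "integrable M (\<lambda>w. \<bar>a - a'\<bar> * \<bar>S n w\<bar>)" using iS by simp
    show "cmod (iexp (a * S n w) - iexp (a' * S n w)) \<le> \<bar>a - a'\<bar> * \<bar>S n w\<bar>" for w
      using iexp_lipschitz[of "a * S n w" "a' * S n w"] by (simp only: left_diff_distrib[symmetric] abs_mult)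
  qed
  also have "\<dots> = \<bar>a - a'\<bar> * expectation (\<lambda>w. \<bar>S n w\<bar>)" by simp
  also have "\<dots> \<le> \<bar>a - a'\<bar> * (t * ((var_const + 1) / 2))" by (intro mult_left_mono eS) auto
  finally show ?thesis by (simp add: t_def)
qed

text \<open>
  \<open>\<phi>_lipschitz\<close> absorbs the difference between the normalisations by \<open>sqrt (b n /
  \<tau>)\<close> and by \<open>sqrt n\<close>.
\<close>
lemma clt_scaled:
  assumes \<tau>: "0 < \<tau>" and b: "(\<lambda>n. real (b n) / real n) \<longlonglongrightarrow> \<tau>"
  shows "(\<lambda>n. \<phi> (b n) (a / sqrt (real n))) \<longlonglongrightarrow> exp (- (\<sigma>2 * \<tau> * a\<^sup>2 / 2))"
proof -
  have bpos: "\<forall>\<^sub>F n in sequentially. 0 < real (b n) / real n" using order_tendstoD(1)[OF b \<tau>] .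
  have binf: "filterlim b at_top sequentially"
  proof -
    have "filterlim (\<lambda>n. real (b n) / real n * real n) at_top sequentially"
      by (rule filterlim_tendsto_pos_mult_at_top[OF b \<tau> filterlim_real_sequentially])
    moreover have "\<forall>\<^sub>F n in sequentially. real (b n) / real n * real n = real (b n)"
      using eventually_gt_at_top[of "0::nat"] by eventually_elim simp
    ultimately have "filterlim (\<lambda>n. real (b n)) at_top sequentially" by (rule filterlim_cong[OF refl refl, THEN iffD1, rotated])
    thus ?thesis by (simp add: filterlim_sequentially_iff_filterlim_real)
  qed
  have l1: "(\<lambda>n. \<phi> (b n) (a * sqrt \<tau> / sqrt (real (b n)))) \<longlonglongrightarrow> exp (- (\<sigma>2 * (a * sqrt \<tau>)\<^sup>2 / 2))"
    by (rule filterlim_compose[OF clt binf])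
  have l2: "(\<lambda>n. \<phi> (b n) (a / sqrt (real n)) - \<phi> (b n) (a * sqrt \<tau> / sqrt (real (b n)))) \<longlonglongrightarrow> 0"
  proof (rule Lim_null_comparison)
    show "\<forall>\<^sub>F n in sequentially. cmod (\<phi> (b n) (a / sqrt (real n)) - \<phi> (b n) (a * sqrt \<tau> / sqrt (real (b n)))) \<le>
      \<bar>a * sqrt (real (b n) / real n) - a * sqrt \<tau>\<bar> * ((var_const + 1) / 2)"
      using bpos
    proof eventually_elim
      case (elim n)
      hence p: "0 < b n" "0 < n" by (auto simp: zero_less_divide_iff)
      let ?s = "sqrt (real (b n))"
      have "cmod (\<phi> (b n) (a / sqrt (real n)) - \<phi> (b n) (a * sqrt \<tau> / ?s)) \<le>
         \<bar>a / sqrt (real n) - a * sqrt \<tau> / ?s\<bar> * (?s * ((var_const + 1) / 2))" by (rule \<phi>_lipschitz[OF p(1)])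
      also have "\<dots> = \<bar>(a / sqrt (real n) - a * sqrt \<tau> / ?s) * ?s\<bar> * ((var_const + 1) / 2)" by (simp add: abs_mult)
      also have "(a / sqrt (real n) - a * sqrt \<tau> / ?s) * ?s = a * sqrt (real (b n) / real n) - a * sqrt \<tau>"
        using p by (simp add: real_sqrt_divide left_diff_distrib)
      finally show ?case .
    qed
    have "(\<lambda>n. \<bar>a * sqrt (real (b n) / real n) - a * sqrt \<tau>\<bar> * ((var_const + 1) / 2)) \<longlonglongrightarrow> \<bar>a * sqrt \<tau> - a * sqrt \<tau>\<bar> * ((var_const + 1) / 2)"
      by (intro tendsto_intros b)
    thus "(\<lambda>n. \<bar>a * sqrt (real (b n) / real n) - a * sqrt \<tau>\<bar> * ((var_const + 1) / 2)) \<longlonglongrightarrow> 0" by simp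
  qed
  from tendsto_add[OF l2 l1] show ?thesis using \<tau> by (simp add: power_mult_distrib mult_ac)
qed

theorem clt_increment:
  assumes \<tau>: "0 < \<tau>" and b: "(\<lambda>n. real (b n) / real n) \<longlonglongrightarrow> \<tau>"
    and h: "continuous_on UNIV h" "\<And>x. \<bar>h x\<bar> \<le> (B::real)"
  shows "(\<lambda>n. expectation (\<lambda>w. h ((S (m n + b n) w - S (m n) w) / sqrt (real n)))) \<longlonglongrightarrow> (LINT x|centred_normal (\<sigma>2 * \<tau>). h x)"
proof -
  define X where "X n w = (S (m n + b n) w - S (m n) w) / sqrt (real n)" for n w
  have Xm [measurable]: "X n \<in> borel_measurable M" for n unfolding X_def by measurable
  have v: "0 \<le> \<sigma>2 * \<tau>" using \<sigma>2_nonneg \<tau> by simp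
  have hm: "h \<in> borel_measurable borel" using h(1) by (rule borel_measurable_continuous_onI)
  have "weak_conv_m (\<lambda>n. distr M borel (X n)) (centred_normal (\<sigma>2 * \<tau>))"
  proof (rule levy_continuity)
    show "real_distribution (distr M borel (X n))" for n by (rule real_distribution_distr) simp
    show "real_distribution (centred_normal (\<sigma>2 * \<tau>))" by (rule centred_normal_distribution[OF v])
    fix t
    have "char (distr M borel (X n)) t = \<phi> (b n) (t / sqrt (real n))" for n
      unfolding \<phi>_shift[symmetric, of "b n" _ "m n"] by (subst char_distr) (auto simp: X_def)
    thus "(\<lambda>n. char (distr M borel (X n)) t) \<longlonglongrightarrow> char (centred_normal (\<sigma>2 * \<tau>)) t"
      using clt_scaled[OF \<tau> b, of t] by (simp add: char_centred_normal[OF v])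
  qed
  from weak_conv_imp_integral_bdd_continuous_conv[OF _ _ this, of h B]
  have "(\<lambda>n. LINT x|distr M borel (X n). h x) \<longlonglongrightarrow> (LINT x|centred_normal (\<sigma>2 * \<tau>). h x)"
    using h centred_normal_distribution[OF v] by (auto intro!: real_distribution_distr simp: continuous_on_eq_continuous_at)
  thus ?thesis by (simp add: integral_distr[OF Xm hm] X_def)
qed

text \<open>
  Omitting the first \<open>g\<close> terms of the last increment changes it by at most \<open>g * K / sqrt
  n\<close>, after which mixing with gap \<open>g\<close> applies; \<open>g\<close> is fixed before
  \<open>n\<close> grows.
\<close>
theorem asymptotic_independence:
  fixes c :: "nat \<Rightarrow> nat \<Rightarrow> nat"
  assumes mono: "\<And>n. mono (c n)" and gap: "filterlim (\<lambda>n. c n (Suc i) - c n i) at_top sequentially"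
    and p: "coord_lipschitz i L p" "\<And>x. \<bar>p x\<bar> \<le> B" and h: "bdd_lipschitz h"
  defines "D \<equiv> \<lambda>n j w. (S (c n (Suc j)) w - S (c n j) w) / sqrt (real n)"
  shows "(\<lambda>n. expectation (\<lambda>w. p (\<lambda>j. D n j w) * h (D n i w)) - expectation (\<lambda>w. p (\<lambda>j. D n j w)) * expectation (\<lambda>w. h (D n i w))) \<longlonglongrightarrow> 0"
proof (rule LIMSEQ_I)
  fix e :: real assume e: "0 < e"
  obtain Lh where Lh: "\<And>x y. \<bar>h x - h y\<bar> \<le> Lh * \<bar>x - y\<bar>" using h by (auto simp: bdd_lipschitz_def)
  have Lh0: "0 \<le> Lh" using Lh[of 0 1] by simp
  obtain Bh0 where "\<And>x. \<bar>h x\<bar> \<le> Bh0" using h by (auto simp: bdd_lipschitz_def)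
  then obtain Bh where Bh: "\<And>x. \<bar>h x\<bar> \<le> Bh" "0 < Bh" by (meson less_add_one order_less_imp_le order_trans le_less_trans abs_ge_zero)
  obtain Bp where Bp: "\<And>x. \<bar>p x\<bar> \<le> Bp" "0 < Bp" using p(2) by (meson less_add_one order_less_imp_le order_trans le_less_trans abs_ge_zero)
  note hm = bdd_lipschitz_measurable[OF h]
  note pm = coord_lipschitz_measurable[OF p(1)]
  have "(\<lambda>g. Bp * Bh * C * r ^ g) \<longlonglongrightarrow> Bp * Bh * C * 0" using r by (intro tendsto_mult_left LIMSEQ_realpow_zero) auto
  from order_tendstoD(2)[OF this, of "e/2"] e obtain g where g: "Bp * Bh * C * r ^ g < e / 2" by (auto simp: eventually_sequentially)
  have "(\<lambda>n. (2 * Bp * Lh * (real g * K)) / sqrt (real n)) \<longlonglongrightarrow> 0" by (rule inverse_sqrt_tendsto)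
  hence small: "\<forall>\<^sub>F n in sequentially. (2 * Bp * Lh * (real g * K)) / sqrt (real n) < e / 2" using e by (intro order_tendstoD(2)) auto
  have large: "\<forall>\<^sub>F n in sequentially. g \<le> c n (Suc i) - c n i" using gap by (simp add: filterlim_at_top)
  have "\<forall>\<^sub>F n in sequentially. norm (expectation (\<lambda>w. p (\<lambda>j. D n j w) * h (D n i w)) - expectation (\<lambda>w. p (\<lambda>j. D n j w)) * expectation (\<lambda>w. h (D n i w)) - 0) < e"
    using small large eventually_gt_at_top[of "0::nat"]
  proof eventually_elim
    case (elim n)
    have ci: "c n i \<le> c n (Suc i)" using mono[of n] by (simp add: monoD)
    define l where "l = c n (Suc i) - c n i - g"
    have cSi: "c n (Suc i) = c n i + g + l" using elim(2) ci by (simp add: l_def)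
    define D' where "D' w = (S (c n i + g + l) w - S (c n i + g) w) / sqrt (real n)" for w
    define u where "u x = p (\<lambda>j. if j < i then ((\<Sum>k<c n (Suc j). x k) - (\<Sum>k<c n j. x k)) / sqrt (real n) else 0)" for x :: "nat \<Rightarrow> real"
    define v where "v x = h ((\<Sum>k<l. x k) / sqrt (real n))" for x :: "nat \<Rightarrow> real"
    have um: "u \<in> borel_measurable borel" unfolding u_def
      by (rule measurable_compose[OF _ pm]) (intro measurable_coordinatewise_then_product, auto)
    have vm: "v \<in> borel_measurable borel" unfolding v_def by (rule measurable_compose[OF _ hm]) auto
    have uS: "u (\<lambda>k. if k < c n i then Z k w else 0) = p (\<lambda>j. D n j w)" for w
    proof -
      have "(\<Sum>k<c n j. if k < c n i then Z k w else 0) = S (c n j) w" if "j \<le> i" for j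
        unfolding S_def using monoD[OF mono[of n] that] by (intro sum.cong) auto
      thus ?thesis unfolding u_def by (intro coord_lipschitz_local[OF p(1)]) (auto simp: D_def)
    qed
    have vS: "v (\<lambda>k. Z (c n i + g + k) w) = h (D' w)" for w
      unfolding v_def D'_def S_shift ..
    have mix: "\<bar>expectation (\<lambda>w. p (\<lambda>j. D n j w) * h (D' w)) - expectation (\<lambda>w. p (\<lambda>j. D n j w)) * expectation (\<lambda>w. h (D' w))\<bar> \<le> Bp * Bh * C * r ^ g"
      using mixing_scaled[OF um vm _ _ Bp(2) Bh(2), of "c n i" g] Bp(1) Bh(1) unfolding uS vS by (simp add: u_def v_def)
    have Dm [measurable]: "D n j \<in> borel_measurable M" for j unfolding D_def by measurable
    have D'm [measurable]: "D' \<in> borel_measurable M" unfolding D'_def by measurable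
    have [measurable]: "(\<lambda>w. p (\<lambda>j. D n j w)) \<in> borel_measurable M"
      by (rule measurable_compose[OF _ pm]) (intro measurable_coordinatewise_then_product Dm)
    have [measurable]: "(\<lambda>w. h (D n i w)) \<in> borel_measurable M" "(\<lambda>w. h (D' w)) \<in> borel_measurable M"
      using measurable_compose[OF Dm hm] measurable_compose[OF D'm hm] by auto
    have ip: "integrable M (\<lambda>w. p (\<lambda>j. D n j w))" by (rule integrable_const_bound[of _ Bp]) (use Bp in auto)
    have ih: "integrable M (\<lambda>w. h (D n i w))" "integrable M (\<lambda>w. h (D' w))" by (rule integrable_const_bound[of _ Bh], use Bh in auto)+
    have iph: "integrable M (\<lambda>w. p (\<lambda>j. D n j w) * h (D n i w))" "integrable M (\<lambda>w. p (\<lambda>j. D n j w) * h (D' w))"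
      by (rule integrable_const_bound[of _ "Bp * Bh"], use Bp Bh in \<open>auto simp: abs_mult intro!: AE_I2 mult_mono\<close>)+
    let ?d = "Lh * (real g * K / sqrt (real n))"
    have hd: "\<bar>h (D n i w) - h (D' w)\<bar> \<le> ?d" if w0: "w \<in> space M" for w
    proof -
      have "D n i w - D' w = (S (c n i + g) w - S (c n i) w) / sqrt (real n)"
        unfolding D_def D'_def cSi by (simp add: diff_divide_distrib)
      hence "\<bar>D n i w - D' w\<bar> \<le> real g * K / sqrt (real n)"
        using S_diff_bound[OF w0, of "c n i" g] by (simp add: abs_divide divide_right_mono)
      thus ?thesis using Lh[of "D n i w" "D' w"] Lh0 by (meson mult_left_mono order_trans)
    qed
    have d0: "0 \<le> ?d" using Lh0 K by simp
    have 1: "\<bar>expectation (\<lambda>w. h (D n i w)) - expectation (\<lambda>w. h (D' w))\<bar> \<le> ?d"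
    proof -
      have "\<bar>expectation (\<lambda>w. h (D n i w)) - expectation (\<lambda>w. h (D' w))\<bar> = \<bar>expectation (\<lambda>w. h (D n i w) - h (D' w))\<bar>" using ih by simp
      also have "\<dots> \<le> expectation (\<lambda>w. \<bar>h (D n i w) - h (D' w)\<bar>)" by (rule integral_abs_bound)
      also have "\<dots> \<le> expectation (\<lambda>w. ?d)" using ih hd by (intro integral_mono) auto
      finally show ?thesis by (simp add: prob_space)
    qed
    have 2: "\<bar>expectation (\<lambda>w. p (\<lambda>j. D n j w) * h (D n i w)) - expectation (\<lambda>w. p (\<lambda>j. D n j w) * h (D' w))\<bar> \<le> Bp * ?d"
    proof -
      have "\<bar>expectation (\<lambda>w. p (\<lambda>j. D n j w) * h (D n i w)) - expectation (\<lambda>w. p (\<lambda>j. D n j w) * h (D' w))\<bar>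
         = \<bar>expectation (\<lambda>w. p (\<lambda>j. D n j w) * (h (D n i w) - h (D' w)))\<bar>" using iph by (simp add: right_diff_distrib)
      also have "\<dots> \<le> expectation (\<lambda>w. \<bar>p (\<lambda>j. D n j w) * (h (D n i w) - h (D' w))\<bar>)" by (rule integral_abs_bound)
      also have "\<dots> \<le> expectation (\<lambda>w. Bp * ?d)"
      proof (rule integral_mono)
        show "integrable M (\<lambda>w. \<bar>p (\<lambda>j. D n j w) * (h (D n i w) - h (D' w))\<bar>)" using iph by (simp add: right_diff_distrib)
        show "\<bar>p (\<lambda>j. D n j w) * (h (D n i w) - h (D' w))\<bar> \<le> Bp * ?d" if "w \<in> space M" for w
          unfolding abs_mult using Bp hd[OF that] d0 by (intro mult_mono) auto
      qed simp
      finally show ?thesis by (simp add: prob_space)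
    qed
    have ep: "\<bar>expectation (\<lambda>w. p (\<lambda>j. D n j w))\<bar> \<le> Bp"
    proof -
      have "\<bar>expectation (\<lambda>w. p (\<lambda>j. D n j w))\<bar> \<le> expectation (\<lambda>w. \<bar>p (\<lambda>j. D n j w)\<bar>)" by (rule integral_abs_bound)
      also have "\<dots> \<le> expectation (\<lambda>w. Bp)" using ip Bp by (intro integral_mono) auto
      finally show ?thesis by (simp add: prob_space)
    qed
    have 3: "\<bar>expectation (\<lambda>w. p (\<lambda>j. D n j w)) * expectation (\<lambda>w. h (D n i w)) - expectation (\<lambda>w. p (\<lambda>j. D n j w)) * expectation (\<lambda>w. h (D' w))\<bar> \<le> Bp * ?d"
      unfolding right_diff_distrib[symmetric] abs_mult using ep 1 Bp by (intro mult_mono) auto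
    have "2 * (Bp * ?d) < e / 2" using elim(1) by (simp add: mult_ac)
    thus ?case using 2 3 mix g unfolding real_norm_def diff_0_right by linarith
  qed
  thus "\<exists>no. \<forall>n\<ge>no. norm (expectation (\<lambda>w. p (\<lambda>j. D n j w) * h (D n i w)) - expectation (\<lambda>w. p (\<lambda>j. D n j w)) * expectation (\<lambda>w. h (D n i w)) - 0) < e"
    by (simp add: eventually_sequentially)
qed

end

section \<open>Existence of Brownian motion\<close>

abbreviation "std_normal \<equiv> centred_normal 1"

definition gauss_seq :: "(nat \<Rightarrow> real) measure" where
  "gauss_seq = Pi\<^sub>M UNIV (\<lambda>_. std_normal)"

lemma std_normal_real_distribution: "real_distribution std_normal" by (rule centred_normal_distribution) simp

lemma std_normal_prob: "prob_space std_normal" using std_normal_real_distribution by (simp add: real_distribution_def)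

lemma centred_normal_sets: "0 \<le> v \<Longrightarrow> sets (centred_normal v) = sets borel"
  using centred_normal_distribution[of v] by (simp add: real_distribution_def real_distribution_axioms_def)

interpretation gauss: product_prob_space "\<lambda>_::nat. std_normal" UNIV
  by (simp add: product_prob_space_def product_sigma_finite_def product_prob_space_axioms_def std_normal_prob
      prob_space_imp_sigma_finite)

lemma gauss_seq_prob: "prob_space gauss_seq"
  unfolding gauss_seq_def by (rule prob_space_PiM) (rule std_normal_prob)

interpretation G: prob_space gauss_seq by (rule gauss_seq_prob)

lemma gaussian_sets [measurable_cong]: "sets gauss_seq = sets (Pi\<^sub>M UNIV (\<lambda>_. borel))"
  unfolding gauss_seq_def by (intro sets_PiM_cong) (auto simp: centred_normal_sets)

lemma gaussian_space [simp]: "space gauss_seq = UNIV"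
  using sets_eq_imp_space_eq[OF gaussian_sets] by (simp add: space_PiM PiE_UNIV_domain)

lemma gaussian_coord [measurable]: "(\<lambda>x. x i) \<in> borel_measurable gauss_seq"
  by (subst measurable_cong_sets[OF gaussian_sets refl]) (rule measurable_component_singleton, simp)

lemma gaussian_coord_law: "distr gauss_seq borel (\<lambda>x. x i) = std_normal"
proof -
  have "distr gauss_seq std_normal (\<lambda>x. x i) = std_normal"
    unfolding gauss_seq_def by (rule distr_PiM_component) (auto simp: std_normal_prob)
  moreover have "distr gauss_seq std_normal (\<lambda>x. x i) = distr gauss_seq borel (\<lambda>x. x i)"
    by (rule distr_cong) (auto simp: centred_normal_sets)
  ultimately show ?thesis by simp
qed

lemma gaussian_indep: "G.indep_vars (\<lambda>_. borel) (\<lambda>i x. x i) UNIV"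
proof (subst G.indep_vars_iff_distr_eq_PiM)
  have "distr gauss_seq (Pi\<^sub>M UNIV (\<lambda>_. borel)) (\<lambda>x. \<lambda>i\<in>UNIV. x i) = distr gauss_seq gauss_seq (\<lambda>x. x)"
    by (rule distr_cong) (auto simp: gaussian_sets)
  also have "\<dots> = gauss_seq" by (rule distr_id)
  finally show "distr gauss_seq (Pi\<^sub>M UNIV (\<lambda>_. borel)) (\<lambda>x. \<lambda>i\<in>UNIV. x i) = Pi\<^sub>M UNIV (\<lambda>i. distr gauss_seq borel (\<lambda>x. x i))"
    unfolding gaussian_coord_law by (simp add: gauss_seq_def)
qed (auto simp: gaussian_coord)

lemma gaussian_sum_char:
  assumes "finite A"
  shows "char (distr gauss_seq borel (\<lambda>x. c * (\<Sum>i\<in>A. x i))) t = exp (- (c\<^sup>2 * real (card A) * t\<^sup>2 / 2))"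
proof -
  have "char (distr gauss_seq borel (\<lambda>x. c * (\<Sum>i\<in>A. x i))) t = char (distr gauss_seq borel (\<lambda>x. \<Sum>i\<in>A. x i)) (t * c)"
    by (subst (1 2) char_distr) (auto simp: mult.assoc)
  also have "\<dots> = (\<Prod>i\<in>A. char (distr gauss_seq borel (\<lambda>x. x i)) (t * c))"
    by (rule G.char_distr_sum) (rule G.indep_vars_subset[OF gaussian_indep], simp)
  also have "\<dots> = (complex_of_real (exp (- ((t * c)\<^sup>2 / 2)))) ^ card A"
    unfolding gaussian_coord_law by (simp add: char_centred_normal)
  also have "\<dots> = complex_of_real (exp (- ((t * c)\<^sup>2 / 2)) ^ card A)" by simp
  also have "exp (- ((t * c)\<^sup>2 / 2)) ^ card A = exp (real (card A) * (- ((t * c)\<^sup>2 / 2)))" by (rule exp_of_nat_mult[symmetric])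
  also have "real (card A) * (- ((t * c)\<^sup>2 / 2)) = - (c\<^sup>2 * real (card A) * t\<^sup>2 / 2)" by (simp add: power_mult_distrib)
  finally show ?thesis .
qed

lemma gaussian_sum_law:
  assumes A: "finite A"
  shows "distr gauss_seq borel (\<lambda>x. c * (\<Sum>i\<in>A. x i)) = centred_normal (c\<^sup>2 * real (card A))"
proof (rule Levy_uniqueness)
  show "real_distribution (distr gauss_seq borel (\<lambda>x. c * (\<Sum>i\<in>A. x i)))"
    by (rule G.real_distribution_distr) simp
  show "real_distribution (centred_normal (c\<^sup>2 * real (card A)))" by (rule centred_normal_distribution) simp
  show "char (distr gauss_seq borel (\<lambda>x. c * (\<Sum>i\<in>A. x i))) = char (centred_normal (c\<^sup>2 * real (card A)))"
    by (rule ext) (simp add: gaussian_sum_char[OF A] char_centred_normal)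
qed

lemma gaussian_block_indep:
  assumes "disjoint_family_on A I" "\<And>j. j \<in> I \<Longrightarrow> finite (A j)"
  shows "G.indep_vars (\<lambda>_. borel) (\<lambda>j x. c j * (\<Sum>i\<in>A j. x i)) I"
proof -
  have "G.indep_vars (\<lambda>j. Pi\<^sub>M (A j) (\<lambda>_. borel)) (\<lambda>j x. restrict (\<lambda>i. x i) (A j)) I"
    by (rule G.indep_vars_restrict[OF gaussian_indep _ assms(1)]) simp
  hence "G.indep_vars (\<lambda>_. borel) (\<lambda>j x. (\<lambda>y. c j * (\<Sum>i\<in>A j. y i)) (restrict (\<lambda>i. x i) (A j))) I"
    by (rule G.indep_vars_compose2) measurable
  thus ?thesis by simp
qed

text \<open>
  Adding neighbours and normalising preserves the law of independent standard normals, and it carries the walk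
  on the grid of level \<open>Suc n\<close> to the walk on the grid of level \<open>n\<close>. This is the
  consistency condition of Kolmogorov's theorem.
\<close>
definition pair_up :: "(nat \<Rightarrow> real) \<Rightarrow> nat \<Rightarrow> real" where
  "pair_up x i = (x (2 * i) + x (2 * i + 1)) / sqrt 2"

lemma pair_up_eq: "pair_up x i = (1 / sqrt 2) * (\<Sum>k\<in>{2 * i, 2 * i + 1}. x k)"
  by (simp add: pair_up_def)

lemma pair_up_measurable [measurable]: "pair_up \<in> gauss_seq \<rightarrow>\<^sub>M Pi\<^sub>M UNIV (\<lambda>_. borel)"
proof -
  have "(\<lambda>x. \<lambda>i\<in>UNIV. pair_up x i) \<in> gauss_seq \<rightarrow>\<^sub>M Pi\<^sub>M UNIV (\<lambda>_. borel)"
    unfolding pair_up_def by (intro measurable_restrict) measurable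
  moreover have "(\<lambda>x. \<lambda>i\<in>UNIV. pair_up x i) = pair_up" by (simp add: fun_eq_iff)
  ultimately show ?thesis by simp
qed

lemma pair_up_law: "distr gauss_seq gauss_seq pair_up = gauss_seq"
proof -
  have "disjoint_family_on (\<lambda>i::nat. {2 * i, 2 * i + 1}) UNIV"
    unfolding disjoint_family_on_def by (auto; presburger)
  hence "G.indep_vars (\<lambda>_. borel) (\<lambda>i x. (1 / sqrt 2) * (\<Sum>k\<in>{2 * i, 2 * i + 1}. x k)) UNIV"
    by (intro gaussian_block_indep) auto
  hence ind: "G.indep_vars (\<lambda>_. borel) (\<lambda>i x. pair_up x i) UNIV" unfolding pair_up_eq .
  have law: "distr gauss_seq borel (\<lambda>x. pair_up x i) = std_normal" for i
    unfolding pair_up_eq by (subst gaussian_sum_law) (auto simp: power_divide)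
  have "distr gauss_seq gauss_seq pair_up = distr gauss_seq (Pi\<^sub>M UNIV (\<lambda>_. borel)) (\<lambda>x. \<lambda>i\<in>UNIV. pair_up x i)"
    by (rule distr_cong) (auto simp: gaussian_sets)
  also have "\<dots> = Pi\<^sub>M UNIV (\<lambda>i. distr gauss_seq borel (\<lambda>x. pair_up x i))"
    using ind by (subst (asm) G.indep_vars_iff_distr_eq_PiM) (assumption | simp add: pair_up_def)+
  also have "\<dots> = gauss_seq" unfolding law by (simp add: gauss_seq_def)
  finally show ?thesis .
qed

definition dyadic_grid :: "nat \<Rightarrow> real set" where "dyadic_grid n = range (\<lambda>k::nat. real k / 2 ^ n)"

text \<open>
  For \<open>d\<close> in the grid of level \<open>n\<close> this has variance \<open>d\<close>.
\<close>
definition grid_walk :: "nat \<Rightarrow> (nat \<Rightarrow> real) \<Rightarrow> real \<Rightarrow> real" where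
  "grid_walk n x d = (1 / sqrt (2 ^ n)) * (\<Sum>i<nat \<lfloor>d * 2 ^ n\<rfloor>. x i)"

lemma grid_walk_measurable [measurable]: "(\<lambda>x. grid_walk n x d) \<in> borel_measurable gauss_seq"
  unfolding grid_walk_def by measurable

lemma dyadic_grid_mono_Suc: "dyadic_grid n \<subseteq> dyadic_grid (Suc n)"
proof
  fix d assume "d \<in> dyadic_grid n"
  then obtain k :: nat where "d = real k / 2 ^ n" by (auto simp: dyadic_grid_def)
  hence "d = real (2 * k) / 2 ^ Suc n" by simp
  thus "d \<in> dyadic_grid (Suc n)" unfolding dyadic_grid_def by blast
qed

lemma dyadic_grid_mono: "m \<le> n \<Longrightarrow> dyadic_grid m \<subseteq> dyadic_grid n"
  using dyadic_grid_mono_Suc by (rule lift_Suc_mono_le)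

lemma sum_pairs: "(\<Sum>i<2 * k. x i) = (\<Sum>i<k. x (2 * i) + x (2 * i + 1 :: nat) :: real)"
  by (induction k) auto

lemma grid_walk_refine:
  assumes "d \<in> dyadic_grid n" shows "grid_walk (Suc n) x d = grid_walk n (pair_up x) d"
proof -
  obtain k :: nat where d: "d = real k / 2 ^ n" using assms by (auto simp: dyadic_grid_def)
  have 1: "nat \<lfloor>d * 2 ^ n\<rfloor> = k" by (simp add: d)
  have "d * 2 ^ Suc n = real (2 * k)" by (simp add: d)
  hence 2: "nat \<lfloor>d * 2 ^ Suc n\<rfloor> = 2 * k" by (metis floor_of_nat nat_int)
  have "grid_walk (Suc n) x d = (1 / sqrt (2 ^ Suc n)) * (\<Sum>i<k. x (2 * i) + x (2 * i + 1))"
    unfolding grid_walk_def 2 sum_pairs ..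
  also have "\<dots> = (1 / sqrt (2 ^ n)) * (\<Sum>i<k. pair_up x i)"
    unfolding pair_up_def sum_divide_distrib[symmetric] by (simp add: real_sqrt_mult)
  finally show ?thesis unfolding grid_walk_def 1 .
qed

definition grid_law :: "nat \<Rightarrow> real set \<Rightarrow> (real \<Rightarrow> real) measure" where
  "grid_law n J = distr gauss_seq (Pi\<^sub>M J (\<lambda>_. borel)) (\<lambda>x. \<lambda>d\<in>J. grid_walk n x d)"

lemma grid_walk_vector_measurable [measurable]: "(\<lambda>x. \<lambda>d\<in>J. grid_walk n x d) \<in> gauss_seq \<rightarrow>\<^sub>M Pi\<^sub>M J (\<lambda>_. borel)"
  by (intro measurable_restrict grid_walk_measurable)

lemma grid_law_Suc:
  assumes "J \<subseteq> dyadic_grid n" shows "grid_law (Suc n) J = grid_law n J"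
proof -
  have pm: "pair_up \<in> gauss_seq \<rightarrow>\<^sub>M gauss_seq"
    using pair_up_measurable by (subst measurable_cong_sets[OF refl gaussian_sets])
  have "grid_law (Suc n) J = distr gauss_seq (Pi\<^sub>M J (\<lambda>_. borel)) ((\<lambda>x. \<lambda>d\<in>J. grid_walk n x d) \<circ> pair_up)"
    unfolding grid_law_def using assms by (intro distr_cong refl) (auto simp: grid_walk_refine subset_iff restrict_def fun_eq_iff)
  also have "\<dots> = distr (distr gauss_seq gauss_seq pair_up) (Pi\<^sub>M J (\<lambda>_. borel)) (\<lambda>x. \<lambda>d\<in>J. grid_walk n x d)"
    by (rule distr_distr[symmetric]) (auto intro: pm)
  finally show ?thesis unfolding pair_up_law by (simp add: grid_law_def)
qed

lemma grid_law_le: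
  assumes "J \<subseteq> dyadic_grid m" "m \<le> n" shows "grid_law n J = grid_law m J"
  using assms(2)
proof (induction n rule: dec_induct)
  case (step n)
  have "J \<subseteq> dyadic_grid n" using assms(1) dyadic_grid_mono[OF step.hyps(1)] by blast
  thus ?case using grid_law_Suc step.IH by simp
qed simp

definition dyadics :: "real set" where "dyadics = (\<Union>n. dyadic_grid n)"

text \<open>
  Any level whose grid contains \<open>J\<close> gives the same law, see \<open>dyadic_fdd_eq\<close>; the
  least one is an arbitrary choice.
\<close>
definition grid_level :: "real set \<Rightarrow> nat" where "grid_level J = (LEAST n. J \<subseteq> dyadic_grid n)"

lemma grid_level:
  assumes "finite J" "J \<subseteq> dyadics" shows "J \<subseteq> dyadic_grid (grid_level J)"
  unfolding grid_level_def
proof (rule LeastI_ex)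
  show "\<exists>n. J \<subseteq> dyadic_grid n" using assms
  proof (induction J)
    case (insert d J)
    then obtain n m where nm: "J \<subseteq> dyadic_grid n" "d \<in> dyadic_grid m" by (auto simp: dyadics_def)
    hence "insert d J \<subseteq> dyadic_grid (max n m)"
      using dyadic_grid_mono[of n "max n m"] dyadic_grid_mono[of m "max n m"] by auto
    thus ?case by blast
  qed simp
qed

definition dyadic_fdd :: "real set \<Rightarrow> (real \<Rightarrow> real) measure" where "dyadic_fdd J = grid_law (grid_level J) J"

lemma dyadic_fdd_eq:
  assumes "finite J" "J \<subseteq> dyadic_grid n" shows "dyadic_fdd J = grid_law n J"
proof -
  have "J \<subseteq> dyadics" using assms by (auto simp: dyadics_def)
  hence "J \<subseteq> dyadic_grid (grid_level J)" using assms grid_level by blast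
  moreover have "grid_level J \<le> n" unfolding grid_level_def using assms(2) by (rule Least_le)
  ultimately show ?thesis unfolding dyadic_fdd_def by (rule grid_law_le[symmetric])
qed

interpretation dyadic_bm: polish_projective dyadics dyadic_fdd
proof (intro polish_projective.intro projective_family.intro, goal_cases)
  case (1 J H)
  note JH = 1
  let ?n = "grid_level H"
  have Hn: "H \<subseteq> dyadic_grid ?n" by (rule grid_level[OF JH(2,3)])
  have "dyadic_fdd J = grid_law ?n J" using JH Hn finite_subset by (intro dyadic_fdd_eq) auto
  also have "\<dots> = distr gauss_seq (Pi\<^sub>M J (\<lambda>_. borel)) ((\<lambda>f. restrict f J) \<circ> (\<lambda>x. \<lambda>d\<in>H. grid_walk ?n x d))"
    unfolding grid_law_def using JH(1) by (intro distr_cong refl) (auto simp: restrict_def fun_eq_iff subset_iff)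
  also have "\<dots> = distr (grid_law ?n H) (Pi\<^sub>M J (\<lambda>_. borel)) (\<lambda>f. restrict f J)"
    unfolding grid_law_def using JH(1) by (intro distr_distr[symmetric]) (auto intro: measurable_restrict_subset)
  finally show ?case
    by (simp add: dyadic_fdd_def)
next
  case (2 J)
  show ?case unfolding dyadic_fdd_def grid_law_def
    by (rule G.prob_space_distr) (rule grid_walk_vector_measurable)
qed

definition dyadic_brownian :: "(real \<Rightarrow> real) measure" where "dyadic_brownian = dyadic_bm.lim"

lemma dyadic_brownian_prob: "prob_space dyadic_brownian"
  unfolding dyadic_brownian_def by (rule dyadic_bm.P.prob_space_axioms)

lemma dyadic_brownian_sets [measurable_cong]: "sets dyadic_brownian = sets (Pi\<^sub>M dyadics (\<lambda>_. borel))"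
  by (simp add: dyadic_brownian_def)

lemma dyadic_brownian_coord: "d \<in> dyadics \<Longrightarrow> (\<lambda>w. w d) \<in> borel_measurable dyadic_brownian"
  by (subst measurable_cong_sets[OF dyadic_brownian_sets refl]) (rule measurable_component_singleton)

lemma dyadic_brownian_fdd:
  assumes J: "finite J" "J \<subseteq> dyadic_grid n"
  shows "distr dyadic_brownian (Pi\<^sub>M J (\<lambda>_. borel)) (\<lambda>w. restrict w J) = grid_law n J"
proof (rule measure_eqI)
  have Jd: "J \<subseteq> dyadics" using J by (auto simp: dyadics_def)
  show "sets (distr dyadic_brownian (Pi\<^sub>M J (\<lambda>_. borel)) (\<lambda>w. restrict w J)) = sets (grid_law n J)"
    by (simp add: grid_law_def)
  fix X assume "X \<in> sets (distr dyadic_brownian (Pi\<^sub>M J (\<lambda>_. borel)) (\<lambda>w. restrict w J))"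
  hence X: "X \<in> sets (Pi\<^sub>M J (\<lambda>_. borel))" by simp
  have rm: "(\<lambda>w. restrict w J) \<in> dyadic_brownian \<rightarrow>\<^sub>M Pi\<^sub>M J (\<lambda>_. borel)"
    using measurable_restrict_subset[OF Jd] by (subst measurable_cong_sets[OF dyadic_brownian_sets refl])
  have "emeasure (distr dyadic_brownian (Pi\<^sub>M J (\<lambda>_. borel)) (\<lambda>w. restrict w J)) X = emeasure dyadic_brownian ((\<lambda>w. restrict w J) -` X \<inter> space dyadic_brownian)"
    by (rule emeasure_distr[OF rm X])
  also have "(\<lambda>w. restrict w J) -` X \<inter> space dyadic_brownian = prod_emb dyadics (\<lambda>_. borel) J X"
    by (auto simp: prod_emb_def dyadic_brownian_def space_PiM)
  also have "emeasure dyadic_brownian \<dots> = emeasure (dyadic_fdd J) X"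
    unfolding dyadic_brownian_def by (rule dyadic_bm.emeasure_lim_emb[OF Jd J(1) X])
  finally show "emeasure (distr dyadic_brownian (Pi\<^sub>M J (\<lambda>_. borel)) (\<lambda>w. restrict w J)) X = emeasure (grid_law n J) X"
    by (simp only: dyadic_fdd_eq[OF J])
qed

lemma dyadic_brownian_integral:
  fixes F :: "(real \<Rightarrow> real) \<Rightarrow> real"
  assumes J: "finite J" "J \<subseteq> dyadic_grid n" and F: "F \<in> borel_measurable (Pi\<^sub>M J (\<lambda>_. borel))"
  shows "(LINT w|dyadic_brownian. F (restrict w J)) = (LINT x|gauss_seq. F (\<lambda>d\<in>J. grid_walk n x d))"
    and "integrable dyadic_brownian (\<lambda>w. F (restrict w J)) \<longleftrightarrow> integrable gauss_seq (\<lambda>x. F (\<lambda>d\<in>J. grid_walk n x d))"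
proof -
  have Jd: "J \<subseteq> dyadics" using J by (auto simp: dyadics_def)
  have rm: "(\<lambda>w. restrict w J) \<in> dyadic_brownian \<rightarrow>\<^sub>M Pi\<^sub>M J (\<lambda>_. borel)"
    using measurable_restrict_subset[OF Jd] by (subst measurable_cong_sets[OF dyadic_brownian_sets refl])
  have "(LINT w|dyadic_brownian. F (restrict w J)) = (LINT y|grid_law n J. F y)"
    unfolding dyadic_brownian_fdd[OF J, symmetric] by (rule integral_distr[OF rm F, symmetric])
  also have "\<dots> = (LINT x|gauss_seq. F (\<lambda>d\<in>J. grid_walk n x d))"
    unfolding grid_law_def by (rule integral_distr[OF grid_walk_vector_measurable F])
  finally show "(LINT w|dyadic_brownian. F (restrict w J)) = (LINT x|gauss_seq. F (\<lambda>d\<in>J. grid_walk n x d))" .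
  have "integrable dyadic_brownian (\<lambda>w. F (restrict w J)) \<longleftrightarrow> integrable (grid_law n J) F"
    unfolding dyadic_brownian_fdd[OF J, symmetric] by (rule integrable_distr_eq[OF rm F, symmetric])
  also have "\<dots> \<longleftrightarrow> integrable gauss_seq (\<lambda>x. F (\<lambda>d\<in>J. grid_walk n x d))"
    unfolding grid_law_def by (rule integrable_distr_eq[OF grid_walk_vector_measurable F])
  finally show "integrable dyadic_brownian (\<lambda>w. F (restrict w J)) \<longleftrightarrow> integrable gauss_seq (\<lambda>x. F (\<lambda>d\<in>J. grid_walk n x d))" .
qed

lemma grid_walk_grid: "grid_walk n x (real k / 2 ^ n) = (1 / sqrt (2 ^ n)) * (\<Sum>i<k. x i)"
  by (simp add: grid_walk_def)

lemma grid_point: "real k / 2 ^ n \<in> dyadic_grid n" by (auto simp: dyadic_grid_def)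
lemma grid_point_dyadic: "real k / 2 ^ n \<in> dyadics" unfolding dyadics_def using grid_point by blast

lemma dyadic_brownian_0: "AE w in dyadic_brownian. w 0 = 0"
proof -
  interpret prob_space dyadic_brownian by (rule dyadic_brownian_prob)
  have 0: "{0} \<subseteq> dyadic_grid 0" using grid_point[of 0 0] by simp
  have "(LINT w|dyadic_brownian. (\<lambda>y. (y 0)\<^sup>2) (restrict w {0})) = (LINT x|gauss_seq. (\<lambda>y. (y 0)\<^sup>2) (\<lambda>d\<in>{0}. grid_walk 0 x d))"
    by (rule dyadic_brownian_integral[OF _ 0]) auto
  hence e: "(LINT w|dyadic_brownian. (w 0)\<^sup>2) = 0" by (simp add: grid_walk_def)
  have "integrable dyadic_brownian (\<lambda>w. (\<lambda>y. (y 0)\<^sup>2) (restrict w {0}))"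
    by (subst dyadic_brownian_integral(2)[OF _ 0]) (auto simp: grid_walk_def)
  hence i: "integrable dyadic_brownian (\<lambda>w. (w 0)\<^sup>2)" by simp
  have "AE w in dyadic_brownian. (w 0)\<^sup>2 = 0" using e i by (subst (asm) integral_nonneg_eq_0_iff_AE) auto
  thus ?thesis by simp
qed

lemma std_normal_fourth: "integrable std_normal (\<lambda>x. x ^ 4)" "(LINT x|std_normal. x ^ 4) = 3"
proof -
  have e: "std_normal = distr std_normal_distribution borel (\<lambda>x. x)" using centred_normal_eq[of 1] by simp
  show "integrable std_normal (\<lambda>x. x ^ 4)" unfolding e
    using integrable_std_normal_distribution_moment[of 4] by (subst integrable_distr_eq) auto
  have "(LINT x|std_normal. x ^ 4) = (LINT x|std_normal_distribution. x ^ 4)" unfolding e by (subst integral_distr) auto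
  also have "\<dots> = fact 4 / (2 ^ 2 * fact 2)" using std_normal_distribution_even_moments(1)[of 2] by simp
  finally show "(LINT x|std_normal. x ^ 4) = 3" by (simp add: fact_numeral)
qed

lemma dyadic_brownian_fourth_moment:
  "integrable dyadic_brownian (\<lambda>w. (w (real (Suc i) / 2 ^ m) - w (real i / 2 ^ m)) ^ 4) \<and>
   (LINT w|dyadic_brownian. (w (real (Suc i) / 2 ^ m) - w (real i / 2 ^ m)) ^ 4) \<le> 3 * (1 / 2 ^ m)\<^sup>2"
proof -
  let ?J = "{real (Suc i) / 2 ^ m, real i / 2 ^ m}"
  define F where "F y = (y (real (Suc i) / 2 ^ m) - y (real i / 2 ^ m)) ^ 4" for y :: "real \<Rightarrow> real"
  have J: "finite ?J" "?J \<subseteq> dyadic_grid m" using grid_point[of _ m] by (simp_all only: insert_subset) auto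
  have F: "F \<in> borel_measurable (Pi\<^sub>M ?J (\<lambda>_. borel))" unfolding F_def
    by (intro borel_measurable_power borel_measurable_diff measurable_component_singleton) auto
  have FG: "F (\<lambda>d\<in>?J. grid_walk m x d) = (1 / 2 ^ m)\<^sup>2 * x i ^ 4" for x
  proof -
    have "F (\<lambda>d\<in>?J. grid_walk m x d) = ((1 / sqrt (2 ^ m)) * x i) ^ 4"
      unfolding F_def by (simp add: grid_walk_grid del: of_nat_Suc) (simp add: distrib_left[symmetric] add_divide_distrib)
    also have "\<dots> = ((1 / sqrt (2 ^ m))\<^sup>2)\<^sup>2 * x i ^ 4" by (simp only: power_mult_distrib) (simp flip: power_mult)
    also have "(1 / sqrt (2 ^ m))\<^sup>2 = 1 / 2 ^ m" by (simp add: power_divide)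
    finally show ?thesis .
  qed
  have i1: "integrable gauss_seq (\<lambda>x. x i ^ 4)"
    using integrable_distr_eq[OF gaussian_coord, of "\<lambda>x. x ^ 4" i] std_normal_fourth(1) by (simp add: gaussian_coord_law)
  have e1: "(LINT x|gauss_seq. x i ^ 4) = 3"
    using integral_distr[OF gaussian_coord, of "\<lambda>x. x ^ 4" i] std_normal_fourth(2) by (simp add: gaussian_coord_law)
  have FR: "F (restrict w ?J) = (w (real (Suc i) / 2 ^ m) - w (real i / 2 ^ m)) ^ 4" for w by (simp add: F_def)
  show ?thesis using i1 e1 dyadic_brownian_integral[OF J F, unfolded FG] unfolding FR by simp
qed

lemma step_path_close:
  assumes s: "0 \<le> s" "s \<le> t" "t \<le> real N" "t - s < 1 / 2 ^ m"
  shows "\<bar>step_path m (grid_values m w) t - step_path m (grid_values m w) s\<bar> \<le> dyadic_osc N m w"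
proof -
  define p q where "p = nat \<lfloor>s * 2 ^ m\<rfloor>" and "q = nat \<lfloor>t * 2 ^ m\<rfloor>"
  have "t * 2 ^ m \<le> real N * 2 ^ m" using s by (intro mult_right_mono) auto
  hence "\<lfloor>t * 2 ^ m\<rfloor> \<le> \<lfloor>real (N * 2 ^ m)\<rfloor>" by (intro floor_mono) simp
  hence qN: "q \<le> N * 2 ^ m" unfolding q_def by (simp add: nat_le_iff del: of_nat_mult)
  have "s * 2 ^ m \<le> t * 2 ^ m" using s by (intro mult_right_mono) auto
  hence pq: "p \<le> q" unfolding p_def q_def by (intro nat_mono floor_mono)
  have "(t - s) * 2 ^ m < 1" using s(4) by (simp add: field_simps)
  hence "t * 2 ^ m < s * 2 ^ m + 1" by (simp add: algebra_simps)
  hence "\<lfloor>t * 2 ^ m\<rfloor> \<le> \<lfloor>s * 2 ^ m\<rfloor> + 1" by linarith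
  hence qp: "q \<le> Suc p" unfolding p_def q_def using s(1) by simp
  have e: "step_path m (grid_values m w) t = w (real q / 2 ^ m)" "step_path m (grid_values m w) s = w (real p / 2 ^ m)"
    by (simp_all add: step_path_def grid_values_def p_def q_def)
  show ?thesis
  proof (cases "q = p")
    case True thus ?thesis unfolding e by (simp add: dyadic_osc_nonneg)
  next
    case False
    hence q: "q = Suc p" using pq qp by simp
    show ?thesis unfolding e q using dyadic_osc_increment[of p N m w] qN q by simp
  qed
qed

text \<open>
  Summable oscillations make the step approximations converge uniformly on bounded intervals.
\<close>
definition dyadic_regular :: "(real \<Rightarrow> real) \<Rightarrow> bool" where
  "dyadic_regular w \<longleftrightarrow> (\<forall>N. summable (\<lambda>m. dyadic_osc N m w))"

definition dyadic_extension :: "(real \<Rightarrow> real) \<Rightarrow> real \<Rightarrow> real" where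
  "dyadic_extension w t = lim (\<lambda>m. step_path m (grid_values m w) t)"

lemma dyadic_extension_uniform:
  assumes "dyadic_regular w"
  shows "uniform_limit {0..real N} (\<lambda>m. step_path m (grid_values m w)) (dyadic_extension w) sequentially"
proof -
  let ?g = "\<lambda>m. step_path m (grid_values m w)"
  have tel: "(\<Sum>i<n. ?g (Suc i) t - ?g i t) = ?g n t - ?g 0 t" for n t by (rule sum_lessThan_telescope)
  have sm: "summable (\<lambda>m. dyadic_osc N (Suc m) w)" using assms by (subst summable_Suc_iff) (simp add: dyadic_regular_def)
  have "uniform_limit {0..real N} (\<lambda>n t. \<Sum>i<n. ?g (Suc i) t - ?g i t) (\<lambda>t. \<Sum>i. ?g (Suc i) t - ?g i t) sequentially"
    by (rule Weierstrass_m_test[OF _ sm]) (auto intro: step_path_refine)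
  hence "uniform_limit {0..real N} (\<lambda>n t. ?g n t - ?g 0 t) (\<lambda>t. \<Sum>i. ?g (Suc i) t - ?g i t) sequentially"
    unfolding tel .
  hence u: "uniform_limit {0..real N} (\<lambda>n t. ?g 0 t + (?g n t - ?g 0 t)) (\<lambda>t. ?g 0 t + (\<Sum>i. ?g (Suc i) t - ?g i t)) sequentially"
    by (intro uniform_limit_add uniform_limit_const)
  hence u: "uniform_limit {0..real N} ?g (\<lambda>t. ?g 0 t + (\<Sum>i. ?g (Suc i) t - ?g i t)) sequentially"
    by simp
  have "dyadic_extension w t = ?g 0 t + (\<Sum>i. ?g (Suc i) t - ?g i t)" if "t \<in> {0..real N}" for t
    unfolding dyadic_extension_def by (rule limI) (rule tendsto_uniform_limitI[OF u that])
  thus ?thesis using u by (subst uniform_limit_cong'[where g="?g"]) auto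
qed

lemma dyadic_extension_tendsto:
  assumes "dyadic_regular w" "0 \<le> t"
  shows "(\<lambda>m. step_path m (grid_values m w) t) \<longlonglongrightarrow> dyadic_extension w t"
proof -
  obtain N :: nat where "t \<le> real N" using real_arch_simple by blast
  thus ?thesis using tendsto_uniform_limitI[OF dyadic_extension_uniform[OF assms(1), of N], of t] assms(2) by simp
qed

text \<open>
  The extension is uniformly close to the step path of level \<open>m\<close>, and points at distance less
  than \<open>1/2^m\<close> lie in equal or neighbouring cells of that step path.
\<close>
lemma dyadic_extension_continuous:
  assumes w: "dyadic_regular w" shows "continuous_on {0..} (dyadic_extension w)"
proof -
  have N: "continuous_on {0..real N} (dyadic_extension w)" for N
  proof (rule uniformly_continuous_imp_continuous, unfold uniformly_continuous_on_def dist_real_def, intro allI impI)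
    fix e :: real assume e: "0 < e"
    let ?g = "\<lambda>m. step_path m (grid_values m w)"
    have 1: "\<forall>\<^sub>F m in sequentially. \<forall>t\<in>{0..real N}. dist (?g m t) (dyadic_extension w t) < e / 3"
      using uniform_limitD[OF dyadic_extension_uniform[OF w, of N], of "e / 3"] e by simp
    have 2: "\<forall>\<^sub>F m in sequentially. dyadic_osc N m w < e / 3"
      using order_tendstoD(2)[OF summable_LIMSEQ_zero, of "\<lambda>m. dyadic_osc N m w" "e / 3"] w e by (simp add: dyadic_regular_def)
    obtain m where m: "\<And>t. t \<in> {0..real N} \<Longrightarrow> \<bar>?g m t - dyadic_extension w t\<bar> < e / 3" "dyadic_osc N m w < e / 3"
      using eventually_happens'[OF sequentially_bot eventually_conj[OF 1 2]] unfolding dist_real_def by blast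
    have close: "\<bar>dyadic_extension w t - dyadic_extension w s\<bar> < e"
      if "s \<in> {0..real N}" "t \<in> {0..real N}" "s \<le> t" "t - s < 1 / 2 ^ m" for s t
    proof -
      have "\<bar>?g m t - ?g m s\<bar> < e / 3" using step_path_close[of s t N m w] that m(2) by auto
      thus ?thesis using m(1)[OF that(1)] m(1)[OF that(2)] by linarith
    qed
    show "\<exists>d>0. \<forall>x\<in>{0..real N}. \<forall>x'\<in>{0..real N}. \<bar>x' - x\<bar> < d \<longrightarrow> \<bar>dyadic_extension w x' - dyadic_extension w x\<bar> < e"
    proof (intro exI[of _ "1 / 2 ^ m"] conjI ballI impI)
      fix x x' assume x: "x \<in> {0..real N}" "x' \<in> {0..real N}" "\<bar>x' - x\<bar> < 1 / 2 ^ m"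
      show "\<bar>dyadic_extension w x' - dyadic_extension w x\<bar> < e"
      proof (cases "x \<le> x'")
        case True thus ?thesis using close[of x x'] x by auto
      next
        case False thus ?thesis using close[of x' x] x by (auto simp: abs_minus_commute)
      qed
    qed simp
  qed
  show ?thesis
  proof (rule continuous_on_eq_continuous_within[THEN iffD2], rule ballI)
    fix t :: real assume t: "t \<in> {0..}"
    obtain M :: nat where M: "t < real M" using reals_Archimedean2 by blast
    have "continuous (at t within {0..real M}) (dyadic_extension w)"
      using N[of M] t M by (auto simp: continuous_on_eq_continuous_within)
    moreover have "at t within {0..real M} = at t within {0..}"
      by (rule at_within_nhd[of t "{..<real M}"]) (use M in auto)
    ultimately show "continuous (at t within {0..}) (dyadic_extension w)" by simp
  qed
qed

lemma dyadic_extension_grid: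
  assumes w: "dyadic_regular w" shows "dyadic_extension w (real i / 2 ^ m) = w (real i / 2 ^ m)"
proof (rule LIMSEQ_unique[OF dyadic_extension_tendsto[OF w]])
  have "step_path (m + n) (grid_values (m + n) w) (real i / 2 ^ m) = w (real i / 2 ^ m)" for n
  proof -
    have "real i / 2 ^ m * 2 ^ (m + n) = real (i * 2 ^ n)" by (simp add: power_add)
    hence "nat \<lfloor>real i / 2 ^ m * 2 ^ (m + n)\<rfloor> = i * 2 ^ n" by (simp only: floor_of_nat nat_int)
    thus ?thesis by (simp add: step_path_def grid_values_def power_add)
  qed
  hence "(\<lambda>n. step_path (n + m) (grid_values (n + m) w) (real i / 2 ^ m)) \<longlonglongrightarrow> w (real i / 2 ^ m)" by (simp add: add.commute)
  thus "(\<lambda>n. step_path n (grid_values n w) (real i / 2 ^ m)) \<longlonglongrightarrow> w (real i / 2 ^ m)" by (rule LIMSEQ_offset)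
qed simp

lemma dyadic_osc_measurable [measurable]: "dyadic_osc N m \<in> borel_measurable dyadic_brownian"
  unfolding dyadic_osc_def[abs_def]
  by (intro borel_measurable_add borel_measurable_const borel_measurable_divide borel_measurable_sum
      borel_measurable_power borel_measurable_diff dyadic_brownian_coord grid_point_dyadic)

lemma dyadic_brownian_regular: "AE w in dyadic_brownian. dyadic_regular w"
  unfolding dyadic_regular_def AE_all_countable
proof
  fix N
  have i: "integrable dyadic_brownian (dyadic_osc N m)"
    and b: "(LINT w|dyadic_brownian. dyadic_osc N m w) \<le> (1 + real N * 3) * (9/10) ^ m" for m
    using dyadic_osc_integral[OF dyadic_brownian_prob, of "\<lambda>w. w" m 3 N] dyadic_brownian_fourth_moment by auto
  have "(\<integral>\<^sup>+ w. (\<Sum>m. ennreal (dyadic_osc N m w)) \<partial>dyadic_brownian) = (\<Sum>m. \<integral>\<^sup>+ w. ennreal (dyadic_osc N m w) \<partial>dyadic_brownian)"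
    by (rule nn_integral_suminf) measurable
  also have "\<dots> = (\<Sum>m. ennreal (LINT w|dyadic_brownian. dyadic_osc N m w))"
    by (intro suminf_cong nn_integral_eq_integral i) (simp add: dyadic_osc_nonneg)
  also have "\<dots> \<le> (\<Sum>m. ennreal ((1 + real N * 3) * (9/10) ^ m))"
    by (intro suminf_le ennreal_leI b) auto
  also have "\<dots> = ennreal (\<Sum>m. (1 + real N * 3) * (9/10) ^ m)"
    by (intro suminf_ennreal2 summable_mult summable_geometric) auto
  finally have "(\<integral>\<^sup>+ w. (\<Sum>m. ennreal (dyadic_osc N m w)) \<partial>dyadic_brownian) \<noteq> \<infinity>" by (auto simp: top_unique)
  hence "AE w in dyadic_brownian. (\<Sum>m. ennreal (dyadic_osc N m w)) \<noteq> \<infinity>"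
    by (intro nn_integral_PInf_AE) measurable
  thus "AE w in dyadic_brownian. summable (\<lambda>m. dyadic_osc N m w)"
  proof eventually_elim
    case (elim w)
    thus ?case by (intro summable_suminf_not_top) (auto simp: dyadic_osc_nonneg)
  qed
qed

text \<open>
  On irregular arguments the path is constant 0, so that all paths are continuous without exception.
\<close>
definition bm_path :: "(real \<Rightarrow> real) \<Rightarrow> real \<Rightarrow> real" where
  "bm_path w = (\<lambda>t\<in>{0..}. if dyadic_regular w then dyadic_extension w t else 0)"

lemma dyadic_regular_measurable [measurable]: "Measurable.pred dyadic_brownian dyadic_regular"
proof -
  have "{w \<in> space dyadic_brownian. \<forall>N. Cauchy (\<lambda>n. \<Sum>m<n. dyadic_osc N m w)} \<in> sets dyadic_brownian"
    by (intro sets.sets_Collect_countable_All sets_Collect_Cauchy borel_measurable_sum dyadic_osc_measurable)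
  moreover have "dyadic_regular w \<longleftrightarrow> (\<forall>N. Cauchy (\<lambda>n. \<Sum>m<n. dyadic_osc N m w))" for w
    unfolding dyadic_regular_def Cauchy_convergent_iff summable_iff_convergent ..
  ultimately show ?thesis by (simp add: pred_def)
qed

lemma step_path_measurable: "(\<lambda>w. step_path m (grid_values m w) t) \<in> borel_measurable dyadic_brownian"
  unfolding step_path_def grid_values_def by (intro dyadic_brownian_coord grid_point_dyadic)

lemma bm_path_random: "random_path dyadic_brownian bm_path"
  unfolding random_path_def
proof (intro conjI ballI allI impI)
  fix w
  have "continuous_on {0..} (\<lambda>t. if dyadic_regular w then dyadic_extension w t else 0)"
    by (cases "dyadic_regular w") (auto intro: dyadic_extension_continuous)
  hence "continuous_on {0..} (bm_path w)" by (rule continuous_on_eq) (simp add: bm_path_def)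
  thus "bm_path w \<in> continuous_paths" by (simp add: continuous_paths_def bm_path_def)
next
  fix t :: real assume "0 \<le> t"
  have [measurable]: "(\<lambda>w. dyadic_extension w t) \<in> borel_measurable dyadic_brownian"
    unfolding dyadic_extension_def by (intro borel_measurable_lim_metric step_path_measurable)
  have "(\<lambda>w. if dyadic_regular w then dyadic_extension w t else 0) \<in> borel_measurable dyadic_brownian" by measurable
  thus "(\<lambda>w. bm_path w t) \<in> borel_measurable dyadic_brownian" using \<open>0 \<le> t\<close> by (simp add: bm_path_def)
qed

lemma bm_path_tendsto:
  "dyadic_regular w \<Longrightarrow> 0 \<le> t \<Longrightarrow> (\<lambda>m. w (real (nat \<lfloor>t * 2 ^ m\<rfloor>) / 2 ^ m)) \<longlonglongrightarrow> bm_path w t"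
  using dyadic_extension_tendsto[of w t] by (simp add: bm_path_def step_path_def grid_values_def)

lemma bm_path_0: "AE w in dyadic_brownian. bm_path w 0 = 0"
  using dyadic_brownian_0 dyadic_brownian_regular
proof eventually_elim
  case (elim w)
  thus ?case using dyadic_extension_grid[of w 0 0] by (simp add: bm_path_def)
qed

text \<open>
  Indicators of open sets are pointwise limits of continuous functions bounded by 1.
\<close>
lemma product_formula_open:
  fixes Y :: "nat \<Rightarrow> 'b \<Rightarrow> real"
  assumes M: "prob_space M" and Y: "\<And>j. Y j \<in> borel_measurable M"
    and \<nu>: "\<And>j. real_distribution (\<nu> j)"
    and prod: "\<And>p :: nat \<Rightarrow> real \<Rightarrow> real. (\<And>j. continuous_on UNIV (p j)) \<Longrightarrow> (\<And>j x. \<bar>p j x\<bar> \<le> 1) \<Longrightarrow>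
        (LINT w|M. (\<Prod>j<k. p j (Y j w))) = (\<Prod>j<k. LINT x|\<nu> j. p j x)"
    and U: "\<And>j. open (U j)" and k: "0 < k"
  shows "measure M (\<Inter>j<k. Y j -` U j \<inter> space M) = (\<Prod>j<k. measure (\<nu> j) (U j))"
proof -
  interpret prob_space M by fact
  have "\<exists>h::nat \<Rightarrow> real \<Rightarrow> real. (\<forall>n. continuous_on UNIV (h n)) \<and> (\<forall>n x. \<bar>h n x\<bar> \<le> 1) \<and> (\<forall>x. (\<lambda>n. h n x) \<longlonglongrightarrow> indicator (U j) x)" for j
    by (rule open_indicator_limit[OF U[of j]]) blast
  then obtain h :: "nat \<Rightarrow> nat \<Rightarrow> real \<Rightarrow> real" where hc: "\<And>j n. continuous_on UNIV (h j n)"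
    and hb: "\<And>j n x. \<bar>h j n x\<bar> \<le> 1" and hl: "\<And>j x. (\<lambda>n. h j n x) \<longlonglongrightarrow> indicator (U j) x" by metis
  have hm: "h j n \<in> borel_measurable borel" for j n by (intro borel_measurable_continuous_onI hc)
  have Um: "U j \<in> sets borel" for j using U[of j] by simp
  have "(\<lambda>n. LINT w|M. (\<Prod>j<k. h j n (Y j w))) \<longlonglongrightarrow> (LINT w|M. (\<Prod>j<k. indicator (U j) (Y j w)))"
  proof (rule integral_dominated_convergence[where w="\<lambda>_. 1"])
    show "(\<lambda>w. \<Prod>j<k. indicator (U j) (Y j w) :: real) \<in> borel_measurable M"
      by (intro borel_measurable_prod measurable_compose[OF Y] borel_measurable_indicator Um)
    show "(\<lambda>w. \<Prod>j<k. h j n (Y j w)) \<in> borel_measurable M" for n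
      by (intro borel_measurable_prod measurable_compose[OF Y] hm)
    show "AE w in M. (\<lambda>n. \<Prod>j<k. h j n (Y j w)) \<longlonglongrightarrow> (\<Prod>j<k. indicator (U j) (Y j w))"
      by (intro AE_I2 tendsto_prod hl)
    show "AE w in M. norm (\<Prod>j<k. h j n (Y j w)) \<le> 1" for n
      by (intro AE_I2) (auto simp: abs_prod intro!: prod_le_1 hb)
  qed simp
  moreover have "(\<lambda>n. \<Prod>j<k. LINT x|\<nu> j. h j n x) \<longlonglongrightarrow> (\<Prod>j<k. LINT x|\<nu> j. indicator (U j) x)"
  proof (rule tendsto_prod)
    fix j
    interpret N: real_distribution "\<nu> j" by (rule \<nu>)
    show "(\<lambda>n. LINT x|\<nu> j. h j n x) \<longlonglongrightarrow> (LINT x|\<nu> j. indicator (U j) x)"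
      by (rule integral_dominated_convergence[where w="\<lambda>_. 1"]) (use hm hl hb Um in auto)
  qed
  ultimately have e: "(LINT w|M. (\<Prod>j<k. indicat_real (U j) (Y j w))) = (\<Prod>j<k. LINT x|\<nu> j. indicat_real (U j) x)"
    unfolding prod[of "\<lambda>j. h j _", OF hc hb] by (rule LIMSEQ_unique)
  have ie: "(\<Prod>j<k. indicator (U j) (Y j w)) = (indicator (\<Inter>j<k. Y j -` U j \<inter> space M) w :: real)" if "w \<in> space M" for w
  proof (cases "\<forall>j<k. Y j w \<in> U j")
    case True
    have "(\<Prod>j<k. indicator (U j) (Y j w)) = (\<Prod>j<k. 1 :: real)" using True by (intro prod.cong) auto
    thus ?thesis using True that by simp
  next
    case False
    then obtain i where "i < k" "Y i w \<notin> U i" by blast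
    hence "(\<Prod>j<k. indicator (U j) (Y j w)) = (0::real)" by (intro prod_zero) (auto intro!: bexI[of _ i])
    moreover have "w \<notin> (\<Inter>j<k. Y j -` U j \<inter> space M)" using \<open>i < k\<close> \<open>Y i w \<notin> U i\<close> by blast
    ultimately show ?thesis by simp
  qed
  have "(LINT w|M. (\<Prod>j<k. indicat_real (U j) (Y j w))) = (LINT w|M. indicator (\<Inter>j<k. Y j -` U j \<inter> space M) w)"
    by (rule Bochner_Integration.integral_cong[OF refl ie])
  also have "\<dots> = measure M (\<Inter>j<k. Y j -` U j \<inter> space M)"
  proof -
    have "(\<Inter>j<k. Y j -` U j \<inter> space M) \<in> sets M"
      using k by (intro sets.finite_INT measurable_sets[OF Y] Um) auto
    thus ?thesis by simp
  qed
  finally have "measure M (\<Inter>j<k. Y j -` U j \<inter> space M) = (\<Prod>j<k. LINT x|\<nu> j. indicator (U j) x)" using e by simp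
  also have "\<dots> = (\<Prod>j<k. measure (\<nu> j) (U j))"
  proof (rule prod.cong)
    fix j
    interpret N: real_distribution "\<nu> j" by (rule \<nu>)
    show "(LINT x|\<nu> j. indicator (U j) x) = measure (\<nu> j) (U j)" using Um by simp
  qed simp
  finally show ?thesis .
qed

lemma open_sets_distr_eq:
  assumes M: "prob_space M" and Y: "Y \<in> borel_measurable M" and \<nu>: "real_distribution \<nu>"
    and e: "\<And>U. open (U :: real set) \<Longrightarrow> measure M (Y -` U \<inter> space M) = measure \<nu> U"
  shows "distr M borel Y = \<nu>"
proof (rule measure_eqI_generator_eq[where E="{U. open U}" and \<Omega>=UNIV and A="\<lambda>_. UNIV"])
  interpret prob_space M by fact
  interpret N: real_distribution \<nu> by fact
  show "Int_stable {U :: real set. open U}" by (auto simp: Int_stable_def)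
  show "sets (distr M borel Y) = sigma_sets UNIV {U. open U}" "sets \<nu> = sigma_sets UNIV {U. open U}"
    by (simp_all add: borel_def)
  fix U :: "real set" assume "U \<in> {U. open U}"
  hence U: "open U" by simp
  have "emeasure (distr M borel Y) U = emeasure M (Y -` U \<inter> space M)" using Y U by (intro emeasure_distr) auto
  thus "emeasure (distr M borel Y) U = emeasure \<nu> U" using e[OF U] by (simp add: emeasure_eq_measure N.emeasure_eq_measure)
qed (use prob_space.emeasure_space_1[OF prob_space.prob_space_distr[OF M Y]] in auto)

text \<open>
  The open sets are stable under intersection and generate the Borel sets, so the product formula for them
  gives both the marginals and the independence.
\<close>
lemma product_formula_indep:
  fixes Y :: "nat \<Rightarrow> 'b \<Rightarrow> real"
  assumes M: "prob_space M" and Y: "\<And>j. Y j \<in> borel_measurable M"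
    and \<nu>: "\<And>j. real_distribution (\<nu> j)"
    and prod: "\<And>p :: nat \<Rightarrow> real \<Rightarrow> real. (\<And>j. continuous_on UNIV (p j)) \<Longrightarrow> (\<And>j x. \<bar>p j x\<bar> \<le> 1) \<Longrightarrow>
        (LINT w|M. (\<Prod>j<k. p j (Y j w))) = (\<Prod>j<k. LINT x|\<nu> j. p j x)"
  shows "j < k \<Longrightarrow> distr M borel (Y j) = \<nu> j" and "prob_space.indep_vars M (\<lambda>_. borel) Y {..<k}"
proof -
  interpret prob_space M by fact
  note open' = product_formula_open[OF M Y \<nu> prod]
  have one: "measure M (Y j -` U \<inter> space M) = measure (\<nu> j) U" if j: "j < k" and U: "open U" for j U
  proof -
    have k: "0 < k" using j by simp
    have N1: "measure (\<nu> i) UNIV = 1" for i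
    proof -
      interpret N: real_distribution "\<nu> i" by (rule \<nu>)
      show ?thesis using N.prob_space by simp
    qed
    define V where "V i = (if i = j then U else UNIV)" for i
    have "measure M (\<Inter>i<k. Y i -` V i \<inter> space M) = (\<Prod>i<k. measure (\<nu> i) (V i))"
      using U k by (intro open') (auto simp: V_def)
    also have "(\<Inter>i<k. Y i -` V i \<inter> space M) = Y j -` U \<inter> space M" using j by (auto simp: V_def split: if_splits)
    also have "(\<Prod>i<k. measure (\<nu> i) (V i)) = (\<Prod>i<k. if i = j then measure (\<nu> j) U else 1)"
      by (intro prod.cong) (auto simp: V_def N1)
    also have "\<dots> = measure (\<nu> j) U" using j by simp
    finally show ?thesis .
  qed
  show "j < k \<Longrightarrow> distr M borel (Y j) = \<nu> j" by (intro open_sets_distr_eq M Y \<nu> one)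
  show "indep_vars (\<lambda>_. borel) Y {..<k}"
  proof (cases "k = 0")
    case True
    thus ?thesis by (simp add: indep_vars_def2 indep_sets_def)
  next
    case False
    have "\<forall>A\<in>(\<Pi> i\<in>{..<k}. {U. open U}). prob (\<Inter>j\<in>{..<k}. Y j -` A j \<inter> space M) = (\<Prod>j\<in>{..<k}. prob (Y j -` A j \<inter> space M))"
    proof
      fix A assume A: "A \<in> (\<Pi> i\<in>{..<k}. {U :: real set. open U})"
      define V where "V i = (if i < k then A i else UNIV)" for i
      have V: "open (V i)" for i using A by (auto simp: V_def)
      have "prob (\<Inter>j\<in>{..<k}. Y j -` A j \<inter> space M) = prob (\<Inter>j<k. Y j -` V j \<inter> space M)"
        by (intro arg_cong[where f=prob] INF_cong) (auto simp: V_def)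
      also have "\<dots> = (\<Prod>j<k. measure (\<nu> j) (V j))" using False by (intro open' V) auto
      also have "\<dots> = (\<Prod>j<k. prob (Y j -` A j \<inter> space M))"
      proof (intro prod.cong refl)
        fix i assume "i \<in> {..<k}"
        hence i: "i < k" "V i = A i" by (auto simp: V_def)
        show "measure (\<nu> i) (V i) = prob (Y i -` A i \<inter> space M)" using one[OF i(1) V[of i]] unfolding i(2) by (rule sym)
      qed
      finally show "prob (\<Inter>j\<in>{..<k}. Y j -` A j \<inter> space M) = (\<Prod>j\<in>{..<k}. prob (Y j -` A j \<inter> space M))" .
    qed
    moreover have "sets borel = sigma_sets (space borel) {U :: real set. open U}" by (simp add: borel_def)
    ultimately show ?thesis using False
      by (subst indep_vars_finite[where E="\<lambda>_. {U. open U}"]) (assumption | auto simp: Y Int_stable_def)+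
  qed
qed

lemma centred_normal_integral:
  "0 \<le> v \<Longrightarrow> h \<in> borel_measurable borel \<Longrightarrow> (LINT x|centred_normal v. (h x :: real)) = (LINT x|std_normal_distribution. h (sqrt v * x))"
  by (subst centred_normal_eq) (auto intro: integral_distr)

lemma centred_normal_integral_tendsto:
  fixes h :: "real \<Rightarrow> real"
  assumes h: "continuous_on UNIV h" "\<And>x. \<bar>h x\<bar> \<le> B" and v: "\<And>n. 0 \<le> v n" "v \<longlonglongrightarrow> l"
  shows "(\<lambda>n. LINT x|centred_normal (v n). h x) \<longlonglongrightarrow> (LINT x|centred_normal l. h x)"
proof -
  interpret real_distribution std_normal_distribution by (rule real_dist_normal_dist)
  have l: "0 \<le> l" using v by (intro LIMSEQ_le_const[OF v(2)]) auto
  have hm [measurable]: "h \<in> borel_measurable borel" by (intro borel_measurable_continuous_onI h)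
  have "(\<lambda>n. LINT x|std_normal_distribution. h (sqrt (v n) * x)) \<longlonglongrightarrow> (LINT x|std_normal_distribution. h (sqrt l * x))"
  proof (rule integral_dominated_convergence[where w="\<lambda>_. B"])
    show "AE x in std_normal_distribution. (\<lambda>n. h (sqrt (v n) * x)) \<longlonglongrightarrow> h (sqrt l * x)"
      by (intro AE_I2 continuous_on_tendsto_compose[OF h(1)] tendsto_intros v) auto
  qed (use h(2) in auto)
  thus ?thesis by (simp add: centred_normal_integral v(1) l)
qed

definition dyadic_floor :: "nat \<Rightarrow> real \<Rightarrow> nat" where "dyadic_floor n t = nat \<lfloor>t * 2 ^ n\<rfloor>"

lemma dyadic_floor_mono: "s \<le> t \<Longrightarrow> dyadic_floor n s \<le> dyadic_floor n t"
  unfolding dyadic_floor_def by (intro nat_mono floor_mono mult_right_mono) auto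

lemma dyadic_floor_tendsto:
  assumes "0 \<le> t" shows "(\<lambda>n. real (dyadic_floor n t) / 2 ^ n) \<longlonglongrightarrow> t"
proof (rule tendsto_sandwich[of "\<lambda>n. t - (1/2) ^ n" _ _ "\<lambda>_. t"])
  have f: "real (dyadic_floor n t) = of_int \<lfloor>t * 2 ^ n\<rfloor>" for n using assms by (simp add: dyadic_floor_def)
  have "t * 2 ^ n - 1 \<le> real (dyadic_floor n t)" for n unfolding f by linarith
  hence "(t * 2 ^ n - 1) / 2 ^ n \<le> real (dyadic_floor n t) / 2 ^ n" for n by (intro divide_right_mono) auto
  thus "\<forall>\<^sub>F n in sequentially. t - (1/2) ^ n \<le> real (dyadic_floor n t) / 2 ^ n"
    by (simp add: diff_divide_distrib power_one_over)
  have "real (dyadic_floor n t) \<le> t * 2 ^ n" for n unfolding f by linarith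
  thus "\<forall>\<^sub>F n in sequentially. real (dyadic_floor n t) / 2 ^ n \<le> t" by (simp add: field_simps)
  have "(\<lambda>n. t - (1/2) ^ n) \<longlonglongrightarrow> t - 0" by (intro tendsto_intros LIMSEQ_realpow_zero) auto
  thus "(\<lambda>n. t - (1/2) ^ n) \<longlonglongrightarrow> t" by simp
qed simp

text \<open>
  On the grid of level \<open>n\<close> the increments are sums of standard normals over disjoint index sets.
\<close>
lemma dyadic_increments_product:
  fixes p :: "nat \<Rightarrow> real \<Rightarrow> real"
  assumes v: "0 \<le> v" and q: "mono q" and p: "\<And>j. continuous_on UNIV (p j)" "\<And>j x. \<bar>p j x\<bar> \<le> 1"
  shows "(LINT w|dyadic_brownian. (\<Prod>j<k. p j (sqrt v * (w (real (q (Suc j)) / 2 ^ n) - w (real (q j) / 2 ^ n)))))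
    = (\<Prod>j<k. LINT x|centred_normal (v * (real (q (Suc j)) / 2 ^ n - real (q j) / 2 ^ n)). p j x)"
proof -
  define J where "J = (\<lambda>j. real (q j) / 2 ^ n) ` {..k}"
  define F where "F y = (\<Prod>j<k. p j (sqrt v * (y (real (q (Suc j)) / 2 ^ n) - y (real (q j) / 2 ^ n))))" for y
  define c where "c = sqrt v / sqrt (2 ^ n)"
  define A where "A j = {q j..<q (Suc j)}" for j
  have pm [measurable]: "p j \<in> borel_measurable borel" for j by (intro borel_measurable_continuous_onI p)
  have J: "finite J" "J \<subseteq> dyadic_grid n" by (auto simp: J_def grid_point)
  have inJ: "real (q j) / 2 ^ n \<in> J" if "j \<le> k" for j using that by (auto simp: J_def)
  have F: "F \<in> borel_measurable (Pi\<^sub>M J (\<lambda>_. borel))" unfolding F_def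
    by (intro borel_measurable_prod measurable_compose[OF _ pm] borel_measurable_times borel_measurable_diff
        measurable_component_singleton borel_measurable_const inJ) auto
  have qm: "q j \<le> q (Suc j)" for j using q by (simp add: monoD)
  have gw: "sqrt v * (grid_walk n x (real (q (Suc j)) / 2 ^ n) - grid_walk n x (real (q j) / 2 ^ n)) = c * (\<Sum>i\<in>A j. x i)" for x j
  proof -
    have "(\<Sum>i<q (Suc j). x i) = (\<Sum>i<q j. x i) + (\<Sum>i\<in>A j. x i)"
      unfolding A_def using qm[of j] by (metis sum.atLeastLessThan_concat lessThan_atLeast0 zero_le)
    thus ?thesis by (simp add: grid_walk_grid c_def algebra_simps diff_divide_distrib add_divide_distrib)
  qed
  have c2: "c\<^sup>2 * real (card (A j)) = v * (real (q (Suc j)) / 2 ^ n - real (q j) / 2 ^ n)" for j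
    using v qm[of j] by (simp add: c_def A_def power_divide of_nat_diff diff_divide_distrib right_diff_distrib)
  have dis: "disjoint_family_on A {..<k}" unfolding disjoint_family_on_def
  proof (intro ballI impI)
    fix i j :: nat assume "i \<noteq> j"
    have "A i \<inter> A j = {}" if "i < j" for i j :: nat
    proof -
      have "q (Suc i) \<le> q j" using q that by (intro monoD[OF q]) simp
      thus ?thesis by (auto simp: A_def)
    qed
    thus "A i \<inter> A j = {}" using \<open>i \<noteq> j\<close> by (metis linorder_neqE_nat Int_commute)
  qed
  have "(LINT w|dyadic_brownian. F w) = (LINT w|dyadic_brownian. F (restrict w J))"
    by (intro Bochner_Integration.integral_cong) (auto simp: F_def inJ intro!: prod.cong)
  also have "\<dots> = (LINT x|gauss_seq. F (\<lambda>d\<in>J. grid_walk n x d))" by (rule dyadic_brownian_integral[OF J F])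
  also have "\<dots> = (LINT x|gauss_seq. (\<Prod>j<k. p j (c * (\<Sum>i\<in>A j. x i))))"
    by (intro Bochner_Integration.integral_cong) (auto simp: F_def inJ gw intro!: prod.cong)
  also have "\<dots> = (\<Prod>j<k. LINT x|gauss_seq. p j (c * (\<Sum>i\<in>A j. x i)))"
  proof (rule G.indep_vars_lebesgue_integral)
    show "G.indep_vars (\<lambda>_. borel) (\<lambda>j x. p j (c * (\<Sum>i\<in>A j. x i))) {..<k}"
      by (rule G.indep_vars_compose2[OF gaussian_block_indep[OF dis]]) (auto simp: A_def)
    show "integrable gauss_seq (\<lambda>x. p j (c * (\<Sum>i\<in>A j. x i)))" for j
      by (rule G.integrable_const_bound[of _ 1]) (use p(2) in auto)
  qed simp
  also have "\<dots> = (\<Prod>j<k. LINT x|centred_normal (v * (real (q (Suc j)) / 2 ^ n - real (q j) / 2 ^ n)). p j x)"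
  proof (intro prod.cong refl)
    fix j
    have "centred_normal (v * (real (q (Suc j)) / 2 ^ n - real (q j) / 2 ^ n)) = distr gauss_seq borel (\<lambda>x. c * (\<Sum>i\<in>A j. x i))"
      unfolding c2[symmetric] by (rule gaussian_sum_law[symmetric]) (simp add: A_def)
    thus "(LINT x|gauss_seq. p j (c * (\<Sum>i\<in>A j. x i))) = (LINT x|centred_normal (v * (real (q (Suc j)) / 2 ^ n - real (q j) / 2 ^ n)). p j x)"
      by (simp add: integral_distr)
  qed
  finally show ?thesis by (simp add: F_def)
qed

lemma bm_path_measurable: "0 \<le> t \<Longrightarrow> (\<lambda>w. bm_path w t) \<in> borel_measurable dyadic_brownian"
  using bm_path_random by (simp add: random_path_def)

text \<open>
  Round the times down to the grid of level \<open>n\<close> and let \<open>n\<close> grow: the left-hand side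
  converges because the path is the limit of its step approximations, the right-hand side because normal laws
  depend continuously on the variance.
\<close>
lemma bm_increments_product:
  fixes p :: "nat \<Rightarrow> real \<Rightarrow> real"
  assumes v: "0 \<le> v" and \<tau>: "0 \<le> \<tau> 0" "mono \<tau>" and p: "\<And>j. continuous_on UNIV (p j)" "\<And>j x. \<bar>p j x\<bar> \<le> 1"
  shows "(LINT w|dyadic_brownian. (\<Prod>j<k. p j (sqrt v * (bm_path w (\<tau> (Suc j)) - bm_path w (\<tau> j)))))
    = (\<Prod>j<k. LINT x|centred_normal (v * (\<tau> (Suc j) - \<tau> j)). p j x)"
proof (rule LIMSEQ_unique)
  interpret prob_space dyadic_brownian by (rule dyadic_brownian_prob)
  have \<tau>0: "0 \<le> \<tau> j" for j using order_trans[OF \<tau>(1) monoD[OF \<tau>(2), of 0 j]] by simp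
  have pm [measurable]: "p j \<in> borel_measurable borel" for j by (intro borel_measurable_continuous_onI p)
  let ?I = "\<lambda>n w. \<Prod>j<k. p j (sqrt v * (w (real (dyadic_floor n (\<tau> (Suc j))) / 2 ^ n) - w (real (dyadic_floor n (\<tau> j)) / 2 ^ n)))"
  show "(\<lambda>n. LINT w|dyadic_brownian. ?I n w) \<longlonglongrightarrow> (LINT w|dyadic_brownian. (\<Prod>j<k. p j (sqrt v * (bm_path w (\<tau> (Suc j)) - bm_path w (\<tau> j)))))"
  proof (rule integral_dominated_convergence[where w="\<lambda>_. 1"])
    show "(\<lambda>w. \<Prod>j<k. p j (sqrt v * (bm_path w (\<tau> (Suc j)) - bm_path w (\<tau> j)))) \<in> borel_measurable dyadic_brownian"
      by (intro borel_measurable_prod measurable_compose[OF _ pm] borel_measurable_times borel_measurable_diff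
          borel_measurable_const bm_path_measurable \<tau>0)
    show "?I n \<in> borel_measurable dyadic_brownian" for n
      by (intro borel_measurable_prod measurable_compose[OF _ pm] borel_measurable_times borel_measurable_diff
          borel_measurable_const dyadic_brownian_coord grid_point_dyadic)
    show "AE w in dyadic_brownian. (\<lambda>n. ?I n w) \<longlonglongrightarrow> (\<Prod>j<k. p j (sqrt v * (bm_path w (\<tau> (Suc j)) - bm_path w (\<tau> j))))"
      using dyadic_brownian_regular
    proof eventually_elim
      case (elim w)
      show ?case
        by (intro tendsto_prod continuous_on_tendsto_compose[OF p(1)] tendsto_intros
            bm_path_tendsto[OF elim \<tau>0, folded dyadic_floor_def]) auto
    qed
    show "AE w in dyadic_brownian. norm (?I n w) \<le> 1" for n
      by (intro AE_I2) (auto simp: abs_prod intro!: prod_le_1 p(2))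
  qed simp
  have q: "mono (\<lambda>j. dyadic_floor n (\<tau> j))" for n
    by (intro monoI dyadic_floor_mono monoD[OF \<tau>(2)])
  have m: "real (dyadic_floor n (\<tau> j)) / 2 ^ n \<le> real (dyadic_floor n (\<tau> (Suc j))) / 2 ^ n" for n j
    using monoD[OF q[of n], of j "Suc j"] by (intro divide_right_mono) auto
  show "(\<lambda>n. LINT w|dyadic_brownian. ?I n w) \<longlonglongrightarrow> (\<Prod>j<k. LINT x|centred_normal (v * (\<tau> (Suc j) - \<tau> j)). p j x)"
    unfolding dyadic_increments_product[OF v q p]
    by (intro tendsto_prod centred_normal_integral_tendsto[OF p] tendsto_intros dyadic_floor_tendsto \<tau>0 mult_nonneg_nonneg v)
      (use m in auto)
qed

theorem brownian_motion_exists: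
  assumes v: "0 \<le> v" shows "\<exists>W. brownian_motion_law v W"
proof -
  interpret D: prob_space dyadic_brownian by (rule dyadic_brownian_prob)
  define X where "X w = (\<lambda>t\<in>{0..}. sqrt v * bm_path w t)" for w
  have X: "random_path dyadic_brownian X" unfolding random_path_def
  proof (intro conjI ballI allI impI)
    fix w assume "w \<in> space dyadic_brownian"
    hence "continuous_on {0..} (bm_path w)" using bm_path_random by (simp add: random_path_def continuous_paths_cont)
    hence "continuous_on {0..} (\<lambda>t. sqrt v * bm_path w t)" by (intro continuous_intros)
    hence "continuous_on {0..} (X w)" by (rule continuous_on_eq) (simp add: X_def)
    thus "X w \<in> continuous_paths" by (simp add: continuous_paths_def X_def)
  next
    fix t :: real assume "0 \<le> t"
    thus "(\<lambda>w. X w t) \<in> borel_measurable dyadic_brownian" using bm_path_measurable[of t] by (simp add: X_def)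
  qed
  define W where "W = distr dyadic_brownian (borel_of continuous_path_topology) X"
  have Xm: "X \<in> dyadic_brownian \<rightarrow>\<^sub>M borel_of continuous_path_topology" by (rule random_path_measurable[OF X])
  have Ws: "sets W = sets (borel_of continuous_path_topology)" by (simp add: W_def)
  interpret W: prob_space W unfolding W_def by (rule D.prob_space_distr[OF Xm])
  have coord: "(\<lambda>w. w t) \<in> borel_measurable (borel_of continuous_path_topology)" if "0 \<le> t" for t :: real
    using coordinate_continuous_map that by (intro continuous_map_borel_measurable)
  have inc: "(\<forall>j<k. distr W borel (\<lambda>w. w (\<tau> (Suc j)) - w (\<tau> j)) = centred_normal (v * (\<tau> (Suc j) - \<tau> j))) \<and>
      W.indep_vars (\<lambda>_. borel) (\<lambda>i w. w (\<tau> (Suc i)) - w (\<tau> i)) {..<k}"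
    if \<tau>: "0 \<le> \<tau> 0" "mono \<tau>" for \<tau> :: "nat \<Rightarrow> real" and k
  proof -
    have \<tau>0: "0 \<le> \<tau> j" for j using order_trans[OF \<tau>(1) monoD[OF \<tau>(2), of 0 j]] by simp
    have Ym': "(\<lambda>w. w (\<tau> (Suc j)) - w (\<tau> j)) \<in> borel_measurable (borel_of continuous_path_topology)" for j
      by (intro borel_measurable_diff coord \<tau>0)
    have Ym: "(\<lambda>w. w (\<tau> (Suc j)) - w (\<tau> j)) \<in> borel_measurable W" for j
      using Ym' by (subst measurable_cong_sets[OF Ws refl])
    have nd: "real_distribution (centred_normal (v * (\<tau> (Suc j) - \<tau> j)))" for j
      using v monoD[OF \<tau>(2), of j "Suc j"] by (intro centred_normal_distribution) auto
    have prod: "(LINT w|W. (\<Prod>j<k. p j (w (\<tau> (Suc j)) - w (\<tau> j)))) = (\<Prod>j<k. LINT x|centred_normal (v * (\<tau> (Suc j) - \<tau> j)). p j x)"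
      if p: "\<And>j. continuous_on UNIV (p j)" "\<And>j x. \<bar>p j x\<bar> \<le> 1" for p :: "nat \<Rightarrow> real \<Rightarrow> real"
    proof -
      have pm: "p j \<in> borel_measurable borel" for j by (intro borel_measurable_continuous_onI p)
      have "(LINT w|W. (\<Prod>j<k. p j (w (\<tau> (Suc j)) - w (\<tau> j)))) = (LINT w|dyadic_brownian. (\<Prod>j<k. p j (X w (\<tau> (Suc j)) - X w (\<tau> j))))"
        unfolding W_def by (intro integral_distr Xm borel_measurable_prod measurable_compose[OF Ym' pm])
      also have "\<dots> = (LINT w|dyadic_brownian. (\<Prod>j<k. p j (sqrt v * (bm_path w (\<tau> (Suc j)) - bm_path w (\<tau> j)))))"
        by (simp add: X_def \<tau>0 right_diff_distrib)
      also have "\<dots> = (\<Prod>j<k. LINT x|centred_normal (v * (\<tau> (Suc j) - \<tau> j)). p j x)"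
        by (rule bm_increments_product[OF v \<tau> p])
      finally show ?thesis .
    qed
    show ?thesis using product_formula_indep[where Y="\<lambda>j w. w (\<tau> (Suc j)) - w (\<tau> j)", OF W.prob_space_axioms Ym nd prod] by simp
  qed
  have "brownian_motion_law v W" unfolding brownian_motion_law_def
  proof (intro conjI allI impI)
    show "prob_space W" by (rule W.prob_space_axioms)
    show "sets W = sets (borel_of continuous_path_topology)" by (rule Ws)
    have "AE w in dyadic_brownian. X w 0 = 0" using bm_path_0 by eventually_elim (simp add: X_def)
    moreover have "{w \<in> space (borel_of continuous_path_topology). w 0 = 0} \<in> sets (borel_of continuous_path_topology)"
      using coord[of 0] by measurable
    ultimately show "AE w in W. w 0 = 0" unfolding W_def by (subst AE_distr_iff[OF Xm]) auto
    show "W.indep_vars (\<lambda>_. borel) (\<lambda>i w. w (\<tau> (Suc i)) - w (\<tau> i)) {..<k}" if "0 \<le> \<tau> 0 \<and> mono \<tau>" for \<tau> :: "nat \<Rightarrow> real" and k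
      using inc that by blast
    show "distr W borel (\<lambda>w. w t - w s) = centred_normal (v * (t - s))" if st: "0 \<le> s \<and> s < t" for s t
    proof -
      define \<tau> where "\<tau> j = (if j = 0 then s else t)" for j :: nat
      have "0 \<le> \<tau> 0" "mono \<tau>" using st by (auto simp: \<tau>_def mono_def)
      from conjunct1[OF inc[OF this, of 1]] show ?thesis by (simp add: \<tau>_def)
    qed
  qed
  thus ?thesis by blast
qed

lemma indep_vars_coord_lipschitz:
  fixes E :: "nat \<Rightarrow> 'b \<Rightarrow> real"
  assumes W: "prob_space W" and ind: "prob_space.indep_vars W (\<lambda>_. borel) E {..<Suc i}"
    and p: "coord_lipschitz i L p" "\<And>x. \<bar>p x\<bar> \<le> B" and h: "bdd_lipschitz h"
  shows "(LINT w|W. p (\<lambda>j. E j w) * h (E i w)) = (LINT w|W. p (\<lambda>j. E j w)) * (LINT w|W. h (E i w))"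
proof -
  interpret prob_space W by fact
  define u where "u y = p (\<lambda>j. if j < i then y j else 0)" for y :: "nat \<Rightarrow> real"
  have Em: "E j \<in> borel_measurable W" if "j < Suc i" for j using ind that by (auto simp: indep_vars_def)
  have um: "u \<in> borel_measurable (Pi\<^sub>M {..<i} (\<lambda>_. borel))" unfolding u_def
  proof (intro measurable_compose[OF _ coord_lipschitz_measurable[OF p(1)]] measurable_coordinatewise_then_product)
    fix j
    show "(\<lambda>y. if j < i then y j else 0) \<in> borel_measurable (Pi\<^sub>M {..<i} (\<lambda>_. borel :: real measure))"
      by (cases "j < i") auto
  qed
  have hm: "(\<lambda>y. h (y i)) \<in> borel_measurable (Pi\<^sub>M {i} (\<lambda>_. borel))"
    by (intro measurable_compose[OF _ bdd_lipschitz_measurable[OF h]]) measurable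
  obtain Bh where Bh: "\<And>x. \<bar>h x\<bar> \<le> Bh" using h by (auto simp: bdd_lipschitz_def)
  have "indep_var (Pi\<^sub>M {..<i} (\<lambda>_. borel)) (\<lambda>w. restrict (\<lambda>j. E j w) {..<i}) (Pi\<^sub>M {i} (\<lambda>_. borel)) (\<lambda>w. restrict (\<lambda>j. E j w) {i})"
    by (rule indep_var_restrict[OF ind]) auto
  hence "indep_var borel (u \<circ> (\<lambda>w. restrict (\<lambda>j. E j w) {..<i})) borel ((\<lambda>y. h (y i)) \<circ> (\<lambda>w. restrict (\<lambda>j. E j w) {i}))"
    by (rule indep_var_compose[OF _ um hm])
  moreover have "u \<circ> (\<lambda>w. restrict (\<lambda>j. E j w) {..<i}) = (\<lambda>w. p (\<lambda>j. E j w))"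
    by (auto simp: fun_eq_iff u_def intro!: coord_lipschitz_local[OF p(1)])
  moreover have "(\<lambda>y. h (y i)) \<circ> (\<lambda>w. restrict (\<lambda>j. E j w) {i}) = (\<lambda>w. h (E i w))" by (simp add: fun_eq_iff)
  ultimately have iv: "indep_var borel (\<lambda>w. p (\<lambda>j. E j w)) borel (\<lambda>w. h (E i w))" by simp
  show ?thesis
  proof (rule indep_var_lebesgue_integral[OF iv])
    show "integrable W (\<lambda>w. p (\<lambda>j. E j w))"
      by (rule integrable_const_bound[of _ B]) (use p(2) indep_var_rv1[OF iv] in auto)
    show "integrable W (\<lambda>w. h (E i w))"
      by (rule integrable_const_bound[of _ Bh]) (use Bh indep_var_rv2[OF iv] in auto)
  qed
qed

section \<open>The rescaled additive functional\<close>

text \<open>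
  A stationary Markov process whose transition operators decay exponentially in
  \<open>L\<^sup>1(\<nu>)\<close>. The constant \<open>K\<close> is taken positive because it serves as a
  scale in \<open>mixing_sequence\<close>.
\<close>
locale mixing_functional =
  fixes P :: "'a::polish_space \<Rightarrow> (real \<Rightarrow> 'a) measure" and \<nu> :: "'a measure" and f :: "'a \<Rightarrow> real"
    and C \<delta> K :: real
  assumes process: "markov_process P" and inv: "invariant_distribution P \<nu>"
    and C: "0 \<le> C" and \<delta>: "0 < \<delta>" and K: "0 < K"
    and decay: "\<And>h t. h \<in> borel_measurable borel \<Longrightarrow> (\<And>x. \<bar>h x\<bar> \<le> 1) \<Longrightarrow> 0 \<le> t \<Longrightarrow>
      (LINT x|\<nu>. \<bar>transition P t h x - (LINT x|\<nu>. h x)\<bar>) \<le> C * exp (- \<delta> * t)"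
    and f: "continuous_on UNIV f" and centred: "\<And>x. \<bar>f x - (LINT x|\<nu>. f x)\<bar> \<le> K"
begin

abbreviation "Q \<equiv> law_from P \<nu>"

sublocale Q: prob_space Q by (rule law_prob[OF process inv])

definition fc :: "'a \<Rightarrow> real" where "fc x = f x - (LINT x|\<nu>. f x)"

definition J :: "real \<Rightarrow> real \<Rightarrow> (real \<Rightarrow> 'a) \<Rightarrow> real" where
  "J a b w = integral {a..b} (\<lambda>s. fc (w s))"

lemma fc_continuous: "continuous_on UNIV fc" unfolding fc_def by (intro continuous_intros f)
lemma fc_bound: "\<bar>fc x\<bar> \<le> K" using centred by (simp add: fc_def)
lemma fc_measurable [measurable]: "fc \<in> borel_measurable borel" by (intro borel_measurable_continuous_onI fc_continuous)

lemma path_rc: "w \<in> space path_space \<Longrightarrow> rc_on (\<lambda>s. fc (w s)) K"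
  by (rule path_rc_on[OF process _ fc_continuous fc_bound])

lemma rsum_past_measurable:
  assumes "0 \<le> a" "a \<le> b" "b \<le> t"
  shows "(\<lambda>w. rsum (\<lambda>s. fc (w s)) a (b - a) N) \<in> borel_measurable (past t)"
  unfolding rsum_def
proof (intro borel_measurable_sum borel_measurable_times borel_measurable_const measurable_compose[OF _ fc_measurable] past_evaluation)
  fix l assume l: "l \<in> {..<Suc N}"
  have "(b - a) * real (Suc l) \<le> (b - a) * real (Suc N)" using l assms by (intro mult_left_mono) auto
  hence "(b - a) * real (Suc l) / real (Suc N) \<le> b - a" by (simp add: divide_le_eq)
  thus "a + (b - a) * real (Suc l) / real (Suc N) \<le> t" using assms by linarith
  show "0 \<le> a + (b - a) * real (Suc l) / real (Suc N)" using assms by (intro add_nonneg_nonneg divide_nonneg_nonneg mult_nonneg_nonneg) auto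
qed

lemma J_limit: "w \<in> space path_space \<Longrightarrow> 0 \<le> a \<Longrightarrow> a \<le> b \<Longrightarrow> (\<lambda>N. rsum (\<lambda>s. fc (w s)) a (b - a) N) \<longlonglongrightarrow> J a b w"
  using rsum_tendsto[OF path_rc, of w a "b - a"] by (simp add: J_def)

text \<open>
  A limit of Riemann sums, whose nodes lie in \<open>{0..t}\<close>.
\<close>
lemma J_past_measurable:
  assumes "0 \<le> a" "a \<le> b" "b \<le> t" shows "J a b \<in> borel_measurable (past t)"
proof (rule borel_measurable_LIMSEQ_real)
  show "(\<lambda>w. rsum (\<lambda>s. fc (w s)) a (b - a) N) \<in> borel_measurable (past t)" for N
    by (rule rsum_past_measurable[OF assms])
qed (use J_limit assms in \<open>auto simp: space_past\<close>)

lemma J_path_measurable: "0 \<le> a \<Longrightarrow> a \<le> b \<Longrightarrow> J a b \<in> borel_measurable path_space"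
  by (rule past_measurable_path_space[OF J_past_measurable]) auto

lemma law_measurable: "(F \<in> Q \<rightarrow>\<^sub>M N) = (F \<in> path_space \<rightarrow>\<^sub>M N)"
  by (rule arg_cong[OF measurable_cong_sets[OF law_sets[OF process inv] refl]])

lemma J_measurable: "0 \<le> a \<Longrightarrow> a \<le> b \<Longrightarrow> J a b \<in> borel_measurable Q"
  by (simp add: law_measurable J_path_measurable)

lemma J_bound: "w \<in> space path_space \<Longrightarrow> 0 \<le> a \<Longrightarrow> a \<le> b \<Longrightarrow> \<bar>J a b w\<bar> \<le> K * (b - a)"
  unfolding J_def by (rule rc_on_integral_bound[OF path_rc])

lemma J_combine: "w \<in> space path_space \<Longrightarrow> 0 \<le> a \<Longrightarrow> a \<le> b \<Longrightarrow> b \<le> c \<Longrightarrow> J a b w + J b c w = J a c w"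
  unfolding J_def by (rule rc_on_integral_combine[OF path_rc])

lemma J_shift:
  assumes "w \<in> space path_space" "0 \<le> c" "0 \<le> a" "a \<le> b"
  shows "J a b (time_shift c w) = J (c + a) (c + b) w"
proof -
  have "J a b (time_shift c w) = integral {a..b} (\<lambda>s. fc (w (c + s)))"
    unfolding J_def using assms by (intro Henstock_Kurzweil_Integration.integral_cong) (auto simp: time_shift_def)
  also have "\<dots> = J (c + a) (c + b) w"
    unfolding J_def by (rule rc_on_integral_shift[OF path_rc[OF assms(1)] assms(2-4)])
  finally show ?thesis .
qed

lemma fc_mean: "(LINT x|\<nu>. fc x) = 0"
proof -
  interpret N: prob_space \<nu> by (rule inv_prob[OF process inv])
  have m: "f \<in> borel_measurable \<nu>"
    using borel_measurable_continuous_onI[OF f] by (simp cong: measurable_cong_sets add: inv_sets[OF process inv])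
  have "integrable \<nu> f"
  proof (rule N.integrable_const_bound[of _ "K + \<bar>LINT x|\<nu>. f x\<bar>"])
    show "AE x in \<nu>. norm (f x) \<le> K + \<bar>LINT x|\<nu>. f x\<bar>"
    proof (rule AE_I2)
      fix x show "norm (f x) \<le> K + \<bar>LINT x|\<nu>. f x\<bar>" using centred[of x] unfolding real_norm_def by linarith
    qed
  qed (rule m)
  thus ?thesis by (simp add: fc_def[abs_def] N.prob_space)
qed

text \<open>
  Riemann sums have mean 0 since each coordinate has law \<open>\<nu>\<close>, and they are bounded by
  \<open>K * (b - a)\<close>.
\<close>
lemma J_mean:
  assumes ab: "0 \<le> a" "a \<le> b" shows "(LINT w|Q. J a b w) = 0"
proof (rule LIMSEQ_unique)
  have sp: "space Q = space path_space" by (rule law_space[OF process inv])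
  have rm: "(\<lambda>w. rsum (\<lambda>s. fc (w s)) a (b - a) N) \<in> borel_measurable Q" for N
    unfolding law_measurable by (rule past_measurable_path_space[OF rsum_past_measurable[OF ab order_refl]])
  show "(\<lambda>N. LINT w|Q. rsum (\<lambda>s. fc (w s)) a (b - a) N) \<longlonglongrightarrow> (LINT w|Q. J a b w)"
  proof (rule integral_dominated_convergence[where w="\<lambda>_. K * (b - a)"])
    show "AE w in Q. (\<lambda>N. rsum (\<lambda>s. fc (w s)) a (b - a) N) \<longlonglongrightarrow> J a b w"
      by (rule AE_I2) (simp add: sp J_limit ab)
    fix N
    have "\<bar>rsum (\<lambda>s. fc (w s)) a (b - a) N\<bar> \<le> K * (b - a)" for w
    proof -
      have "\<bar>rsum (\<lambda>s. fc (w s)) a (b - a) N\<bar> \<le> (\<Sum>l<Suc N. K * ((b - a) / real (Suc N)))"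
        unfolding rsum_def
        by (rule order_trans[OF sum_abs], intro sum_mono, unfold abs_mult)
           (use ab in \<open>auto intro!: mult_mono divide_right_mono fc_bound simp del: of_nat_Suc simp: K less_imp_le\<close>)
      also have "\<dots> = K * (b - a)" by (simp del: of_nat_Suc)
      finally show ?thesis .
    qed
    thus "AE w in Q. norm (rsum (\<lambda>s. fc (w s)) a (b - a) N) \<le> K * (b - a)" by simp
  qed (simp_all add: rm J_measurable ab)
  have "(LINT w|Q. rsum (\<lambda>s. fc (w s)) a (b - a) N) = 0" for N
  proof -
    have t0: "0 \<le> a + (b - a) * real (Suc l) / real (Suc N)" for l
      using ab by (intro add_nonneg_nonneg divide_nonneg_nonneg mult_nonneg_nonneg) auto
    have "integrable Q (\<lambda>w. fc (w (a + (b - a) * real (Suc l) / real (Suc N))))" for l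
    proof (rule Q.integrable_const_bound[of _ K])
      show "(\<lambda>w. fc (w (a + (b - a) * real (Suc l) / real (Suc N)))) \<in> borel_measurable Q"
        unfolding law_measurable by (rule measurable_compose[OF evaluation_path_space[OF t0] fc_measurable])
    qed (simp add: fc_bound)
    hence "(LINT w|Q. rsum (\<lambda>s. fc (w s)) a (b - a) N) = (\<Sum>l<Suc N. (LINT w|Q. fc (w (a + (b - a) * real (Suc l) / real (Suc N)))) * ((b - a) / real (Suc N)))"
      unfolding rsum_def by (subst Bochner_Integration.integral_sum) (auto simp del: of_nat_Suc)
    also have "\<dots> = 0"
      by (intro sum.neutral) (simp only: law_marginal[OF process inv t0 fc_measurable] fc_mean, simp)
    finally show ?thesis .
  qed
  thus "(\<lambda>N. LINT w|Q. rsum (\<lambda>s. fc (w s)) a (b - a) N) \<longlonglongrightarrow> 0" by simp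
qed

definition Z :: "nat \<Rightarrow> (real \<Rightarrow> 'a) \<Rightarrow> real" where "Z j = J (real j) (real j + 1)"

lemma Z_bound: "w \<in> space path_space \<Longrightarrow> \<bar>Z j w\<bar> \<le> K"
  using J_bound[of w "real j" "real j + 1"] by (simp add: Z_def)

lemma Z_shift: "w \<in> space path_space \<Longrightarrow> Z i (time_shift (real n) w) = Z (n + i) w"
  using J_shift[of w "real n" "real i" "real i + 1"] by (simp add: Z_def add.assoc)

lemma Z_vector_measurable: "(\<lambda>w. (\<lambda>i. Z i w)) \<in> borel_measurable path_space"
  by (intro measurable_coordinatewise_then_product) (simp add: Z_def J_path_measurable)

lemma Z_past_vector_measurable: "(\<lambda>w. (\<lambda>i. if i < n then Z i w else 0)) \<in> borel_measurable (past (real n))"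
proof (intro measurable_coordinatewise_then_product)
  fix i
  show "(\<lambda>w. if i < n then Z i w else 0) \<in> borel_measurable (past (real n))"
  proof (cases "i < n")
    case True
    hence "real i + 1 \<le> real n" by linarith
    thus ?thesis using True by (simp add: Z_def J_past_measurable)
  qed simp
qed

text \<open>
  The first \<open>n\<close> variables are functions of the past of time \<open>n\<close>, and the variables
  from index \<open>n\<close> on are those of the shifted path, so \<open>law_mixing\<close> and
  \<open>law_stationary\<close> apply.
\<close>
sublocale mixing_sequence Q Z K C "exp (- \<delta>)"
proof
  show "Z j \<in> borel_measurable Q" for j by (simp add: Z_def J_measurable)
  show "\<bar>Z j w\<bar> \<le> K" if "w \<in> space Q" for j w using that by (simp add: law_space[OF process inv] Z_bound)
  show "Q.expectation (Z j) = 0" for j by (simp add: Z_def J_mean)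
  show "0 < K" "0 \<le> C" "0 < exp (- \<delta>)" "exp (- \<delta>) < 1" using K C \<delta> by auto
  have shift: "Q.expectation (\<lambda>w. G w * v (\<lambda>i. Z (n + i) w)) = Q.expectation (\<lambda>w. G w * v (\<lambda>i. Z i (time_shift (real n) w)))" for n v G
    by (intro Bochner_Integration.integral_cong) (auto simp: law_space[OF process inv] Z_shift)
  have stat: "Q.expectation (\<lambda>w. v (\<lambda>i. Z (n + i) w)) = Q.expectation (\<lambda>w. v (\<lambda>i. Z i w))"
    if v: "v \<in> borel_measurable borel" "\<And>x. (\<And>i. \<bar>x i\<bar> \<le> K) \<Longrightarrow> \<bar>v x\<bar> \<le> 1" for n and v :: "(nat \<Rightarrow> real) \<Rightarrow> real"
  proof -
    have "Q.expectation (\<lambda>w. v (\<lambda>i. Z i (time_shift (real n) w))) = Q.expectation (\<lambda>w. v (\<lambda>i. Z i w))"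
      by (rule law_stationary[OF process inv _ measurable_compose[OF Z_vector_measurable v(1)] v(2)]) (auto simp: Z_bound)
    thus ?thesis using shift[of "\<lambda>_. 1" v n] by simp
  qed
  show "Q.expectation (\<lambda>w. v (\<lambda>i. Z (n + i) w)) = Q.expectation (\<lambda>w. v (\<lambda>i. Z i w))"
    if v: "v \<in> borel_measurable borel" "\<And>x. (\<And>i. \<bar>x i\<bar> \<le> K) \<Longrightarrow> \<bar>v x\<bar> \<le> 1" for n and v :: "(nat \<Rightarrow> real) \<Rightarrow> real"
    by (rule stat[OF that])
  fix n g and u v :: "(nat \<Rightarrow> real) \<Rightarrow> real"
  assume u: "u \<in> borel_measurable borel" and v: "v \<in> borel_measurable borel"
    and ub: "\<And>x. (\<And>i. \<bar>x i\<bar> \<le> K) \<Longrightarrow> \<bar>u x\<bar> \<le> 1" and vb: "\<And>x. (\<And>i. \<bar>x i\<bar> \<le> K) \<Longrightarrow> \<bar>v x\<bar> \<le> 1"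
  define G where "G w = u (\<lambda>i. if i < n then Z i w else 0)" for w
  have Gm: "G \<in> borel_measurable (past (real n))" unfolding G_def by (rule measurable_compose[OF Z_past_vector_measurable u])
  have Gb: "\<bar>G w\<bar> \<le> 1" if "w \<in> space path_space" for w
    unfolding G_def by (rule ub) (use Z_bound[OF that] K in auto)
  have st: "Q.expectation (\<lambda>w. v (\<lambda>i. Z (n + g + i) w)) = Q.expectation (\<lambda>w. v (\<lambda>i. Z i w))"
    by (rule stat[OF v]) (rule vb)
  have "\<bar>Q.expectation (\<lambda>w. G w * v (\<lambda>i. Z i (time_shift (real n + real g) w))) - Q.expectation G * Q.expectation (\<lambda>w. v (\<lambda>i. Z i w))\<bar>
      \<le> C * exp (- \<delta> * real g)"
    by (rule law_mixing[OF process inv _ _ _ Gm Gb measurable_compose[OF Z_vector_measurable v] vb])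
       (use decay Z_bound in auto)
  also have "C * exp (- \<delta> * real g) = C * exp (- \<delta>) ^ g" by (simp add: exp_of_nat_mult[symmetric] mult.commute)
  finally show "\<bar>Q.expectation (\<lambda>w. u (\<lambda>i. if i < n then Z i w else 0) * v (\<lambda>i. Z (n + g + i) w)) -
      Q.expectation (\<lambda>w. u (\<lambda>i. if i < n then Z i w else 0)) * Q.expectation (\<lambda>w. v (\<lambda>i. Z (n + g + i) w))\<bar> \<le> C * exp (- \<delta>) ^ g"
    unfolding shift[of G v "n + g", unfolded G_def] st G_def by simp
qed

lemma S_eq_J: "w \<in> space path_space \<Longrightarrow> S n w = J 0 (real n) w"
proof (induction n)
  case 0 thus ?case by (simp add: S_def J_def)
next
  case (Suc n)
  have "S (Suc n) w = S n w + Z n w" by (simp add: S_def)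
  also have "\<dots> = J 0 (real n) w + J (real n) (real n + 1) w"
    using Suc.IH[OF Suc.prems] Z_def[of n] by metis
  also have "\<dots> = J 0 (real n + 1) w" by (intro J_combine Suc) auto
  finally show ?case by (simp add: add.commute)
qed

end

lemma fourth_power_add: "(x + y) ^ 4 \<le> 8 * x ^ 4 + 8 * (y::real) ^ 4"
proof -
  have sq: "(a + b)\<^sup>2 \<le> 2 * a\<^sup>2 + 2 * b\<^sup>2" for a b :: real
    using zero_le_power2[of "a - b"] by (simp add: power2_eq_square algebra_simps)
  have "((x + y)\<^sup>2)\<^sup>2 \<le> (2 * x\<^sup>2 + 2 * y\<^sup>2)\<^sup>2" by (intro power_mono sq) auto
  also have "\<dots> \<le> 2 * (2 * x\<^sup>2)\<^sup>2 + 2 * (2 * y\<^sup>2)\<^sup>2" by (rule sq)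
  finally show ?thesis by (simp add: power_mult_distrib flip: power_mult)
qed

lemma coord_lipschitz_partial_sums:
  assumes F: "coord_lipschitz K L F"
  shows "coord_lipschitz K (max L 0 * real K) (\<lambda>x. F (\<lambda>i. \<Sum>j<i. x j))"
  unfolding coord_lipschitz_def
proof (intro allI)
  fix x y :: "nat \<Rightarrow> real"
  have "\<bar>F (\<lambda>i. \<Sum>j<i. x j) - F (\<lambda>i. \<Sum>j<i. y j)\<bar> \<le> max L 0 * (\<Sum>i<K. \<bar>(\<Sum>j<i. x j) - (\<Sum>j<i. y j)\<bar>)"
    using coord_lipschitz_nonneg[OF F] by (simp add: coord_lipschitz_def)
  also have "\<dots> \<le> max L 0 * (\<Sum>i<K. \<Sum>j<K. \<bar>x j - y j\<bar>)"
  proof (intro mult_left_mono sum_mono)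
    fix i assume i: "i \<in> {..<K}"
    have "\<bar>(\<Sum>j<i. x j) - (\<Sum>j<i. y j)\<bar> \<le> (\<Sum>j<i. \<bar>x j - y j\<bar>)" by (simp add: sum_subtractf[symmetric])
    also have "\<dots> \<le> (\<Sum>j<K. \<bar>x j - y j\<bar>)" using i by (intro sum_mono2) auto
    finally show "\<bar>(\<Sum>j<i. x j) - (\<Sum>j<i. y j)\<bar> \<le> (\<Sum>j<K. \<bar>x j - y j\<bar>)" .
  qed simp
  finally show "\<bar>F (\<lambda>i. \<Sum>j<i. x j) - F (\<lambda>i. \<Sum>j<i. y j)\<bar> \<le> max L 0 * real K * (\<Sum>j<K. \<bar>x j - y j\<bar>)" by simp
qed

lemma floor_increment_tendsto:
  assumes ab: "0 \<le> a" "a \<le> b"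
  shows "(\<lambda>n. real (nat \<lfloor>real n * b\<rfloor> - nat \<lfloor>real n * a\<rfloor>) / real n) \<longlonglongrightarrow> b - a"
proof (rule LIM_zero_cancel, rule Lim_null_comparison[OF _ lim_const_over_n[of 1]])
  show "\<forall>\<^sub>F n in sequentially. norm (real (nat \<lfloor>real n * b\<rfloor> - nat \<lfloor>real n * a\<rfloor>) / real n - (b - a)) \<le> 1 / real n"
    using eventually_gt_at_top[of 0]
  proof eventually_elim
    case (elim n)
    have m: "real n * a \<le> real n * b" "0 \<le> real n * a" "0 \<le> real n * b" using ab by (auto intro: mult_left_mono)
    hence "nat \<lfloor>real n * a\<rfloor> \<le> nat \<lfloor>real n * b\<rfloor>" by (intro nat_mono floor_mono)
    hence e: "real (nat \<lfloor>real n * b\<rfloor> - nat \<lfloor>real n * a\<rfloor>) = of_int \<lfloor>real n * b\<rfloor> - of_int \<lfloor>real n * a\<rfloor>"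
      using m by (simp add: of_nat_diff)
    have "\<bar>of_int \<lfloor>real n * b\<rfloor> - of_int \<lfloor>real n * a\<rfloor> - (real n * b - real n * a)\<bar> \<le> 1" by linarith
    moreover have "real (nat \<lfloor>real n * b\<rfloor> - nat \<lfloor>real n * a\<rfloor>) / real n - (b - a) =
        (of_int \<lfloor>real n * b\<rfloor> - of_int \<lfloor>real n * a\<rfloor> - (real n * b - real n * a)) / real n"
      unfolding e using elim by (simp add: field_simps)
    ultimately show ?case using elim by (simp add: abs_divide divide_right_mono)
  qed
qed

context mixing_functional
begin

definition X :: "nat \<Rightarrow> (real \<Rightarrow> 'a) \<Rightarrow> real \<Rightarrow> real" where "X = rescaled_functional f \<nu>"

lemma X_eq:
  assumes "w \<in> space path_space" "0 \<le> t" shows "X n w t = J 0 (real n * t) w / sqrt (real n)"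
proof -
  have "X n w t = (LINT s:{0..real n * t}|lborel. fc (w s) / sqrt (real n))"
    using assms(2) by (simp add: X_def rescaled_functional_def fc_def)
  also have "\<dots> = (LINT s:{0..real n * t}|lborel. fc (w s)) / sqrt (real n)" by simp
  also have "(LINT s:{0..real n * t}|lborel. fc (w s)) = J 0 (real n * t) w"
    unfolding J_def by (rule rc_on_integrable(3)[OF path_rc[OF assms(1)]]) simp
  finally show ?thesis .
qed

lemma X_increment:
  assumes w: "w \<in> space path_space" and st: "0 \<le> s" "s \<le> t"
  shows "X n w t - X n w s = J (real n * s) (real n * t) w / sqrt (real n)"
proof -
  have "J 0 (real n * s) w + J (real n * s) (real n * t) w = J 0 (real n * t) w"
    using st by (intro J_combine w) (auto intro: mult_left_mono)
  thus ?thesis using st by (simp add: X_eq w diff_divide_distrib[symmetric])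
qed

lemma X_random_path: "random_path Q (X n)"
  unfolding random_path_def
proof (intro conjI ballI allI impI)
  fix w assume "w \<in> space Q"
  hence w: "w \<in> space path_space" by (simp add: law_space[OF process inv])
  define Lc where "Lc = K * real n / sqrt (real n)"
  have Lc: "0 \<le> Lc" using K by (simp add: Lc_def)
  have inc: "\<bar>X n w t - X n w s\<bar> \<le> Lc * (t - s)" if "0 \<le> s" "s \<le> t" for s t
  proof -
    have "\<bar>J (real n * s) (real n * t) w\<bar> \<le> K * (real n * t - real n * s)"
      using that by (intro J_bound w) (auto intro: mult_left_mono)
    hence "\<bar>J (real n * s) (real n * t) w\<bar> / sqrt (real n) \<le> K * (real n * t - real n * s) / sqrt (real n)" by (intro divide_right_mono) auto
    also have "\<dots> = Lc * (t - s)" by (simp add: Lc_def algebra_simps diff_divide_distrib)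
    finally show ?thesis unfolding X_increment[OF w that] by (simp add: abs_divide)
  qed
  have "Lc-lipschitz_on {0..} (X n w)"
  proof (rule lipschitz_onI)
    fix s t :: real assume "s \<in> {0..}" "t \<in> {0..}"
    thus "dist (X n w s) (X n w t) \<le> Lc * dist s t"
      using inc[of s t] inc[of t s] by (cases "s \<le> t") (auto simp: dist_real_def abs_minus_commute)
  qed (rule Lc)
  hence "continuous_on {0..} (X n w)" by (rule lipschitz_on_continuous_on)
  thus "X n w \<in> continuous_paths" by (simp add: continuous_paths_def X_def rescaled_functional_def)
next
  fix t :: real assume t: "0 \<le> t"
  have "(\<lambda>w. J 0 (real n * t) w / sqrt (real n)) \<in> borel_measurable Q"
    using t by (intro borel_measurable_divide J_measurable borel_measurable_const) auto
  thus "(\<lambda>w. X n w t) \<in> borel_measurable Q"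
    by (subst measurable_cong[where g="\<lambda>w. J 0 (real n * t) w / sqrt (real n)"]) (auto simp: X_eq t law_space[OF process inv])
qed

lemma J_near_S:
  assumes w: "w \<in> space path_space" and t: "0 \<le> t"
  shows "\<bar>J 0 t w - S (nat \<lfloor>t\<rfloor>) w\<bar> \<le> K"
proof -
  have f: "real (nat \<lfloor>t\<rfloor>) = of_int \<lfloor>t\<rfloor>" using t by simp
  have le: "real (nat \<lfloor>t\<rfloor>) \<le> t" and gt: "t - real (nat \<lfloor>t\<rfloor>) \<le> 1" unfolding f by linarith+
  have "J 0 (real (nat \<lfloor>t\<rfloor>)) w + J (real (nat \<lfloor>t\<rfloor>)) t w = J 0 t w" by (rule J_combine[OF w]) (use le in auto)
  moreover have "\<bar>J (real (nat \<lfloor>t\<rfloor>)) t w\<bar> \<le> K * (t - real (nat \<lfloor>t\<rfloor>))" by (rule J_bound[OF w]) (use le in auto)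
  moreover have "K * (t - real (nat \<lfloor>t\<rfloor>)) \<le> K * 1" using gt K by (intro mult_left_mono) auto
  ultimately show ?thesis by (simp add: S_eq_J[OF w])
qed

definition incr_const :: real where "incr_const = 32 * mom4_const + 128 * K ^ 4"

lemma incr_const_bounds: "0 \<le> incr_const" "K ^ 4 \<le> incr_const" using mom4_const_nonneg zero_le_power[OF less_imp_le[OF K], of 4] by (auto simp: incr_const_def)

lemma J_fourth_integrable: "0 \<le> a \<Longrightarrow> a \<le> b \<Longrightarrow> integrable Q (\<lambda>w. J a b w ^ 4)"
proof (rule Q.integrable_const_bound[of _ "(K * (b - a)) ^ 4"])
  assume ab: "0 \<le> a" "a \<le> b"
  show "AE w in Q. norm (J a b w ^ 4) \<le> (K * (b - a)) ^ 4"
    by (rule AE_I2) (use J_bound ab power_mono[of "\<bar>J a b _\<bar>" _ 4] in \<open>auto simp: law_space[OF process inv] power_abs\<close>)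
  show "(\<lambda>w. J a b w ^ 4) \<in> borel_measurable Q" using J_measurable[OF ab] by measurable
qed

text \<open>
  On short intervals the integral itself is at most \<open>K * (b - a)\<close>. A longer interval differs from
  a union of unit intervals by pieces of integral at most \<open>2 * K\<close>, and a constant is at most a
  multiple of \<open>(b - a)^2\<close> there.
\<close>
lemma J_fourth_moment:
  assumes ab: "0 \<le> a" "a \<le> b" shows "(LINT w|Q. J a b w ^ 4) \<le> incr_const * (b - a)\<^sup>2"
proof (cases "b - a \<le> 1")
  case True
  have "(LINT w|Q. J a b w ^ 4) \<le> (LINT w|Q. incr_const * (b - a)\<^sup>2)"
  proof (rule integral_mono[OF J_fourth_integrable[OF ab]])
    fix w assume "w \<in> space Q"
    hence "\<bar>J a b w\<bar> \<le> K * (b - a)" using ab by (intro J_bound) (auto simp: law_space[OF process inv])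
    hence "\<bar>J a b w\<bar> ^ 4 \<le> (K * (b - a)) ^ 4" by (intro power_mono) auto
    also have "\<dots> = K ^ 4 * ((b - a)\<^sup>2 * (b - a)\<^sup>2)" by (simp add: power_mult_distrib flip: power_add)
    also have "\<dots> \<le> incr_const * ((b - a)\<^sup>2 * 1)"
      using True ab incr_const_bounds by (intro mult_mono mult_left_mono power_le_one) auto
    finally show "J a b w ^ 4 \<le> incr_const * (b - a)\<^sup>2" by (simp add: power_abs)
  qed simp
  thus ?thesis by (simp add: Q.prob_space)
next
  case False
  define p q where "p = nat \<lfloor>a\<rfloor>" and "q = nat \<lfloor>b\<rfloor>"
  have pq: "p \<le> q" unfolding p_def q_def using ab by (intro nat_mono floor_mono)
  obtain l where l: "q = p + l" using pq le_Suc_ex by blast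
  have "real p = of_int \<lfloor>a\<rfloor>" "real q = of_int \<lfloor>b\<rfloor>" using ab by (auto simp: p_def q_def)
  hence "real l = of_int \<lfloor>b\<rfloor> - of_int \<lfloor>a\<rfloor>" using l by simp
  moreover have "of_int \<lfloor>b\<rfloor> \<le> b" "a < of_int \<lfloor>a\<rfloor> + 1" by linarith+
  ultimately have ld: "real l \<le> 2 * (b - a)" using False by argo
  have pt: "J a b w ^ 4 \<le> 8 * (S (p + l) w - S p w) ^ 4 + 128 * K ^ 4" if w: "w \<in> space path_space" for w
  proof -
    have "J 0 a w + J a b w = J 0 b w" using ab by (intro J_combine w) auto
    moreover have "\<bar>J 0 a w - S p w\<bar> \<le> K" "\<bar>J 0 b w - S (p + l) w\<bar> \<le> K"
      unfolding l[symmetric] unfolding p_def q_def using ab by (auto intro!: J_near_S w)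
    ultimately have e: "\<bar>J a b w - (S (p + l) w - S p w)\<bar> \<le> 2 * K" by linarith
    have "J a b w ^ 4 \<le> 8 * (S (p + l) w - S p w) ^ 4 + 8 * (J a b w - (S (p + l) w - S p w)) ^ 4"
      using fourth_power_add[of "S (p + l) w - S p w" "J a b w - (S (p + l) w - S p w)"] by simp
    moreover have "(J a b w - (S (p + l) w - S p w)) ^ 4 \<le> (2 * K) ^ 4"
      using power_mono[OF e, of 4] by (simp add: power_abs)
    ultimately show ?thesis by (simp add: power_mult_distrib)
  qed
  have Si: "integrable Q (\<lambda>w. (S (p + l) w - S p w) ^ 4)"
  proof -
    have "integrable Q (\<lambda>w. J (real p) (real (p + l)) w ^ 4)" by (rule J_fourth_integrable) auto
    moreover have "J (real p) (real (p + l)) w ^ 4 = (S (p + l) w - S p w) ^ 4" if "w \<in> space Q" for w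
    proof -
      have w: "w \<in> space path_space" using that by (simp add: law_space[OF process inv])
      have "J 0 (real p) w + J (real p) (real (p + l)) w = J 0 (real (p + l)) w" by (rule J_combine[OF w]) auto
      thus ?thesis unfolding S_eq_J[OF w] by (metis add_diff_cancel_left')
    qed
    ultimately show ?thesis by (simp cong: Bochner_Integration.integrable_cong)
  qed
  have "(LINT w|Q. J a b w ^ 4) \<le> (LINT w|Q. 8 * (S (p + l) w - S p w) ^ 4 + 128 * K ^ 4)"
    using Si by (intro integral_mono J_fourth_integrable ab pt) (auto simp: law_space[OF process inv])
  also have "\<dots> = 8 * (LINT w|Q. (S (p + l) w - S p w) ^ 4) + 128 * K ^ 4" using Si by (simp add: Q.prob_space)
  also have "\<dots> \<le> 8 * (mom4_const * (real l)\<^sup>2) + 128 * K ^ 4 * 1" using fourth_moment_increment[of p l] by simp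
  also have "\<dots> \<le> 8 * (mom4_const * (2 * (b - a))\<^sup>2) + 128 * K ^ 4 * (b - a)\<^sup>2"
    using ld False mom4_const_nonneg by (intro add_mono mult_left_mono power_mono one_le_power) auto
  also have "\<dots> = incr_const * (b - a)\<^sup>2" by (simp only: incr_const_def power_mult_distrib) (simp add: distrib_right)
  finally show ?thesis .
qed

lemma X_fourth_moment:
  assumes n: "0 < n" and st: "0 \<le> s" "s \<le> t"
  shows "integrable Q (\<lambda>w. (X n w t - X n w s) ^ 4) \<and> (LINT w|Q. (X n w t - X n w s) ^ 4) \<le> incr_const * (t - s)\<^sup>2"
proof -
  have ab: "0 \<le> real n * s" "real n * s \<le> real n * t" using st by (auto intro: mult_left_mono)
  have sq: "sqrt (real n) ^ 4 = (real n)\<^sup>2"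
    by (metis of_nat_0_le_iff power_mult real_sqrt_pow2 mult_2_right numeral_Bit0 numeral_plus_numeral)
  have eq: "(X n w t - X n w s) ^ 4 = J (real n * s) (real n * t) w ^ 4 / (real n)\<^sup>2" if "w \<in> space Q" for w
    using that st by (simp add: X_increment law_space[OF process inv] power_divide sq)
  have "integrable Q (\<lambda>w. (X n w t - X n w s) ^ 4)"
    using J_fourth_integrable[OF ab] by (simp add: eq cong: Bochner_Integration.integrable_cong)
  moreover have "(LINT w|Q. (X n w t - X n w s) ^ 4) = (LINT w|Q. J (real n * s) (real n * t) w ^ 4) / (real n)\<^sup>2"
    by (simp add: eq cong: Bochner_Integration.integral_cong)
  moreover have "(LINT w|Q. J (real n * s) (real n * t) w ^ 4) / (real n)\<^sup>2 \<le> incr_const * (real n * t - real n * s)\<^sup>2 / (real n)\<^sup>2"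
    by (intro divide_right_mono J_fourth_moment ab) auto
  moreover have "incr_const * (real n * t - real n * s)\<^sup>2 / (real n)\<^sup>2 = incr_const * (t - s)\<^sup>2"
    using n by (simp add: right_diff_distrib[symmetric] power_mult_distrib)
  ultimately show ?thesis by simp
qed

text \<open>
  The increments of \<open>X n\<close> over the grid are, up to \<open>K / sqrt n\<close> at every grid point,
  increments of \<open>S\<close> over blocks of about \<open>n / 2^m\<close> terms. These converge jointly to
  the increments of \<open>W\<close>, and the grid values are partial sums of increments.
\<close>
lemma finite_dimensional_convergence:
  assumes W: "brownian_motion_law \<sigma>2 W" and F: "coord_lipschitz k L F" and B: "\<And>x. \<bar>F x\<bar> \<le> B"
  shows "(\<lambda>n. LINT z|Q. F (grid_values m (X n z))) \<longlonglongrightarrow> (LINT w|W. F (grid_values m w))"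
proof -
  interpret W: prob_space W using W by (simp add: brownian_motion_law_def)
  define c where "c n i = nat \<lfloor>real n * (real i / 2 ^ m)\<rfloor>" for n i
  define D where "D n j z = (S (c n (Suc j)) z - S (c n j) z) / sqrt (real n)" for n j z
  define E where "E i w = w (real (Suc i) / 2 ^ m) - w (real i / 2 ^ m)" for i and w :: "real \<Rightarrow> real"
  define G where "G x = F (\<lambda>i. \<Sum>j<i. x j)" for x
  have G: "coord_lipschitz k (max L 0 * real k) G" unfolding G_def by (rule coord_lipschitz_partial_sums[OF F])
  have grid: "real i / 2 ^ m \<le> real j / 2 ^ m" if "i \<le> j" for i j using that by (intro divide_right_mono) auto
  have cmono: "mono (c n)" for n unfolding c_def
    by (intro monoI nat_mono floor_mono mult_left_mono grid) auto
  have cstep: "(\<lambda>n. real (c n (Suc i) - c n i) / real n) \<longlonglongrightarrow> 1 / 2 ^ m" for i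
  proof -
    have "(\<lambda>n. real (c n (Suc i) - c n i) / real n) \<longlonglongrightarrow> real (Suc i) / 2 ^ m - real i / 2 ^ m"
      unfolding c_def by (rule floor_increment_tendsto[OF _ grid]) auto
    also have "real (Suc i) / 2 ^ m - real i / 2 ^ m = 1 / 2 ^ m" by (simp add: diff_divide_distrib[symmetric])
    finally show ?thesis .
  qed
  have gap: "filterlim (\<lambda>n. c n (Suc i) - c n i) at_top sequentially" for i
  proof -
    have "filterlim (\<lambda>n. (real (c n (Suc i) - c n i) / real n) * real n) at_top sequentially"
      by (rule filterlim_tendsto_pos_mult_at_top[OF cstep _ filterlim_real_sequentially]) simp
    moreover have "\<forall>\<^sub>F n in sequentially. (real (c n (Suc i) - c n i) / real n) * real n = real (c n (Suc i) - c n i)"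
      using eventually_gt_at_top[of 0] by eventually_elim simp
    ultimately have "filterlim (\<lambda>n. real (c n (Suc i) - c n i)) at_top sequentially"
      by (rule filterlim_cong[OF refl refl, THEN iffD1, rotated])
    thus ?thesis by (simp add: filterlim_sequentially_iff_filterlim_real)
  qed
  have coord: "(\<lambda>w. w t) \<in> borel_measurable W" if "0 \<le> t" for t :: real
    using continuous_map_borel_measurable[OF coordinate_continuous_map[OF that]] W
    by (simp add: brownian_motion_law_def cong: measurable_cong_sets)
  have main: "(\<lambda>n. LINT z|Q. G (\<lambda>j. D n j z)) \<longlonglongrightarrow> (LINT w|W. G (\<lambda>j. E j w))"
  proof (rule joint_convergence[OF Q.prob_space_axioms _ W.prob_space_axioms _ _ _ _ G])
    show "D n i \<in> borel_measurable Q" for n i unfolding D_def by measurable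
    show "E i \<in> borel_measurable W" for i unfolding E_def by (intro borel_measurable_diff coord) auto
    show "\<bar>G x\<bar> \<le> B" for x unfolding G_def by (rule B)
    show "(\<lambda>n. Q.expectation (\<lambda>z. p (\<lambda>j. D n j z) * h (D n i z)) - Q.expectation (\<lambda>z. p (\<lambda>j. D n j z)) * Q.expectation (\<lambda>z. h (D n i z))) \<longlonglongrightarrow> 0"
      if "coord_lipschitz i L p" "\<And>x. \<bar>p x\<bar> \<le> B" "bdd_lipschitz h" for i L p B h
      unfolding D_def by (rule asymptotic_independence[OF cmono gap that])
    show "(LINT z|W. p (\<lambda>j. E j z) * h (E i z)) = (LINT z|W. p (\<lambda>j. E j z)) * (LINT z|W. h (E i z))"
      if "coord_lipschitz i L p" "\<And>x. \<bar>p x\<bar> \<le> B" "bdd_lipschitz h" for i L p B h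
    proof (rule indep_vars_coord_lipschitz[OF W.prob_space_axioms _ that])
      have "mono (\<lambda>i. real i / 2 ^ m)" by (intro monoI grid)
      hence m: "0 \<le> (\<lambda>i. real i / 2 ^ m) 0 \<and> mono (\<lambda>i. real i / 2 ^ m)" by simp
      have all: "\<forall>\<tau> :: nat \<Rightarrow> real. \<forall>k. 0 \<le> \<tau> 0 \<and> mono \<tau> \<longrightarrow> W.indep_vars (\<lambda>_. borel) (\<lambda>i w. w (\<tau> (Suc i)) - w (\<tau> i)) {..<k}"
        using W by (simp add: brownian_motion_law_def)
      show "W.indep_vars (\<lambda>_. borel) E {..<Suc i}" unfolding E_def using all[rule_format, OF m] .
    qed
    show "(\<lambda>n. Q.expectation (\<lambda>z. h (D n i z))) \<longlonglongrightarrow> (LINT z|W. h (E i z))" if h: "bdd_lipschitz h" for i h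
    proof -
      obtain Bh where Bh: "\<And>x. \<bar>h x\<bar> \<le> Bh" using h by (auto simp: bdd_lipschitz_def)
      have "(\<lambda>n. Q.expectation (\<lambda>z. h ((S (c n i + (c n (Suc i) - c n i)) z - S (c n i) z) / sqrt (real n)))) \<longlonglongrightarrow> (LINT x|centred_normal (\<sigma>2 * (1 / 2 ^ m)). h x)"
        by (rule clt_increment[OF _ cstep bdd_lipschitz_continuous[OF h] Bh]) simp
      moreover have "c n i + (c n (Suc i) - c n i) = c n (Suc i)" for n using monoD[OF cmono, of i "Suc i" n] by simp
      moreover have "(LINT x|centred_normal (\<sigma>2 * (1 / 2 ^ m)). h x) = (LINT w|W. h (E i w))"
      proof -
        have d: "real (Suc i) / 2 ^ m - real i / 2 ^ m = 1 / 2 ^ m" by (simp add: diff_divide_distrib[symmetric])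
        have "0 \<le> real i / 2 ^ m \<and> real i / 2 ^ m < real (Suc i) / 2 ^ m" by (simp add: divide_strict_right_mono)
        hence "distr W borel (E i) = centred_normal (\<sigma>2 * (1 / 2 ^ m))"
          using W unfolding brownian_motion_law_def E_def d[symmetric] by blast
        hence "(LINT x|centred_normal (\<sigma>2 * (1 / 2 ^ m)). h x) = (LINT x|distr W borel (E i). h x)" by simp
        also have "\<dots> = (LINT w|W. h (E i w))"
          unfolding E_def by (intro integral_distr borel_measurable_diff coord bdd_lipschitz_measurable[OF h]) auto
        finally show ?thesis .
      qed
      ultimately show ?thesis by (simp add: D_def)
    qed
  qed
  have EW: "(LINT w|W. G (\<lambda>j. E j w)) = (LINT w|W. F (grid_values m w))"
  proof (rule integral_cong_AE)
    have tel: "(\<Sum>j<i. E j w) = w (real i / 2 ^ m) - w 0" for i w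
      unfolding E_def by (subst sum_lessThan_telescope) simp
    have "AE w in W. w 0 = 0" using W by (simp add: brownian_motion_law_def)
    thus "AE w in W. G (\<lambda>j. E j w) = F (grid_values m w)"
      by eventually_elim (simp add: G_def tel grid_values_def[abs_def])
    show "(\<lambda>w. G (\<lambda>j. E j w)) \<in> borel_measurable W"
      by (intro measurable_compose[OF _ coord_lipschitz_measurable[OF G]] measurable_coordinatewise_then_product)
         (auto simp: E_def intro!: borel_measurable_diff coord)
    show "(\<lambda>w. F (grid_values m w)) \<in> borel_measurable W"
      by (intro measurable_compose[OF _ coord_lipschitz_measurable[OF F]] measurable_coordinatewise_then_product)
         (auto simp: grid_values_def intro!: coord)
  qed
  have Fm: "(\<lambda>z. F (grid_values m (X n z))) \<in> borel_measurable Q" for n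
    by (rule measurable_compose[OF random_path_grid[OF X_random_path] coord_lipschitz_measurable[OF F]])
  have Gm: "(\<lambda>z. G (\<lambda>j. D n j z)) \<in> borel_measurable Q" for n
    by (intro measurable_compose[OF _ coord_lipschitz_measurable[OF G]] measurable_coordinatewise_then_product) (simp add: D_def)
  have Fi: "integrable Q (\<lambda>z. F (grid_values m (X n z)))" for n
    by (rule Q.integrable_const_bound[of _ B]) (use B Fm in auto)
  have Gi: "integrable Q (\<lambda>z. G (\<lambda>j. D n j z))" for n
    by (rule Q.integrable_const_bound[of _ B]) (use B Gm in \<open>auto simp: G_def\<close>)
  have near: "\<bar>F (grid_values m (X n z)) - G (\<lambda>j. D n j z)\<bar> \<le> (max L 0 * (real k * K)) / sqrt (real n)" if "z \<in> space Q" for n z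
  proof -
    have z: "z \<in> space path_space" using that by (simp add: law_space[OF process inv])
    have tel: "(\<Sum>j<i. D n j z) = S (c n i) z / sqrt (real n)" for i
      unfolding D_def sum_divide_distrib[symmetric] by (subst sum_lessThan_telescope) (simp add: c_def S_def)
    have "\<bar>F (grid_values m (X n z)) - G (\<lambda>j. D n j z)\<bar> \<le> max L 0 * (\<Sum>i<k. \<bar>grid_values m (X n z) i - S (c n i) z / sqrt (real n)\<bar>)"
      unfolding G_def tel using coord_lipschitz_nonneg[OF F] by (simp add: coord_lipschitz_def)
    also have "\<dots> \<le> max L 0 * (\<Sum>i<k. K / sqrt (real n))"
    proof (intro mult_left_mono sum_mono)
      fix i
      have "\<bar>grid_values m (X n z) i - S (c n i) z / sqrt (real n)\<bar> = \<bar>J 0 (real n * (real i / 2 ^ m)) z - S (c n i) z\<bar> / sqrt (real n)"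
        by (simp add: grid_values_def X_eq[OF z] diff_divide_distrib[symmetric] abs_divide)
      also have "\<dots> \<le> K / sqrt (real n)" unfolding c_def by (intro divide_right_mono J_near_S z) auto
      finally show "\<bar>grid_values m (X n z) i - S (c n i) z / sqrt (real n)\<bar> \<le> K / sqrt (real n)" .
    qed simp
    finally show ?thesis by simp
  qed
  have "(\<lambda>n. (LINT z|Q. F (grid_values m (X n z))) - (LINT z|Q. G (\<lambda>j. D n j z))) \<longlonglongrightarrow> 0"
  proof (rule Lim_null_comparison[OF _ inverse_sqrt_tendsto[of "max L 0 * (real k * K)"]], rule always_eventually, rule allI)
    fix n
    have "norm ((LINT z|Q. F (grid_values m (X n z))) - (LINT z|Q. G (\<lambda>j. D n j z))) = \<bar>LINT z|Q. F (grid_values m (X n z)) - G (\<lambda>j. D n j z)\<bar>"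
      using Fi Gi by simp
    also have "\<dots> \<le> (LINT z|Q. \<bar>F (grid_values m (X n z)) - G (\<lambda>j. D n j z)\<bar>)" by (rule integral_abs_bound)
    also have "\<dots> \<le> (LINT z|Q. (max L 0 * (real k * K)) / sqrt (real n))"
      using Fi Gi near by (intro integral_mono) auto
    finally show "norm ((LINT z|Q. F (grid_values m (X n z))) - (LINT z|Q. G (\<lambda>j. D n j z))) \<le> (max L 0 * (real k * K)) / sqrt (real n)"
      by (simp add: Q.prob_space)
  qed
  from tendsto_add[OF this main] show ?thesis unfolding EW by simp
qed

theorem invariance_principle:
  "\<exists>v\<ge>0. \<exists>W. brownian_motion_law v W \<and> weakly_converges continuous_path_topology
      (\<lambda>n. distr Q (borel_of continuous_path_topology) (rescaled_functional f \<nu> n)) W"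
proof -
  obtain W where W: "brownian_motion_law \<sigma>2 W" using brownian_motion_exists[OF \<sigma>2_nonneg] by blast
  have "prob_space W" "sets W = sets (borel_of continuous_path_topology)" using W by (auto simp: brownian_motion_law_def)
  hence "weakly_converges continuous_path_topology (\<lambda>n. distr Q (borel_of continuous_path_topology) (X n)) W"
    by (intro weak_convergence_criterion[OF Q.prob_space_axioms X_random_path incr_const_bounds(1) X_fourth_moment]
        finite_dimensional_convergence W)
  thus ?thesis using W \<sigma>2_nonneg unfolding X_def by blast
qed

end

theorem proposition3p6:
  fixes P Pe :: "'a::polish_space \<Rightarrow> (real \<Rightarrow> 'a) measure"
    and \<mu> \<mu>e :: "'a measure"
    and Lhat :: "('a \<Rightarrow> real) \<Rightarrow> ('a \<Rightarrow> real)"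
    and Se :: "real \<Rightarrow> ('a \<Rightarrow> real) \<Rightarrow> ('a \<Rightarrow> real)"
    and \<epsilon> \<gamma> :: real
    and f :: "'a \<Rightarrow> real"
  assumes unperturbed: "markov_process P"
    and perturbed: "markov_process Pe"
    and invariant: "invariant_distribution P \<mu>"
    and ergodic: "ergodic_distribution P \<mu>"
    and semigroup: "L2_contraction_semigroup \<mu> (transition P)"
    and perturbation: "L2_bounded_operator \<mu> Lhat"
    and eps: "\<epsilon> = L2_operator_norm \<mu> Lhat" "0 < \<epsilon>"
    and perturbed_semigroup: "L2_semigroup \<mu> Se"
    and perturbed_generator:
      "\<And>h g. L2_generator \<mu> Se h g \<longleftrightarrow> g \<in> L2_space \<mu> \<and>
         (\<exists>g0. L2_generator \<mu> (transition P) h g0 \<and> (AE x in \<mu>. g x = g0 x + Lhat h x))"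
    and gap: "0 < \<gamma>"
    and poincare:
      "\<And>h g. L2_generator \<mu> (transition P) h g \<Longrightarrow> (\<integral>x. h x \<partial>\<mu>) = 0 \<Longrightarrow>
         \<gamma> * (L2_norm \<mu> h)\<^sup>2 \<le> - (\<integral>x. h x * g x \<partial>\<mu>)"
    and represents:
      "\<And>t h. 0 \<le> t \<Longrightarrow> h \<in> bcontfun \<Longrightarrow> AE \<eta> in \<mu>. Se t h \<eta> = transition Pe t h \<eta>"
    and feller: "feller Pe"
    and small: "\<epsilon> < \<gamma>"
    and mu_eps: "invariant_distribution Pe \<mu>e" "absolutely_continuous \<mu> \<mu>e"
    and f: "f \<in> bcontfun"
  shows "\<exists>\<sigma>2 \<ge> 0. \<exists>W. brownian_motion_law \<sigma>2 W \<and>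
    weakly_converges continuous_path_topology
      (\<lambda>n. distr (law_from Pe \<mu>e) (borel_of continuous_path_topology) (rescaled_functional f \<mu>e n)) W"
proof -
  interpret perturbed_process P Pe \<mu> Lhat Se \<epsilon> \<gamma>
    by unfold_locales (use assms in \<open>simp_all\<close>)
  obtain B where B: "\<And>x. \<bar>f x\<bar> \<le> B" using bcontfunD(2)[OF f] by blast
  \<comment> \<open>adding 1 makes the bound positive\<close>
  define K where "K = B + \<bar>\<integral>x. f x \<partial>\<mu>e\<bar> + 1"
  interpret mixing_functional Pe \<mu>e f "(1 + drift_const)\<^sup>2" "\<gamma> - \<epsilon>" K
  proof
    show "markov_process Pe" "invariant_distribution Pe \<mu>e" by fact+
    show "0 \<le> (1 + drift_const)\<^sup>2" "0 < \<gamma> - \<epsilon>" using small by auto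
    show "0 < K" using B[of undefined] unfolding K_def by linarith
    show "(\<integral>x. \<bar>transition Pe t h x - (\<integral>x. h x \<partial>\<mu>e)\<bar> \<partial>\<mu>e) \<le> (1 + drift_const)\<^sup>2 * exp (- (\<gamma> - \<epsilon>) * t)"
      if "h \<in> borel_measurable borel" "\<And>x. \<bar>h x\<bar> \<le> 1" "0 \<le> t" for h t
      by (rule decay_bounded[OF mu_eps that])
    show "continuous_on UNIV f" by (rule bcontfunD(1)[OF f])
    show "\<bar>f x - (\<integral>x. f x \<partial>\<mu>e)\<bar> \<le> K" for x using B[of x] unfolding K_def by linarith
  qed
  show ?thesis by (rule invariance_principle)
qed

end
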